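(* Let $\mathcal S$ be the topological space of a finite CW-complex of dimension $d$, endowed with a finite diffuse measure $\mu$, let $k\ge 2$ be an even integer, and let $(\Delta,\Psi)$ be a triangulation of $\mathcal S$. Then \[ \mathrm{Sym}_k(\mathcal S;\mu)=\mathrm{Sym}_k(\Delta;y), \] where $y_\delta:=\mu(\Psi(\delta))$ for every facet $\delta$ of $\Delta$.
   Context: A measure $\mu$ on $\mathcal S$ is diffuse if it vanishes on every subset homeomorphic to a $(d-1)$-dimensional ball. $\tilde{\mathcal S}$ is the set of points of $\mathcal S$ having a neighborhood homeomorphic to a $d$-dimensional ball. For a singular $d$-cycle (or $d$-homology class) $c$ of $\mathcal S$ and $z\in\tilde{\mathcal S}$, $\omega_c(z)$ is the image of $c$ in $H_d(\mathcal S,\mathcal S-z)\cong\mathbb Z$. For $d$-cycles $c_1,\dots,c_k$ set $(c_1,\dots,c_k)_{k,\mu}:=\int_{\mathcal S}\omega_{c_1}(z)\cdots\omega_{c_k}(z)\,d\mu(z)$ (independent of the chosen isomorphisms with $\mathbb Z$ since $k$ is even). For a hypercubic matrix $C=(c_{i_1,\dots,i_k})$ of order $k$ and size $m$, $\det(C):=\frac1{m!}\sum_{\tau_1,\dots,\tau_k\in\mathfrak S_m}\prod_j\mathrm{sgn}(\tau_j)\prod_{a=1}^m c_{\tau_1(a),\dots,\tau_k(a)}$. Define $\mathrm{Sym}_k(\mathcal S;\mu):=|\mathrm{Tor}(H^{\mathrm{sing}}_{d-1}(\mathcal S))|^k\det\bigl((v_{i_1},\dots,v_{i_k})_{k,\mu}\bigr)_{i_1,\dots,i_k}$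 where $v=(v_1,\dots,v_m)$ is any basis of $H^{\mathrm{sing}}_d(\mathcal S)$ (integer coefficients). A triangulation of $\mathcal S$ is a simplicial complex $\Delta$ with vertices numbered $1,\dots,N$ together with a homeomorphism $\Phi:|\Delta|\to\mathcal S$, where $|\Delta|=\bigcup_{\delta\in\Delta}\mathrm{conv}(e_i:i\in\delta)\subset\mathbb R^N$; $\Psi(\delta):=\Phi(\mathrm{conv}(e_i:i\in\delta))$. For $\Delta$ of dimension $d$ with $n$ facets and $d$-th incidence matrix $U\in\mathcal M_{p,n}(\mathbb Z)$ (matrix of the simplicial boundary map $C_d\to C_{d-1}$ in the bases of oriented faces), columns $u$, rank $r$: $\mathrm{Sym}_k(\Delta;y):=\|\mathrm{span}(u)\cap\mathbb Z^p\|^{-k}\sum_{|I|=r}\det(U_I^{\intercal}U_I)^{k/2}\prod_{i\notin I}y_i$, where $\|A\|$ is the covolume $\sqrt{\det(F^{\intercal}F)}$ of a lattice $A$ with basis matrix $F$. *)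

theory Defs
  imports
    "HOL-Analysis.Analysis"
    "HOL-Homology.Homology"
    "HOL-Combinatorics.Combinatorics"
    "Jordan_Normal_Form.DL_Rank_Submatrix"
begin

no_notation Finite_Cartesian_Product.vec_nth (infixl \<open>$\<close> 90)

subsection \<open>Balls and finite CW-complexes\<close>

definition open_ball_space :: "nat \<Rightarrow> (nat \<Rightarrow> real) topology" where
  "open_ball_space n = subtopology (Euclidean_space n) {x. (\<Sum>i<n. (x i)\<^sup>2) < 1}"

definition closed_ball_space :: "nat \<Rightarrow> (nat \<Rightarrow> real) topology" where
  "closed_ball_space n = subtopology (Euclidean_space n) {x. (\<Sum>i<n. (x i)\<^sup>2) \<le> 1}"

text \<open>A cell is a pair \<open>(n, \<phi>)\<close> of its dimension and its characteristic map, defined on the closed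
  ball; the cell itself is the image of the open ball. For finitely many cells in a
  Hausdorff space, closure-finiteness and the weak topology are automatic.\<close>

definition open_cell :: "nat \<times> ((nat \<Rightarrow> real) \<Rightarrow> 'a) \<Rightarrow> 'a set" where
  "open_cell c = snd c ` topspace (open_ball_space (fst c))"

definition finite_CW_structure :: "'a topology \<Rightarrow> (nat \<times> ((nat \<Rightarrow> real) \<Rightarrow> 'a)) set \<Rightarrow> bool" where
  "finite_CW_structure X \<C> \<longleftrightarrow>
     Hausdorff_space X \<and> finite \<C> \<and>
     topspace X = (\<Union>c\<in>\<C>. open_cell c) \<and>
     (\<forall>c\<in>\<C>. \<forall>c'\<in>\<C>. c \<noteq> c' \<longrightarrow> disjnt (open_cell c) (open_cell c')) \<and>
     (\<forall>(n, \<phi>)\<in>\<C>.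
        continuous_map (closed_ball_space n) X \<phi> \<and>
        homeomorphic_map (open_ball_space n) (subtopology X (open_cell (n, \<phi>))) \<phi> \<and>
        \<phi> ` (topspace (closed_ball_space n) - topspace (open_ball_space n))
          \<subseteq> (\<Union>c\<in>{c \<in> \<C>. fst c < n}. open_cell c))"

definition finite_CW_complex :: "nat \<Rightarrow> 'a topology \<Rightarrow> bool" where
  "finite_CW_complex d X \<longleftrightarrow>
     (\<exists>\<C>. finite_CW_structure X \<C> \<and> (\<exists>c\<in>\<C>. fst c = d) \<and> (\<forall>c\<in>\<C>. fst c \<le> d))"


subsection \<open>Diffuse measures\<close>

definition borel_measure_on :: "'a topology \<Rightarrow> 'a measure \<Rightarrow> bool" where
  "borel_measure_on X M \<longleftrightarrow>
     space M = topspace X \<and> sets M = sigma_sets (topspace X) {U. openin X U}"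

text \<open>Balls are open balls. A measure vanishing on all closed balls vanishes on all open ones, so
  this is the weaker of the two possible requirements. In a compact Hausdorff space the sets \<open>B\<close>
  below are locally closed, hence Borel. For \<open>d = 0\<close> the \<open>(d-1)\<close>-dimensional ball is empty and the
  condition is void.\<close>

definition diffuse :: "nat \<Rightarrow> 'a topology \<Rightarrow> 'a measure \<Rightarrow> bool" where
  "diffuse d X M \<longleftrightarrow>
     (\<forall>B. d > 0 \<and> B \<subseteq> topspace X \<and> subtopology X B homeomorphic_space open_ball_space (d - 1)
        \<longrightarrow> emeasure M B = 0)"


subsection \<open>The topological side\<close>

definition manifold_points :: "nat \<Rightarrow> 'a topology \<Rightarrow> 'a set" where
  "manifold_points d X =
     {z \<in> topspace X. \<exists>U N. openin X U \<and> z \<in> U \<and> U \<subseteq> N \<and> N \<subseteq> topspace X \<and>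
        subtopology X N homeomorphic_space open_ball_space d}"

text \<open>The local multiplicity of a \<open>d\<close>-dimensional homology class at \<open>z\<close>. The identification with the
  integers is an arbitrary choice made once for each point, so that the value is only meaningful up
  to a sign depending on \<open>z\<close>; it is used below only in products with an even number of factors.
  It is zero by convention at the points which are not \<open>d\<close>-manifold points.\<close>

definition local_iso :: "nat \<Rightarrow> 'a topology \<Rightarrow> 'a \<Rightarrow> 'a chain set \<Rightarrow> int" where
  "local_iso d X z =
     (SOME h. h \<in> iso (relative_homology_group (int d) X (topspace X - {z})) integer_group)"

definition local_multiplicity :: "nat \<Rightarrow> 'a topology \<Rightarrow> 'a chain set \<Rightarrow> 'a \<Rightarrow> int" where
  "local_multiplicity d X c z =
     (if z \<in> manifold_points d X
      then local_iso d X z (hom_induced (int d) X {} X (topspace X - {z}) id c)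
      else 0)"

definition cycle_form :: "nat \<Rightarrow> 'a topology \<Rightarrow> 'a measure \<Rightarrow> 'a chain set list \<Rightarrow> real" where
  "cycle_form d X M cs =
     (LINT z|M. (\<Prod>c\<leftarrow>cs. real_of_int (local_multiplicity d X c z)))"

text \<open>A hypercubic matrix of order \<open>k\<close> and size \<open>m\<close> is a function on the lists of length \<open>k\<close> with
  entries in \<open>{..<m}\<close>.\<close>

definition hyperdet :: "nat \<Rightarrow> nat \<Rightarrow> (nat list \<Rightarrow> real) \<Rightarrow> real" where
  "hyperdet k m C =
     1 / fact m *
     (\<Sum>\<tau> \<in> {..<k} \<rightarrow>\<^sub>E {\<pi>. \<pi> permutes {..<m}}.
        (\<Prod>j<k. of_int (sign (\<tau> j))) * (\<Prod>a<m. C (map (\<lambda>j. \<tau> j a) [0..<k])))"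

definition torsion_elements :: "('a, 'b) monoid_scheme \<Rightarrow> 'a set" where
  "torsion_elements G = {x \<in> carrier G. \<exists>n::nat. n > 0 \<and> x [^]\<^bsub>G\<^esub> n = \<one>\<^bsub>G\<^esub>}"

text \<open>A finite basis of a (multiplicatively written) free abelian group.\<close>

definition abelian_basis :: "('a, 'b) monoid_scheme \<Rightarrow> 'a list \<Rightarrow> bool" where
  "abelian_basis G v \<longleftrightarrow>
     set v \<subseteq> carrier G \<and>
     bij_betw (\<lambda>f. \<Otimes>\<^bsub>G\<^esub>i\<in>{..<length v}. (v ! i) [^]\<^bsub>G\<^esub> (f i))
       ({..<length v} \<rightarrow>\<^sub>E (UNIV :: int set)) (carrier G)"

text \<open>The definite description stands for the value common to all bases \<open>v\<close>. For \<open>d = 0\<close> the library's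
  homology group in degree \<open>-1\<close> is trivial.\<close>

definition Sym_space :: "nat \<Rightarrow> nat \<Rightarrow> 'a topology \<Rightarrow> 'a measure \<Rightarrow> real" where
  "Sym_space k d X M =
     (THE s. \<exists>v. abelian_basis (homology_group (int d) X) v \<and>
        s = real (card (torsion_elements (homology_group (int d - 1) X))) ^ k *
            hyperdet k (length v) (\<lambda>is. cycle_form d X M (map ((!) v) is)))"


subsection \<open>Triangulations\<close>

definition abstract_complex :: "nat \<Rightarrow> nat set set \<Rightarrow> bool" where
  "abstract_complex N \<Delta> \<longleftrightarrow>
     (\<forall>\<delta>\<in>\<Delta>. \<delta> \<noteq> {} \<and> \<delta> \<subseteq> {1..N}) \<and>
     (\<forall>i\<in>{1..N}. {i} \<in> \<Delta>) \<and>
     (\<forall>\<delta>\<in>\<Delta>. \<forall>\<sigma>. \<sigma> \<noteq> {} \<and> \<sigma> \<subseteq> \<delta> \<longrightarrow> \<sigma> \<in> \<Delta>)"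

text \<open>The convex hull of the unit vectors \<open>e\<^sub>i\<close>, \<open>i \<in> \<delta>\<close>. As elsewhere in the homology library,
  \<open>\<real>\<^sup>N\<close> is the space of functions vanishing outside the index set, here \<open>{1..N}\<close>.\<close>

definition face_hull :: "nat set \<Rightarrow> (nat \<Rightarrow> real) set" where
  "face_hull \<delta> =
     {(\<lambda>j. \<Sum>i\<in>\<delta>. t i * (if j = i then 1 else 0)) | t. (\<forall>i\<in>\<delta>. 0 \<le> t i) \<and> (\<Sum>i\<in>\<delta>. t i) = 1}"

definition realization :: "nat set set \<Rightarrow> (nat \<Rightarrow> real) topology" where
  "realization \<Delta> = subtopology (powertop_real UNIV) (\<Union>\<delta>\<in>\<Delta>. face_hull \<delta>)"

definition space_triangulation ::
    "nat \<Rightarrow> nat set set \<Rightarrow> ((nat \<Rightarrow> real) \<Rightarrow> 'a) \<Rightarrow> 'a topology \<Rightarrow> bool" where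
  "space_triangulation N \<Delta> \<Phi> X \<longleftrightarrow>
     abstract_complex N \<Delta> \<and> homeomorphic_map (realization \<Delta>) X \<Phi>"

definition face_image :: "((nat \<Rightarrow> real) \<Rightarrow> 'a) \<Rightarrow> nat set \<Rightarrow> 'a set" where
  "face_image \<Phi> \<delta> = \<Phi> ` face_hull \<delta>"


subsection \<open>The combinatorial side\<close>

definition complex_dim :: "nat set set \<Rightarrow> nat" where
  "complex_dim \<Delta> = Max (card ` \<Delta>) - 1"

text \<open>An enumeration, in an arbitrary order, of the faces with \<open>m\<close> vertices, i.e. of dimension
  \<open>m - 1\<close>. Faces are nonempty, so there are none for \<open>m = 0\<close>.\<close>

definition face_list :: "nat set set \<Rightarrow> nat \<Rightarrow> nat set list" where
  "face_list \<Delta> m = (SOME xs. distinct xs \<and> set xs = {\<delta> \<in> \<Delta>. card \<delta> = m})"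

text \<open>Faces are oriented by the increasing order of their vertices: this is the coefficient of \<open>\<sigma>\<close> in
  the simplicial boundary of \<open>\<delta>\<close>.\<close>

definition incidence :: "nat set \<Rightarrow> nat set \<Rightarrow> int" where
  "incidence \<sigma> \<delta> = (\<Sum>v | v \<in> \<delta> \<and> \<sigma> = \<delta> - {v}. (-1) ^ card {w \<in> \<delta>. w < v})"

definition top_faces :: "nat set set \<Rightarrow> nat set list" where
  "top_faces \<Delta> = face_list \<Delta> (complex_dim \<Delta> + 1)"

definition incidence_mat :: "nat set set \<Rightarrow> real mat" where
  "incidence_mat \<Delta> =
     mat (length (face_list \<Delta> (complex_dim \<Delta>))) (length (top_faces \<Delta>))
       (\<lambda>(i, j). of_int (incidence (face_list \<Delta> (complex_dim \<Delta>) ! i) (top_faces \<Delta> ! j)))"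

definition lattice_basis_mat :: "nat \<Rightarrow> real Matrix.vec set \<Rightarrow> real mat \<Rightarrow> bool" where
  "lattice_basis_mat p L F \<longleftrightarrow>
     dim_row F = p \<and>
     (\<forall>x \<in> carrier_vec (dim_col F). F *\<^sub>v x = 0\<^sub>v p \<longrightarrow> x = 0\<^sub>v (dim_col F)) \<and>
     L = (\<lambda>x. F *\<^sub>v map_vec real_of_int x) ` carrier_vec (dim_col F)"

text \<open>The value common to all basis matrices \<open>F\<close> of the lattice \<open>L\<close> in \<open>\<real>\<^sup>p\<close>.\<close>

definition covolume :: "nat \<Rightarrow> real Matrix.vec set \<Rightarrow> real" where
  "covolume p L =
     (THE c. \<exists>F. lattice_basis_mat p L F \<and> c = sqrt (Determinant.det (transpose_mat F * F)))"

definition integer_vecs :: "nat \<Rightarrow> real Matrix.vec set" where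
  "integer_vecs p = {x \<in> carrier_vec p. \<forall>i<p. x $ i \<in> \<int>}"

definition saturated_lattice :: "real mat \<Rightarrow> real Matrix.vec set" where
  "saturated_lattice U =
     LinearCombinations.module.span class_ring (module_vec TYPE(real) (dim_row U)) (set (cols U))
       \<inter> integer_vecs (dim_row U)"

text \<open>In the sum, \<open>I\<close> runs through sets of column indices and \<open>k\<close> is meant to be even.\<close>

definition Sym_complex :: "nat \<Rightarrow> nat set set \<Rightarrow> (nat set \<Rightarrow> real) \<Rightarrow> real" where
  "Sym_complex k \<Delta> y =
     (let U = incidence_mat \<Delta>; p = dim_row U; n = dim_col U; r = vec_space.rank p U in
        (\<Sum>I | I \<subseteq> {..<n} \<and> card I = r.
           (let U\<^sub>I = submatrix U UNIV I in
              Determinant.det (transpose_mat U\<^sub>I * U\<^sub>I) ^ (k div 2) *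
              (\<Prod>i\<in>{..<n} - I. y (top_faces \<Delta> ! i))))
        / covolume p (saturated_lattice U) ^ k)"

end

theory Submission
  imports Defs
begin

text \<open>A triangulation turns the homology of the space into simplicial homology, so that \<open>H\<^sub>d\<close> is the
  kernel of the incidence matrix \<open>U\<close> and the torsion of \<open>H\<^sub>d\<^sub>-\<^sub>1\<close> is the quotient of the saturation of
  the column lattice of \<open>U\<close> by this lattice. The local multiplicity of a cycle at an interior point
  of a facet is, up to sign, its coefficient there; everything else is either null, because \<open>\<mu>\<close> is
  diffuse and faces of dimension \<open>d-1\<close> are balls, or does not lie in the support of any cycle. The
  form of a tuple of cycles is therefore a sum over the facets.

  Expanding the determinant of the hypercubic matrix over maps \<open>g\<close> from \<open>{..<m}\<close> to the facets gives
  the \<open>k\<close>-th powers of the maximal minors of a kernel basis \<open>V\<close>. Write \<open>U = F W\<close> with \<open>F\<close> a basis of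
  the saturated lattice. Then \<open>det (U\<^sub>I\<^sup>T U\<^sub>I) = (det W\<^sub>I)\<^sup>2 det (F\<^sup>T F)\<close>, and the minors of \<open>W\<close> are, up to
  sign, \<open>|Tor|\<close> times the complementary minors of \<open>V\<close>.\<close>

subsection \<open>Simplicial complexes and simplicial chains\<close>

text \<open>The identification of a local homology group with the integers is an arbitrary choice at
  every point, so measurability of the integrand and constancy along a facet cannot be read off the
  definition. Both come from deforming the realization minus a point of an open face \<sigma> onto
  the subcomplex of faces not containing \<sigma>: the local group then depends on \<sigma> only,
  two identifications differ by one sign common to all cycles, and an even number of factors absorbs
  it. No orientations are ever compared between points. To find the constant on a facet, a generator
  of the relative group has to be represented by a simplicial chain, so simplicial and singular
  homology are compared for pairs too, on the level of chains. \<open>Sym_complex\<close> takes its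
  dimension from the complex and \<open>Sym_space\<close> from the CW structure; they agree by
  invariance of dimension, itself a consequence of local homology. Lastly, the saturated lattice is
  defined by a real span but torsion by integer multiples; a rational-linear functional on the reals
  reconciles them.\<close>

abbreviation polyhedron :: "nat set set \<Rightarrow> (nat \<Rightarrow> real) set" where
  "polyhedron K \<equiv> (\<Union>\<delta>\<in>K. face_hull \<delta>)"

text \<open>\<open>abstract_complex\<close> fixes the vertex set \<open>{1..N}\<close>, which
  costars and boundaries of simplices may violate. This weaker notion is inherited by them, and the
  empty complex satisfies it, which starts the induction over complexes.\<close>

definition finite_complex :: "nat set set \<Rightarrow> bool" where
  "finite_complex K \<longleftrightarrow> finite K \<and> (\<forall>\<delta>\<in>K. finite \<delta> \<and> \<delta> \<noteq> {}) \<and>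
     (\<forall>\<delta>\<in>K. \<forall>\<sigma>. \<sigma> \<noteq> {} \<and> \<sigma> \<subseteq> \<delta> \<longrightarrow> \<sigma> \<in> K)"

lemma finite_complexD:
  assumes "finite_complex K"
  shows "finite K" and "\<delta> \<in> K \<Longrightarrow> finite \<delta>" and "\<delta> \<in> K \<Longrightarrow> \<delta> \<noteq> {}" and "\<delta> \<in> K \<Longrightarrow> card \<delta> > 0"
    and "\<delta> \<in> K \<Longrightarrow> \<sigma> \<noteq> {} \<Longrightarrow> \<sigma> \<subseteq> \<delta> \<Longrightarrow> \<sigma> \<in> K"
  using assms unfolding finite_complex_def card_gt_0_iff by blast+

lemma abstract_complex_imp_finite_complex:
  assumes "abstract_complex N \<Delta>" shows "finite_complex \<Delta>"
proof -
  have "\<Delta> \<subseteq> Pow {1..N}" using assms by (auto simp: abstract_complex_def)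
  then have "finite \<Delta>" by (rule finite_subset) simp
  with assms show ?thesis unfolding abstract_complex_def finite_complex_def
    by (meson finite_atLeastAtMost finite_subset)
qed

text \<open>The unit vectors are affinely independent, so the coefficients of a convex combination
  are just its coordinates.\<close>

lemma face_hull_eq:
  assumes "finite \<delta>"
  shows "face_hull \<delta> = {x. (\<forall>i. 0 \<le> x i) \<and> (\<forall>i. i \<notin> \<delta> \<longrightarrow> x i = 0) \<and> sum x \<delta> = 1}"
    (is "_ = ?R")
proof -
  have eq: "(\<Sum>i\<in>\<delta>. t i * (if j = i then 1 else 0)) = (if j \<in> \<delta> then t j else 0)" for t :: "nat \<Rightarrow> real" and j
    using assms by (simp add: if_distrib [of "\<lambda>u. _ * u"] cong: if_cong)
  show ?thesis
  proof
    show "face_hull \<delta> \<subseteq> ?R"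
      using assms by (auto simp: face_hull_def eq)
    show "?R \<subseteq> face_hull \<delta>"
    proof
      fix x :: "nat \<Rightarrow> real" assume x: "x \<in> ?R"
      then have "x = (\<lambda>j. \<Sum>i\<in>\<delta>. x i * (if j = i then 1 else 0))" by (auto simp: eq)
      with x show "x \<in> face_hull \<delta>" unfolding face_hull_def by blast
    qed
  qed
qed

lemma topspace_realization [simp]: "topspace (realization K) = polyhedron K"
  by (simp add: realization_def)

lemma subtopology_realization:
  "L \<subseteq> K \<Longrightarrow> subtopology (realization K) (polyhedron L) = realization L"
  by (force simp: realization_def subtopology_subtopology intro!: arg_cong [of _ _ "subtopology _"])

text \<open>The vertices are listed in increasing order, the orientation that
  \<open>incidence\<close> uses; being an affine simplex of the library, it is subject to the
  singular boundary operator as it stands.\<close>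

definition vertex_simplex :: "nat set \<Rightarrow> (nat \<Rightarrow> real) \<Rightarrow> nat \<Rightarrow> real" where
  "vertex_simplex \<delta> =
     oriented_simplex (card \<delta> - 1) (\<lambda>j i. if i = sorted_list_of_set \<delta> ! j then 1 else 0)"

text \<open>The vertices of the standard simplex go to unit vectors, from which the vertex list can
  be read off. Hence distinct faces of one dimension are distinct generators of the free group of
  chains.\<close>

lemma inj_on_vertex_simplex:
  assumes "finite \<delta>" "finite \<delta>'" "card \<delta> = card \<delta>'" "vertex_simplex \<delta> = vertex_simplex \<delta>'"
  shows "\<delta> = \<delta>'"
proof -
  have "sorted_list_of_set \<delta> ! i = sorted_list_of_set \<delta>' ! i" if "i < card \<delta>" for i
  proof -
    have "(\<lambda>j. if j = sorted_list_of_set \<delta> ! i then 1 else (0::real)) =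
          (\<lambda>j. if j = sorted_list_of_set \<delta>' ! i then 1 else 0)"
      using assms that unfolding vertex_simplex_def by (simp add: oriented_simplex_eq)
    from fun_cong [OF this, of "sorted_list_of_set \<delta> ! i"] show ?thesis by (metis zero_neq_one)
  qed
  then have "sorted_list_of_set \<delta> = sorted_list_of_set \<delta>'"
    using assms(3) by (simp add: list_eq_iff_nth_eq)
  then show ?thesis
    using assms by (metis set_sorted_list_of_set)
qed

lemma vertex_simplex_image:
  assumes "finite \<delta>" "\<delta> \<noteq> {}"
  shows "vertex_simplex \<delta> ` standard_simplex (card \<delta> - 1) \<subseteq> face_hull \<delta>"
proof
  fix y assume "y \<in> vertex_simplex \<delta> ` standard_simplex (card \<delta> - 1)"
  then obtain x where x: "x \<in> standard_simplex (card \<delta> - 1)" and y: "y = vertex_simplex \<delta> x" by blast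
  let ?l = "sorted_list_of_set \<delta>"
  have c: "card \<delta> > 0" using assms by (simp add: card_gt_0_iff)
  have nthin: "?l ! j \<in> \<delta>" if "j \<le> card \<delta> - 1" for j
    using that c assms by (metis Suc_pred' le_imp_less_Suc length_sorted_list_of_set nth_mem set_sorted_list_of_set)
  have y': "y i = (\<Sum>j\<le>card \<delta> - 1. (if i = ?l ! j then 1 else 0) * x j)" for i
    unfolding y vertex_simplex_def oriented_simplex_def using x by simp
  have x0: "x j \<ge> 0" for j using x by (auto simp: standard_simplex_def)
  have x1: "(\<Sum>j\<le>card \<delta> - 1. x j) = 1" using x by (auto simp: standard_simplex_def)
  have "y i \<ge> 0" for i unfolding y' by (intro sum_nonneg) (auto simp: x0)
  moreover have "y i = 0" if "i \<notin> \<delta>" for i unfolding y' using nthin that by (intro sum.neutral) auto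
  moreover have "sum y \<delta> = 1"
  proof -
    have "sum y \<delta> = (\<Sum>j\<le>card \<delta> - 1. \<Sum>i\<in>\<delta>. (if i = ?l ! j then 1 else 0) * x j)"
      unfolding y' by (rule sum.swap)
    also have "\<dots> = (\<Sum>j\<le>card \<delta> - 1. x j)"
      using nthin assms by (intro sum.cong) (auto simp: if_distrib [of "\<lambda>u. u * _"] cong: if_cong)
    finally show ?thesis using x1 by simp
  qed
  ultimately show "y \<in> face_hull \<delta>" using assms by (simp add: face_hull_eq)
qed

lemma singular_simplex_vertex_simplex:
  assumes "\<delta> \<in> K" "finite \<delta>" "\<delta> \<noteq> {}"
  shows "singular_simplex (card \<delta> - 1) (realization K) (vertex_simplex \<delta>)"
  unfolding realization_def
proof (rule simplicial_imp_singular_simplex)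
  show "simplicial_simplex (card \<delta> - 1) (polyhedron K) (vertex_simplex \<delta>)"
    unfolding simplicial_simplex using vertex_simplex_image [OF assms(2,3)] assms(1)
    by (auto simp: vertex_simplex_def)
qed

text \<open>Reconciles two sign conventions: the singular boundary uses the position of the omitted
  vertex, \<open>incidence\<close> the number of smaller vertices.\<close>

lemma card_less_nth_sorted_list_of_set:
  assumes "finite (\<delta>::nat set)" "k < card \<delta>"
  shows "card {w \<in> \<delta>. w < sorted_list_of_set \<delta> ! k} = k"
proof -
  let ?l = "sorted_list_of_set \<delta>"
  have s: "sorted_wrt (<) ?l" by simp
  have len: "length ?l = card \<delta>" by simp
  have "{w \<in> \<delta>. w < ?l ! k} = (!) ?l ` {..<k}"
  proof
    show "(!) ?l ` {..<k} \<subseteq> {w \<in> \<delta>. w < ?l ! k}"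
    proof (rule image_subsetI)
      fix j assume "j \<in> {..<k}"
      then have j: "j < k" by simp
      then have "?l ! j < ?l ! k" using assms len by (intro sorted_wrt_nth_less [OF s]) simp_all
      moreover have "?l ! j \<in> set ?l" using j assms len by (intro nth_mem) simp
      ultimately show "?l ! j \<in> {w \<in> \<delta>. w < ?l ! k}" using assms by simp
    qed
    show "{w \<in> \<delta>. w < ?l ! k} \<subseteq> (!) ?l ` {..<k}"
    proof
      fix w assume "w \<in> {w \<in> \<delta>. w < ?l ! k}"
      then have w: "w \<in> \<delta>" "w < ?l ! k" by simp_all
      then obtain j where j: "j < card \<delta>" "w = ?l ! j"
        using assms(1) by (metis in_set_conv_nth len set_sorted_list_of_set)
      have "j < k"
      proof (rule ccontr)
        assume "\<not> j < k"
        then have "?l ! k \<le> ?l ! j" using j len by (intro sorted_nth_mono) simp_all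
        with w j show False by linarith
      qed
      with j show "w \<in> (!) ?l ` {..<k}" by blast
    qed
  qed
  moreover have "inj_on ((!) ?l) {..<k}"
    using assms len by (intro inj_onI) (simp add: nth_eq_iff_index_eq)
  ultimately show ?thesis by (simp add: card_image)
qed

text \<open>Deleting an entry of a sorted list leaves a sorted list, so faces of increasing
  simplices are increasing simplices. The bound \<open>card \<delta> \<ge> 2\<close> excludes a
  single vertex, whose face would be empty.\<close>

lemma singular_face_vertex_simplex:
  assumes "finite \<delta>" "card \<delta> \<ge> 2" "k < card \<delta>"
  shows "singular_face (card \<delta> - 1) k (vertex_simplex \<delta>)
       = vertex_simplex (\<delta> - {sorted_list_of_set \<delta> ! k})"
proof -
  let ?l = "sorted_list_of_set \<delta>"
  let ?x = "?l ! k"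
  have xin: "?x \<in> \<delta>" using assms by (metis length_sorted_list_of_set nth_mem set_sorted_list_of_set)
  have "sorted_list_of_set (\<delta> - {?x}) = remove1 ?x ?l"
    using assms(1) by (rule sorted_list_of_set_remove)
  also have "\<dots> = take k ?l @ drop (Suc k) ?l"
  proof -
    have d: "?l = take k ?l @ ?x # drop (Suc k) ?l" using assms by (simp add: id_take_nth_drop)
    have "?x \<notin> set (take k ?l)"
      using distinct_sorted_list_of_set [of \<delta>] d by (metis distinct_append disjoint_iff list.set_intros(1))
    then show ?thesis by (metis d remove1.simps(2) remove1_append)
  qed
  finally have r: "sorted_list_of_set (\<delta> - {?x}) = take k ?l @ drop (Suc k) ?l" .
  have n: "sorted_list_of_set (\<delta> - {?x}) ! j = (if j < k then ?l ! j else ?l ! Suc j)"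
    if "j \<le> card \<delta> - 2" for j
    using that assms unfolding r by (auto simp: nth_append)
  have c: "card (\<delta> - {?x}) - 1 = card \<delta> - 2" using xin assms by simp
  have "singular_face (card \<delta> - 1) k (vertex_simplex \<delta>) =
     oriented_simplex (card \<delta> - 2) (\<lambda>j. if j < k then (\<lambda>i. if i = ?l ! j then 1 else 0)
         else (\<lambda>i. if i = ?l ! (Suc j) then 1 else 0))"
    unfolding vertex_simplex_def using assms
    by (subst singular_face_oriented_simplex) (auto simp: numeral_2_eq_2)
  also have "\<dots> = vertex_simplex (\<delta> - {?x})"
    unfolding vertex_simplex_def c oriented_simplex_eq using n by auto
  finally show ?thesis .
qed

lemma chain_boundary_vertex_simplex:
  assumes "finite \<delta>" "card \<delta> = Suc n"
  shows "chain_boundary n (frag_of (vertex_simplex \<delta>)) =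
    (if n = 0 then 0 else
     (\<Sum>v\<in>\<delta>. frag_cmul ((-1) ^ card {w \<in> \<delta>. w < v}) (frag_of (vertex_simplex (\<delta> - {v})))))"
proof (cases "n = 0")
  case False
  let ?l = "sorted_list_of_set \<delta>"
  have b: "bij_betw ((!) ?l) {..n} \<delta>"
    using assms bij_betw_nth [of ?l "{..<Suc n}" \<delta>] by (simp add: lessThan_Suc_atMost)
  have "chain_boundary n (frag_of (vertex_simplex \<delta>)) =
     (\<Sum>k\<le>n. frag_cmul ((-1) ^ k) (frag_of (singular_face n k (vertex_simplex \<delta>))))"
    using False by (simp add: chain_boundary_of)
  also have "\<dots> = (\<Sum>k\<le>n. frag_cmul ((-1) ^ card {w \<in> \<delta>. w < ?l ! k}) (frag_of (vertex_simplex (\<delta> - {?l ! k}))))"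
  proof (rule sum.cong)
    fix k assume "k \<in> {..n}"
    then have k: "k < card \<delta>" using assms by simp
    then show "frag_cmul ((-1) ^ k) (frag_of (singular_face n k (vertex_simplex \<delta>))) =
       frag_cmul ((-1) ^ card {w \<in> \<delta>. w < ?l ! k}) (frag_of (vertex_simplex (\<delta> - {?l ! k})))"
      using assms False card_less_nth_sorted_list_of_set [OF assms(1) k]
        singular_face_vertex_simplex [OF assms(1) _ k] by simp
  qed simp
  also have "\<dots> = (\<Sum>v\<in>\<delta>. frag_cmul ((-1) ^ card {w \<in> \<delta>. w < v}) (frag_of (vertex_simplex (\<delta> - {v}))))"
    by (rule sum.reindex_bij_betw [OF b])
  finally show ?thesis using False by simp
qed (simp add: chain_boundary_of)

text \<open>Simplicial chains form a subgroup of the singular chains: both theories share one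
  boundary operator, and the comparison map is an inclusion.\<close>

definition schain :: "nat \<Rightarrow> nat set set \<Rightarrow> (nat \<Rightarrow> real) chain \<Rightarrow> bool" where
  "schain n K c \<longleftrightarrow> Poly_Mapping.keys c \<subseteq> vertex_simplex ` {\<delta> \<in> K. card \<delta> = Suc n}"

lemma schain_0 [simp]: "schain n K 0"
  by (simp add: schain_def)

lemma schain_of [intro]: "\<delta> \<in> K \<Longrightarrow> card \<delta> = Suc n \<Longrightarrow> schain n K (frag_of (vertex_simplex \<delta>))"
  by (auto simp: schain_def)

lemma schain_cmul: "schain n K a \<Longrightarrow> schain n K (frag_cmul k a)"
  unfolding schain_def by (meson keys_cmul order_trans)

lemma schain_add: "schain n K a \<Longrightarrow> schain n K b \<Longrightarrow> schain n K (a + b)"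
  unfolding schain_def using keys_add [of a b] by blast

lemma schain_diff: "schain n K a \<Longrightarrow> schain n K b \<Longrightarrow> schain n K (a - b)"
  unfolding schain_def using keys_diff [of a b] by blast

lemma schain_sum: "(\<And>i. i \<in> I \<Longrightarrow> schain n K (f i)) \<Longrightarrow> schain n K (sum f I)"
  by (induction I rule: infinite_finite_induct) (auto intro: schain_add)

lemma schain_mono: "schain n L a \<Longrightarrow> L \<subseteq> K \<Longrightarrow> schain n K a"
  unfolding schain_def by blast

lemma schain_induct [consumes 1, case_names zero of diff]:
  assumes "schain n K c" "P 0"
    and "\<And>\<delta>. \<delta> \<in> K \<Longrightarrow> card \<delta> = Suc n \<Longrightarrow> P (frag_of (vertex_simplex \<delta>))"
    and "\<And>a b. P a \<Longrightarrow> P b \<Longrightarrow> P (a - b)"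
  shows "P c"
proof (rule frag_induction [of c "vertex_simplex ` {\<delta> \<in> K. card \<delta> = Suc n}"])
  show "Poly_Mapping.keys c \<subseteq> vertex_simplex ` {\<delta> \<in> K. card \<delta> = Suc n}"
    using assms(1) by (simp add: schain_def)
qed (use assms in auto)

context
  fixes K assumes K: "finite_complex K"
begin

lemma schain_imp_singular_chain:
  assumes "schain n K c" shows "singular_chain n (realization K) c"
  using assms
proof (induction rule: schain_induct)
  case (of \<delta>)
  then show ?case
    using singular_simplex_vertex_simplex [OF of(1) finite_complexD(2,3) [OF K of(1)]]
    by (simp add: singular_chain_of)
qed (auto intro: singular_chain_diff)

lemma schain_boundary:
  assumes "schain n K c" shows "schain (n - 1) K (chain_boundary n c)"
  using assms
proof (induction rule: schain_induct)
  case (of \<delta>)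
  show ?case
  proof (cases "n = 0")
    case True then show ?thesis by (simp add: chain_boundary_of)
  next
    case False
    have fin: "finite \<delta>" by (rule finite_complexD(2) [OF K of(1)])
    show ?thesis
      unfolding chain_boundary_vertex_simplex [OF fin of(2)] using False
    proof (simp only: if_False, intro schain_sum schain_cmul schain_of)
      fix v assume v: "v \<in> \<delta>"
      show c: "card (\<delta> - {v}) = Suc (n - 1)" using v fin of False by simp
      show "\<delta> - {v} \<in> K"
      proof (rule finite_complexD(5) [OF K of(1)])
        show "\<delta> - {v} \<noteq> {}" using c by (metis card.empty nat.distinct(1))
      qed (rule Diff_subset)
    qed
  qed
qed (auto simp: chain_boundary_diff intro: schain_diff)

end

text \<open>These four predicates express, on the level of chains, that simplicial homology maps onto and
  injects into singular homology. For \<open>n = 0\<close> the truncated \<open>n - 1\<close> is harmless, as \<open>chain_boundary 0\<close>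
  vanishes.\<close>

definition homology_surj :: "nat \<Rightarrow> nat set set \<Rightarrow> bool" where
  "homology_surj n K \<longleftrightarrow> (\<forall>c. singular_chain n (realization K) c \<and> chain_boundary n c = 0 \<longrightarrow>
     (\<exists>a t. schain n K a \<and> chain_boundary n a = 0 \<and> singular_chain (Suc n) (realization K) t \<and>
        c = a + chain_boundary (Suc n) t))"

definition homology_inj :: "nat \<Rightarrow> nat set set \<Rightarrow> bool" where
  "homology_inj n K \<longleftrightarrow> (\<forall>a t. schain n K a \<and> singular_chain (Suc n) (realization K) t \<and>
     a = chain_boundary (Suc n) t \<longrightarrow> (\<exists>b. schain (Suc n) K b \<and> a = chain_boundary (Suc n) b))"

definition rel_homology_surj :: "nat \<Rightarrow> nat set set \<Rightarrow> nat set set \<Rightarrow> bool" where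
  "rel_homology_surj n K L \<longleftrightarrow>
     (\<forall>c. singular_chain n (realization K) c \<and> singular_chain (n - 1) (realization L) (chain_boundary n c) \<longrightarrow>
     (\<exists>a t u. schain n K a \<and> schain (n - 1) L (chain_boundary n a) \<and>
        singular_chain (Suc n) (realization K) t \<and> singular_chain n (realization L) u \<and>
        c = a + chain_boundary (Suc n) t + u))"

definition rel_homology_inj :: "nat \<Rightarrow> nat set set \<Rightarrow> nat set set \<Rightarrow> bool" where
  "rel_homology_inj n K L \<longleftrightarrow>
     (\<forall>a t u. schain n K a \<and> schain (n - 1) L (chain_boundary n a) \<and>
        singular_chain (Suc n) (realization K) t \<and> singular_chain n (realization L) u \<and>
        a = chain_boundary (Suc n) t + u \<longrightarrow>
     (\<exists>b l. schain (Suc n) K b \<and> schain n L l \<and> a = chain_boundary (Suc n) b + l))"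

section \<open>The five lemma for a pair of complexes, on chains\<close>

context
  fixes K L assumes K: "finite_complex K" and L: "finite_complex L" and LK: "L \<subseteq> K"
begin

lemma singular_chain_sub: "singular_chain n (realization L) c \<Longrightarrow> singular_chain n (realization K) c"
  unfolding realization_def using LK by (elim singular_chain_mono) blast

lemma schain_sub: "schain n L c \<Longrightarrow> schain n K c"
  by (rule schain_mono [OF _ LK])

lemmas boundary_simps = chain_boundary_diff chain_boundary_add

text \<open>The boundary of \<open>c\<close> is, up to the boundary of a chain \<open>t\<close> in
  \<open>L\<close>, a simplicial cycle of \<open>L\<close>. That cycle is the boundary of
  \<open>c - t\<close> in \<open>K\<close>, hence also of a simplicial chain \<open>b\<close>, and
  \<open>c - t - b\<close> is an absolute cycle, to which surjectivity for \<open>K\<close>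
  applies.\<close>

lemma rel_homology_surj_if_abs:
  assumes absK: "\<And>n. homology_surj n K \<and> homology_inj n K" and absL: "\<And>n. homology_surj n L \<and> homology_inj n L"
  shows "rel_homology_surj n K L"
  unfolding rel_homology_surj_def
proof (intro allI impI, elim conjE)
  fix c assume c: "singular_chain n (realization K) c"
    and dc: "singular_chain (n - 1) (realization L) (chain_boundary n c)"
  show "\<exists>a t u. schain n K a \<and> schain (n - 1) L (chain_boundary n a) \<and>
        singular_chain (Suc n) (realization K) t \<and> singular_chain n (realization L) u \<and>
        c = a + chain_boundary (Suc n) t + u"
  proof (cases n)
    case 0
    have "chain_boundary n c = 0" by (simp add: 0 chain_boundary_def)
    then obtain a t where "schain n K a" "chain_boundary n a = 0"
        "singular_chain (Suc n) (realization K) t" "c = a + chain_boundary (Suc n) t"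
      using absK c unfolding homology_surj_def by metis
    then show ?thesis by (intro exI [of _ a] exI [of _ t] exI [of _ 0]) simp
  next
    case (Suc m)
    have "chain_boundary m (chain_boundary n c) = 0" using c chain_boundary_boundary_alt Suc by blast
    then obtain a t where a: "schain m L a" "chain_boundary m a = 0"
        and t: "singular_chain n (realization L) t" and e: "chain_boundary n c = a + chain_boundary n t"
      using absL dc Suc unfolding homology_surj_def by (metis diff_Suc_1)
    have "a = chain_boundary n (c - t)" by (simp add: boundary_simps e)
    moreover have ct: "singular_chain n (realization K) (c - t)"
      by (intro singular_chain_diff singular_chain_sub [OF t] c)
    ultimately obtain b where b: "schain n K b" "a = chain_boundary n b"
      using absK a(1) schain_sub unfolding homology_inj_def Suc by metis
    have "singular_chain n (realization K) (c - t - b)"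
      by (intro singular_chain_diff ct schain_imp_singular_chain [OF K] b)
    moreover have "chain_boundary n (c - t - b) = 0" using b e by (simp add: boundary_simps)
    ultimately obtain a' u where a': "schain n K a'" "chain_boundary n a' = 0"
        and u: "singular_chain (Suc n) (realization K) u" and e': "c - t - b = a' + chain_boundary (Suc n) u"
      using absK unfolding homology_surj_def by metis
    have "schain n K (a' + b)" using a' b by (intro schain_add)
    moreover have "schain (n - 1) L (chain_boundary n (a' + b))" using a b a' Suc by (simp add: boundary_simps)
    moreover have "c = (a' + b) + chain_boundary (Suc n) u + t" using e' by (simp add: algebra_simps)
    ultimately show ?thesis using u t by blast
  qed
qed

text \<open>The boundary of \<open>a\<close> is that of \<open>u\<close>, hence also that of a
  simplicial chain \<open>b\<close> of \<open>L\<close>; the cycle \<open>u - b\<close> is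
  homologous in \<open>L\<close> to a simplicial cycle \<open>a'\<close>. Then
  \<open>a - b - a'\<close> is a boundary in \<open>K\<close>, hence a simplicial boundary.\<close>

lemma rel_homology_inj_if_abs:
  assumes absK: "\<And>n. homology_surj n K \<and> homology_inj n K" and absL: "\<And>n. homology_surj n L \<and> homology_inj n L"
  shows "rel_homology_inj n K L"
  unfolding rel_homology_inj_def
proof (intro allI impI, elim conjE)
  fix a t u assume a: "schain n K a" "schain (n - 1) L (chain_boundary n a)"
    and t: "singular_chain (Suc n) (realization K) t" and u: "singular_chain n (realization L) u"
    and e: "a = chain_boundary (Suc n) t + u"
  obtain b where b: "schain n L b" "chain_boundary n a = chain_boundary n b"
  proof (cases n)
    case 0 then show ?thesis using that [of 0] by (simp add: chain_boundary_def)
  next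
    case (Suc m)
    have "chain_boundary n a = chain_boundary n u"
      using chain_boundary_boundary_alt [OF t] by (simp add: e boundary_simps)
    then show ?thesis using that absL a u unfolding homology_inj_def Suc by (metis diff_Suc_1)
  qed
  have ub: "singular_chain n (realization L) (u - b)"
    using u b schain_imp_singular_chain [OF L] by (intro singular_chain_diff)
  moreover have "chain_boundary n (u - b) = 0"
    using chain_boundary_boundary_alt [OF t] b e by (simp add: boundary_simps)
  ultimately obtain a' s where a': "schain n L a'" "chain_boundary n a' = 0"
      and s: "singular_chain (Suc n) (realization L) s" and e': "u - b = a' + chain_boundary (Suc n) s"
    using absL unfolding homology_surj_def by metis
  have "schain n K (a - b - a')" by (intro schain_diff schain_sub [OF b(1)] schain_sub [OF a'(1)] a)
  moreover have "a - b - a' = chain_boundary (Suc n) (t + s)" using e e' by (simp add: boundary_simps algebra_simps)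
  moreover have "singular_chain (Suc n) (realization K) (t + s)" by (intro singular_chain_add t singular_chain_sub [OF s])
  ultimately obtain f where f: "schain (Suc n) K f" "a - b - a' = chain_boundary (Suc n) f"
    using absK unfolding homology_inj_def by metis
  show "\<exists>b l. schain (Suc n) K b \<and> schain n L l \<and> a = chain_boundary (Suc n) b + l"
  proof (intro exI conjI)
    show "schain n L (b + a')" using b a' by (intro schain_add)
    show "a = chain_boundary (Suc n) f + (b + a')" using f(2) by (simp add: algebra_simps)
  qed (fact f(1))
qed

text \<open>In the relative decomposition of the cycle \<open>c\<close>, the boundary of
  \<open>a\<close> is also that of \<open>-u\<close> in \<open>L\<close>, hence that of a simplicial
  chain \<open>b\<close> there. Shifting \<open>b\<close> from \<open>a\<close> to \<open>u\<close>
  turns both into cycles, and the one in \<open>L\<close> is homologous to a simplicial one.\<close>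

lemma homology_surj_if_rel:
  assumes absL: "\<And>n. homology_surj n L \<and> homology_inj n L" and rel: "rel_homology_surj n K L"
  shows "homology_surj n K"
  unfolding homology_surj_def
proof (intro allI impI, elim conjE)
  fix c assume c: "singular_chain n (realization K) c" "chain_boundary n c = 0"
  then have "singular_chain (n - 1) (realization L) (chain_boundary n c)" by simp
  then obtain a t u where a: "schain n K a" "schain (n - 1) L (chain_boundary n a)"
     and t: "singular_chain (Suc n) (realization K) t" and u: "singular_chain n (realization L) u"
     and e: "c = a + chain_boundary (Suc n) t + u"
    using rel c unfolding rel_homology_surj_def by metis
  have da: "chain_boundary n a = chain_boundary n (- u)"
    using c e chain_boundary_boundary_alt [OF t] by (simp add: boundary_simps chain_boundary_minus eq_neg_iff_add_eq_0)
  obtain b where b: "schain n L b" "chain_boundary n a = chain_boundary n b"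
  proof (cases n)
    case 0 then show ?thesis using that [of 0] by (simp add: chain_boundary_def)
  next
    case (Suc m)
    have "singular_chain n (realization L) (- u)" using u by (simp add: singular_chain_minus)
    with da show ?thesis using that absL a unfolding homology_inj_def Suc by (metis diff_Suc_1)
  qed
  have "singular_chain n (realization L) (u + b)"
    using u b schain_imp_singular_chain [OF L] by (intro singular_chain_add)
  moreover have "chain_boundary n (u + b) = 0"
    using b(2) da by (simp add: boundary_simps chain_boundary_minus) (metis add.right_inverse)
  ultimately obtain a' s where a': "schain n L a'" "chain_boundary n a' = 0"
      and s: "singular_chain (Suc n) (realization L) s" and e': "u + b = a' + chain_boundary (Suc n) s"
    using absL unfolding homology_surj_def by metis
  show "\<exists>a t. schain n K a \<and> chain_boundary n a = 0 \<and> singular_chain (Suc n) (realization K) t \<and>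
        c = a + chain_boundary (Suc n) t"
  proof (intro exI conjI)
    show "schain n K (a - b + a')" by (intro schain_add schain_diff schain_sub [OF b(1)] schain_sub [OF a'(1)] a)
    show "chain_boundary n (a - b + a') = 0" using b a' by (simp add: boundary_simps)
    show "singular_chain (Suc n) (realization K) (t + s)" by (intro singular_chain_add t singular_chain_sub [OF s])
    show "c = a - b + a' + chain_boundary (Suc n) (t + s)"
      using e e' by (simp add: boundary_simps algebra_simps)
  qed
qed

text \<open>Injectivity for the pair leaves a remainder \<open>l\<close> in \<open>L\<close>, the
  boundary of \<open>t - b\<close>. This chain is a relative cycle one degree higher, so
  surjectivity there rewrites \<open>l\<close> as the boundary of a simplicial chain of
  \<open>K\<close> plus that of a singular chain of \<open>L\<close>; injectivity for
  \<open>L\<close> makes the latter simplicial.\<close>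

lemma homology_inj_if_rel:
  assumes absL: "\<And>n. homology_surj n L \<and> homology_inj n L" and rel: "\<And>n. rel_homology_surj n K L \<and> rel_homology_inj n K L"
  shows "homology_inj n K"
  unfolding homology_inj_def
proof (intro allI impI, elim conjE)
  fix a t assume a: "schain n K a" and t: "singular_chain (Suc n) (realization K) t"
    and e: "a = chain_boundary (Suc n) t"
  have da: "chain_boundary n a = 0" using chain_boundary_boundary_alt [OF t] e by simp
  have "schain (n - 1) L (chain_boundary n a)" "a = chain_boundary (Suc n) t + 0"
    "singular_chain n (realization L) 0"
    using da e by auto
  then obtain b l where b: "schain (Suc n) K b" and l: "schain n L l" and e': "a = chain_boundary (Suc n) b + l"
    using rel a t unfolding rel_homology_inj_def by metis
  have tb: "singular_chain (Suc n) (realization K) (t - b)"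
    using t b schain_imp_singular_chain [OF K] by (intro singular_chain_diff)
  moreover have dtb: "chain_boundary (Suc n) (t - b) = l" using e e' by (simp add: boundary_simps diff_eq_eq add.commute)
  moreover have "singular_chain n (realization L) l" using l schain_imp_singular_chain [OF L] by blast
  ultimately obtain a' s u where a': "schain (Suc n) K a'" "schain n L (chain_boundary (Suc n) a')"
     and s: "singular_chain (Suc (Suc n)) (realization K) s" and u: "singular_chain (Suc n) (realization L) u"
     and f: "t - b = a' + chain_boundary (Suc (Suc n)) s + u"
    using rel [of "Suc n"] unfolding rel_homology_surj_def by (metis diff_Suc_1)
  have "l = chain_boundary (Suc n) a' + chain_boundary (Suc n) u"
    using dtb f chain_boundary_boundary_alt [OF s] by (simp add: boundary_simps)
  then have "schain n L (l - chain_boundary (Suc n) a')" "l - chain_boundary (Suc n) a' = chain_boundary (Suc n) u"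
    using schain_diff [OF l a'(2)] by (simp_all add: algebra_simps)
  then obtain b' where b': "schain (Suc n) L b'" "l - chain_boundary (Suc n) a' = chain_boundary (Suc n) b'"
    using absL u unfolding homology_inj_def by metis
  show "\<exists>b. schain (Suc n) K b \<and> a = chain_boundary (Suc n) b"
  proof (intro exI conjI)
    show "schain (Suc n) K (b + a' + b')" by (intro schain_add b a' schain_sub [OF b'(1)])
    show "a = chain_boundary (Suc n) (b + a' + b')" using e' b' by (simp add: boundary_simps algebra_simps)
  qed
qed

end

subsection \<open>Deformation of punctured realizations onto costars\<close>

definition support :: "(nat \<Rightarrow> real) \<Rightarrow> nat set" where
  "support x = {i. x i \<noteq> 0}"

definition open_face :: "nat set \<Rightarrow> (nat \<Rightarrow> real) set" where
  "open_face \<sigma> = {x. (\<forall>i. 0 \<le> x i) \<and> support x = \<sigma> \<and> sum x \<sigma> = 1}"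

text \<open>The complement of the open star of \<sigma>. It is the same subcomplex for every point
  of the open face \<sigma>, which is what makes local homology constant along open faces.\<close>

definition costar :: "nat set \<Rightarrow> nat set set \<Rightarrow> nat set set" where
  "costar \<sigma> K = {\<delta> \<in> K. \<not> \<sigma> \<subseteq> \<delta>}"

lemma open_face_subset_face_hull: "finite \<sigma> \<Longrightarrow> open_face \<sigma> \<subseteq> face_hull \<sigma>"
  by (auto simp: open_face_def face_hull_eq support_def)

text \<open>Each point lies in the open face of its support and in no other, so membership becomes a
  condition on \<open>support x\<close> without a search over faces.\<close>

lemma in_polyhedron:
  assumes "finite_complex K"
  shows "x \<in> polyhedron K \<longleftrightarrow> (\<forall>i. 0 \<le> x i) \<and> support x \<in> K \<and> sum x (support x) = 1"
proof
  assume "x \<in> polyhedron K"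
  then obtain \<delta> where \<delta>: "\<delta> \<in> K" "x \<in> face_hull \<delta>" by blast
  then have x: "\<forall>i. 0 \<le> x i" "\<forall>i. i \<notin> \<delta> \<longrightarrow> x i = 0" "sum x \<delta> = 1"
    using finite_complexD(2) [OF assms] by (simp_all add: face_hull_eq)
  then have sub: "support x \<subseteq> \<delta>" by (auto simp: support_def)
  have s: "sum x (support x) = sum x \<delta>"
    using sub finite_complexD(2) [OF assms \<delta>(1)] by (intro sum.mono_neutral_left) (auto simp: support_def)
  then have "support x \<noteq> {}" using x(3) by (metis sum.empty zero_neq_one)
  then show "(\<forall>i. 0 \<le> x i) \<and> support x \<in> K \<and> sum x (support x) = 1"
    using x s sub finite_complexD(5) [OF assms \<delta>(1)] by simp
next
  assume "(\<forall>i. 0 \<le> x i) \<and> support x \<in> K \<and> sum x (support x) = 1"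
  moreover from this have "x \<in> face_hull (support x)"
    using finite_complexD(2) [OF assms] by (simp add: face_hull_eq) (simp add: support_def)
  ultimately show "x \<in> polyhedron K" by blast
qed

lemma polyhedron_eq_Union_open_face:
  assumes "finite_complex K" shows "polyhedron K = (\<Union>\<sigma>\<in>K. open_face \<sigma>)"
proof -
  have "x \<in> polyhedron K \<longleftrightarrow> x \<in> (\<Union>\<sigma>\<in>K. open_face \<sigma>)" for x
    unfolding in_polyhedron [OF assms] by (auto simp: open_face_def)
  then show ?thesis by blast
qed

lemma finite_complex_costar: "finite_complex K \<Longrightarrow> finite_complex (costar \<sigma> K)"
  unfolding finite_complex_def costar_def by (auto intro: finite_subset)

lemma polyhedron_costar:
  assumes "finite_complex K"
  shows "polyhedron (costar \<sigma> K) = {x \<in> polyhedron K. \<exists>i\<in>\<sigma>. x i = 0}"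
proof -
  have "x \<in> polyhedron (costar \<sigma> K) \<longleftrightarrow> x \<in> {x \<in> polyhedron K. \<exists>i\<in>\<sigma>. x i = 0}" for x
    unfolding mem_Collect_eq in_polyhedron [OF assms] in_polyhedron [OF finite_complex_costar [OF assms]]
    by (auto simp: costar_def support_def)
  then show ?thesis by blast
qed

lemma continuous_map_Min:
  assumes "finite I" "I \<noteq> {}" "\<And>i. i \<in> I \<Longrightarrow> continuous_map X euclideanreal (f i)"
  shows "continuous_map X euclideanreal (\<lambda>x. Min ((\<lambda>i. f i x) ` I))"
  using assms
proof (induction I rule: finite_ne_induct)
  case (insert j F)
  have "continuous_map X euclideanreal (\<lambda>x. min (f j x) (Min ((\<lambda>i. f i x) ` F)))"
    using insert by (intro continuous_map_real_min) auto
  with insert show ?case by simp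
qed simp

lemma continuous_map_coordinate:
  "continuous_map (subtopology (powertop_real UNIV) S) euclideanreal (\<lambda>x. x i)"
  by (rule continuous_map_from_subtopology)
    (use continuous_map_product_projection [of i UNIV "\<lambda>_. euclideanreal"] in simp)

text \<open>The ratio test: for \<open>z\<close> positive on \<sigma>, the largest \<open>q\<close>
  such that \<open>x - q * z\<close> has no negative coordinate on \<sigma>.\<close>

definition bary_min :: "nat set \<Rightarrow> (nat \<Rightarrow> real) \<Rightarrow> (nat \<Rightarrow> real) \<Rightarrow> real" where
  "bary_min \<sigma> z x = Min ((\<lambda>i. x i / z i) ` \<sigma>)"

text \<open>Moves \<open>x\<close> away from \<open>z\<close> along the ray from \<open>z\<close> through \<open>x\<close>; the value \<open>q = bary_min \<sigma> z x\<close>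
  is where the ray leaves the open star of the face \<open>\<sigma>\<close>.\<close>

definition push :: "(nat \<Rightarrow> real) \<Rightarrow> real \<Rightarrow> (nat \<Rightarrow> real) \<Rightarrow> nat \<Rightarrow> real" where
  "push z q x = (\<lambda>i. (x i - q * z i) / (1 - q))"

context
  fixes K \<sigma> z assumes K: "finite_complex K" and \<sigma>: "\<sigma> \<in> K" and z: "z \<in> open_face \<sigma>"
begin

lemma z_facts: "finite \<sigma>" "\<sigma> \<noteq> {}" "z i \<ge> 0" "i \<in> \<sigma> \<Longrightarrow> z i > 0" "i \<notin> \<sigma> \<Longrightarrow> z i = 0" "sum z \<sigma> = 1"
proof -
  show "finite \<sigma>" "\<sigma> \<noteq> {}" using finite_complexD [OF K] \<sigma> by blast+
  show "z i \<ge> 0" "i \<in> \<sigma> \<Longrightarrow> z i > 0" "i \<notin> \<sigma> \<Longrightarrow> z i = 0" "sum z \<sigma> = 1"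
    using z by (auto simp: open_face_def support_def order_less_le)
qed

lemma z_in_polyhedron: "z \<in> polyhedron K"
  using z \<sigma> polyhedron_eq_Union_open_face [OF K] by blast

lemma bary_min_props:
  assumes x: "x \<in> polyhedron K" and xz: "x \<noteq> z"
  shows "0 \<le> bary_min \<sigma> z x" and "bary_min \<sigma> z x < 1"
    and "i \<in> \<sigma> \<Longrightarrow> bary_min \<sigma> z x * z i \<le> x i"
    and "\<exists>i\<in>\<sigma>. bary_min \<sigma> z x * z i = x i"
proof -
  have x': "\<forall>i. 0 \<le> x i" "support x \<in> K" "sum x (support x) = 1" using x in_polyhedron [OF K] by auto
  have fin: "finite ((\<lambda>i. x i / z i) ` \<sigma>)" "(\<lambda>i. x i / z i) ` \<sigma> \<noteq> {}" using z_facts by auto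
  show "0 \<le> bary_min \<sigma> z x" unfolding bary_min_def
    using fin x' z_facts(3) by (simp add: Min_ge_iff)
  show le: "bary_min \<sigma> z x * z i \<le> x i" if "i \<in> \<sigma>" for i
  proof -
    have "bary_min \<sigma> z x \<le> x i / z i" unfolding bary_min_def using fin that by (intro Min_le) auto
    then show ?thesis using z_facts(4) [OF that] by (simp add: pos_le_divide_eq)
  qed
  show "\<exists>i\<in>\<sigma>. bary_min \<sigma> z x * z i = x i"
  proof -
    have "bary_min \<sigma> z x \<in> (\<lambda>i. x i / z i) ` \<sigma>" unfolding bary_min_def using fin by (rule Min_in)
    then obtain i where i: "i \<in> \<sigma>" "bary_min \<sigma> z x = x i / z i" by blast
    then show ?thesis using z_facts(4) [OF i(1)] by (intro bexI [of _ i]) simp_all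
  qed
  \<comment> \<open>Otherwise \<open>x\<close> dominates \<open>z\<close> in every coordinate; both
    have total weight 1, so they coincide.\<close>
  show "bary_min \<sigma> z x < 1"
  proof (rule ccontr)
    assume "\<not> bary_min \<sigma> z x < 1"
    then have ge: "z i \<le> x i" if "i \<in> \<sigma>" for i
      using le [OF that] z_facts(3) [of i] by (metis dual_order.trans linorder_not_less mult_le_cancel_right1)
    let ?S = "\<sigma> \<union> support x"
    have finS: "finite ?S" using z_facts(1) finite_complexD(2) [OF K x'(2)] by simp
    have "sum x ?S = 1" using x'(3) finS by (subst sum.mono_neutral_right [of ?S "support x"]) (auto simp: support_def)
    moreover have "sum z ?S = 1" using z_facts(6) finS z_facts(5) by (subst sum.mono_neutral_right [of ?S \<sigma>]) auto
    ultimately have s0: "sum (\<lambda>i. x i - z i) ?S = 0" by (simp add: sum_subtractf)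
    have ge': "0 \<le> x i - z i" for i
      using ge [of i] x'(1) z_facts(5) [of i] by (cases "i \<in> \<sigma>") auto
    have "x i - z i = 0" if "i \<in> ?S" for i
      using s0 ge' that finS by (simp add: sum_nonneg_eq_0_iff)
    moreover have "x i = 0" "z i = 0" if "i \<notin> ?S" for i
      using that z_facts(5) by (auto simp: support_def)
    ultimately have "x = z" by (metis (no_types) eq_iff_diff_eq_0 ext)
    with xz show False by simp
  qed
qed

text \<open>For \<open>q > 0\<close> the support of \<open>x\<close> contains \<sigma>, so
  subtracting \<open>q * z\<close> creates no new vertices and leaves weight \<open>1 - q\<close>,
  which the division restores to 1. For \<open>q = 0\<close> nothing moves.\<close>

lemma push_in_polyhedron:
  assumes x: "x \<in> polyhedron K" and xz: "x \<noteq> z" and q: "0 \<le> q" "q \<le> bary_min \<sigma> z x"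
  shows "push z q x \<in> polyhedron K" and "push z q x \<noteq> z"
proof -
  note b = bary_min_props [OF x xz]
  have x': "\<forall>i. 0 \<le> x i" "support x \<in> K" "sum x (support x) = 1" using x in_polyhedron [OF K] by auto
  have q1: "q < 1" using q b(2) by simp
  have qz: "q * z i \<le> x i" for i
    using b(3) [of i] z_facts(3) [of i] z_facts(5) [of i] q x'(1)
    by (cases "i \<in> \<sigma>") (auto intro: order_trans [OF mult_right_mono])
  have nonneg: "\<forall>i. 0 \<le> push z q x i" using qz q1 by (simp add: push_def)
  have sub: "support (push z q x) \<subseteq> support x"
  proof
    fix i assume i: "i \<in> support (push z q x)"
    show "i \<in> support x"
    proof (rule ccontr)
      assume "i \<notin> support x"
      then have "x i = 0" by (simp add: support_def)
      moreover from this have "q * z i = 0" using qz [of i] mult_nonneg_nonneg [OF q(1) z_facts(3) [of i]] by simp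
      ultimately show False using i by (auto simp: support_def push_def)
    qed
  qed
  have fin: "finite (support x)" using finite_complexD(2) [OF K x'(2)] .
  have sum1: "sum (push z q x) (support (push z q x)) = 1"
  proof (cases "q = 0")
    case True then show ?thesis using x'(3) by (simp add: push_def)
  next
    case False
    have "z i = 0" if "i \<notin> support x" for i
    proof -
      have "x i = 0" using that by (simp add: support_def)
      then show ?thesis using qz [of i] z_facts(3) [of i] q False by (simp add: mult_le_0_iff)
    qed
    then have "\<sigma> \<subseteq> support x" using z_facts(4) by force
    then have "sum z (support x) = 1"
      using z_facts(5,6) fin by (subst sum.mono_neutral_right [of "support x" \<sigma>]) auto
    then have "sum (push z q x) (support x) = 1"
      using x'(3) q1 unfolding push_def
      by (simp add: sum_divide_distrib [symmetric] sum_subtractf sum_distrib_left [symmetric])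
    moreover have "sum (push z q x) (support (push z q x)) = sum (push z q x) (support x)"
      using sub fin by (intro sum.mono_neutral_left) (auto simp: support_def)
    ultimately show ?thesis by simp
  qed
  then have "support (push z q x) \<noteq> {}" by (metis sum.empty zero_neq_one)
  then have "support (push z q x) \<in> K" using finite_complexD(5) [OF K x'(2)] sub by blast
  with nonneg sum1 show "push z q x \<in> polyhedron K" using in_polyhedron [OF K] by blast
  show "push z q x \<noteq> z"
  proof
    assume "push z q x = z"
    then have "(x i - q * z i) / (1 - q) = z i" for i by (metis push_def)
    then have "x i = z i" for i using q1 by (simp add: divide_eq_eq algebra_simps)
    with xz show False by blast
  qed
qed

lemma push_min_in_costar:
  assumes x: "x \<in> polyhedron K" and xz: "x \<noteq> z"
  shows "push z (bary_min \<sigma> z x) x \<in> polyhedron (costar \<sigma> K)"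
proof -
  note b = bary_min_props [OF x xz]
  obtain i where "i \<in> \<sigma>" "bary_min \<sigma> z x * z i = x i" using b(4) by blast
  then have "push z (bary_min \<sigma> z x) x i = 0" by (simp add: push_def)
  then show ?thesis
    using \<open>i \<in> \<sigma>\<close> push_in_polyhedron(1) [OF x xz b(1) order_refl] polyhedron_costar [OF K] by blast
qed

lemma bary_min_costar:
  assumes x: "x \<in> polyhedron (costar \<sigma> K)"
  shows "x \<in> polyhedron K" "x \<noteq> z" "bary_min \<sigma> z x = 0"
proof -
  obtain i where i: "i \<in> \<sigma>" "x i = 0" and xK: "x \<in> polyhedron K" using x polyhedron_costar [OF K] by auto
  show "x \<in> polyhedron K" by (fact xK)
  show xz: "x \<noteq> z" using i z_facts(4) [OF i(1)] by auto
  show "bary_min \<sigma> z x = 0"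
    using bary_min_props(1) [OF xK xz] bary_min_props(3) [OF xK xz i(1)] i z_facts(4) [OF i(1)]
    by (simp add: mult_le_0_iff)
qed

lemma continuous_map_bary_min:
  "continuous_map (subtopology (powertop_real UNIV) S) euclideanreal (bary_min \<sigma> z)"
proof -
  have "continuous_map (subtopology (powertop_real UNIV) S) euclideanreal (\<lambda>x. Min ((\<lambda>i. x i / z i) ` \<sigma>))"
  proof (rule continuous_map_Min)
    fix i assume "i \<in> \<sigma>"
    then show "continuous_map (subtopology (powertop_real UNIV) S) euclideanreal (\<lambda>x. x i / z i)"
      using z_facts(4) [of i] by (intro continuous_map_real_divide continuous_map_coordinate) auto
  qed (use z_facts in auto)
  then show ?thesis by (simp add: bary_min_def [abs_def])
qed

lemma homotopic_push:
  "homotopic_with (\<lambda>h. True) (subtopology (powertop_real UNIV) (polyhedron K - {z}))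
     (subtopology (powertop_real UNIV) (polyhedron K - {z}))
     (\<lambda>x. push z (bary_min \<sigma> z x) x) id"
proof -
  let ?X = "subtopology (powertop_real UNIV) (polyhedron K - {z})"
  let ?P = "prod_topology (top_of_set {0..1::real}) ?X"
  \<comment> \<open>The fraction of the full push shrinks from 1 at \<open>t = 0\<close> to 0 at
    \<open>t = 1\<close>, where \<open>push z 0\<close> is the identity.\<close>
  let ?h = "\<lambda>(t, x). push z ((1 - t) * bary_min \<sigma> z x) x"
  have q: "0 \<le> (1 - t) * bary_min \<sigma> z x" "(1 - t) * bary_min \<sigma> z x \<le> bary_min \<sigma> z x" "(1 - t) * bary_min \<sigma> z x < 1"
    if "t \<in> {0..1}" "x \<in> polyhedron K - {z}" for t x
  proof -
    note b = bary_min_props(1,2) [of x]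
    show "0 \<le> (1 - t) * bary_min \<sigma> z x" using that b by simp
    show "(1 - t) * bary_min \<sigma> z x \<le> bary_min \<sigma> z x" using that b by (intro mult_left_le_one_le) auto
    then show "(1 - t) * bary_min \<sigma> z x < 1" using that b by fastforce
  qed
  have c1: "continuous_map ?P euclideanreal (\<lambda>p. bary_min \<sigma> z (snd p))"
    using continuous_map_compose [OF continuous_map_snd continuous_map_bary_min] by (simp add: o_def)
  have c2: "continuous_map ?P euclideanreal (\<lambda>p. snd p i)" for i
    using continuous_map_compose [OF continuous_map_snd continuous_map_coordinate] by (simp add: o_def)
  have c3: "continuous_map ?P euclideanreal fst"
    by (metis continuous_map_fst continuous_map_into_fulltopology)
  have cont: "continuous_map ?P (powertop_real UNIV) ?h"
    unfolding continuous_map_componentwise_UNIV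
  proof
    fix i
    have "continuous_map ?P euclideanreal
       (\<lambda>p. (snd p i - (1 - fst p) * bary_min \<sigma> z (snd p) * z i) / (1 - (1 - fst p) * bary_min \<sigma> z (snd p)))"
    proof (intro continuous_map_real_divide continuous_map_diff continuous_map_real_mult c1 c2 c3)
      fix p assume "p \<in> topspace ?P"
      then have "fst p \<in> {0..1}" "snd p \<in> polyhedron K - {z}" by (cases p; simp)+
      from q(3) [OF this] show "1 - (1 - fst p) * bary_min \<sigma> z (snd p) \<noteq> 0" by simp
    qed simp_all
    then show "continuous_map ?P euclideanreal (\<lambda>p. ?h p i)"
      by (simp add: push_def case_prod_unfold)
  qed
  have im: "?h ` topspace ?P \<subseteq> polyhedron K - {z}"
  proof
    fix y assume "y \<in> ?h ` topspace ?P"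
    then obtain p where p: "p \<in> topspace ?P" "y = ?h p" by blast
    define t x where "t = fst p" and "x = snd p"
    have tx: "t \<in> {0..1}" "x \<in> polyhedron K - {z}"
      using p(1) unfolding t_def x_def by (cases p; simp)+
    have y: "y = push z ((1 - t) * bary_min \<sigma> z x) x"
      using p(2) by (simp add: t_def x_def case_prod_unfold)
    show "y \<in> polyhedron K - {z}"
      unfolding y using push_in_polyhedron [OF _ _ q(1,2) [OF tx]] tx(2) by blast
  qed
  show ?thesis
    unfolding homotopic_with_def
  proof (intro exI [of _ ?h] conjI)
    show "continuous_map ?P ?X ?h" using cont im by (simp add: continuous_map_in_subtopology image_subset_iff_funcset)
  qed (auto simp: push_def)
qed

text \<open>In the exact sequence of the triple formed by the realization, its punctured part and
  the costar, the groups of the pair consisting of the last two vanish by the deformation. So the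
  map between the two remaining pairs is an isomorphism.\<close>

lemma iso_costar_punctured:
  "hom_induced n (realization K) (polyhedron (costar \<sigma> K)) (realization K) (polyhedron K - {z}) id
    \<in> iso (relative_homology_group n (realization K) (polyhedron (costar \<sigma> K)))
          (relative_homology_group n (realization K) (polyhedron K - {z}))"
proof -
  let ?A = "polyhedron (costar \<sigma> K)" and ?S = "polyhedron K - {z}"
  let ?X = "subtopology (realization K) ?S"
  have AS: "?A \<subseteq> ?S" using bary_min_costar by blast
  have X: "?X = subtopology (powertop_real UNIV) ?S"
    by (simp add: realization_def subtopology_subtopology inf.absorb2)
  have XA: "subtopology ?X ?A = subtopology (powertop_real UNIV) ?A"
    unfolding X using AS by (simp add: subtopology_subtopology inf.absorb2)
  let ?r = "\<lambda>x. push z (bary_min \<sigma> z x) x"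
  have hom: "homotopic_with (\<lambda>h. True) ?X ?X ?r id" unfolding X by (rule homotopic_push)
  have triv: "trivial_group (relative_homology_group m ?X ?A)" for m
  proof (rule trivial_relative_homology_group_gen [OF _ _ hom])
    have c: "continuous_map ?X ?X ?r" using homotopic_with_imp_continuous_maps [OF hom] by simp
    show c': "continuous_map ?X (subtopology ?X ?A) ?r"
      using c push_min_in_costar by (auto simp: continuous_map_in_subtopology X)
    have rid: "?r x = x" if "x \<in> ?A" for x
      using bary_min_costar(3) [OF that] by (simp add: push_def)
    show "homotopic_with (\<lambda>h. True) (subtopology ?X ?A) (subtopology ?X ?A) ?r id"
    proof (rule homotopic_with_equal)
      show "continuous_map (subtopology ?X ?A) (subtopology ?X ?A) ?r"
        by (rule continuous_map_from_subtopology [OF c'])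
      show "?r x = id x" if "x \<in> topspace (subtopology ?X ?A)" for x
        using that rid by (simp add: XA)
    qed simp_all
  qed
  have e: "exact_seq ([relative_homology_group (n - 1) ?X ?A, relative_homology_group n (realization K) ?S,
             relative_homology_group n (realization K) ?A, relative_homology_group n ?X ?A],
             [hom_relboundary n (realization K) ?S ?A, hom_induced n (realization K) ?A (realization K) ?S id,
              hom_induced n ?X ?A (realization K) ?A id])"
    using homology_exactness_triple_1 [OF AS, of n "realization K"] homology_exactness_triple_3 [OF AS, of n "realization K"]
    by (simp add: exact_seq_cons_iff)
  show ?thesis
    by (rule very_short_exact_sequence [OF e triv triv])
qed

end

lemma Hausdorff_realization: "Hausdorff_space (realization K)"
  unfolding realization_def
  by (intro Hausdorff_space_subtopology) (simp add: Hausdorff_space_product_topology)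

lemma closedin_polyhedron_costar:
  assumes "finite_complex K" "\<sigma> \<in> K"
  shows "closedin (realization K) (polyhedron (costar \<sigma> K))"
proof -
  have "closedin (realization K) (\<Union>i\<in>\<sigma>. {x \<in> topspace (realization K). x i \<in> {0}})"
  proof (rule closedin_Union)
    show "finite ((\<lambda>i. {x \<in> topspace (realization K). x i \<in> {0}}) ` \<sigma>)"
      using finite_complexD(2) [OF assms] by simp
    fix S assume "S \<in> (\<lambda>i. {x \<in> topspace (realization K). x i \<in> {0}}) ` \<sigma>"
    then obtain i where S: "S = {x \<in> topspace (realization K). x i \<in> {0}}" by blast
    show "closedin (realization K) S" unfolding S
      by (rule closedin_continuous_map_preimage [where Y = euclideanreal])
         (simp_all add: realization_def continuous_map_coordinate)
  qed
  moreover have "(\<Union>i\<in>\<sigma>. {x \<in> topspace (realization K). x i \<in> {0}}) = polyhedron (costar \<sigma> K)"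
    unfolding polyhedron_costar [OF assms(1)] topspace_realization by blast
  ultimately show ?thesis by simp
qed

section \<open>Excision for a maximal face\<close>

lemma id_funcset: "A \<subseteq> B \<Longrightarrow> id \<in> A \<rightarrow> B"
  by auto

lemma iso_cancel_left:
  assumes "g \<circ> f \<in> iso A C" "g \<in> iso B C" "f \<in> hom A B"
  shows "f \<in> iso A B"
proof -
  have im: "f ` carrier A \<subseteq> carrier B" using assms(3) by (auto simp: hom_def)
  have "bij_betw f (carrier A) (carrier B)"
    using bij_betw_comp_iff2 [OF _ im, of g "carrier C"] assms(1,2) by (simp add: iso_def)
  with assms(3) show ?thesis by (simp add: iso_def)
qed

definition faces :: "nat set \<Rightarrow> nat set set" where
  "faces \<tau> = Pow \<tau> - {{}}"

lemma in_faces: "\<delta> \<in> faces \<tau> \<longleftrightarrow> \<delta> \<subseteq> \<tau> \<and> \<delta> \<noteq> {}"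
  by (simp add: faces_def)

lemma finite_complex_faces:
  assumes "finite \<tau>" shows "finite_complex (faces \<tau>)"
  unfolding finite_complex_def in_faces
proof (intro conjI ballI allI impI)
  show "finite (faces \<tau>)" using assms by (simp add: faces_def)
qed (use assms finite_subset in \<open>auto simp: in_faces\<close>)

lemma faces_subset: "finite_complex K \<Longrightarrow> \<tau> \<in> K \<Longrightarrow> faces \<tau> \<subseteq> K"
  using finite_complexD(5) by (auto simp: in_faces)

lemma polyhedron_faces:
  assumes "finite \<tau>" "\<tau> \<noteq> {}" shows "polyhedron (faces \<tau>) = face_hull \<tau>"
proof
  show "face_hull \<tau> \<subseteq> polyhedron (faces \<tau>)" using assms by (auto simp: faces_def)
  have "x \<in> face_hull \<tau>" if d: "\<delta> \<subseteq> \<tau>" "x \<in> face_hull \<delta>" for \<delta> x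
  proof -
    have fd: "finite \<delta>" using d assms finite_subset by blast
    have "sum x \<tau> = sum x \<delta>" using d assms fd by (intro sum.mono_neutral_right) (auto simp: face_hull_eq)
    then show ?thesis using d assms fd by (auto simp: face_hull_eq)
  qed
  then show "polyhedron (faces \<tau>) \<subseteq> face_hull \<tau>" by (auto simp: faces_def)
qed

lemma barycenter_in_open_face:
  assumes "finite \<sigma>" "\<sigma> \<noteq> {}"
  shows "(\<lambda>i. if i \<in> \<sigma> then 1 / real (card \<sigma>) else 0) \<in> open_face \<sigma>"
  using assms by (auto simp: open_face_def support_def)

text \<open>Excising the rest of \<open>K\<close> directly is not allowed, since its closure need
  not lie in the interior of the subcomplex. The subcomplexes are first enlarged to complements of
  an interior point \<open>z\<close> of \<tau>, where excision applies, and
  \<open>iso_costar_punctured\<close> leads back on both sides.\<close>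

lemma iso_simplex_excision:
  assumes K: "finite_complex K" and \<tau>: "\<tau> \<in> K" and costar: "costar \<tau> K = K - {\<tau>}"
  shows "hom_induced n (realization (faces \<tau>)) (polyhedron (faces \<tau> - {\<tau>}))
           (realization K) (polyhedron (K - {\<tau>})) id
    \<in> iso (relative_homology_group n (realization (faces \<tau>)) (polyhedron (faces \<tau> - {\<tau>})))
          (relative_homology_group n (realization K) (polyhedron (K - {\<tau>})))"
proof -
  let ?T = "faces \<tau>"
  have fin: "finite \<tau>" "\<tau> \<noteq> {}" using finite_complexD [OF K] \<tau> by blast+
  have T: "finite_complex ?T" "\<tau> \<in> ?T" "?T \<subseteq> K"
    using finite_complex_faces [OF fin(1)] faces_subset [OF K \<tau>] fin(2) by (simp_all add: faces_def)
  have costarT: "costar \<tau> ?T = ?T - {\<tau>}" by (auto simp: costar_def faces_def)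
  obtain z where z: "z \<in> open_face \<tau>" using barycenter_in_open_face [OF fin] by blast
  have zT: "z \<in> polyhedron ?T" using z_in_polyhedron [OF T(1,2) z] .
  have TK: "polyhedron ?T \<subseteq> polyhedron K" using T(3) by blast
  let ?U = "polyhedron K - polyhedron ?T" and ?S = "polyhedron K - {z}"
  have exc: "hom_induced n (subtopology (realization K) (polyhedron K - ?U)) (?S - ?U)
       (subtopology (realization K) (polyhedron K)) ?S id
     \<in> iso (relative_homology_group n (subtopology (realization K) (polyhedron K - ?U)) (?S - ?U))
           (relative_homology_group n (subtopology (realization K) (polyhedron K)) ?S)"
  proof (rule homology_excision_axiom)
    \<comment> \<open>Points outside the simplex lie in the closed costar, which avoids
      \<open>z\<close>; hence the closure of \<open>?U\<close> stays in the open set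
      \<open>?S\<close>.\<close>
    have "?U \<subseteq> polyhedron (costar \<tau> K)"
      unfolding costar using \<tau> T(2) by blast
    then have "realization K closure_of ?U \<subseteq> polyhedron (costar \<tau> K)"
      using closedin_polyhedron_costar [OF K \<tau>] by (simp add: closure_of_minimal)
    moreover have "z \<notin> polyhedron (costar \<tau> K)" using bary_min_costar(2) [OF K \<tau> z] by blast
    moreover have "polyhedron (costar \<tau> K) \<subseteq> polyhedron K" by (auto simp: costar_def)
    moreover have "realization K interior_of ?S = ?S"
    proof -
      have "closedin (realization K) {z}"
        using Hausdorff_realization closedin_Hausdorff_singleton zT TK by (metis subsetD topspace_realization)
      then have "openin (realization K) ?S" by (metis openin_closedin_eq closedin_def topspace_realization)
      then show ?thesis by (rule interior_of_openin)
    qed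
    ultimately show "realization K closure_of ?U \<subseteq> realization K interior_of ?S" by auto
  qed blast
  have e1: "polyhedron K - ?U = polyhedron ?T" "?S - ?U = polyhedron ?T - {z}" using TK by auto
  have sK: "subtopology (realization K) (polyhedron K) = realization K"
    by (metis subtopology_topspace topspace_realization)
  note exc' = exc [unfolded e1 subtopology_realization [OF T(3)] sK]
  note jT = iso_costar_punctured [OF T(1,2) z, of n, unfolded costarT]
  note jK = iso_costar_punctured [OF K \<tau> z, of n, unfolded costar]
  have cont: "continuous_map (realization ?T) (realization K) id"
    by (metis continuous_map_from_subtopology continuous_map_id subtopology_realization T(3))
  have sub: "polyhedron (?T - {\<tau>}) \<subseteq> polyhedron (K - {\<tau>})" using T(3) by blast
  have nz: "polyhedron (?T - {\<tau>}) \<subseteq> polyhedron ?T - {z}"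
    using bary_min_costar(1,2) [OF T(1,2) z] unfolding costarT by blast
  have nzK: "polyhedron (K - {\<tau>}) \<subseteq> ?S"
    using bary_min_costar(1,2) [OF K \<tau> z] unfolding costar by blast
  have nzT: "polyhedron ?T - {z} \<subseteq> ?S" using TK by blast
  let ?i = "hom_induced n (realization ?T) (polyhedron (?T - {\<tau>})) (realization K) (polyhedron (K - {\<tau>})) id"
  let ?jK = "hom_induced n (realization K) (polyhedron (K - {\<tau>})) (realization K) ?S id"
  have "?jK \<circ> ?i = hom_induced n (realization ?T) (polyhedron (?T - {\<tau>})) (realization K) ?S (id \<circ> id)"
    by (rule hom_induced_compose [OF cont id_funcset [OF sub] continuous_map_id id_funcset [OF nzK], symmetric])
  also have "\<dots> = hom_induced n (realization ?T) (polyhedron ?T - {z}) (realization K) ?S id \<circ>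
        hom_induced n (realization ?T) (polyhedron (?T - {\<tau>})) (realization ?T) (polyhedron ?T - {z}) id"
    unfolding id_comp by (rule hom_induced_compose [OF continuous_map_id id_funcset [OF nz] cont id_funcset [OF nzT], simplified])
  finally have "?jK \<circ> ?i \<in> iso (relative_homology_group n (realization ?T) (polyhedron (?T - {\<tau>})))
      (relative_homology_group n (realization K) ?S)"
    using iso_set_trans [OF jT exc'] by (simp add: compose_def o_def)
  then show ?thesis by (rule iso_cancel_left [OF _ jK hom_induced_hom])
qed

text \<open>Unfolds bijectivity on relative homology classes into explicit decompositions of chains,
  the form in which the comparison with simplicial chains is carried out.\<close>

lemma hom_induced_id_chain_level:
  assumes LK: "L \<subseteq> K" and AL: "A \<subseteq> L" and BK: "B \<subseteq> K" and AB: "A \<subseteq> B"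
    and iso: "hom_induced (int n) (realization L) (polyhedron A) (realization K) (polyhedron B) id
      \<in> iso (relative_homology_group (int n) (realization L) (polyhedron A))
            (relative_homology_group (int n) (realization K) (polyhedron B))"
  shows "\<And>c. singular_chain n (realization K) c \<Longrightarrow> singular_chain (n - 1) (realization B) (chain_boundary n c) \<Longrightarrow>
      \<exists>c' t u. singular_chain n (realization L) c' \<and> singular_chain (n - 1) (realization A) (chain_boundary n c') \<and>
        singular_chain (Suc n) (realization K) t \<and> singular_chain n (realization B) u \<and>
        c = c' + chain_boundary (Suc n) t + u"
    and "\<And>c t u. singular_chain n (realization L) c \<Longrightarrow> singular_chain (n - 1) (realization A) (chain_boundary n c) \<Longrightarrow>
        singular_chain (Suc n) (realization K) t \<Longrightarrow> singular_chain n (realization B) u \<Longrightarrow>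
        c = chain_boundary (Suc n) t + u \<Longrightarrow>
      \<exists>t u. singular_chain (Suc n) (realization L) t \<and> singular_chain n (realization A) u \<and>
        c = chain_boundary (Suc n) t + u"
proof -
  let ?h = "hom_induced (int n) (realization L) (polyhedron A) (realization K) (polyhedron B) id"
  have relK: "singular_relcycle n (realization K) (polyhedron B) c \<longleftrightarrow>
      singular_chain n (realization K) c \<and> singular_chain (n - 1) (realization B) (chain_boundary n c)" for c
    by (simp add: singular_relcycle subtopology_realization [OF BK])
  have relL: "singular_relcycle n (realization L) (polyhedron A) c \<longleftrightarrow>
      singular_chain n (realization L) c \<and> singular_chain (n - 1) (realization A) (chain_boundary n c)" for c
    by (simp add: singular_relcycle subtopology_realization [OF AL])
  have cont: "continuous_map (realization L) (realization K) id"
    by (metis continuous_map_from_subtopology continuous_map_id subtopology_realization LK)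
  have ind: "?h (homologous_rel_set n (realization L) (polyhedron A) c) = homologous_rel_set n (realization K) (polyhedron B) c"
    if "singular_relcycle n (realization L) (polyhedron A) c" for c
  proof -
    have "id \<in> polyhedron A \<rightarrow> polyhedron B" by (intro id_funcset UN_mono AB subset_refl)
    from hom_induced_chain_map [OF cont this that] show ?thesis
      using that chain_map_ident [of n "realization L" c] by (simp add: relL)
  qed
  have bij: "bij_betw ?h (homologous_rel_set n (realization L) (polyhedron A) ` Collect (singular_relcycle n (realization L) (polyhedron A)))
      (homologous_rel_set n (realization K) (polyhedron B) ` Collect (singular_relcycle n (realization K) (polyhedron B)))"
    using iso by (simp add: iso_def carrier_relative_homology_group)
  have one: "homologous_rel_set n X S 0 = homologous_rel_set n X S c \<longleftrightarrow> singular_relboundary n X S c" for X :: "(nat \<Rightarrow> real) topology" and S c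
    by (simp add: homologous_rel_set_eq) (simp add: homologous_rel_def singular_relboundary_minus)
  { fix c assume "singular_chain n (realization K) c" "singular_chain (n - 1) (realization B) (chain_boundary n c)"
    then have "singular_relcycle n (realization K) (polyhedron B) c" by (simp add: relK)
    then have "homologous_rel_set n (realization K) (polyhedron B) c \<in>
      ?h ` homologous_rel_set n (realization L) (polyhedron A) ` Collect (singular_relcycle n (realization L) (polyhedron A))"
      using bij unfolding bij_betw_def by blast
    then obtain c' where c': "singular_relcycle n (realization L) (polyhedron A) c'"
      "homologous_rel_set n (realization K) (polyhedron B) c = ?h (homologous_rel_set n (realization L) (polyhedron A) c')"
      by auto
    then have "homologous_rel n (realization K) (polyhedron B) c c'"
      using ind [OF c'(1)] by (simp add: homologous_rel_set_eq)
    then obtain t u where "singular_chain (Suc n) (realization K) t" "singular_chain n (realization B) u"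
        "chain_boundary (Suc n) t + u = c - c'"
      unfolding homologous_rel_def singular_relboundary subtopology_realization [OF BK] by blast
    moreover from this have "c = c' + chain_boundary (Suc n) t + u" by (metis add.assoc add.commute diff_add_cancel)
    ultimately show "\<exists>c' t u. singular_chain n (realization L) c' \<and> singular_chain (n - 1) (realization A) (chain_boundary n c') \<and>
        singular_chain (Suc n) (realization K) t \<and> singular_chain n (realization B) u \<and>
        c = c' + chain_boundary (Suc n) t + u"
      using c'(1) unfolding relL by blast }
  { fix c t u assume c: "singular_chain n (realization L) c" "singular_chain (n - 1) (realization A) (chain_boundary n c)"
      and "singular_chain (Suc n) (realization K) t" "singular_chain n (realization B) u" "c = chain_boundary (Suc n) t + u"
    then have "singular_relboundary n (realization K) (polyhedron B) c"
      unfolding singular_relboundary subtopology_realization [OF BK] by blast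
    then have "?h (homologous_rel_set n (realization L) (polyhedron A) 0) = ?h (homologous_rel_set n (realization L) (polyhedron A) c)"
      using c ind by (simp add: relL one)
    then have "homologous_rel_set n (realization L) (polyhedron A) 0 = homologous_rel_set n (realization L) (polyhedron A) c"
      by (rule inj_onD [OF bij_betw_imp_inj_on [OF bij]]) (use c in \<open>simp_all add: relL\<close>)
    then have "singular_relboundary n (realization L) (polyhedron A) c" by (simp only: one)
    then show "\<exists>t u. singular_chain (Suc n) (realization L) t \<and> singular_chain n (realization A) u \<and>
        c = chain_boundary (Suc n) t + u"
      unfolding singular_relboundary subtopology_realization [OF AL] by metis }
qed

subsection \<open>Simplicial and singular homology\<close>

text \<open>The cone with apex \<open>v\<close>. The face is recovered from its simplex by a
  definite description, unique among the faces with \<open>Suc n\<close> vertices; the degenerate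
  cone over a face through \<open>v\<close> counts as zero.\<close>

definition cone_chain :: "nat \<Rightarrow> nat \<Rightarrow> (nat \<Rightarrow> real) chain \<Rightarrow> (nat \<Rightarrow> real) chain" where
  "cone_chain v n = frag_extend (\<lambda>f.
     let \<delta> = (THE \<delta>. finite \<delta> \<and> card \<delta> = Suc n \<and> vertex_simplex \<delta> = f)
     in if v \<in> \<delta> then 0 else frag_of (vertex_simplex (insert v \<delta>)))"

lemma cone_chain_of:
  assumes "finite \<delta>" "card \<delta> = Suc n"
  shows "cone_chain v n (frag_of (vertex_simplex \<delta>)) =
     (if v \<in> \<delta> then 0 else frag_of (vertex_simplex (insert v \<delta>)))"
proof -
  have "(THE \<delta>'. finite \<delta>' \<and> card \<delta>' = Suc n \<and> vertex_simplex \<delta>' = vertex_simplex \<delta>) = \<delta>"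
  proof (rule the_equality)
    fix \<delta>' assume "finite \<delta>' \<and> card \<delta>' = Suc n \<and> vertex_simplex \<delta>' = vertex_simplex \<delta>"
    then show "\<delta>' = \<delta>" using assms inj_on_vertex_simplex by metis
  qed (use assms in simp)
  then show ?thesis by (simp add: cone_chain_def)
qed

text \<open>The cone is a contracting homotopy. As \<open>v\<close> is at most every vertex it
  stands first in every cone, so no extra signs occur; in degree 0 the correction term is the
  augmentation, placed at \<open>v\<close>.\<close>

lemma chain_boundary_cone_chain_of:
  assumes \<delta>: "finite \<delta>" "card \<delta> = Suc n" and v: "\<And>w. w \<in> \<delta> \<Longrightarrow> v \<le> w"
  shows "chain_boundary (Suc n) (cone_chain v n (frag_of (vertex_simplex \<delta>))) =
     frag_of (vertex_simplex \<delta>)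
     - (if n = 0 then frag_of (vertex_simplex {v})
        else cone_chain v (n - 1) (chain_boundary n (frag_of (vertex_simplex \<delta>))))"
proof -
  let ?s = "\<lambda>\<delta> w. (-1::int) ^ card {u \<in> \<delta>. u < w}"
  have coneb: "cone_chain v (n - 1) (chain_boundary n (frag_of (vertex_simplex \<delta>))) =
      (\<Sum>w\<in>\<delta>. frag_cmul (?s \<delta> w) (cone_chain v (n - 1) (frag_of (vertex_simplex (\<delta> - {w})))))" if "n \<noteq> 0"
    using that \<delta> by (simp add: chain_boundary_vertex_simplex) (simp add: cone_chain_def frag_extend_sum frag_extend_cmul o_def)
  show ?thesis
  proof (cases "v \<in> \<delta>")
    case True
    have cone0: "cone_chain v n (frag_of (vertex_simplex \<delta>)) = 0" using True \<delta> by (simp add: cone_chain_of)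
    show ?thesis
    proof (cases "n = 0")
      case True': True
      then have "\<delta> = {v}" using \<delta> True by (metis One_nat_def card_1_singletonE singletonD)
      then show ?thesis using True' cone0 by simp
    next
      case False
      \<comment> \<open>Only the face opposite \<open>v\<close> has a nondegenerate cone, and this
        cone is \<delta> itself.\<close>
      have e: "cone_chain v (n - 1) (frag_of (vertex_simplex (\<delta> - {w}))) = (if w = v then frag_of (vertex_simplex \<delta>) else 0)"
        if w: "w \<in> \<delta>" for w
      proof -
        have f: "finite (\<delta> - {w})" "card (\<delta> - {w}) = Suc (n - 1)" using \<delta> w False by simp_all
        show ?thesis unfolding cone_chain_of [OF f] using True by (simp add: insert_absorb)
      qed
      have "{u \<in> \<delta>. u < v} = {}" using v by force
      then have s1: "?s \<delta> v = 1" by (metis card.empty power_0)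
      have "cone_chain v (n - 1) (chain_boundary n (frag_of (vertex_simplex \<delta>))) =
         (\<Sum>w\<in>\<delta>. if w = v then frag_cmul (?s \<delta> w) (frag_of (vertex_simplex \<delta>)) else 0)"
        unfolding coneb [OF False]
      proof (intro sum.cong refl)
        fix w assume w: "w \<in> \<delta>"
        show "frag_cmul (?s \<delta> w) (cone_chain v (n - 1) (frag_of (vertex_simplex (\<delta> - {w})))) =
            (if w = v then frag_cmul (?s \<delta> w) (frag_of (vertex_simplex \<delta>)) else 0)"
          unfolding e [OF w] by simp
      qed
      also have "\<dots> = frag_of (vertex_simplex \<delta>)" using True \<delta> s1 by (simp add: sum.delta)
      finally show ?thesis using False by (simp add: cone0)
    qed
  next
    case False
    have f: "finite (insert v \<delta>)" "card (insert v \<delta>) = Suc (Suc n)" using \<delta> False by simp_all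
    have pos: "{u \<in> insert v \<delta>. u < v} = {}" using v by force
    \<comment> \<open>In the cone the apex precedes every vertex of \<delta>, so each of their
      positions moves up by one and each sign flips.\<close>
    have pos': "card {u \<in> insert v \<delta>. u < w} = Suc (card {u \<in> \<delta>. u < w})" if w: "w \<in> \<delta>" for w
    proof -
      have "v < w" using v [OF w] False w by (metis le_neq_implies_less)
      then have "{u \<in> insert v \<delta>. u < w} = insert v {u \<in> \<delta>. u < w}" by blast
      then show ?thesis using \<delta> False by simp
    qed
    have "chain_boundary (Suc n) (cone_chain v n (frag_of (vertex_simplex \<delta>))) =
       (\<Sum>w\<in>insert v \<delta>. frag_cmul (?s (insert v \<delta>) w) (frag_of (vertex_simplex (insert v \<delta> - {w}))))"
      using False \<delta> by (simp add: cone_chain_of chain_boundary_vertex_simplex [OF f])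
    also have "\<dots> = frag_cmul (?s (insert v \<delta>) v) (frag_of (vertex_simplex (insert v \<delta> - {v}))) +
        (\<Sum>w\<in>\<delta>. frag_cmul (?s (insert v \<delta>) w) (frag_of (vertex_simplex (insert v \<delta> - {w}))))"
      by (rule sum.insert [OF \<delta>(1) False])
    also have "\<dots> = frag_of (vertex_simplex \<delta>) - (\<Sum>w\<in>\<delta>. frag_cmul (?s \<delta> w) (frag_of (vertex_simplex (insert v \<delta> - {w}))))"
    proof -
      have v0: "insert v \<delta> - {v} = \<delta>" using False by blast
      have "(\<Sum>w\<in>\<delta>. frag_cmul (?s (insert v \<delta>) w) (frag_of (vertex_simplex (insert v \<delta> - {w}))))
          = (\<Sum>w\<in>\<delta>. - frag_cmul (?s \<delta> w) (frag_of (vertex_simplex (insert v \<delta> - {w}))))"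
        by (intro sum.cong refl) (simp only: pos', simp)
      also have "\<dots> = - (\<Sum>w\<in>\<delta>. frag_cmul (?s \<delta> w) (frag_of (vertex_simplex (insert v \<delta> - {w}))))"
        by (rule sum_negf)
      finally show ?thesis
        by (simp only: v0 pos card.empty power_0 frag_cmul_one add_uminus_conv_diff)
    qed
    also have "(\<Sum>w\<in>\<delta>. frag_cmul (?s \<delta> w) (frag_of (vertex_simplex (insert v \<delta> - {w})))) =
       (if n = 0 then frag_of (vertex_simplex {v})
        else cone_chain v (n - 1) (chain_boundary n (frag_of (vertex_simplex \<delta>))))"
    proof (cases "n = 0")
      case True
      then obtain w where w: "\<delta> = {w}" using \<delta> by (metis One_nat_def card_1_singletonE)
      have vw: "v \<noteq> w" using False w by simp
      have "{u \<in> {w}. u < w} = {}" by blast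
      then have s1: "?s {w} w = 1" by (metis card.empty power_0)
      have s2: "insert v {w} - {w} = {v}" using vw by blast
      have "(\<Sum>x\<in>{w}. frag_cmul (?s {w} x) (frag_of (vertex_simplex (insert v {w} - {x})))) =
          frag_cmul (?s {w} w) (frag_of (vertex_simplex (insert v {w} - {w})))"
        by (simp only: sum.insert finite.emptyI sum.empty empty_iff not_False_eq_True add_0_right)
      also have "\<dots> = frag_of (vertex_simplex {v})" by (simp only: s1 s2 frag_cmul_one)
      finally show ?thesis unfolding w using True by (simp only: if_True refl)
    next
      case n0: False
      have "cone_chain v (n - 1) (frag_of (vertex_simplex (\<delta> - {w}))) = frag_of (vertex_simplex (insert v \<delta> - {w}))"
        if w: "w \<in> \<delta>" for w
      proof -
        have f: "finite (\<delta> - {w})" "card (\<delta> - {w}) = Suc (n - 1)" using \<delta> w n0 by simp_all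
        have "insert v (\<delta> - {w}) = insert v \<delta> - {w}" using w False by blast
        then show ?thesis unfolding cone_chain_of [OF f] using False by simp
      qed
      then show ?thesis unfolding coneb [OF n0] using n0 by simp
    qed
    finally show ?thesis .
  qed
qed

lemma schain_cone_chain:
  assumes \<tau>: "finite \<tau>" "v \<in> \<tau>" and c: "schain n (faces \<tau>) c"
  shows "schain (Suc n) (faces \<tau>) (cone_chain v n c)"
  using c
proof (induction rule: schain_induct)
  case zero then show ?case by (simp add: cone_chain_def)
next
  case (of \<delta>)
  have f: "finite \<delta>" using of \<tau> by (metis in_faces finite_subset)
  show ?case
  proof (cases "v \<in> \<delta>")
    case False
    have "insert v \<delta> \<in> faces \<tau>" using of \<tau> by (simp add: in_faces)
    then show ?thesis using False f of by (simp add: cone_chain_of) (intro schain_of, simp_all)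
  qed (use f of in \<open>simp add: cone_chain_of\<close>)
next
  case (diff a b) then show ?case by (simp add: cone_chain_def frag_extend_diff schain_diff)
qed

lemma chain_boundary_cone_chain:
  assumes \<tau>: "finite \<tau>" "v \<in> \<tau>" "\<And>w. w \<in> \<tau> \<Longrightarrow> v \<le> w" and c: "schain n (faces \<tau>) c"
  shows "chain_boundary (Suc n) (cone_chain v n c) =
     c - (if n = 0 then frag_extend (\<lambda>_. frag_of (vertex_simplex {v})) c
        else cone_chain v (n - 1) (chain_boundary n c))"
  using c
proof (induction rule: schain_induct)
  case zero then show ?case by (simp add: cone_chain_def)
next
  case (of \<delta>)
  have "finite \<delta>" "\<And>w. w \<in> \<delta> \<Longrightarrow> v \<le> w" using of \<tau> by (metis in_faces finite_subset, metis in_faces subsetD)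
  from chain_boundary_cone_chain_of [OF this(1) of(2) this(2)] show ?case by simp
next
  case (diff a b)
  have cone_diff: "cone_chain v m (x - y) = cone_chain v m x - cone_chain v m y" for m x y
    by (simp add: cone_chain_def frag_extend_diff)
  define Y where "Y c = (if n = 0 then frag_extend (\<lambda>_. frag_of (vertex_simplex {v})) c
        else cone_chain v (n - 1) (chain_boundary n c))" for c
  have Ydiff: "Y (a - b) = Y a - Y b" by (simp add: Y_def cone_diff chain_boundary_diff frag_extend_diff)
  show ?case
    unfolding Y_def [symmetric] unfolding cone_diff chain_boundary_diff
      diff(1) [folded Y_def] diff(2) [folded Y_def] Ydiff by simp
qed

text \<open>Both theories see a full simplex as a point: the straight-line homotopy to the least
  vertex contracts singular chains, the cone over this vertex contracts simplicial ones.\<close>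

lemma simplicial_homology_iso_faces:
  assumes \<tau>: "finite \<tau>" "\<tau> \<noteq> {}"
  shows "homology_surj n (faces \<tau>) \<and> homology_inj n (faces \<tau>)"
proof -
  define v where "v = Min \<tau>"
  have v: "v \<in> \<tau>" "\<And>w. w \<in> \<tau> \<Longrightarrow> v \<le> w" using \<tau> by (simp_all add: v_def)
  define e :: "nat \<Rightarrow> real" where "e = (\<lambda>i. if i = v then 1 else 0)"
  define X where "X = realization (faces \<tau>)"
  define Y where "Y = realization {{v}}"
  have T: "finite_complex (faces \<tau>)" using \<tau>(1) by (rule finite_complex_faces)
  have vT: "{v} \<in> faces \<tau>" using v by (simp add: in_faces)
  have topY: "topspace Y = {e}"
  proof -
    have "face_hull {v} = {e}" by (auto simp: face_hull_eq e_def)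
    then show ?thesis by (simp add: Y_def)
  qed
  have topX: "topspace X = face_hull \<tau>" using polyhedron_faces [OF \<tau>] by (simp add: X_def)
  have eX: "e \<in> face_hull \<tau>" using v(1) \<tau>(1) by (simp add: face_hull_eq e_def)
  have YX: "Y = subtopology X {e}"
    using subtopology_realization [of "{{v}}" "faces \<tau>"] vT topY by (simp add: Y_def X_def)
  let ?w = "restrict (\<lambda>x. e) (standard_simplex 0)"
  have vs: "vertex_simplex {v} = ?w"
    using singular_simplex_vertex_simplex [of "{v}" "{{v}}"] singular_simplex_singleton [OF topY, of 0 "vertex_simplex {v}"]
    by (simp add: Y_def)
  have cmap: "chain_map n (\<lambda>x. e) c = frag_extend (\<lambda>f. frag_of (restrict (\<lambda>x. e) (standard_simplex n))) c" for n and c :: "(nat \<Rightarrow> real) chain"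
    by (simp add: chain_map_def o_def simplex_map_def)
  have contY: "continuous_map X Y (\<lambda>x. e)" using eX by (simp add: YX continuous_map_in_subtopology topX)
  have surj: "homology_surj n (faces \<tau>)"
    unfolding homology_surj_def X_def [symmetric]
  proof (intro allI impI, elim conjE)
    fix c assume c: "singular_chain n X c" "chain_boundary n c = 0"
    then have cyc: "singular_relcycle n X {} c" by (simp add: singular_cycle)
    have hom: "homotopic_with (\<lambda>h. h \<in> {} \<rightarrow> ({} :: (nat \<Rightarrow> real) set)) X X id (\<lambda>x. e)"
      unfolding homotopic_with_def
    proof (intro exI conjI)
      let ?P = "prod_topology (top_of_set {0..1::real}) X"
      let ?h = "\<lambda>(t, x) i. (1 - t) * x i + t * e i"
      have c2: "continuous_map ?P euclideanreal (\<lambda>p. snd p i)" for i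
        using continuous_map_compose [OF continuous_map_snd continuous_map_coordinate]
        by (simp add: o_def X_def realization_def)
      have c3: "continuous_map ?P euclideanreal fst"
        by (metis continuous_map_fst continuous_map_into_fulltopology)
      have "continuous_map ?P (powertop_real UNIV) ?h"
        unfolding continuous_map_componentwise_UNIV
      proof
        fix i
        have "continuous_map ?P euclideanreal (\<lambda>p. (1 - fst p) * snd p i + fst p * e i)"
          by (intro continuous_map_add continuous_map_real_mult continuous_map_diff c2 c3) simp_all
        then show "continuous_map ?P euclideanreal (\<lambda>p. ?h p i)" by (simp add: case_prod_unfold)
      qed
      moreover have "?h p \<in> face_hull \<tau>" if p: "p \<in> topspace ?P" for p
      proof -
        have t: "0 \<le> fst p" "fst p \<le> 1" and x: "snd p \<in> face_hull \<tau>"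
          using p topX by (cases p; simp)+
        have "sum (\<lambda>i. (1 - fst p) * snd p i + fst p * e i) \<tau> = (1 - fst p) * sum (snd p) \<tau> + fst p * sum e \<tau>"
          by (simp add: sum.distrib sum_distrib_left)
        then show ?thesis using t x eX \<tau>(1) by (simp add: face_hull_eq case_prod_unfold)
      qed
      ultimately show "continuous_map ?P X ?h"
        by (simp add: X_def realization_def continuous_map_in_subtopology polyhedron_faces [OF \<tau>] image_subset_iff_funcset Pi_iff)
    qed (auto simp: fun_eq_iff)
    have "homologous_rel n X {} (chain_map n id c) (chain_map n (\<lambda>x. e) c)"
      by (rule homotopic_imp_homologous_rel_chain_maps [OF hom cyc])
    then have "singular_relboundary n X {} (c - chain_map n (\<lambda>x. e) c)"
      using chain_map_ident [OF c(1)] by (simp add: homologous_rel_def)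
    then obtain t where t: "singular_chain (Suc n) X t" "chain_boundary (Suc n) t = c - chain_map n (\<lambda>x. e) c"
      by (auto simp: singular_boundary)
    have cY: "singular_relcycle n Y {} (chain_map n (\<lambda>x. e) c)"
      using singular_relcycle_chain_map [OF cyc contY, of "{}"] by simp
    show "\<exists>a t. schain n (faces \<tau>) a \<and> chain_boundary n a = 0 \<and> singular_chain (Suc n) X t \<and> c = a + chain_boundary (Suc n) t"
    \<comment> \<open>A chain in a one-point space is a multiple of the constant simplex: in degree
      0 this is the vertex \<open>v\<close>, a simplicial chain, and in positive degree every cycle
      is a boundary.\<close>
    proof (cases "n = 0")
      case True
      obtain b where b: "chain_map n (\<lambda>x. e) c = frag_cmul b (frag_of ?w)"
        using cY singular_chain_singleton [OF topY, of n] unfolding singular_cycle True by blast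
      have "schain n (faces \<tau>) (frag_cmul b (frag_of ?w))"
        unfolding vs [symmetric] using vT True by (intro schain_cmul schain_of) simp_all
      moreover have "chain_boundary n (frag_cmul b (frag_of ?w)) = 0" by (simp add: True chain_boundary_def)
      ultimately show ?thesis using t b by (metis add.commute diff_add_cancel)
    next
      case False
      then have "singular_relboundary n Y {} (chain_map n (\<lambda>x. e) c)"
        using cY singular_boundary_eq_cycle_singleton [OF topY, of n] by simp
      then obtain s where s: "singular_chain (Suc n) Y s" "chain_boundary (Suc n) s = chain_map n (\<lambda>x. e) c"
        by (auto simp: singular_boundary)
      have "singular_chain (Suc n) X s" using s(1) unfolding YX singular_chain_subtopology by blast
      then have "singular_chain (Suc n) X (t + s)" using t by (intro singular_chain_add)
      moreover have "c = 0 + chain_boundary (Suc n) (t + s)" using t s by (simp add: chain_boundary_add)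
      ultimately show ?thesis by (metis schain_0 chain_boundary_0)
    qed
  qed
  have inj: "homology_inj n (faces \<tau>)"
    unfolding homology_inj_def X_def [symmetric]
  proof (intro allI impI, elim conjE)
    fix a t assume a: "schain n (faces \<tau>) a" and t: "singular_chain (Suc n) X t" "a = chain_boundary (Suc n) t"
    \<comment> \<open>The correction term of the cone formula vanishes: in degree 0 it is the image
      of a boundary in a one-point space, hence 0, and in positive degree it is the cone over the
      boundary of a cycle.\<close>
    have "(if n = 0 then frag_extend (\<lambda>_. frag_of (vertex_simplex {v})) a
        else cone_chain v (n - 1) (chain_boundary n a)) = 0"
    proof (cases "n = 0")
      case True
      have "singular_relboundary n X {} a" using t by (auto simp: singular_boundary)
      then have "singular_relboundary n Y {} (chain_map n (\<lambda>x. e) a)"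
        using singular_relboundary_chain_map [OF _ contY, of n "{}" a "{}"] by simp
      then have "chain_map n (\<lambda>x. e) a = 0"
        using singular_boundary_singleton [OF topY, of n] True by simp
      then show ?thesis using True by (simp add: cmap vs)
    next
      case False
      have "chain_boundary n a = 0" using chain_boundary_boundary_alt [OF t(1)] t(2) by simp
      then show ?thesis using False by (simp add: cone_chain_def)
    qed
    then have "chain_boundary (Suc n) (cone_chain v n a) = a"
      using chain_boundary_cone_chain [OF \<tau>(1) v a] by simp
    then show "\<exists>b. schain (Suc n) (faces \<tau>) b \<and> a = chain_boundary (Suc n) b"
      using schain_cone_chain [OF \<tau>(1) v(1) a] by metis
  qed
  show ?thesis using surj inj by blast
qed

lemma schain_split:
  assumes "schain n K c"
  shows "\<exists>a b. schain n {\<tau>} a \<and> schain n (K - {\<tau>}) b \<and> c = a + b"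
  using assms
proof (induction rule: schain_induct)
  case zero show ?case by (intro exI [of _ 0]) simp
next
  case (of \<delta>)
  show ?case
  proof (cases "\<delta> = \<tau>")
    case True
    then have "schain n {\<tau>} (frag_of (vertex_simplex \<delta>))" using of by (intro schain_of) simp_all
    then show ?thesis by (metis add.right_neutral schain_0)
  next
    case False
    then have "schain n (K - {\<tau>}) (frag_of (vertex_simplex \<delta>))" using of by (intro schain_of) simp_all
    then show ?thesis by (metis add.left_neutral schain_0)
  qed
next
  case (diff x y)
  then obtain a b a' b' where "schain n {\<tau>} a" "schain n (K - {\<tau>}) b" "x = a + b"
    "schain n {\<tau>} a'" "schain n (K - {\<tau>}) b'" "y = a' + b'" by blast
  then show ?case
    by (intro exI [of _ "a - a'"] exI [of _ "b - b'"] conjI schain_diff) (simp_all add: algebra_simps)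
qed

text \<open>Excision reduces the pair to the full simplex on \<tau> modulo its boundary. The full
  simplex is contractible, its boundary is covered by the assumption \<open>bd\<close>, and the
  absolute comparisons combine to the relative one.\<close>

lemma rel_simplicial_homology_iso_maximal_face:
  assumes K: "finite_complex K" and \<tau>: "\<tau> \<in> K" and max: "\<And>\<delta>. \<delta> \<in> K \<Longrightarrow> \<tau> \<subseteq> \<delta> \<Longrightarrow> \<delta> = \<tau>"
    and bd: "\<And>n. homology_surj n (faces \<tau> - {\<tau>}) \<and> homology_inj n (faces \<tau> - {\<tau>})"
  shows "rel_homology_surj n K (K - {\<tau>})" and "rel_homology_inj n K (K - {\<tau>})"
proof -
  let ?T = "faces \<tau>"
  have fin: "finite \<tau>" "\<tau> \<noteq> {}" by (fact finite_complexD(2) [OF K \<tau>], fact finite_complexD(3) [OF K \<tau>])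
  have costar: "costar \<tau> K = K - {\<tau>}" unfolding costar_def using max by blast
  have T: "finite_complex ?T" "?T \<subseteq> K" by (fact finite_complex_faces [OF fin(1)], fact faces_subset [OF K \<tau>])
  have "costar \<tau> ?T = ?T - {\<tau>}" by (force simp: costar_def in_faces)
  then have bdT: "finite_complex (?T - {\<tau>})" using finite_complex_costar [OF T(1), of \<tau>] by simp
  have K': "finite_complex (K - {\<tau>})" using finite_complex_costar [OF K, of \<tau>] costar by simp
  have sub: "?T - {\<tau>} \<subseteq> ?T" "?T - {\<tau>} \<subseteq> K - {\<tau>}" "K - {\<tau>} \<subseteq> K" using T(2) by blast+
  have TsurjT: "rel_homology_surj n ?T (?T - {\<tau>})" and TinjT: "rel_homology_inj n ?T (?T - {\<tau>})"
    using rel_homology_surj_if_abs [OF T(1) bdT sub(1) simplicial_homology_iso_faces [OF fin] bd]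
      rel_homology_inj_if_abs [OF T(1) bdT sub(1) simplicial_homology_iso_faces [OF fin] bd] by blast+
  note chain_level = hom_induced_id_chain_level [OF T(2) sub(1) sub(3) sub(2) iso_simplex_excision [OF K \<tau> costar]]
  note down = singular_chain_sub [OF K T(1,2)] and down' = singular_chain_sub [OF K' bdT sub(2)]
  show "rel_homology_surj n K (K - {\<tau>})"
    unfolding rel_homology_surj_def
  proof (intro allI impI, elim conjE)
    fix c assume c: "singular_chain n (realization K) c" "singular_chain (n - 1) (realization (K - {\<tau>})) (chain_boundary n c)"
    obtain c' t u where c': "singular_chain n (realization ?T) c'" "singular_chain (n - 1) (realization (?T - {\<tau>})) (chain_boundary n c')"
      and t: "singular_chain (Suc n) (realization K) t" and u: "singular_chain n (realization (K - {\<tau>})) u"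
      and e: "c = c' + chain_boundary (Suc n) t + u"
      using chain_level(1) [OF c] by blast
    obtain a t' u' where a: "schain n ?T a" "schain (n - 1) (?T - {\<tau>}) (chain_boundary n a)"
      and t': "singular_chain (Suc n) (realization ?T) t'" and u': "singular_chain n (realization (?T - {\<tau>})) u'"
      and e': "c' = a + chain_boundary (Suc n) t' + u'"
      using TsurjT c' unfolding rel_homology_surj_def by metis
    show "\<exists>a t u. schain n K a \<and> schain (n - 1) (K - {\<tau>}) (chain_boundary n a) \<and>
       singular_chain (Suc n) (realization K) t \<and> singular_chain n (realization (K - {\<tau>})) u \<and>
       c = a + chain_boundary (Suc n) t + u"
    proof (intro exI conjI)
      show "schain n K a" by (rule schain_mono [OF a(1) T(2)])
      show "schain (n - 1) (K - {\<tau>}) (chain_boundary n a)" by (rule schain_mono [OF a(2) sub(2)])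
      show "singular_chain (Suc n) (realization K) (t + t')" by (intro singular_chain_add t down [OF t'])
      show "singular_chain n (realization (K - {\<tau>})) (u + u')" by (intro singular_chain_add u down' [OF u'])
      show "c = a + chain_boundary (Suc n) (t + t') + (u + u')"
        unfolding e e' by (simp add: chain_boundary_add algebra_simps)
    qed
  qed
  show "rel_homology_inj n K (K - {\<tau>})"
    unfolding rel_homology_inj_def
  proof (intro allI impI, elim conjE)
    fix a t u assume a: "schain n K a" "schain (n - 1) (K - {\<tau>}) (chain_boundary n a)"
      and t: "singular_chain (Suc n) (realization K) t" and u: "singular_chain n (realization (K - {\<tau>})) u"
      and e: "a = chain_boundary (Suc n) t + u"
    \<comment> \<open>Only the \<tau>-component \<open>a1\<close> is brought into the simplex; the
      rest lies in \<open>K - {\<tau>}\<close> and is absorbed into \<open>u\<close>.\<close>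
    obtain a1 a2 where a1: "schain n {\<tau>} a1" and a2: "schain n (K - {\<tau>}) a2" and a12: "a = a1 + a2"
      using schain_split [OF a(1)] by blast
    have a1T: "schain n ?T a1" by (rule schain_mono [OF a1]) (use fin in \<open>simp add: in_faces\<close>)
    have bdy: "schain (n - 1) (?T - {\<tau>}) (chain_boundary n a1)"
    proof (cases "n = 0")
      case True then show ?thesis by (simp add: chain_boundary_def)
    next
      case False
      show ?thesis using a1
      proof (induction rule: schain_induct)
        case (of \<delta>)
        then have \<delta>: "\<delta> = \<tau>" by simp
        have "schain (n - 1) (?T - {\<tau>}) (\<Sum>v\<in>\<tau>. frag_cmul ((-1) ^ card {w \<in> \<tau>. w < v}) (frag_of (vertex_simplex (\<tau> - {v}))))"
        proof (intro schain_sum schain_cmul schain_of)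
          fix v assume v: "v \<in> \<tau>"
          show card: "card (\<tau> - {v}) = Suc (n - 1)" using v fin of(2) False \<delta> by simp
          have "\<tau> - {v} \<noteq> {}" using card by (metis card.empty nat.distinct(1))
          then show "\<tau> - {v} \<in> ?T - {\<tau>}" using v by (simp add: in_faces Diff_subset) blast
        qed
        then show ?case using chain_boundary_vertex_simplex [OF fin(1) of(2) [unfolded \<delta>]] False \<delta> by simp
      qed (simp_all add: chain_boundary_diff schain_diff)
    qed
    have "singular_chain n (realization (K - {\<tau>})) (u - a2)"
      by (intro singular_chain_diff u schain_imp_singular_chain [OF K' a2])
    moreover have "a1 = chain_boundary (Suc n) t + (u - a2)" using e a12 by (simp add: algebra_simps)
    ultimately obtain t' u' where t': "singular_chain (Suc n) (realization ?T) t'" and u': "singular_chain n (realization (?T - {\<tau>})) u'"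
       and e': "a1 = chain_boundary (Suc n) t' + u'"
      using chain_level(2) [OF schain_imp_singular_chain [OF T(1) a1T] schain_imp_singular_chain [OF bdT bdy] t] by metis
    then obtain b l where b: "schain (Suc n) ?T b" and l: "schain n (?T - {\<tau>}) l" and e'': "a1 = chain_boundary (Suc n) b + l"
      using TinjT a1T bdy unfolding rel_homology_inj_def by metis
    show "\<exists>b l. schain (Suc n) K b \<and> schain n (K - {\<tau>}) l \<and> a = chain_boundary (Suc n) b + l"
    proof (intro exI conjI)
      show "schain (Suc n) K b" by (rule schain_mono [OF b T(2)])
      show "schain n (K - {\<tau>}) (l + a2)" by (intro schain_add a2 schain_mono [OF l sub(2)])
      show "a = chain_boundary (Suc n) b + (l + a2)" unfolding a12 e'' by simp
    qed
  qed
qed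

text \<open>Induction on the number of faces. Removing a maximal face \<tau> leaves a smaller
  complex, and the boundary of \<tau> is a subcomplex of it. The pair is treated by excision, and
  the absolute statement follows by the five lemma.\<close>

theorem simplicial_homology_iso:
  assumes "finite_complex K"
  shows "homology_surj n K \<and> homology_inj n K"
  using assms
proof (induction "card K" arbitrary: K n rule: less_induct)
  case less
  note K = less.prems
  show ?case
  proof (cases "K = {}")
    case True
    have "topspace (realization K) = {}" by (simp add: True)
    then have "singular_chain m (realization K) c \<longleftrightarrow> c = 0" for m c by (rule singular_chain_empty)
    then show ?thesis unfolding homology_surj_def homology_inj_def
      by (metis schain_0 chain_boundary_0 add.right_neutral)
  next
    case False
    obtain \<tau> where \<tau>: "\<tau> \<in> K" and max: "\<And>\<delta>. \<delta> \<in> K \<Longrightarrow> \<tau> \<subseteq> \<delta> \<Longrightarrow> \<delta> = \<tau>"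
      using finite_has_maximal [OF finite_complexD(1) [OF K] False] by metis
    have costar: "costar \<tau> K = K - {\<tau>}" unfolding costar_def using max by blast
    then have K': "finite_complex (K - {\<tau>})" using finite_complex_costar [OF K, of \<tau>] by simp
    have fin: "finite \<tau>" "\<tau> \<noteq> {}" by (fact finite_complexD(2) [OF K \<tau>], fact finite_complexD(3) [OF K \<tau>])
    have "costar \<tau> (faces \<tau>) = faces \<tau> - {\<tau>}" by (force simp: costar_def in_faces)
    then have bdT: "finite_complex (faces \<tau> - {\<tau>})"
      using finite_complex_costar [OF finite_complex_faces [OF fin(1)], of \<tau>] by simp
    have lt: "card (K - {\<tau>}) < card K" using finite_complexD(1) [OF K] \<tau> by (rule card_Diff1_less)
    have "faces \<tau> - {\<tau>} \<subseteq> K - {\<tau>}" using faces_subset [OF K \<tau>] by blast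
    then have lt': "card (faces \<tau> - {\<tau>}) < card K"
      using lt finite_complexD(1) [OF K'] card_mono by (metis le_less_trans)
    have absK': "\<And>m. homology_surj m (K - {\<tau>}) \<and> homology_inj m (K - {\<tau>})" by (rule less.hyps [OF lt K'])
    have bd: "\<And>m. homology_surj m (faces \<tau> - {\<tau>}) \<and> homology_inj m (faces \<tau> - {\<tau>})" by (rule less.hyps [OF lt' bdT])
    note rel = rel_simplicial_homology_iso_maximal_face [OF K \<tau> max bd]
    have "\<And>m. rel_homology_surj m K (K - {\<tau>}) \<and> rel_homology_inj m K (K - {\<tau>})" using rel by blast
    then show ?thesis
      using homology_surj_if_rel [OF K K' Diff_subset absK' rel(1)] homology_inj_if_rel [OF K K' Diff_subset absK'] by blast
  qed
qed

text \<open>Serves for the pair of a complex and the costar of a facet, where it provides simplicial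
  representatives of local homology classes.\<close>

theorem rel_simplicial_homology_iso:
  assumes "finite_complex K" "finite_complex L" "L \<subseteq> K"
  shows "rel_homology_surj n K L" and "rel_homology_inj n K L"
  using rel_homology_surj_if_abs [OF assms] rel_homology_inj_if_abs [OF assms] simplicial_homology_iso [OF assms(1)] simplicial_homology_iso [OF assms(2)] by blast+

subsection \<open>Homology classes in coordinates\<close>

definition face_chain :: "nat set list \<Rightarrow> (nat \<Rightarrow> int) \<Rightarrow> (nat \<Rightarrow> real) chain" where
  "face_chain fs x = (\<Sum>j<length fs. frag_cmul (x j) (frag_of (vertex_simplex (fs ! j))))"

text \<open>\<open>face_list\<close> picks an unspecified enumeration; this predicate is all that
  the computations with chains use about it.\<close>

definition lists_faces :: "nat set set \<Rightarrow> nat \<Rightarrow> nat set list \<Rightarrow> bool" where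
  "lists_faces K m fs \<longleftrightarrow> distinct fs \<and> set fs = {\<delta> \<in> K. card \<delta> = m}"

lemma lists_faces_face_list:
  assumes "finite_complex K" shows "lists_faces K m (face_list K m)"
proof -
  have "\<exists>xs. distinct xs \<and> set xs = {\<delta> \<in> K. card \<delta> = m}"
    using finite_distinct_list [of "{\<delta> \<in> K. card \<delta> = m}"] finite_complexD(1) [OF assms] by auto
  then show ?thesis unfolding lists_faces_def face_list_def by (rule someI_ex)
qed

lemma frag_cmul_sum_left: "frag_cmul (sum f A) x = (\<Sum>a\<in>A. frag_cmul (f a) x)"
  by (rule poly_mapping_eqI) (simp add: lookup_sum sum_distrib_right)

lemma face_chain_add: "face_chain fs (\<lambda>j. x j + y j) = face_chain fs x + face_chain fs y"
  by (simp add: face_chain_def frag_cmul_distrib sum.distrib)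

lemma face_chain_diff: "face_chain fs (\<lambda>j. x j - y j) = face_chain fs x - face_chain fs y"
  by (simp add: face_chain_def frag_cmul_diff_distrib sum_subtractf)

lemma face_chain_cmul: "face_chain fs (\<lambda>j. k * x j) = frag_cmul k (face_chain fs x)"
  by (simp add: face_chain_def frag_cmul_sum)

context
  fixes K m fs assumes K: "finite_complex K" and fs: "lists_faces K (Suc m) fs"
begin

lemma nth_face: "j < length fs \<Longrightarrow> fs ! j \<in> K" "j < length fs \<Longrightarrow> card (fs ! j) = Suc m"
  "j < length fs \<Longrightarrow> finite (fs ! j)"
proof -
  assume "j < length fs"
  then have "fs ! j \<in> set fs" by simp
  then show "fs ! j \<in> K" "card (fs ! j) = Suc m" using fs unfolding lists_faces_def by blast+
  then show "finite (fs ! j)" using finite_complexD(2) [OF K] by blast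
qed

lemma schain_face_chain: "schain m K (face_chain fs x)"
  unfolding face_chain_def by (intro schain_sum schain_cmul schain_of nth_face) simp_all

lemma lookup_face_chain:
  assumes "i < length fs"
  shows "Poly_Mapping.lookup (face_chain fs x) (vertex_simplex (fs ! i)) = x i"
proof -
  have "vertex_simplex (fs ! i) = vertex_simplex (fs ! j) \<longleftrightarrow> j = i" if "j < length fs" for j
    using inj_on_vertex_simplex [OF nth_face(3) [OF assms] nth_face(3) [OF that]] nth_face(2) [OF assms] nth_face(2) [OF that]
      fs assms that nth_eq_iff_index_eq unfolding lists_faces_def by metis
  then have "Poly_Mapping.lookup (face_chain fs x) (vertex_simplex (fs ! i)) = (\<Sum>j<length fs. if j = i then x j else 0)"
    unfolding face_chain_def lookup_sum by (intro sum.cong) simp_all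
  then show ?thesis using assms by simp
qed

lemma face_chain_eq_iff: "face_chain fs x = face_chain fs y \<longleftrightarrow> (\<forall>j<length fs. x j = y j)"
proof
  assume "face_chain fs x = face_chain fs y"
  then show "\<forall>j<length fs. x j = y j" using lookup_face_chain by metis
qed (simp add: face_chain_def)

lemma face_chain_0: "face_chain fs (\<lambda>_. 0) = 0"
  by (simp add: face_chain_def)

lemma schain_imp_face_chain:
  assumes "schain m K a"
  shows "\<exists>x. (\<forall>j\<ge>length fs. x j = 0) \<and> a = face_chain fs x"
  using assms
proof (induction rule: schain_induct)
  case zero show ?case by (intro exI [of _ "\<lambda>_. 0"]) (simp add: face_chain_0)
next
  case (of \<delta>)
  then have "\<delta> \<in> set fs" using fs unfolding lists_faces_def by blast
  then obtain i where i: "i < length fs" "fs ! i = \<delta>" by (metis in_set_conv_nth)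
  have "face_chain fs (\<lambda>j. if j = i then 1 else 0) = (\<Sum>j<length fs. if j = i then frag_of (vertex_simplex \<delta>) else 0)"
    unfolding face_chain_def using i by (intro sum.cong) auto
  also have "\<dots> = frag_of (vertex_simplex \<delta>)" using i by simp
  finally show ?case using i by (intro exI [of _ "\<lambda>j. if j = i then 1 else 0"]) simp
next
  case (diff a b)
  then obtain x y where "\<forall>j\<ge>length fs. x j = 0" "a = face_chain fs x" "\<forall>j\<ge>length fs. y j = 0" "b = face_chain fs y"
    by blast
  then show ?case by (intro exI [of _ "\<lambda>j. x j - y j"]) (simp add: face_chain_diff)
qed

end

lemma chain_boundary_face_chain:
  assumes K: "finite_complex K" and fs: "lists_faces K (Suc (Suc m)) fs" and gs: "lists_faces K (Suc m) gs"
  shows "chain_boundary (Suc m) (face_chain fs x) =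
    face_chain gs (\<lambda>i. \<Sum>j<length fs. incidence (gs ! i) (fs ! j) * x j)"
proof -
  have bij: "bij_betw ((!) gs) {..<length gs} (set gs)"
    using gs unfolding lists_faces_def by (intro bij_betw_nth) simp_all
  have one: "chain_boundary (Suc m) (frag_of (vertex_simplex \<delta>)) =
     (\<Sum>i<length gs. frag_cmul (incidence (gs ! i) \<delta>) (frag_of (vertex_simplex (gs ! i))))"
    if \<delta>: "\<delta> \<in> K" "card \<delta> = Suc (Suc m)" for \<delta>
  proof -
    let ?h = "\<lambda>v. frag_cmul ((-1) ^ card {w \<in> \<delta>. w < v}) (frag_of (vertex_simplex (\<delta> - {v})))"
    have fin: "finite \<delta>" using finite_complexD(2) [OF K \<delta>(1)] .
    have sub: "(\<lambda>v. \<delta> - {v}) ` \<delta> \<subseteq> set gs"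
    proof (rule image_subsetI)
      fix v assume v: "v \<in> \<delta>"
      have c: "card (\<delta> - {v}) = Suc m" using fin v \<delta>(2) by simp
      then have "\<delta> - {v} \<noteq> {}" by (metis card.empty nat.distinct(1))
      then have "\<delta> - {v} \<in> K" by (rule finite_complexD(5) [OF K \<delta>(1) _ Diff_subset])
      then show "\<delta> - {v} \<in> set gs" using c gs unfolding lists_faces_def by blast
    qed
    have "chain_boundary (Suc m) (frag_of (vertex_simplex \<delta>)) = (\<Sum>v\<in>\<delta>. ?h v)"
      using chain_boundary_vertex_simplex [OF fin \<delta>(2)] by simp
    \<comment> \<open>The vertices of \<delta> are grouped by the face opposite to them, which is
      how \<open>incidence\<close> collects signs.\<close>
    also have "\<dots> = (\<Sum>\<sigma>\<in>set gs. \<Sum>v\<in>{v \<in> \<delta>. \<delta> - {v} = \<sigma>}. ?h v)"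
      by (rule sum.group [symmetric]) (use fin sub in simp_all)
    also have "\<dots> = (\<Sum>\<sigma>\<in>set gs. frag_cmul (incidence \<sigma> \<delta>) (frag_of (vertex_simplex \<sigma>)))"
    proof (intro sum.cong refl)
      fix \<sigma>
      have "{v \<in> \<delta>. \<delta> - {v} = \<sigma>} = {v. v \<in> \<delta> \<and> \<sigma> = \<delta> - {v}}" by blast
      then show "(\<Sum>v\<in>{v \<in> \<delta>. \<delta> - {v} = \<sigma>}. ?h v) = frag_cmul (incidence \<sigma> \<delta>) (frag_of (vertex_simplex \<sigma>))"
        unfolding incidence_def frag_cmul_sum_left by (intro sum.cong) simp_all
    qed
    also have "\<dots> = (\<Sum>i<length gs. frag_cmul (incidence (gs ! i) \<delta>) (frag_of (vertex_simplex (gs ! i))))"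
      by (rule sum.reindex_bij_betw [OF bij, symmetric])
    finally show ?thesis .
  qed
  have "chain_boundary (Suc m) (face_chain fs x) =
     (\<Sum>j<length fs. frag_cmul (x j) (\<Sum>i<length gs. frag_cmul (incidence (gs ! i) (fs ! j)) (frag_of (vertex_simplex (gs ! i)))))"
    unfolding face_chain_def chain_boundary_sum o_def chain_boundary_cmul
    using one nth_face [OF K fs] by (intro sum.cong refl) (simp only: lessThan_iff)
  also have "\<dots> = (\<Sum>j<length fs. \<Sum>i<length gs. frag_cmul (incidence (gs ! i) (fs ! j) * x j) (frag_of (vertex_simplex (gs ! i))))"
    by (simp add: frag_cmul_sum mult.commute)
  also have "\<dots> = (\<Sum>i<length gs. \<Sum>j<length fs. frag_cmul (incidence (gs ! i) (fs ! j) * x j) (frag_of (vertex_simplex (gs ! i))))"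
    by (rule sum.swap)
  also have "\<dots> = face_chain gs (\<lambda>i. \<Sum>j<length fs. incidence (gs ! i) (fs ! j) * x j)"
    by (simp only: face_chain_def frag_cmul_sum_left)
  finally show ?thesis .
qed

definition simplicial_class :: "nat \<Rightarrow> nat set set \<Rightarrow> 'a topology \<Rightarrow> ((nat \<Rightarrow> real) \<Rightarrow> 'a) \<Rightarrow> (nat \<Rightarrow> real) chain \<Rightarrow> 'a chain set" where
  "simplicial_class n K X \<Phi> a =
     hom_induced (int n) (realization K) {} X {} \<Phi> (homologous_rel_set n (realization K) {} a)"

context
  fixes K X \<Phi> assumes K: "finite_complex K" and hom: "homeomorphic_map (realization K) X \<Phi>"
begin

abbreviation scycle :: "nat \<Rightarrow> (nat \<Rightarrow> real) chain \<Rightarrow> bool" where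
  "scycle n a \<equiv> schain n K a \<and> chain_boundary n a = 0"

lemma scycle_relcycle: "scycle n a \<Longrightarrow> singular_relcycle n (realization K) {} a"
  using schain_imp_singular_chain [OF K] by (simp add: singular_cycle)

lemma homologous_rel_set_hom:
  "homologous_rel_set n R {} \<in> hom (relcycle_group n R {}) (homology_group (int n) R)"
  using normal.r_coset_hom_Mod [OF normal_subgroup_singular_relboundary_relcycle, of n R "{}"]
  by (simp add: nontrivial_relative_homology_group right_coset_singular_relboundary)

lemma simplicial_class_add:
  assumes "scycle n a" "scycle n b"
  shows "simplicial_class n K X \<Phi> (a + b) =
    simplicial_class n K X \<Phi> a \<otimes>\<^bsub>homology_group (int n) X\<^esub> simplicial_class n K X \<Phi> b"
proof -
  have h: "homologous_rel_set n (realization K) {} c \<in> carrier (homology_group (int n) (realization K))" if "scycle n c" for c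
    using scycle_relcycle [OF that] by (simp add: carrier_relative_homology_group)
  have "homologous_rel_set n (realization K) {} (a + b) =
     homologous_rel_set n (realization K) {} a \<otimes>\<^bsub>homology_group (int n) (realization K)\<^esub> homologous_rel_set n (realization K) {} b"
    using hom_mult [OF homologous_rel_set_hom, of a n "realization K" b] scycle_relcycle [OF assms(1)] scycle_relcycle [OF assms(2)]
    by simp
  then show ?thesis
    unfolding simplicial_class_def using hom_mult [OF hom_induced_hom] h [OF assms(1)] h [OF assms(2)] by metis
qed

lemma carrier_homology_eq_simplicial_class:
  "carrier (homology_group (int n) X) = simplicial_class n K X \<Phi> ` {a. scycle n a}"
proof -
  have bij: "bij_betw (hom_induced (int n) (realization K) {} X {} \<Phi>) (carrier (homology_group (int n) (realization K)))
     (carrier (homology_group (int n) X))"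
    using homeomorphic_map_homology_iso [OF hom, of "int n"] by (simp add: iso_def)
  have "carrier (homology_group (int n) (realization K)) = homologous_rel_set n (realization K) {} ` {a. scycle n a}"
  proof
    show "homologous_rel_set n (realization K) {} ` {a. scycle n a} \<subseteq> carrier (homology_group (int n) (realization K))"
      unfolding carrier_relative_homology_group using scycle_relcycle by blast
    show "carrier (homology_group (int n) (realization K)) \<subseteq> homologous_rel_set n (realization K) {} ` {a. scycle n a}"
      unfolding carrier_relative_homology_group
    proof (rule image_subsetI)
      fix c assume "c \<in> singular_relcycle_set n (realization K) {}"
      then have "singular_chain n (realization K) c" "chain_boundary n c = 0" by (simp_all add: singular_cycle)
      then obtain a t where a: "scycle n a" and t: "singular_chain (Suc n) (realization K) t" "c = a + chain_boundary (Suc n) t"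
        using simplicial_homology_iso [OF K, of n] unfolding homology_surj_def by metis
      have "homologous_rel n (realization K) {} c a"
        unfolding homologous_rel_def singular_boundary using t by (intro exI [of _ t]) simp
      then show "homologous_rel_set n (realization K) {} c \<in> homologous_rel_set n (realization K) {} ` {a. scycle n a}"
        using a by (intro image_eqI [of _ _ a]) (simp_all add: homologous_rel_set_eq)
    qed
  qed
  then show ?thesis
    using bij_betw_imp_surj_on [OF bij] by (simp add: simplicial_class_def [abs_def] image_image)
qed

text \<open>A singular chain bounding the difference of two simplicial cycles is replaced by a
  simplicial one through injectivity of the comparison map.\<close>

lemma simplicial_class_eq_iff:
  assumes a: "scycle n a" and b: "scycle n b"
  shows "simplicial_class n K X \<Phi> a = simplicial_class n K X \<Phi> b \<longleftrightarrow>
    (\<exists>t. schain (Suc n) K t \<and> a - b = chain_boundary (Suc n) t)"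
proof -
  have inj: "inj_on (hom_induced (int n) (realization K) {} X {} \<Phi>) (carrier (homology_group (int n) (realization K)))"
    using homeomorphic_map_homology_iso [OF hom, of "int n"] by (simp add: iso_def bij_betw_def)
  have h: "homologous_rel_set n (realization K) {} c \<in> carrier (homology_group (int n) (realization K))" if "scycle n c" for c
    using scycle_relcycle [OF that] by (simp add: carrier_relative_homology_group)
  have "simplicial_class n K X \<Phi> a = simplicial_class n K X \<Phi> b \<longleftrightarrow>
     homologous_rel_set n (realization K) {} a = homologous_rel_set n (realization K) {} b"
    unfolding simplicial_class_def using inj_on_eq_iff [OF inj h [OF a] h [OF b]] .
  also have "\<dots> \<longleftrightarrow> homologous_rel n (realization K) {} a b" by (rule homologous_rel_set_eq)
  also have "\<dots> \<longleftrightarrow> (\<exists>t. singular_chain (Suc n) (realization K) t \<and> a - b = chain_boundary (Suc n) t)"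
    unfolding homologous_rel_def singular_boundary
    by (intro iff_exI conj_cong refl) (rule eq_commute)
  also have "\<dots> \<longleftrightarrow> (\<exists>t. schain (Suc n) K t \<and> a - b = chain_boundary (Suc n) t)"
  proof
    have ab: "schain n K (a - b)" using a b by (blast intro: schain_diff)
    assume "\<exists>t. singular_chain (Suc n) (realization K) t \<and> a - b = chain_boundary (Suc n) t"
    then show "\<exists>t. schain (Suc n) K t \<and> a - b = chain_boundary (Suc n) t"
      using simplicial_homology_iso [OF K, of n] ab unfolding homology_inj_def by blast
  next
    assume "\<exists>t. schain (Suc n) K t \<and> a - b = chain_boundary (Suc n) t"
    then show "\<exists>t. singular_chain (Suc n) (realization K) t \<and> a - b = chain_boundary (Suc n) t"
      using schain_imp_singular_chain [OF K] by blast
  qed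
  finally show ?thesis .
qed

lemma scycle_closed:
  "scycle n 0" "scycle n a \<Longrightarrow> scycle n b \<Longrightarrow> scycle n (a + b)" "scycle n a \<Longrightarrow> scycle n (frag_cmul k a)"
  by (simp_all add: schain_add schain_cmul chain_boundary_add chain_boundary_cmul)

text \<open>By additivity the class of 0 is idempotent, and in a group only the identity is.\<close>

lemma simplicial_class_0: "simplicial_class n K X \<Phi> 0 = \<one>\<^bsub>homology_group (int n) X\<^esub>"
proof -
  have c: "simplicial_class n K X \<Phi> 0 \<in> carrier (homology_group (int n) X)"
    unfolding carrier_homology_eq_simplicial_class using scycle_closed(1) by blast
  have "simplicial_class n K X \<Phi> 0 \<otimes>\<^bsub>homology_group (int n) X\<^esub> simplicial_class n K X \<Phi> 0 = simplicial_class n K X \<Phi> 0"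
    using simplicial_class_add [OF scycle_closed(1) scycle_closed(1), of n] by simp
  then show ?thesis using group.l_cancel_one' [OF group_relative_homology_group c c] by metis
qed

lemma simplicial_class_pow:
  assumes "scycle n a"
  shows "simplicial_class n K X \<Phi> a [^]\<^bsub>homology_group (int n) X\<^esub> (N::nat) = simplicial_class n K X \<Phi> (frag_cmul (int N) a)"
proof (induction N)
  case 0 show ?case by (simp add: simplicial_class_0)
next
  case (Suc N)
  have "frag_cmul (int (Suc N)) a = frag_cmul (int N) a + a"
    by (simp add: frag_cmul_distrib add.commute)
  then show ?case
    using Suc simplicial_class_add [OF scycle_closed(3) [OF assms, of "int N"] assms] by simp
qed

text \<open>There are no faces of dimension \<open>d + 1\<close>, hence no nonzero simplicial
  boundaries in degree \<open>d\<close>: a class contains exactly one simplicial cycle, whose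
  coefficients are the coordinates.\<close>

theorem top_homology_coordinates:
  assumes top: "\<And>\<delta>. \<delta> \<in> K \<Longrightarrow> card \<delta> \<le> Suc d" and fs: "lists_faces K (Suc d) fs" and gs: "lists_faces K d gs"
  shows "\<exists>\<kappa>. bij_betw \<kappa> (carrier (homology_group (int d) X))
         {x. (\<forall>j\<ge>length fs. x j = 0) \<and> (\<forall>i<length gs. (\<Sum>j<length fs. incidence (gs ! i) (fs ! j) * x j) = 0)} \<and>
       (\<forall>c\<in>carrier (homology_group (int d) X). \<forall>c'\<in>carrier (homology_group (int d) X).
         \<kappa> (c \<otimes>\<^bsub>homology_group (int d) X\<^esub> c') = (\<lambda>j. \<kappa> c j + \<kappa> c' j)) \<and>
       (\<forall>c\<in>carrier (homology_group (int d) X). scycle d (face_chain fs (\<kappa> c)) \<and>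
          c = simplicial_class d K X \<Phi> (face_chain fs (\<kappa> c)))"
proof -
  let ?L = "{x. (\<forall>j\<ge>length fs. x j = 0) \<and> (\<forall>i<length gs. (\<Sum>j<length fs. incidence (gs ! i) (fs ! j) * x j) = 0)}"
  let ?H = "homology_group (int d) X"
  define \<theta> where "\<theta> x = simplicial_class d K X \<Phi> (face_chain fs x)" for x
  have cyc: "scycle d (face_chain fs x) \<longleftrightarrow> (\<forall>i<length gs. (\<Sum>j<length fs. incidence (gs ! i) (fs ! j) * x j) = 0)" for x
  proof (cases d)
    case 0
    \<comment> \<open>Faces are nonempty, so \<open>gs\<close> has no entries and the linear
      conditions are void, just as the boundary in degree 0 is zero.\<close>
    have "gs = []" using gs finite_complexD(4) [OF K] unfolding lists_faces_def 0
      by (metis (mono_tags, lifting) less_numeral_extra(3) mem_Collect_eq list.set_sel(1))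
    then show ?thesis using schain_face_chain [OF K fs] by (simp add: 0 chain_boundary_def)
  next
    case (Suc m)
    have "chain_boundary d (face_chain fs x) = face_chain gs (\<lambda>i. \<Sum>j<length fs. incidence (gs ! i) (fs ! j) * x j)"
      using chain_boundary_face_chain [OF K, of m fs gs x] fs gs unfolding Suc by blast
    moreover have "face_chain gs y = 0 \<longleftrightarrow> (\<forall>i<length gs. y i = 0)" for y
      using face_chain_eq_iff [OF K, of m gs y "\<lambda>_. 0"] gs face_chain_0 [OF K, of m gs] unfolding Suc by simp
    ultimately show ?thesis using schain_face_chain [OF K fs] by simp
  qed
  have no_top: "t = 0" if "schain (Suc d) K t" for t
  proof -
    have "{\<delta> \<in> K. card \<delta> = Suc (Suc d)} = {}" using top by force
    then have "Poly_Mapping.keys t = {}" using that unfolding schain_def by (metis image_empty subset_empty)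
    then show ?thesis by simp
  qed
  have inj: "inj_on \<theta> ?L"
  proof (rule inj_onI)
    fix x y assume xy: "x \<in> ?L" "y \<in> ?L" and e: "\<theta> x = \<theta> y"
    have cx: "scycle d (face_chain fs x)" and cy: "scycle d (face_chain fs y)" using xy cyc by blast+
    obtain t where "schain (Suc d) K t" "face_chain fs x - face_chain fs y = chain_boundary (Suc d) t"
      using e simplicial_class_eq_iff [OF cx cy] unfolding \<theta>_def by blast
    then have "face_chain fs x = face_chain fs y" using no_top by fastforce
    then have "\<forall>j<length fs. x j = y j" using face_chain_eq_iff [OF K fs] by blast
    moreover have "x j = y j" if "\<not> j < length fs" for j using xy that by simp
    ultimately show "x = y" by blast
  qed
  have surj: "\<theta> ` ?L = carrier ?H"
  proof
    show "\<theta> ` ?L \<subseteq> carrier ?H" unfolding carrier_homology_eq_simplicial_class \<theta>_def using cyc by blast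
    show "carrier ?H \<subseteq> \<theta> ` ?L" unfolding carrier_homology_eq_simplicial_class
    proof (rule image_subsetI)
      fix a assume "a \<in> {a. scycle d a}"
      then have a: "scycle d a" by simp
      then obtain x where x: "\<forall>j\<ge>length fs. x j = 0" "a = face_chain fs x"
        using schain_imp_face_chain [OF K fs] by blast
      then have "x \<in> ?L" using a cyc by simp
      then show "simplicial_class d K X \<Phi> a \<in> \<theta> ` ?L" using x(2) unfolding \<theta>_def by blast
    qed
  qed
  define \<kappa> where "\<kappa> = inv_into ?L \<theta>"
  have bij: "bij_betw \<theta> ?L (carrier ?H)" using inj surj by (simp add: bij_betw_def)
  have k: "\<kappa> c \<in> ?L" "\<theta> (\<kappa> c) = c" if "c \<in> carrier ?H" for c
  proof -
    have "c \<in> \<theta> ` ?L" using that by (simp only: surj)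
    then show "\<kappa> c \<in> ?L" "\<theta> (\<kappa> c) = c" unfolding \<kappa>_def by (rule inv_into_into, rule f_inv_into_f)
  qed
  have k3: "\<kappa> (\<theta> x) = x" if "x \<in> ?L" for x
    unfolding \<kappa>_def by (rule inv_into_f_f [OF inj that])
  show ?thesis
  proof (intro exI [of _ \<kappa>] conjI ballI)
    show "bij_betw \<kappa> (carrier ?H) ?L" unfolding \<kappa>_def by (rule bij_betw_inv_into [OF bij])
    fix c assume c: "c \<in> carrier ?H"
    have cc: "scycle d (face_chain fs (\<kappa> c))" using k(1) [OF c] cyc by blast
    then show "schain d K (face_chain fs (\<kappa> c))" "chain_boundary d (face_chain fs (\<kappa> c)) = 0" by blast+
    show "c = simplicial_class d K X \<Phi> (face_chain fs (\<kappa> c))" using k(2) [OF c] by (simp add: \<theta>_def)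
    fix c' assume c': "c' \<in> carrier ?H"
    have cc': "scycle d (face_chain fs (\<kappa> c'))" using k(1) [OF c'] cyc by blast
    let ?s = "\<lambda>j. \<kappa> c j + \<kappa> c' j"
    have s: "?s \<in> ?L" using k(1) [OF c] k(1) [OF c'] by (simp add: distrib_left sum.distrib)
    have e: "\<theta> ?s = c \<otimes>\<^bsub>?H\<^esub> c'"
      using simplicial_class_add [OF cc cc'] k(2) [OF c] k(2) [OF c'] by (simp add: \<theta>_def face_chain_add)
    show "\<kappa> (c \<otimes>\<^bsub>?H\<^esub> c') = ?s" unfolding e [symmetric] by (rule k3 [OF s])
  qed
qed

text \<open>A class is torsion exactly if a positive multiple of its simplicial cycle is a
  simplicial boundary, so the torsion subgroup is \<open>L\<close> modulo the image of
  \<open>U\<close>. The quotient is expressed by the fibres of \<psi>, which avoids forming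
  it.\<close>

theorem torsion_homology_coordinates:
  assumes fs: "lists_faces K (Suc (Suc m)) fs" and gs: "lists_faces K (Suc m) gs"
  defines "U \<equiv> \<lambda>x i. \<Sum>j<length fs. incidence (gs ! i) (fs ! j) * x j"
  defines "L \<equiv> {x. (\<forall>i\<ge>length gs. x i = 0) \<and> (\<exists>N>0. \<exists>w. \<forall>i<length gs. N * x i = U w i)}"
  shows "\<exists>\<psi>. \<psi> ` L = torsion_elements (homology_group (int m) X) \<and>
     (\<forall>x\<in>L. \<forall>y\<in>L. \<psi> x = \<psi> y \<longleftrightarrow> (\<exists>w. \<forall>i<length gs. x i - y i = U w i))"
proof -
  let ?H = "homology_group (int m) X"
  define \<psi> where "\<psi> x = simplicial_class m K X \<Phi> (face_chain gs x)" for x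
  have bd: "chain_boundary (Suc m) (face_chain fs w) = face_chain gs (U w)" for w
    unfolding U_def by (rule chain_boundary_face_chain [OF K fs gs])
  \<comment> \<open>Elements of \<open>L\<close> are cycles because a positive multiple is a
    boundary and the chain groups are torsion-free.\<close>
  have cyc: "scycle m (face_chain gs x)" if x: "x \<in> L" for x
  proof -
    obtain N w where N: "(N::int) > 0" "\<forall>i<length gs. N * x i = U w i" using x unfolding L_def by blast
    have "frag_cmul N (face_chain gs x) = face_chain gs (U w)"
      unfolding face_chain_cmul [symmetric] using N(2) by (simp add: face_chain_eq_iff [OF K gs])
    also have "\<dots> = chain_boundary (Suc m) (face_chain fs w)" by (simp add: bd)
    finally have "frag_cmul N (chain_boundary m (face_chain gs x)) = chain_boundary m (chain_boundary (Suc m) (face_chain fs w))"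
      by (metis chain_boundary_cmul)
    also have "\<dots> = 0"
      using chain_boundary_boundary_alt schain_imp_singular_chain [OF K schain_face_chain [OF K fs]] by blast
    finally show ?thesis using N(1) schain_face_chain [OF K gs] by simp
  qed
  have bdry: "(\<exists>t. schain (Suc m) K t \<and> face_chain gs z = chain_boundary (Suc m) t) \<longleftrightarrow> (\<exists>w. \<forall>i<length gs. z i = U w i)" for z
  proof
    assume "\<exists>t. schain (Suc m) K t \<and> face_chain gs z = chain_boundary (Suc m) t"
    then obtain w where "face_chain gs z = chain_boundary (Suc m) (face_chain fs w)"
      using schain_imp_face_chain [OF K fs] by blast
    then show "\<exists>w. \<forall>i<length gs. z i = U w i" unfolding bd face_chain_eq_iff [OF K gs] by blast
  next
    assume "\<exists>w. \<forall>i<length gs. z i = U w i"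
    then obtain w where "face_chain gs z = chain_boundary (Suc m) (face_chain fs w)"
      unfolding bd face_chain_eq_iff [OF K gs] by blast
    then show "\<exists>t. schain (Suc m) K t \<and> face_chain gs z = chain_boundary (Suc m) t"
      using schain_face_chain [OF K fs] by blast
  qed
  have eq: "\<psi> x = \<psi> y \<longleftrightarrow> (\<exists>w. \<forall>i<length gs. x i - y i = U w i)" if "x \<in> L" "y \<in> L" for x y
    unfolding \<psi>_def simplicial_class_eq_iff [OF cyc [OF that(1)] cyc [OF that(2)]] face_chain_diff [symmetric] bdry ..
  have torsion: "simplicial_class m K X \<Phi> (face_chain gs x) [^]\<^bsub>?H\<^esub> (N::nat) = \<one>\<^bsub>?H\<^esub> \<longleftrightarrow> (\<exists>w. \<forall>i<length gs. int N * x i = U w i)"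
    if "scycle m (face_chain gs x)" for x N
  proof -
    have e: "frag_cmul (int N) (face_chain gs x) - 0 = face_chain gs (\<lambda>i. int N * x i)"
      by (simp add: face_chain_cmul)
    show ?thesis
      unfolding simplicial_class_pow [OF that] simplicial_class_0 [symmetric]
        simplicial_class_eq_iff [OF scycle_closed(3) [OF that] scycle_closed(1)] e bdry ..
  qed
  have "\<psi> ` L = torsion_elements ?H"
  proof
    show "\<psi> ` L \<subseteq> torsion_elements ?H"
    proof (rule image_subsetI)
      fix x assume x: "x \<in> L"
      obtain N w where N: "(N::int) > 0" "\<forall>i<length gs. N * x i = U w i" using x unfolding L_def by blast
      have "\<psi> x \<in> carrier ?H" unfolding carrier_homology_eq_simplicial_class \<psi>_def using cyc [OF x] by blast
      moreover have "\<psi> x [^]\<^bsub>?H\<^esub> nat N = \<one>\<^bsub>?H\<^esub>"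
        unfolding \<psi>_def torsion [OF cyc [OF x]] using N by auto
      ultimately show "\<psi> x \<in> torsion_elements ?H" unfolding torsion_elements_def using N(1)
        by (metis (mono_tags, lifting) mem_Collect_eq zero_less_nat_eq)
    qed
    show "torsion_elements ?H \<subseteq> \<psi> ` L"
    proof
      fix c assume "c \<in> torsion_elements ?H"
      then obtain N :: nat where c: "c \<in> carrier ?H" "N > 0" "c [^]\<^bsub>?H\<^esub> N = \<one>\<^bsub>?H\<^esub>" unfolding torsion_elements_def by blast
      then obtain a where a: "scycle m a" "c = simplicial_class m K X \<Phi> a"
        unfolding carrier_homology_eq_simplicial_class by blast
      then obtain x where x: "\<forall>j\<ge>length gs. x j = 0" "a = face_chain gs x" using schain_imp_face_chain [OF K gs] by blast
      have "\<exists>w. \<forall>i<length gs. int N * x i = U w i" using c(3) torsion a unfolding x(2) by metis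
      then have "\<exists>N>0. \<exists>w. \<forall>i<length gs. N * x i = U w i" using c(2) by (intro exI [of _ "int N"]) simp
      then have "x \<in> L" unfolding L_def using x(1) by blast
      then show "c \<in> \<psi> ` L" unfolding \<psi>_def using a(2) x(2) by blast
    qed
  qed
  with eq show ?thesis by blast
qed

end

subsection \<open>Local multiplicities of simplicial cycles\<close>

lemma continuous_map_compose_real:
  assumes "continuous_map X euclideanreal f" "continuous_on UNIV g"
  shows "continuous_map X euclideanreal (\<lambda>x. g (f x))"
proof -
  have "continuous_map euclideanreal euclideanreal g" using assms(2) by simp
  from continuous_map_compose [OF assms(1) this] show ?thesis by (simp add: o_def)
qed

text \<open>Radial rescaling stretches the ball over the whole space, which gives access to the
  homology of complements in Euclidean space.\<close>

lemma open_ball_space_homeomorphic_Euclidean_space: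
  "open_ball_space n homeomorphic_space Euclidean_space n"
proof -
  let ?s = "\<lambda>x::nat \<Rightarrow> real. \<Sum>i<n. (x i)\<^sup>2"
  let ?B = "{x::nat \<Rightarrow> real. (\<forall>i\<ge>n. x i = 0) \<and> ?s x < 1}" and ?E = "{x::nat \<Rightarrow> real. \<forall>i\<ge>n. x i = 0}"
  let ?f = "\<lambda>x::nat \<Rightarrow> real. \<lambda>i. x i / sqrt (1 - ?s x)" and ?g = "\<lambda>x::nat \<Rightarrow> real. \<lambda>i. x i / sqrt (1 + ?s x)"
  have B: "open_ball_space n = subtopology (powertop_real UNIV) ?B"
    unfolding open_ball_space_def Euclidean_space_def subtopology_subtopology by (rule arg_cong [of _ _ "subtopology _"]) blast
  have spos: "0 \<le> ?s x" for x by (simp add: sum_nonneg)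
  have cs: "continuous_map (subtopology (powertop_real UNIV) S) euclideanreal ?s" for S
    by (intro continuous_map_sum continuous_map_real_pow continuous_map_coordinate) simp
  have sf: "?s (?f x) = ?s x / (1 - ?s x)" if "?s x < 1" for x
    using that by (simp add: power_divide sum_divide_distrib)
  have sg: "?s (?g x) = ?s x / (1 + ?s x)" for x
    using spos [of x] by (simp add: power_divide sum_divide_distrib)
  have "homeomorphic_maps (open_ball_space n) (Euclidean_space n) ?f ?g"
    unfolding homeomorphic_maps_def
  proof (intro conjI ballI)
    show "continuous_map (open_ball_space n) (Euclidean_space n) ?f"
      unfolding B Euclidean_space_def continuous_map_in_subtopology continuous_map_componentwise_UNIV
    proof (intro conjI allI)
      fix i
      show "continuous_map (subtopology (powertop_real UNIV) ?B) euclideanreal (\<lambda>x. x i / sqrt (1 - ?s x))"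
      proof (intro continuous_map_real_divide continuous_map_coordinate)
        show "continuous_map (subtopology (powertop_real UNIV) ?B) euclideanreal (\<lambda>x. sqrt (1 - ?s x))"
          by (rule continuous_map_compose_real [where g = sqrt]) (intro continuous_map_diff cs continuous_intros; simp)+
      qed auto
    qed auto
    show "continuous_map (Euclidean_space n) (open_ball_space n) ?g"
      unfolding B Euclidean_space_def continuous_map_in_subtopology continuous_map_componentwise_UNIV
    proof (intro conjI allI)
      fix i
      show "continuous_map (subtopology (powertop_real UNIV) ?E) euclideanreal (\<lambda>x. x i / sqrt (1 + ?s x))"
      proof (intro continuous_map_real_divide continuous_map_coordinate)
        show "continuous_map (subtopology (powertop_real UNIV) ?E) euclideanreal (\<lambda>x. sqrt (1 + ?s x))"
          by (rule continuous_map_compose_real [where g = sqrt]) (intro continuous_map_add cs continuous_intros; simp)+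
        show "sqrt (1 + ?s x) \<noteq> 0" for x using spos [of x] by simp
      qed
      show "?g \<in> topspace (subtopology (powertop_real UNIV) ?E) \<rightarrow> ?B"
      proof
        fix x assume "x \<in> topspace (subtopology (powertop_real UNIV) ?E)"
        then show "?g x \<in> ?B" using sg [of x] spos [of x] by simp
      qed
    qed
    show "?g (?f x) = x" if "x \<in> topspace (open_ball_space n)" for x
    proof -
      have x: "?s x < 1" using that by (simp add: B)
      have "sqrt (1 + ?s (?f x)) = 1 / sqrt (1 - ?s x)"
      proof -
        have "1 + ?s x / (1 - ?s x) = 1 / (1 - ?s x)" using x by (simp add: field_simps)
        then show ?thesis unfolding sf [OF x] by (simp only: real_sqrt_divide real_sqrt_one)
      qed
      then show ?thesis using x by simp
    qed
    show "?f (?g x) = x" for x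
    proof -
      have "sqrt (1 - ?s (?g x)) = 1 / sqrt (1 + ?s x)"
      proof -
        have "1 - ?s x / (1 + ?s x) = 1 / (1 + ?s x)" using spos [of x] by (simp add: field_simps)
        then show ?thesis unfolding sg by (simp only: real_sqrt_divide real_sqrt_one)
      qed
      then show ?thesis using spos [of x] by simp
    qed
  qed
  then show ?thesis unfolding homeomorphic_space_def by blast
qed

text \<open>Complements of homeomorphic closed subsets have isomorphic relative groups, so
  \<open>y\<close> may be moved to the origin. The origin is also a closed set of the 0-dimensional
  space; raising the ambient dimension \<open>n\<close> times shifts the degree by \<open>n\<close>,
  and in dimension 0 the complement is empty.\<close>

lemma relative_homology_group_Euclidean_punctured:
  assumes "y \<in> topspace (Euclidean_space n)"
  shows "relative_homology_group m (Euclidean_space n) (topspace (Euclidean_space n) - {y})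
    \<cong> homology_group (m - int n) (Euclidean_space 0)"
proof -
  let ?E = "Euclidean_space n" and ?o = "\<lambda>i::nat. 0::real"
  have o: "?o \<in> topspace (Euclidean_space k)" for k by (simp add: topspace_Euclidean_space)
  have haus: "Hausdorff_space (Euclidean_space k)" for k
    unfolding Euclidean_space_def by (intro Hausdorff_space_subtopology) (simp add: Hausdorff_space_product_topology)
  have closed: "closedin (Euclidean_space k) {x}" if "x \<in> topspace (Euclidean_space k)" for x k
    by (rule closedin_Hausdorff_singleton [OF haus that])
  have top0: "topspace (Euclidean_space 0) = {?o}" by (auto simp: topspace_Euclidean_space)
  have "subtopology ?E {y} homeomorphic_space subtopology ?E {?o}"
    unfolding homeomorphic_space_def
    by (intro exI [of _ "\<lambda>_. ?o"] exI [of _ "\<lambda>_. y"])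
       (use assms o in \<open>auto simp: homeomorphic_maps_def continuous_map_in_subtopology\<close>)
  then have 1: "relative_homology_group m ?E (topspace ?E - {y}) \<cong> relative_homology_group m ?E (topspace ?E - {?o})"
    by (rule isomorphic_relative_homology_groups_Euclidean_complements [OF closed [OF assms] closed [OF o]])
  have "relative_homology_group (m - int n) (Euclidean_space 0) (topspace (Euclidean_space 0) - {?o})
      \<cong> relative_homology_group (m - int n + int n) (Euclidean_space (0 + n)) (topspace (Euclidean_space (0 + n)) - {?o})"
    by (rule relative_homology_group_Euclidean_complement_step [OF closed [OF o]])
  then have "homology_group (m - int n) (Euclidean_space 0) \<cong> relative_homology_group m ?E (topspace ?E - {?o})"
    by (simp add: top0)
  then have "relative_homology_group m ?E (topspace ?E - {?o}) \<cong> homology_group (m - int n) (Euclidean_space 0)"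
    by (rule group.iso_sym [OF group_relative_homology_group])
  with 1 show ?thesis by (rule iso_trans)
qed

text \<open>The complement of \<open>N\<close> can be excised because its closure misses the open
  set \<open>U\<close> around \<open>x\<close>; what remains is a punctured ball. All degrees
  \<open>m\<close> are kept, as invariance of dimension compares degrees.\<close>

lemma relative_homology_group_manifold_point:
  assumes X: "Hausdorff_space X" and x: "x \<in> manifold_points d X"
  shows "relative_homology_group m X (topspace X - {x}) \<cong> homology_group (m - int d) (Euclidean_space 0)"
proof -
  obtain U N where U: "openin X U" "x \<in> U" and UN: "U \<subseteq> N" "N \<subseteq> topspace X"
    and "subtopology X N homeomorphic_space open_ball_space d" and xX: "x \<in> topspace X"
    using x unfolding manifold_points_def by blast
  then have "subtopology X N homeomorphic_space Euclidean_space d"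
    using open_ball_space_homeomorphic_Euclidean_space homeomorphic_space_trans by blast
  then obtain h where h: "homeomorphic_map (subtopology X N) (Euclidean_space d) h"
    unfolding homeomorphic_space by blast
  have topN: "topspace (subtopology X N) = N" using UN by auto
  have inj: "inj_on h N" and im: "h ` N = topspace (Euclidean_space d)"
    using h topN by (metis homeomorphic_imp_injective_map, metis homeomorphic_imp_surjective_map)
  have xN: "x \<in> N" using U UN by blast
  have "h ` (N - {x}) = topspace (Euclidean_space d) - {h x}"
    using inj im xN by (simp add: inj_on_image_set_diff)
  then have 1: "relative_homology_group m (subtopology X N) (N - {x})
      \<cong> relative_homology_group m (Euclidean_space d) (topspace (Euclidean_space d) - {h x})"
    using is_isoI [OF homeomorphic_map_relative_homology_iso [OF h, of "N - {x}"]] topN by blast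
  have "hom_induced m (subtopology X (topspace X - (topspace X - N))) ((topspace X - {x}) - (topspace X - N))
        (subtopology X (topspace X)) (topspace X - {x}) id
     \<in> iso (relative_homology_group m (subtopology X (topspace X - (topspace X - N))) ((topspace X - {x}) - (topspace X - N)))
           (relative_homology_group m (subtopology X (topspace X)) (topspace X - {x}))"
  proof (rule homology_excision_axiom)
    have "closedin X (topspace X - U)" using U(1) by (simp add: closedin_diff)
    then have "X closure_of (topspace X - N) \<subseteq> topspace X - U" using UN by (intro closure_of_minimal) blast+
    moreover have "openin X (topspace X - {x})"
      using closedin_Hausdorff_singleton [OF X xX] by (simp add: openin_diff)
    then have "X interior_of (topspace X - {x}) = topspace X - {x}" by (rule interior_of_openin)
    ultimately show "X closure_of (topspace X - N) \<subseteq> X interior_of (topspace X - {x})" using U(2) by blast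
  qed blast
  moreover have "topspace X - (topspace X - N) = N" "(topspace X - {x}) - (topspace X - N) = N - {x}" using UN by blast+
  ultimately have "relative_homology_group m (subtopology X N) (N - {x}) \<cong> relative_homology_group m X (topspace X - {x})"
    by (intro is_isoI) (simp add: subtopology_topspace)
  then have 2: "relative_homology_group m X (topspace X - {x}) \<cong> relative_homology_group m (subtopology X N) (N - {x})"
    by (rule group.iso_sym [OF group_relative_homology_group])
  have "h x \<in> topspace (Euclidean_space d)" using im xN by blast
  from iso_trans [OF iso_trans [OF 2 1] relative_homology_group_Euclidean_punctured [OF this]] show ?thesis .
qed

lemma relative_homology_group_manifold_point_iso:
  assumes "Hausdorff_space X" "x \<in> manifold_points d X"
  shows "relative_homology_group (int d) X (topspace X - {x}) \<cong> integer_group"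
proof -
  have "topspace (Euclidean_space 0) = {\<lambda>i. 0}" by (auto simp: topspace_Euclidean_space)
  then have "homology_group 0 (Euclidean_space 0) \<cong> integer_group" by (rule homology_coefficients)
  with relative_homology_group_manifold_point [OF assms, of "int d"] show ?thesis by (simp add: iso_trans)
qed

text \<open>In degree \<open>a\<close> the local group at \<open>x\<close> is infinite cyclic by the
  first membership, and trivial by the second if \<open>a \<noteq> b\<close>.\<close>

lemma manifold_points_unique_dim:
  assumes X: "Hausdorff_space X" and x: "x \<in> manifold_points a X" "x \<in> manifold_points b X"
  shows "a = b"
proof (rule ccontr)
  assume ab: "a \<noteq> b"
  have top: "topspace (Euclidean_space 0) = {\<lambda>i. 0}" by (auto simp: topspace_Euclidean_space)
  have "trivial_group (homology_group (int a - int b) (Euclidean_space 0))"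
    by (rule homology_dimension_axiom [OF top]) (use ab in simp)
  moreover have "integer_group \<cong> homology_group (int a - int b) (Euclidean_space 0)"
    using iso_trans [OF group.iso_sym [OF group_relative_homology_group relative_homology_group_manifold_point_iso [OF X x(1)]]
      relative_homology_group_manifold_point [OF X x(2)]] .
  ultimately have "trivial_group integer_group"
    by (meson isomorphic_group_triviality group_integer_group group_relative_homology_group)
  then have "(1::int) \<in> {0}" unfolding trivial_group_def by (metis UNIV_I carrier_integer_group one_integer_group)
  then show False by simp
qed

lemma openin_manifold_points: "openin X (manifold_points d X)"
proof (subst openin_subopen, intro ballI)
  fix x assume "x \<in> manifold_points d X"
  then obtain U N where U: "openin X U" "x \<in> U" "U \<subseteq> N" "N \<subseteq> topspace X" "subtopology X N homeomorphic_space open_ball_space d"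
    unfolding manifold_points_def by blast
  have "U \<subseteq> manifold_points d X" unfolding manifold_points_def using U by blast
  with U show "\<exists>T. openin X T \<and> x \<in> T \<and> T \<subseteq> manifold_points d X" by blast
qed

text \<open>An automorphism of the integers is multiplication by 1 or -1. The sign is chosen before
  the element, so one sign serves the whole group.\<close>

lemma iso_integer_group_unique:
  assumes G: "group G" and g: "g \<in> iso G integer_group" and h: "h \<in> iso G integer_group"
  shows "\<exists>\<epsilon>\<in>{1, -1}. \<forall>x\<in>carrier G. g x = \<epsilon> * h x"
proof -
  have gh: "g \<in> hom G integer_group" "h \<in> hom G integer_group"
    and bij: "bij_betw g (carrier G) UNIV" "bij_betw h (carrier G) UNIV" using g h by (simp_all add: iso_def)
  obtain y where y: "y \<in> carrier G" "g y = 1" using bij(1) by (metis UNIV_I bij_betw_imp_surj_on imageE)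
  obtain u where u: "u \<in> carrier G" "h u = 1" using bij(2) by (metis UNIV_I bij_betw_imp_surj_on imageE)
  have pow: "f (u [^]\<^bsub>G\<^esub> k) = k * f u" if "f \<in> hom G integer_group" for f and k :: int
    using hom_int_pow [OF that u(1) G group_integer_group] by simp
  have eq: "g x = g u * h x" if x: "x \<in> carrier G" for x
  proof -
    have "h (u [^]\<^bsub>G\<^esub> h x) = h x" using pow [OF gh(2)] u(2) by simp
    then have "u [^]\<^bsub>G\<^esub> h x = x"
      using bij(2) x u(1) group.int_pow_closed [OF G] by (metis bij_betw_imp_inj_on inj_onD)
    then show ?thesis using pow [OF gh(1), of "h x"] by (simp add: mult.commute)
  qed
  have "g u * h y = 1" using eq [OF y(1)] y(2) by simp
  then have "g u = 1 \<or> g u = -1" by (auto simp: zmult_eq_1_iff)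
  with eq show ?thesis by blast
qed

text \<open>An arbitrary choice, so that multiplicities are only meaningful up to a sign depending on \<open>\<sigma>\<close>.\<close>

definition star_iso :: "nat \<Rightarrow> nat set set \<Rightarrow> nat set \<Rightarrow> (nat \<Rightarrow> real) chain set \<Rightarrow> int" where
  "star_iso d K \<sigma> = (SOME g. g \<in> iso (relative_homology_group (int d) (realization K) (polyhedron (costar \<sigma> K))) integer_group)"

text \<open>A local multiplicity that mentions no point: by the deformation onto the costar the
  local group depends on the open face only, so one choice of isomorphism per face suffices.\<close>

definition star_multiplicity :: "nat \<Rightarrow> nat set set \<Rightarrow> nat set \<Rightarrow> (nat \<Rightarrow> real) chain \<Rightarrow> int" where
  "star_multiplicity d K \<sigma> a = star_iso d K \<sigma> (homologous_rel_set d (realization K) (polyhedron (costar \<sigma> K)) a)"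

context
  fixes K X \<Phi> assumes K: "finite_complex K" and hom: "homeomorphic_map (realization K) X \<Phi>"
begin

lemma Phi_facts: "continuous_map (realization K) X \<Phi>" "\<Phi> ` polyhedron K = topspace X" "inj_on \<Phi> (polyhedron K)"
  "Hausdorff_space X"
proof -
  show "continuous_map (realization K) X \<Phi>" using hom by (rule homeomorphic_imp_continuous_map)
  show "\<Phi> ` polyhedron K = topspace X" using homeomorphic_imp_surjective_map [OF hom] by simp
  show "inj_on \<Phi> (polyhedron K)" using homeomorphic_imp_injective_map [OF hom] by simp
  show "Hausdorff_space X"
    using Hausdorff_realization homeomorphic_map_imp_homeomorphic_space [OF hom] homeomorphic_Hausdorff_space by blast
qed

context
  fixes \<sigma> z and d :: nat
  assumes \<sigma>: "\<sigma> \<in> K" and z: "z \<in> open_face \<sigma>"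
begin

abbreviation "local_map \<equiv>
  hom_induced (int d) (realization K) (polyhedron (costar \<sigma> K)) X (topspace X - {\<Phi> z}) \<Phi>"

text \<open>Inclusion of the costar into the punctured polyhedron, followed by the homeomorphism;
  both induce isomorphisms.\<close>

lemma local_map_iso:
  "local_map \<in> iso (relative_homology_group (int d) (realization K) (polyhedron (costar \<sigma> K)))
      (relative_homology_group (int d) X (topspace X - {\<Phi> z}))"
proof -
  have zK: "z \<in> polyhedron K" by (rule z_in_polyhedron [OF K \<sigma> z])
  have im: "\<Phi> ` (polyhedron K - {z}) = topspace X - {\<Phi> z}"
    using Phi_facts(2,3) zK by (simp add: inj_on_image_set_diff)
  have 1: "hom_induced (int d) (realization K) (polyhedron K - {z}) X (topspace X - {\<Phi> z}) \<Phi>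
     \<in> iso (relative_homology_group (int d) (realization K) (polyhedron K - {z}))
          (relative_homology_group (int d) X (topspace X - {\<Phi> z}))"
    by (rule homeomorphic_map_relative_homology_iso [OF hom _ im]) simp
  have sub: "polyhedron (costar \<sigma> K) \<subseteq> polyhedron K - {z}"
    using bary_min_costar(1,2) [OF K \<sigma> z] by blast
  have "hom_induced (int d) (realization K) (polyhedron (costar \<sigma> K)) X (topspace X - {\<Phi> z}) (\<Phi> \<circ> id) =
     hom_induced (int d) (realization K) (polyhedron K - {z}) X (topspace X - {\<Phi> z}) \<Phi> \<circ>
     hom_induced (int d) (realization K) (polyhedron (costar \<sigma> K)) (realization K) (polyhedron K - {z}) id"
    by (rule hom_induced_compose [OF continuous_map_id id_funcset [OF sub] Phi_facts(1)]) (use im in blast)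
  with iso_set_trans [OF iso_costar_punctured [OF K \<sigma> z, of "int d"] 1] show ?thesis
    by (simp add: compose_def o_def)
qed

text \<open>Both sides are the relative class of the chain to which \<Phi> carries
  \<open>a\<close>.\<close>

lemma local_class:
  assumes a: "scycle K d a"
  shows "hom_induced (int d) X {} X (topspace X - {\<Phi> z}) id (simplicial_class d K X \<Phi> a) =
     local_map (homologous_rel_set d (realization K) (polyhedron (costar \<sigma> K)) a)"
proof -
  have cyc: "singular_relcycle d (realization K) {} a" by (rule scycle_relcycle [OF K hom a])
  have e: "{} \<rightarrow> S = UNIV" for S :: "'b set" by simp
  have im: "\<Phi> \<in> polyhedron (costar \<sigma> K) \<rightarrow> topspace X - {\<Phi> z}"
  proof
    fix x assume "x \<in> polyhedron (costar \<sigma> K)"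
    then have "x \<in> polyhedron K" "x \<noteq> z" using bary_min_costar [OF K \<sigma> z] by blast+
    then show "\<Phi> x \<in> topspace X - {\<Phi> z}"
      using Phi_facts(2,3) z_in_polyhedron [OF K \<sigma> z] by (metis DiffI image_eqI inj_onD singletonD)
  qed
  have cyc': "singular_relcycle d (realization K) (polyhedron (costar \<sigma> K)) a"
    using cyc a by (simp add: singular_relcycle)
  have "hom_induced (int d) X {} X (topspace X - {\<Phi> z}) id (simplicial_class d K X \<Phi> a) =
     hom_induced (int d) (realization K) {} X (topspace X - {\<Phi> z}) (id \<circ> \<Phi>) (homologous_rel_set d (realization K) {} a)"
    unfolding simplicial_class_def by (rule hom_induced_compose' [OF Phi_facts(1)]) simp_all
  also have "\<dots> = homologous_rel_set d X (topspace X - {\<Phi> z}) (chain_map d \<Phi> a)"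
    using hom_induced_chain_map [OF Phi_facts(1) _ cyc] by simp
  also have "\<dots> = local_map (homologous_rel_set d (realization K) (polyhedron (costar \<sigma> K)) a)"
    using hom_induced_chain_map [OF Phi_facts(1) im cyc'] by simp
  finally show ?thesis .
qed

context
  assumes mfd: "\<Phi> z \<in> manifold_points d X"
begin

lemma local_iso_iso:
  "local_iso d X (\<Phi> z) \<in> iso (relative_homology_group (int d) X (topspace X - {\<Phi> z})) integer_group"
  unfolding local_iso_def using relative_homology_group_manifold_point_iso [OF Phi_facts(4) mfd]
  by (simp add: is_iso_def some_in_eq)

lemma local_comp_iso:
  "local_iso d X (\<Phi> z) \<circ> local_map \<in>
     iso (relative_homology_group (int d) (realization K) (polyhedron (costar \<sigma> K))) integer_group"
  using iso_set_trans [OF local_map_iso local_iso_iso] by (simp add: compose_def o_def)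

lemma star_iso_iso:
  "star_iso d K \<sigma> \<in> iso (relative_homology_group (int d) (realization K) (polyhedron (costar \<sigma> K))) integer_group"
  unfolding star_iso_def some_in_eq using local_comp_iso by blast

text \<open>Two identifications of one infinite cyclic group with the integers are compared. The
  sign may depend on the point but not on the cycle, which is what a product with an even number of
  factors needs.\<close>

lemma local_multiplicity_eq_star_multiplicity:
  "\<exists>\<epsilon>\<in>{1, -1}. \<forall>a. scycle K d a \<longrightarrow>
     local_multiplicity d X (simplicial_class d K X \<Phi> a) (\<Phi> z) = \<epsilon> * star_multiplicity d K \<sigma> a"
proof -
  obtain \<epsilon> :: int where \<epsilon>: "\<epsilon> \<in> {1, -1}" "\<And>x. x \<in> carrier (relative_homology_group (int d) (realization K) (polyhedron (costar \<sigma> K))) \<Longrightarrow>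
      (local_iso d X (\<Phi> z) \<circ> local_map) x = \<epsilon> * star_iso d K \<sigma> x"
    using iso_integer_group_unique [OF group_relative_homology_group local_comp_iso star_iso_iso] by blast
  have "local_multiplicity d X (simplicial_class d K X \<Phi> a) (\<Phi> z) = \<epsilon> * star_multiplicity d K \<sigma> a"
    if a: "scycle K d a" for a
  proof -
    have "singular_relcycle d (realization K) (polyhedron (costar \<sigma> K)) a"
      using scycle_relcycle [OF K hom a] a by (simp add: singular_relcycle)
    then have "homologous_rel_set d (realization K) (polyhedron (costar \<sigma> K)) a \<in>
       carrier (relative_homology_group (int d) (realization K) (polyhedron (costar \<sigma> K)))"
      by (simp add: carrier_relative_homology_group)
    from \<epsilon>(2) [OF this] show ?thesis
      by (simp add: local_multiplicity_def mfd local_class [OF a] star_multiplicity_def)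
  qed
  with \<epsilon>(1) show ?thesis by blast
qed

text \<open>All \<open>d\<close>-faces lie in the costar of \<sigma>, relative to which the cycle is
  zero.\<close>

lemma star_multiplicity_eq_0:
  assumes no: "\<And>\<delta>. \<delta> \<in> K \<Longrightarrow> card \<delta> = Suc d \<Longrightarrow> \<not> \<sigma> \<subseteq> \<delta>" and a: "scycle K d a"
  shows "star_multiplicity d K \<sigma> a = 0"
proof -
  let ?G = "relative_homology_group (int d) (realization K) (polyhedron (costar \<sigma> K))"
  have "{\<delta> \<in> K. card \<delta> = Suc d} \<subseteq> {\<delta> \<in> costar \<sigma> K. card \<delta> = Suc d}" using no by (auto simp: costar_def)
  then have "schain d (costar \<sigma> K) a" using a unfolding schain_def by (meson image_mono order_trans)
  then have "singular_chain d (realization (costar \<sigma> K)) a"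
    using schain_imp_singular_chain [OF finite_complex_costar [OF K]] by blast
  moreover have "costar \<sigma> K \<subseteq> K" by (auto simp: costar_def)
  ultimately have "singular_relboundary d (realization K) (polyhedron (costar \<sigma> K)) a"
    using singular_chain_imp_relboundary subtopology_realization by metis
  then have "homologous_rel_set d (realization K) (polyhedron (costar \<sigma> K)) a = \<one>\<^bsub>?G\<^esub>"
    by (simp add: homologous_rel_set_eq_relboundary)
  then show ?thesis
    using star_iso_iso hom_one [OF _ group_relative_homology_group group_integer_group]
    unfolding star_multiplicity_def iso_def by fastforce
qed

text \<open>The costar of a facet contains all other faces, so modulo the costar a simplicial chain
  is its \<sigma>-component. What remains is that the simplex \<sigma> generates the relative group,
  a statement about singular classes.\<close>

lemma star_multiplicity_top_face:
  assumes top: "\<And>\<delta>. \<delta> \<in> K \<Longrightarrow> card \<delta> \<le> Suc d" and c\<sigma>: "card \<sigma> = Suc d"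
  shows "\<exists>\<epsilon>\<in>{1, -1}. \<forall>a. scycle K d a \<longrightarrow>
     star_multiplicity d K \<sigma> a = \<epsilon> * Poly_Mapping.lookup a (vertex_simplex \<sigma>)"
proof -
  let ?R = "realization K" and ?P = "polyhedron (costar \<sigma> K)"
  let ?G = "relative_homology_group (int d) ?R ?P"
  let ?v = "frag_of (vertex_simplex \<sigma>)"
  let ?cl = "homologous_rel_set d ?R ?P"
  have max: "\<delta> = \<sigma>" if "\<delta> \<in> K" "\<sigma> \<subseteq> \<delta>" for \<delta>
    using that top [OF that(1)] c\<sigma> finite_complexD(2) [OF K that(1)] by (metis card_seteq)
  have costar: "costar \<sigma> K = K - {\<sigma>}" unfolding costar_def using max by blast
  have K': "finite_complex (costar \<sigma> K)" using finite_complex_costar [OF K] .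
  have sub: "costar \<sigma> K \<subseteq> K" unfolding costar by blast
  note subR = subtopology_realization [OF sub]
  have cl_eq: "?cl a = ?cl (frag_cmul (Poly_Mapping.lookup a (vertex_simplex \<sigma>)) ?v)" if a: "schain d K a" for a
  proof -
    obtain b c where b: "schain d {\<sigma>} b" and c: "schain d (K - {\<sigma>}) c" and abc: "a = b + c"
      using schain_split [OF a] by blast
    have "Poly_Mapping.keys b \<subseteq> {vertex_simplex \<sigma>}" using b unfolding schain_def by blast
    then have b': "b = frag_cmul (Poly_Mapping.lookup b (vertex_simplex \<sigma>)) ?v"
      by (intro poly_mapping_eqI) (auto simp: in_keys_iff)
    have "vertex_simplex \<sigma> \<notin> Poly_Mapping.keys c"
    proof
      assume "vertex_simplex \<sigma> \<in> Poly_Mapping.keys c"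
      then obtain \<delta> where \<delta>: "\<delta> \<in> K - {\<sigma>}" "card \<delta> = Suc d" "vertex_simplex \<sigma> = vertex_simplex \<delta>"
        using c unfolding schain_def by blast
      then have "\<sigma> = \<delta>" using inj_on_vertex_simplex [of \<sigma> \<delta>] finite_complexD(2) [OF K] \<sigma> c\<sigma> by (metis DiffD1)
      with \<delta>(1) show False by blast
    qed
    then have l: "Poly_Mapping.lookup a (vertex_simplex \<sigma>) = Poly_Mapping.lookup b (vertex_simplex \<sigma>)"
      by (simp add: abc lookup_add in_keys_iff)
    have "singular_relboundary d ?R ?P c"
      using singular_chain_imp_relboundary schain_imp_singular_chain [OF K'] c unfolding costar [symmetric] subR [symmetric] by blast
    then have "homologous_rel d ?R ?P a b" unfolding homologous_rel_def abc by simp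
    then show ?thesis using b' l homologous_rel_set_eq by metis
  qed
  have sv: "singular_relcycle d ?R ?P ?v"
  proof -
    have sv: "schain d K ?v" using \<sigma> c\<sigma> by blast
    have "schain (d - 1) (costar \<sigma> K) (chain_boundary d ?v)"
    proof -
      have "schain (d - 1) K (chain_boundary d ?v)" by (rule schain_boundary [OF K sv])
      moreover have "{\<delta> \<in> K. card \<delta> = Suc (d - 1)} \<subseteq> {\<delta> \<in> costar \<sigma> K. card \<delta> = Suc (d - 1)}" if "d \<noteq> 0"
      proof
        fix \<delta> assume "\<delta> \<in> {\<delta> \<in> K. card \<delta> = Suc (d - 1)}"
        then have "\<delta> \<in> K" "card \<delta> = d" using that by simp_all
        moreover from this c\<sigma> have "\<delta> \<noteq> \<sigma>" by force
        ultimately show "\<delta> \<in> {\<delta> \<in> costar \<sigma> K. card \<delta> = Suc (d - 1)}" unfolding costar using that by simp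
      qed
      ultimately show ?thesis
        by (cases "d = 0") (simp add: chain_boundary_def, unfold schain_def, meson image_mono order_trans)
    qed
    then show ?thesis unfolding singular_relcycle subR
      using schain_imp_singular_chain [OF K sv] schain_imp_singular_chain [OF K'] by blast
  qed
  have hom_cl: "?cl \<in> hom (relcycle_group d ?R ?P) ?G"
    using normal.r_coset_hom_Mod [OF normal_subgroup_singular_relboundary_relcycle, of d ?R ?P]
    by (simp add: nontrivial_relative_homology_group right_coset_singular_relboundary)
  let ?g = "star_iso d K \<sigma>"
  have g: "?g \<in> hom ?G integer_group" "bij_betw ?g (carrier ?G) UNIV" using star_iso_iso by (simp_all add: iso_def)
  have gc: "?g \<circ> ?cl \<in> hom (relcycle_group d ?R ?P) integer_group" by (rule hom_compose [OF hom_cl g(1)])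
  have add: "?g (?cl (x + y)) = ?g (?cl x) + ?g (?cl y)" if "singular_relcycle d ?R ?P x" "singular_relcycle d ?R ?P y" for x y
    using hom_mult [OF gc, of x y] that by simp
  have gn: "?g (?cl (frag_cmul (int k) ?v)) = int k * ?g (?cl ?v)" for k
  proof (induction k)
    case 0
    show ?case using add [of 0 0] by simp
  next
    case (Suc k)
    have "frag_cmul (int (Suc k)) ?v = frag_cmul (int k) ?v + ?v" by (simp only: of_nat_Suc frag_cmul_distrib frag_cmul_one add.commute)
    then show ?case using add [OF singular_relcycle_cmul [OF sv, of "int k"] sv] Suc by (simp add: distrib_right)
  qed
  have gk: "?g (?cl (frag_cmul k ?v)) = k * ?g (?cl ?v)" for k
  proof (cases "0 \<le> k")
    case True then show ?thesis using gn [of "nat k"] by simp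
  next
    case False
    have "frag_cmul k ?v + frag_cmul (- k) ?v = 0" by (simp only: frag_cmul_distrib [symmetric] add.right_inverse frag_cmul_zero)
    then have "?g (?cl 0) = ?g (?cl (frag_cmul k ?v)) + ?g (?cl (frag_cmul (- k) ?v))"
      using add [OF singular_relcycle_cmul [OF sv, of k] singular_relcycle_cmul [OF sv, of "- k"]] by simp
    moreover have "?g (?cl 0) = 0" using gn [of 0] by simp
    ultimately show ?thesis using gn [of "nat (- k)"] False by simp
  qed
  \<comment> \<open>The class mapped to 1 has a simplicial representative by the relative
    comparison. So 1 is an integer multiple of the value on the simplex \<sigma>, which is therefore
    1 or -1.\<close>
  have "1 \<in> ?g ` carrier ?G" unfolding bij_betw_imp_surj_on [OF g(2)] by (rule UNIV_I)
  then obtain y where y: "y \<in> carrier ?G" "?g y = 1" by (elim imageE) simp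
  obtain c where c: "singular_relcycle d ?R ?P c" "y = ?cl c" using y(1) unfolding carrier_relative_homology_group by blast
  obtain a where a: "schain d K a" "?cl c = ?cl a"
  proof -
    have "singular_chain d ?R c" "singular_chain (d - 1) (realization (costar \<sigma> K)) (chain_boundary d c)"
      using c(1) unfolding singular_relcycle subR by blast+
    then obtain a t u where a: "schain d K a" and t: "singular_chain (Suc d) ?R t" and u: "singular_chain d (realization (costar \<sigma> K)) u"
      and e: "c = a + chain_boundary (Suc d) t + u"
      using rel_simplicial_homology_iso(1) [OF K K' sub, of d] unfolding rel_homology_surj_def by metis
    have "homologous_rel d ?R ?P c a" unfolding homologous_rel_def singular_relboundary subR
      using t u e by (intro exI [of _ t] exI [of _ u]) (simp add: algebra_simps)
    with a that show ?thesis using homologous_rel_set_eq by metis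
  qed
  have "Poly_Mapping.lookup a (vertex_simplex \<sigma>) * ?g (?cl ?v) = 1"
    using gk cl_eq [OF a(1)] a(2) c(2) y(2) by metis
  then have "?g (?cl ?v) \<in> {1, -1}" by (auto simp: zmult_eq_1_iff)
  moreover have "star_multiplicity d K \<sigma> a = ?g (?cl ?v) * Poly_Mapping.lookup a (vertex_simplex \<sigma>)" if "scycle K d a" for a
    unfolding star_multiplicity_def using cl_eq [of a] gk that by (metis mult.commute)
  ultimately show ?thesis by blast
qed

end

end

end

subsection \<open>The form of cycles as a sum over faces\<close>

abbreviation pspace :: "(nat \<Rightarrow> real) set \<Rightarrow> (nat \<Rightarrow> real) topology" where
  "pspace S \<equiv> subtopology (powertop_real UNIV) S"

lemma homeomorphic_maps_pspaceI:
  assumes "\<And>x. x \<in> S \<Longrightarrow> f x \<in> T" "\<And>y. y \<in> T \<Longrightarrow> g y \<in> S"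
    and "\<And>x. x \<in> S \<Longrightarrow> g (f x) = x" "\<And>y. y \<in> T \<Longrightarrow> f (g y) = y"
    and "\<And>i. continuous_map (pspace S) euclideanreal (\<lambda>x. f x i)"
    and "\<And>i. continuous_map (pspace T) euclideanreal (\<lambda>y. g y i)"
  shows "homeomorphic_maps (pspace S) (pspace T) f g"
  using assms
  by (simp add: homeomorphic_maps_def continuous_map_in_subtopology continuous_map_componentwise_UNIV Pi_iff)

lemma continuous_map_real_compose_on:
  assumes "continuous_map X euclideanreal f" "\<And>x. x \<in> topspace X \<Longrightarrow> f x \<in> S" "continuous_on S g"
  shows "continuous_map X euclideanreal (\<lambda>x. g (f x))"
proof -
  have "continuous_map X (top_of_set S) f" using assms(1,2) by (simp add: continuous_map_in_subtopology Pi_iff)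
  moreover have "continuous_map (top_of_set S) euclideanreal g" using assms(3) by simp
  ultimately have "continuous_map X euclideanreal (g \<circ> f)" by (rule continuous_map_compose)
  then show ?thesis by (simp add: o_def)
qed

lemma positive_orthant_homeomorphic_Euclidean_space:
  "pspace {y. (\<forall>i\<ge>n. y i = 0) \<and> (\<forall>i<n. 0 < y i)} homeomorphic_space Euclidean_space n"
proof -
  let ?P = "{y::nat \<Rightarrow> real. (\<forall>i\<ge>n. y i = 0) \<and> (\<forall>i<n. 0 < y i)}" and ?E = "{y::nat \<Rightarrow> real. \<forall>i\<ge>n. y i = 0}"
  have "homeomorphic_maps (pspace ?P) (pspace ?E) (\<lambda>y i. if i < n then ln (y i) else 0) (\<lambda>y i. if i < n then exp (y i) else 0)"
  proof (rule homeomorphic_maps_pspaceI)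
    fix i
    show "continuous_map (pspace ?P) euclideanreal (\<lambda>y. if i < n then ln (y i) else 0)"
    proof (cases "i < n")
      case True
      have "continuous_map (pspace ?P) euclideanreal (\<lambda>y. ln (y i))"
        by (rule continuous_map_real_compose_on [OF continuous_map_coordinate, where S = "{0<..}"])
           (use True in \<open>auto intro!: continuous_intros\<close>)
      with True show ?thesis by simp
    qed simp
    show "continuous_map (pspace ?E) euclideanreal (\<lambda>y. if i < n then exp (y i) else 0)"
    proof (cases "i < n")
      case True
      have "continuous_map (pspace ?E) euclideanreal (\<lambda>y. exp (y i))"
        by (rule continuous_map_real_compose_on [OF continuous_map_coordinate, where S = UNIV])
           (auto intro!: continuous_intros)
      with True show ?thesis by simp
    qed simp
  qed (auto simp: fun_eq_iff)
  then show ?thesis unfolding Euclidean_space_def homeomorphic_space_def by blast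
qed

text \<open>Adding a multiple of the all-ones vector moves every point of the hyperplane of vectors with vanishing last coordinate
  to a unique boundary point of the nonnegative orthant.\<close>

lemma orthant_boundary_homeomorphic_Euclidean_space:
  "pspace {y. (\<forall>i\<ge>Suc n. y i = 0) \<and> (\<forall>i. 0 \<le> y i) \<and> (\<exists>i<Suc n. y i = 0)} homeomorphic_space Euclidean_space n"
proof -
  let ?B = "{y::nat \<Rightarrow> real. (\<forall>i\<ge>Suc n. y i = 0) \<and> (\<forall>i. 0 \<le> y i) \<and> (\<exists>i<Suc n. y i = 0)}"
  let ?E = "{y::nat \<Rightarrow> real. \<forall>i\<ge>n. y i = 0}"
  let ?m = "\<lambda>z::nat \<Rightarrow> real. Min ((\<lambda>i. z i) ` {..<Suc n})"
  let ?f = "\<lambda>y::nat \<Rightarrow> real. \<lambda>i. if i < Suc n then y i - y n else 0"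
  let ?g = "\<lambda>z::nat \<Rightarrow> real. \<lambda>i. if i < Suc n then z i - ?m z else 0"
  have mle: "?m z \<le> z i" if "i < Suc n" for z i using that by (intro Min_le) auto
  have mex: "\<exists>i<Suc n. ?m z = z i" for z
  proof -
    have "?m z \<in> (\<lambda>i. z i) ` {..<Suc n}" by (intro Min_in) auto
    then show ?thesis by auto
  qed
  \<comment> \<open>A boundary point has least coordinate 0, so the amount subtracted by
    \<open>?f\<close> is recovered as the negative of the new minimum.\<close>
  have mf: "?m (?f y) = - y n" if y: "y \<in> ?B" for y
  proof (rule Min_eqI)
    show "finite ((\<lambda>i. ?f y i) ` {..<Suc n})" by simp
    show "- y n \<le> x" if "x \<in> (\<lambda>i. ?f y i) ` {..<Suc n}" for x using that y by auto
    obtain i where "i < Suc n" "y i = 0" using y by blast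
    then show "- y n \<in> (\<lambda>i. ?f y i) ` {..<Suc n}" by (intro image_eqI [of _ _ i]) simp_all
  qed
  have "homeomorphic_maps (pspace ?B) (pspace ?E) ?f ?g"
  proof (rule homeomorphic_maps_pspaceI)
    fix i
    show "continuous_map (pspace ?B) euclideanreal (\<lambda>y. ?f y i)"
      by (cases "i < Suc n") (simp_all add: continuous_map_diff continuous_map_coordinate)
    show "continuous_map (pspace ?E) euclideanreal (\<lambda>z. ?g z i)"
    proof (cases "i < Suc n")
      case True
      have "continuous_map (pspace ?E) euclideanreal (\<lambda>z. z i - ?m z)"
        by (intro continuous_map_diff continuous_map_coordinate continuous_map_Min) auto
      with True show ?thesis by simp
    qed simp
  next
    fix y assume y: "y \<in> ?B"
    have "?f y i = 0" if "i \<ge> n" for i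
    proof -
      have "i = n \<or> i \<ge> Suc n" using that by arith
      then show ?thesis by auto
    qed
    then show "?f y \<in> ?E" by blast
    have "?g (?f y) i = y i" for i unfolding mf [OF y] using y by simp
    then show "?g (?f y) = y" by blast
  next
    fix z assume z: "z \<in> ?E"
    obtain i where i: "i < Suc n" "?m z = z i" using mex by blast
    have "?g z i = 0" using i by simp
    then show "?g z \<in> ?B" using mle [of _ z] i(1) by auto
    show "?f (?g z) = z" using z by (auto simp: fun_eq_iff)
  qed
  then show ?thesis unfolding Euclidean_space_def homeomorphic_space_def by blast
qed

text \<open>The affine chart of projective coordinates: ratios to the weight of \<open>v\<close>
  turn the part of the simplex with \<open>0 < x v\<close> into a whole orthant. The sum
  \<open>?S y\<close> is the reciprocal of the weight of \<open>v\<close>, by which the inverse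
  renormalizes.\<close>

lemma face_ratio_chart:
  assumes \<sigma>: "finite \<sigma>" "card \<sigma> = Suc n" and v: "v \<in> \<sigma>"
  shows "\<exists>\<rho> \<rho>' g. bij_betw g {..<n} (\<sigma> - {v}) \<and>
     homeomorphic_maps (pspace {x \<in> face_hull \<sigma>. 0 < x v}) (pspace {y. (\<forall>i\<ge>n. y i = 0) \<and> (\<forall>i. 0 \<le> y i)}) \<rho> \<rho>' \<and>
     (\<forall>x. \<forall>i<n. \<rho> x i = x (g i) / x v)"
proof -
  let ?D = "{x \<in> face_hull \<sigma>. 0 < x v}" and ?E = "{y::nat \<Rightarrow> real. (\<forall>i\<ge>n. y i = 0) \<and> (\<forall>i. 0 \<le> y i)}"
  have "card (\<sigma> - {v}) = n" using \<sigma> v by simp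
  then obtain g where g: "bij_betw g {..<n} (\<sigma> - {v})"
    using ex_bij_betw_nat_finite [of "\<sigma> - {v}"] \<sigma>(1) by (auto simp: atLeast0LessThan)
  define h where "h = inv_into {..<n} g"
  have gi: "g i \<in> \<sigma>" "g i \<noteq> v" "h (g i) = i" if "i < n" for i
    using g that unfolding h_def by (auto simp: bij_betw_def)
  have hw: "h w < n" "g (h w) = w" if "w \<in> \<sigma>" "w \<noteq> v" for w
  proof -
    have "w \<in> g ` {..<n}" using that bij_betw_imp_surj_on [OF g] by blast
    then show "h w < n" "g (h w) = w"
      unfolding h_def using inv_into_into [of w g "{..<n}"] f_inv_into_f [of w g "{..<n}"] by simp_all
  qed
  let ?S = "\<lambda>y::nat \<Rightarrow> real. 1 + (\<Sum>i<n. y i)"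
  let ?\<rho> = "\<lambda>x::nat \<Rightarrow> real. \<lambda>i. if i < n then x (g i) / x v else 0"
  let ?\<rho>' = "\<lambda>y::nat \<Rightarrow> real. \<lambda>w. if w = v then 1 / ?S y else if w \<in> \<sigma> then y (h w) / ?S y else 0"
  have sumg: "(\<Sum>i<n. f (g i)) = sum f (\<sigma> - {v})" for f :: "nat \<Rightarrow> real"
    by (rule sum.reindex_bij_betw [OF g])
  have Spos: "0 < ?S y" if "y \<in> ?E" for y
  proof -
    have "0 \<le> (\<Sum>i<n. y i)" using that by (intro sum_nonneg) simp
    then show ?thesis by simp
  qed
  have S\<rho>: "?S (?\<rho> x) = 1 / x v" if x: "x \<in> ?D" for x
  proof -
    have "sum x \<sigma> = x v + sum x (\<sigma> - {v})" using \<sigma>(1) v by (simp add: sum.remove)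
    moreover have "(\<Sum>i<n. ?\<rho> x i) = sum x (\<sigma> - {v}) / x v"
      using sumg [of "\<lambda>w. x w / x v"] by (simp add: sum_divide_distrib)
    ultimately show ?thesis using x \<sigma>(1) by (simp add: face_hull_eq field_simps)
  qed
  have "homeomorphic_maps (pspace ?D) (pspace ?E) ?\<rho> ?\<rho>'"
  proof (rule homeomorphic_maps_pspaceI)
    fix x assume x: "x \<in> ?D"
    then show "?\<rho> x \<in> ?E" using \<sigma>(1) by (simp add: face_hull_eq)
    have "?\<rho>' (?\<rho> x) w = x w" for w
      unfolding S\<rho> [OF x] using x hw [of w] \<sigma>(1) by (auto simp: face_hull_eq)
    then show "?\<rho>' (?\<rho> x) = x" by blast
  next
    fix y assume y: "y \<in> ?E"
    note S = Spos [OF y]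
    have "sum (?\<rho>' y) \<sigma> = 1 / ?S y + (\<Sum>w\<in>\<sigma> - {v}. ?\<rho>' y w)" using \<sigma>(1) v by (simp add: sum.remove)
    also have "(\<Sum>w\<in>\<sigma> - {v}. ?\<rho>' y w) = (\<Sum>i<n. ?\<rho>' y (g i))" by (rule sumg [symmetric])
    also have "\<dots> = (\<Sum>i<n. y i / ?S y)" using gi by (intro sum.cong) simp_all
    also have "1 / ?S y + (\<Sum>i<n. y i / ?S y) = ?S y / ?S y" by (simp only: sum_divide_distrib [symmetric] add_divide_distrib [symmetric])
    finally have "sum (?\<rho>' y) \<sigma> = 1" using S by simp
    moreover have "0 \<le> ?\<rho>' y w" for w using y S by simp
    moreover have "0 < ?\<rho>' y v" using S by simp
    ultimately show "?\<rho>' y \<in> ?D" using \<sigma>(1) v by (simp add: face_hull_eq)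
    have "?\<rho> (?\<rho>' y) i = y i" for i using gi [of i] y S by auto
    then show "?\<rho> (?\<rho>' y) = y" by blast
  next
    fix i
    show "continuous_map (pspace ?D) euclideanreal (\<lambda>x. ?\<rho> x i)"
    proof (cases "i < n")
      case True
      have "continuous_map (pspace ?D) euclideanreal (\<lambda>x. x (g i) / x v)"
        by (intro continuous_map_real_divide continuous_map_coordinate) auto
      with True show ?thesis by simp
    qed simp
    have cS: "continuous_map (pspace ?E) euclideanreal ?S"
      by (intro continuous_map_add continuous_map_sum continuous_map_coordinate) simp_all
    have S0: "?S y \<noteq> 0" if "y \<in> topspace (pspace ?E)" for y using Spos [of y] that by simp
    show "continuous_map (pspace ?E) euclideanreal (\<lambda>y. ?\<rho>' y i)"
    proof (cases "i = v")
      case True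
      have "continuous_map (pspace ?E) euclideanreal (\<lambda>y. 1 / ?S y)"
        by (intro continuous_map_real_divide cS S0) simp_all
      with True show ?thesis by simp
    next
      case False
      have "continuous_map (pspace ?E) euclideanreal (\<lambda>y. y (h i) / ?S y)"
        by (intro continuous_map_real_divide cS S0 continuous_map_coordinate) simp_all
      with False show ?thesis by (cases "i \<in> \<sigma>") simp_all
    qed
  qed
  with g show ?thesis by (intro exI [of _ ?\<rho>] exI [of _ ?\<rho>'] exI [of _ g]) simp
qed

lemma homeomorphic_open_ball_space:
  "X homeomorphic_space Euclidean_space n \<Longrightarrow> X homeomorphic_space open_ball_space n"
  using open_ball_space_homeomorphic_Euclidean_space homeomorphic_space_sym homeomorphic_space_trans by blast

text \<open>In the ratio chart at any vertex the open face is the set of positive vectors, which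
  logarithms identify with Euclidean space.\<close>

lemma open_face_homeomorphic_ball:
  assumes \<sigma>: "finite \<sigma>" "card \<sigma> = Suc n"
  shows "pspace (open_face \<sigma>) homeomorphic_space open_ball_space n"
proof -
  obtain v where v: "v \<in> \<sigma>" using \<sigma> by (metis all_not_in_conv card.empty nat.distinct(1))
  let ?D = "{x \<in> face_hull \<sigma>. 0 < x v}" and ?E = "{y::nat \<Rightarrow> real. (\<forall>i\<ge>n. y i = 0) \<and> (\<forall>i. 0 \<le> y i)}"
  let ?P = "{y::nat \<Rightarrow> real. (\<forall>i\<ge>n. y i = 0) \<and> (\<forall>i<n. 0 < y i)}"
  obtain \<rho> \<rho>' g where g: "bij_betw g {..<n} (\<sigma> - {v})" and h: "homeomorphic_maps (pspace ?D) (pspace ?E) \<rho> \<rho>'"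
    and \<rho>: "\<And>x i. i < n \<Longrightarrow> \<rho> x i = x (g i) / x v"
    using face_ratio_chart [OF \<sigma> v] by blast
  have surj: "\<sigma> - {v} = g ` {..<n}" using g by (simp add: bij_betw_def)
  have im: "\<rho> x \<in> ?E" if "x \<in> ?D" for x using h that by (auto simp: homeomorphic_maps_def continuous_map_def)
  have im': "\<rho>' y \<in> ?D" "\<rho> (\<rho>' y) = y" if "y \<in> ?E" for y using h that by (auto simp: homeomorphic_maps_def continuous_map_def)
  have PE: "?P \<subseteq> ?E"
  proof
    fix y assume y: "y \<in> ?P"
    have "0 \<le> y i" for i using y by (cases "i < n") (simp_all add: less_imp_le)
    then show "y \<in> ?E" using y by blast
  qed
  have FD: "open_face \<sigma> \<subseteq> ?D"
    using open_face_subset_face_hull [OF \<sigma>(1)] v by (auto simp: open_face_def support_def order_less_le)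
  have "homeomorphic_maps (subtopology (pspace ?D) (open_face \<sigma>)) (subtopology (pspace ?E) ?P) \<rho> \<rho>'"
  proof (rule homeomorphic_maps_subtopologies_alt [OF h])
    show "\<rho> ` (topspace (pspace ?D) \<inter> open_face \<sigma>) \<subseteq> ?P"
    proof
      fix y assume "y \<in> \<rho> ` (topspace (pspace ?D) \<inter> open_face \<sigma>)"
      then obtain x where x: "x \<in> ?D" "x \<in> open_face \<sigma>" and y: "y = \<rho> x" by auto
      have "0 < y i" if "i < n" for i
      proof -
        have "g i \<in> \<sigma>" using surj that by blast
        then have "0 < x (g i)" using x(2) by (auto simp: open_face_def support_def order_less_le)
        then show ?thesis using x(1) \<rho> [OF that] by (simp add: y)
      qed
      then show "y \<in> ?P" using im [OF x(1)] y by simp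
    qed
    show "\<rho>' ` (topspace (pspace ?E) \<inter> ?P) \<subseteq> open_face \<sigma>"
    proof
      fix x assume "x \<in> \<rho>' ` (topspace (pspace ?E) \<inter> ?P)"
      then obtain y where y: "y \<in> ?E" "y \<in> ?P" and x: "x = \<rho>' y" by auto
      have xD: "x \<in> ?D" and \<rho>x: "\<rho> x = y" using im' [OF y(1)] x by simp_all
      have pos: "0 < x w" if w: "w \<in> \<sigma>" for w
      proof (cases "w = v")
        case False
        then obtain i where i: "i < n" "w = g i" using w surj by blast
        have "0 < y i" using y(2) i(1) by blast
        then have "0 < x (g i) / x v" using \<rho> [OF i(1), of x] unfolding \<rho>x by simp
        then show ?thesis using xD i(2) by (simp add: zero_less_divide_iff)
      qed (use xD in simp)
      then have "support x = \<sigma>" using xD \<sigma>(1) by (auto simp: support_def face_hull_eq) (metis less_irrefl)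
      then show "x \<in> open_face \<sigma>" using xD \<sigma>(1) by (simp add: open_face_def face_hull_eq)
    qed
  qed
  then have "pspace (open_face \<sigma>) homeomorphic_space pspace ?P"
    using PE FD unfolding homeomorphic_space_def by (auto simp: subtopology_subtopology inf.absorb2)
  then show ?thesis
    using positive_orthant_homeomorphic_Euclidean_space homeomorphic_space_trans homeomorphic_open_ball_space by blast
qed

text \<open>\<open>diffuse\<close> speaks only of sets homeomorphic to an open ball, while the whole
  boundary of a face is a sphere. Its part with \<open>0 < x v\<close> is an open ball: in the ratio
  chart at \<open>v\<close> it becomes the boundary of the orthant.\<close>

lemma face_boundary_star_homeomorphic_ball:
  assumes \<sigma>: "finite \<sigma>" "card \<sigma> = Suc (Suc n)" and v: "v \<in> \<sigma>"
  shows "pspace {x \<in> face_hull \<sigma>. 0 < x v \<and> (\<exists>w\<in>\<sigma>. x w = 0)} homeomorphic_space open_ball_space n"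
proof -
  let ?D = "{x \<in> face_hull \<sigma>. 0 < x v}" and ?E = "{y::nat \<Rightarrow> real. (\<forall>i\<ge>Suc n. y i = 0) \<and> (\<forall>i. 0 \<le> y i)}"
  let ?S = "{x \<in> face_hull \<sigma>. 0 < x v \<and> (\<exists>w\<in>\<sigma>. x w = 0)}"
  let ?P = "{y::nat \<Rightarrow> real. (\<forall>i\<ge>Suc n. y i = 0) \<and> (\<forall>i. 0 \<le> y i) \<and> (\<exists>i<Suc n. y i = 0)}"
  obtain \<rho> \<rho>' g where g: "bij_betw g {..<Suc n} (\<sigma> - {v})" and h: "homeomorphic_maps (pspace ?D) (pspace ?E) \<rho> \<rho>'"
    and \<rho>: "\<And>x i. i < Suc n \<Longrightarrow> \<rho> x i = x (g i) / x v"
    using face_ratio_chart [OF \<sigma> v] by blast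
  have surj: "\<sigma> - {v} = g ` {..<Suc n}" using g by (simp add: bij_betw_def)
  have im: "\<rho> x \<in> ?E" if "x \<in> ?D" for x using h that by (auto simp: homeomorphic_maps_def continuous_map_def)
  have im': "\<rho>' y \<in> ?D" "\<rho> (\<rho>' y) = y" if "y \<in> ?E" for y using h that by (auto simp: homeomorphic_maps_def continuous_map_def)
  have PE: "?P \<subseteq> ?E" and SD: "?S \<subseteq> ?D" by blast+
  have "homeomorphic_maps (subtopology (pspace ?D) ?S) (subtopology (pspace ?E) ?P) \<rho> \<rho>'"
  proof (rule homeomorphic_maps_subtopologies_alt [OF h])
    show "\<rho> ` (topspace (pspace ?D) \<inter> ?S) \<subseteq> ?P"
    proof
      fix y assume "y \<in> \<rho> ` (topspace (pspace ?D) \<inter> ?S)"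
      then obtain x where x: "x \<in> ?D" "x \<in> ?S" and y: "y = \<rho> x" by auto
      then obtain w where w: "w \<in> \<sigma>" "x w = 0" by blast
      then have "w \<in> g ` {..<Suc n}" using x(1) unfolding surj [symmetric] by auto
      then obtain i where i: "i < Suc n" "w = g i" by blast
      then have "y i = 0" using \<rho> [OF i(1), of x] w(2) y by simp
      then show "y \<in> ?P" using im [OF x(1)] y i(1) by blast
    qed
    show "\<rho>' ` (topspace (pspace ?E) \<inter> ?P) \<subseteq> ?S"
    proof
      fix x assume "x \<in> \<rho>' ` (topspace (pspace ?E) \<inter> ?P)"
      then obtain y where y: "y \<in> ?E" "y \<in> ?P" and x: "x = \<rho>' y" by auto
      have xD: "x \<in> ?D" and \<rho>x: "\<rho> x = y" using im' [OF y(1)] x by simp_all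
      obtain i where i: "i < Suc n" "y i = 0" using y(2) by blast
      then have "x (g i) = 0" using \<rho> [OF i(1), of x] \<rho>x xD by simp
      moreover have "g i \<in> \<sigma>" using surj i(1) by blast
      ultimately show "x \<in> ?S" using xD by blast
    qed
  qed
  then have "pspace ?S homeomorphic_space pspace ?P"
    using PE SD unfolding homeomorphic_space_def by (simp add: subtopology_subtopology inf.absorb2) blast
  then show ?thesis
    using orthant_boundary_homeomorphic_Euclidean_space homeomorphic_space_trans homeomorphic_open_ball_space by blast
qed

section \<open>Measures of the pieces of a triangulated space\<close>

context
  fixes K and X :: "'a topology" and \<Phi>
  assumes K: "finite_complex K" and hom: "homeomorphic_map (realization K) X \<Phi>"
begin

lemma subtopology_image:
  assumes "S \<subseteq> polyhedron K"
  shows "pspace S homeomorphic_space subtopology X (\<Phi> ` S)"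
proof -
  have "homeomorphic_map (subtopology (realization K) S) (subtopology X (\<Phi> ` S)) \<Phi>"
  proof (rule homeomorphic_map_subtopologies [OF hom])
    show "\<Phi> ` (topspace (realization K) \<inter> S) = topspace X \<inter> \<Phi> ` S"
      using assms Phi_facts(2) [OF K hom] by auto
  qed
  moreover have "subtopology (realization K) S = pspace S"
    using assms by (simp add: realization_def subtopology_subtopology inf.absorb2)
  ultimately show ?thesis using homeomorphic_map_imp_homeomorphic_space by metis
qed

text \<open>The support of a point outside the costar contains \<sigma>, hence equals it by
  maximality. So the open face is the complement of a closed set.\<close>

lemma maximal_open_face:
  assumes \<sigma>: "\<sigma> \<in> K" and max: "\<And>\<delta>. \<delta> \<in> K \<Longrightarrow> \<sigma> \<subseteq> \<delta> \<Longrightarrow> \<delta> = \<sigma>"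
  shows "open_face \<sigma> = polyhedron K - polyhedron (costar \<sigma> K)"
proof
  show "open_face \<sigma> \<subseteq> polyhedron K - polyhedron (costar \<sigma> K)"
    using z_in_polyhedron [OF K \<sigma>] bary_min_costar(2) [OF K \<sigma>] by blast
  show "polyhedron K - polyhedron (costar \<sigma> K) \<subseteq> open_face \<sigma>"
  proof
    fix x assume x: "x \<in> polyhedron K - polyhedron (costar \<sigma> K)"
    then have "support x \<in> K" "\<sigma> \<subseteq> support x" "\<forall>i. 0 \<le> x i" "sum x (support x) = 1"
      unfolding polyhedron_costar [OF K] using in_polyhedron [OF K, of x] by (auto simp: support_def)
    moreover from this have "support x = \<sigma>" using max by blast
    ultimately show "x \<in> open_face \<sigma>" by (simp add: open_face_def)
  qed
qed

lemma openin_image_maximal_open_face: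
  assumes \<sigma>: "\<sigma> \<in> K" and max: "\<And>\<delta>. \<delta> \<in> K \<Longrightarrow> \<sigma> \<subseteq> \<delta> \<Longrightarrow> \<delta> = \<sigma>"
  shows "openin X (\<Phi> ` open_face \<sigma>)"
proof -
  have "openin (realization K) (polyhedron K - polyhedron (costar \<sigma> K))"
    using closedin_polyhedron_costar [OF K \<sigma>] unfolding closedin_def topspace_realization by blast
  moreover have "open_face \<sigma> = polyhedron K - polyhedron (costar \<sigma> K)"
    by (rule maximal_open_face [OF \<sigma> max])
  ultimately have "openin (realization K) (open_face \<sigma>)" by (simp only:)
  then show ?thesis using homeomorphic_map_openness_eq [OF hom] by blast
qed

lemma open_face_subset_polyhedron: "\<sigma> \<in> K \<Longrightarrow> open_face \<sigma> \<subseteq> polyhedron K"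
  using z_in_polyhedron [OF K] by blast

lemma closedin_image_face_hull:
  assumes \<delta>: "\<delta> \<in> K" shows "closedin X (\<Phi> ` face_hull \<delta>)"
proof -
  have "face_hull \<delta> = (if \<delta> = UNIV then polyhedron K else (\<Inter>i\<in>- \<delta>. {x \<in> topspace (realization K). x i \<in> {0}}))"
  proof -
    have "x \<in> face_hull \<delta>" if x: "x \<in> polyhedron K" "\<forall>i. i \<notin> \<delta> \<longrightarrow> x i = 0" for x
    proof -
      have "support x \<subseteq> \<delta>" using x(2) by (auto simp: support_def)
      then have "sum x \<delta> = sum x (support x)"
        using finite_complexD(2) [OF K \<delta>] by (intro sum.mono_neutral_right) (auto simp: support_def)
      then show ?thesis using x in_polyhedron [OF K, of x] finite_complexD(2) [OF K \<delta>] by (simp add: face_hull_eq)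
    qed
    moreover have "x \<in> polyhedron K" "\<forall>i. i \<notin> \<delta> \<longrightarrow> x i = 0" if "x \<in> face_hull \<delta>" for x
      using that \<delta> finite_complexD(2) [OF K \<delta>] by (blast, simp add: face_hull_eq)
    moreover have "\<delta> \<noteq> UNIV" using finite_complexD(2) [OF K \<delta>] by auto
    ultimately show ?thesis by auto
  qed
  moreover have "closedin (realization K) {x \<in> topspace (realization K). x i \<in> {0}}" for i
    by (rule closedin_continuous_map_preimage [where Y = euclideanreal])
       (simp_all add: realization_def continuous_map_coordinate)
  moreover have "- \<delta> \<noteq> {}" using finite_complexD(2) [OF K \<delta>] infinite_UNIV_nat by (metis double_compl Compl_empty_eq)
  ultimately have "closedin (realization K) (face_hull \<delta>)"
    by (metis (no_types, lifting) closedin_INT closedin_topspace topspace_realization)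
  then show ?thesis using homeomorphic_map_closedness_eq [OF hom] by blast
qed

context
  fixes d :: nat and M :: "'a measure"
  assumes top: "\<And>\<delta>. \<delta> \<in> K \<Longrightarrow> card \<delta> \<le> Suc d"
begin

lemma top_face_maximal:
  assumes "card \<sigma> = Suc d" "\<delta> \<in> K" "\<sigma> \<subseteq> \<delta>" shows "\<delta> = \<sigma>"
  using assms top finite_complexD(2) [OF K] by (metis card_seteq)

lemma top_open_face_manifold:
  assumes \<sigma>: "\<sigma> \<in> K" "card \<sigma> = Suc d"
  shows "\<Phi> ` open_face \<sigma> \<subseteq> manifold_points d X"
proof -
  have op: "openin X (\<Phi> ` open_face \<sigma>)"
    by (rule openin_image_maximal_open_face [OF \<sigma>(1) top_face_maximal [OF \<sigma>(2)]])
  have "subtopology X (\<Phi> ` open_face \<sigma>) homeomorphic_space open_ball_space d"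
    using subtopology_image [OF open_face_subset_polyhedron [OF \<sigma>(1)]]
      open_face_homeomorphic_ball [OF finite_complexD(2) [OF K \<sigma>(1)] \<sigma>(2)]
      homeomorphic_space_sym homeomorphic_space_trans by blast
  then show ?thesis
    unfolding manifold_points_def using op openin_subset [OF op] by blast
qed

context
  assumes borel: "borel_measure_on X M" and fin: "finite_measure M" and diff: "diffuse d X M"
begin

lemma sets_M: "openin X U \<Longrightarrow> U \<in> sets M" "closedin X C \<Longrightarrow> C \<in> sets M" "space M = topspace X"
proof -
  show sp: "space M = topspace X" using borel by (simp add: borel_measure_on_def)
  show op: "U \<in> sets M" if "openin X U" for U using borel that by (auto simp: borel_measure_on_def)
  show "C \<in> sets M" if C: "closedin X C"
  proof -
    have "space M - C \<in> sets M" using op C unfolding sp closedin_def by blast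
    then have "space M - (space M - C) \<in> sets M" by blast
    moreover have "space M - (space M - C) = C" using closedin_subset [OF C] sp by blast
    ultimately show ?thesis by simp
  qed
qed

lemma sets_image_open_face: "\<sigma> \<in> K \<Longrightarrow> \<Phi> ` open_face \<sigma> \<in> sets M"
proof -
  assume \<sigma>: "\<sigma> \<in> K"
  have fs: "finite \<sigma>" using finite_complexD(2) [OF K \<sigma>] .
  have FK: "face_hull \<sigma> \<subseteq> polyhedron K" using \<sigma> by blast
  have "open_face \<sigma> = face_hull \<sigma> - polyhedron (costar \<sigma> K)"
  proof -
    have "x \<in> open_face \<sigma> \<longleftrightarrow> x \<in> face_hull \<sigma> \<and> (\<forall>i\<in>\<sigma>. x i \<noteq> 0)" for x
      using fs by (auto simp: open_face_def face_hull_eq support_def)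
    then show ?thesis unfolding polyhedron_costar [OF K] using FK by blast
  qed
  moreover have "face_hull \<sigma> - polyhedron (costar \<sigma> K) \<subseteq> polyhedron K" "polyhedron (costar \<sigma> K) \<subseteq> polyhedron K"
    using FK polyhedron_costar [OF K] by blast+
  ultimately have "\<Phi> ` open_face \<sigma> = \<Phi> ` face_hull \<sigma> - \<Phi> ` polyhedron (costar \<sigma> K)"
    using inj_on_image_set_diff [OF Phi_facts(3) [OF K hom]] by metis
  moreover have "closedin X (\<Phi> ` polyhedron (costar \<sigma> K))"
    using closedin_polyhedron_costar [OF K \<sigma>] homeomorphic_map_closedness_eq [OF hom] by blast
  ultimately show ?thesis using sets_M(2) closedin_image_face_hull [OF \<sigma>] by simp
qed

text \<open>Every boundary point has some vertex of positive weight, so the boundary is the union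
  over the vertices \<open>v\<close> of the open balls where \<open>0 < x v\<close>. For
  \<open>d = 0\<close> it is empty.\<close>

lemma null_face_boundary:
  assumes \<delta>: "\<delta> \<in> K" "card \<delta> = Suc d"
  shows "\<Phi> ` (face_hull \<delta> - open_face \<delta>) \<in> null_sets M"
proof (cases d)
  case 0
  have fd: "finite \<delta>" using finite_complexD(2) [OF K \<delta>(1)] .
  obtain v where v: "\<delta> = {v}" using \<delta>(2) 0 by (metis One_nat_def card_1_singletonE)
  have "face_hull \<delta> \<subseteq> open_face \<delta>" unfolding v
    by (auto simp: face_hull_eq open_face_def support_def)
  then have e: "face_hull \<delta> - open_face \<delta> = {}" by blast
  show ?thesis unfolding e by simp
next
  case (Suc m)
  have fd: "finite \<delta>" using finite_complexD(2) [OF K \<delta>(1)] .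
  let ?B = "\<lambda>v. {x \<in> face_hull \<delta>. 0 < x v \<and> (\<exists>w\<in>\<delta>. x w = 0)}"
  have BK: "?B v \<subseteq> polyhedron K" for v using \<delta>(1) by blast
  have null: "\<Phi> ` ?B v \<in> null_sets M" if v: "v \<in> \<delta>" for v
  proof -
    have "pspace (?B v) homeomorphic_space open_ball_space m"
      by (rule face_boundary_star_homeomorphic_ball [OF fd _ v]) (simp only: \<delta>(2) Suc)
    from homeomorphic_space_trans [OF homeomorphic_space_sym [THEN iffD1, OF subtopology_image [OF BK]] this]
    have "subtopology X (\<Phi> ` ?B v) homeomorphic_space open_ball_space (d - 1)" by (simp only: Suc diff_Suc_1)
    moreover have "\<Phi> ` ?B v \<subseteq> topspace X" using BK [of v] Phi_facts(2) [OF K hom] by blast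
    ultimately have "emeasure M (\<Phi> ` ?B v) = 0" using diff Suc unfolding diffuse_def by blast
    \<comment> \<open>\<open>emeasure\<close> is 0 on non-measurable sets by convention, so a null
      set requires measurability as well; the piece is a Boolean combination of images of closed
      sets.\<close>
    moreover have "\<Phi> ` ?B v \<in> sets M"
    proof -
      have c1: "closedin (realization K) {x \<in> topspace (realization K). x i \<in> {0}}" for i
        by (rule closedin_continuous_map_preimage [where Y = euclideanreal])
           (simp_all add: realization_def continuous_map_coordinate)
      have s1: "\<Phi> ` {x \<in> topspace (realization K). x i \<in> {0}} \<in> sets M" for i
        using c1 homeomorphic_map_closedness_eq [OF hom] sets_M(2) by blast
      have e: "?B v = (\<Union>w\<in>\<delta>. {x \<in> topspace (realization K). x w \<in> {0}}) \<inter> face_hull \<delta> - {x \<in> topspace (realization K). x v \<in> {0}}"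
        (is "_ = ?Z \<inter> _ - ?V")
      proof -
        have pos: "0 < x v \<longleftrightarrow> x v \<noteq> 0" if "x \<in> face_hull \<delta>" for x
        proof -
          have "0 \<le> x v" using that fd by (simp add: face_hull_eq)
          then show ?thesis by (auto simp: order_less_le)
        qed
        have "face_hull \<delta> \<subseteq> topspace (realization K)" using \<delta>(1) by (simp only: topspace_realization) blast
        then show ?thesis using pos by blast
      qed
      have inj: "inj_on \<Phi> (polyhedron K)" by (rule Phi_facts(3) [OF K hom])
      have sub: "?Z \<subseteq> polyhedron K" "face_hull \<delta> \<subseteq> polyhedron K" "?V \<subseteq> polyhedron K" "?Z \<inter> face_hull \<delta> \<subseteq> polyhedron K"
        using \<delta>(1) by auto
      have e': "\<Phi> ` ?B v = \<Phi> ` ?Z \<inter> \<Phi> ` face_hull \<delta> - \<Phi> ` ?V"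
        unfolding e using inj_on_image_set_diff [OF inj, of "?Z \<inter> face_hull \<delta>" ?V] inj_on_image_Int [OF inj sub(1,2)] sub by auto
      have "\<Phi> ` ?Z = (\<Union>w\<in>\<delta>. \<Phi> ` {x \<in> topspace (realization K). x w \<in> {0}})" by blast
      also have "\<dots> \<in> sets M" using fd s1 by (intro sets.finite_UN) auto
      finally show ?thesis unfolding e' using s1 sets_M(2) [OF closedin_image_face_hull [OF \<delta>(1)]] by blast
    qed
    ultimately show ?thesis by blast
  qed
  have "face_hull \<delta> - open_face \<delta> = (\<Union>v\<in>\<delta>. ?B v)"
  proof -
    have "x \<in> (\<Union>v\<in>\<delta>. ?B v)" if x: "x \<in> face_hull \<delta>" "x \<notin> open_face \<delta>" for x
    proof -
      have x': "\<forall>i. 0 \<le> x i" "\<forall>i. i \<notin> \<delta> \<longrightarrow> x i = 0" "sum x \<delta> = 1" using x(1) fd by (simp_all add: face_hull_eq)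
      have "\<exists>w\<in>\<delta>. x w = 0"
      proof (rule ccontr)
        assume "\<not> (\<exists>w\<in>\<delta>. x w = 0)"
        then have "support x = \<delta>" using x'(2) by (auto simp: support_def)
        then show False using x(2) x' by (simp add: open_face_def)
      qed
      moreover have "\<exists>v\<in>\<delta>. 0 < x v"
      proof (rule ccontr)
        assume "\<not> (\<exists>v\<in>\<delta>. 0 < x v)"
        then have "sum x \<delta> = 0" using x'(1) by (intro sum.neutral) (meson antisym not_less)
        then show False using x'(3) by simp
      qed
      ultimately show ?thesis using x(1) by blast
    qed
    moreover have "x \<notin> open_face \<delta>" if "x \<in> ?B v" for x v
      using that by (auto simp: open_face_def support_def)
    ultimately show ?thesis by blast
  qed
  then have "\<Phi> ` (face_hull \<delta> - open_face \<delta>) = (\<Union>v\<in>\<delta>. \<Phi> ` ?B v)" by blast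
  also have "\<dots> \<in> null_sets M" using fd null by (intro null_sets.finite_UN) auto
  finally show ?thesis .
qed

text \<open>The sign \<epsilon> is common to all factors, and their number is even.\<close>

lemma prod_list_signs:
  assumes "even (length cs)" "\<epsilon> \<in> {1, -1}" "\<And>c. c \<in> set cs \<Longrightarrow> f c = \<epsilon> * (g c :: int)"
  shows "(\<Prod>c\<leftarrow>cs. real_of_int (f c)) = (\<Prod>c\<leftarrow>cs. real_of_int (g c))"
proof -
  have "(\<Prod>c\<leftarrow>cs. real_of_int (f c)) = real_of_int \<epsilon> ^ length cs * (\<Prod>c\<leftarrow>cs. real_of_int (g c))"
    using assms(3) by (induction cs) (simp_all add: mult_ac)
  moreover have "real_of_int \<epsilon> ^ length cs = 1" using assms(1,2) by auto
  ultimately show ?thesis by simp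
qed

text \<open>The integrand is constant on each open face intersected with the manifold points, hence
  a finite linear combination of indicator functions. Only the facets contribute, and there the
  constants are the products of the coordinates.\<close>

theorem cycle_form_coordinates:
  assumes fs: "lists_faces K (Suc d) fs" and even: "even (length cs)" "cs \<noteq> []"
    and \<kappa>: "\<And>c. c \<in> set cs \<Longrightarrow> scycle K d (face_chain fs (\<kappa> c))"
      "\<And>c. c \<in> set cs \<Longrightarrow> c = simplicial_class d K X \<Phi> (face_chain fs (\<kappa> c))"
  shows "cycle_form d X M cs = (\<Sum>j<length fs. (\<Prod>c\<leftarrow>cs. real_of_int (\<kappa> c j)) * measure M (face_image \<Phi> (fs ! j)))"
proof -
  let ?F = "\<lambda>z. \<Prod>c\<leftarrow>cs. real_of_int (local_multiplicity d X c z)"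
  let ?P = "\<lambda>\<sigma>. \<Phi> ` open_face \<sigma> \<inter> manifold_points d X"
  let ?s = "\<lambda>\<sigma>. \<Prod>c\<leftarrow>cs. real_of_int (star_multiplicity d K \<sigma> (face_chain fs (\<kappa> c)))"
  have finK: "finite K" by (rule finite_complexD(1) [OF K])
  have F_piece: "?F z = ?s \<sigma>" if \<sigma>: "\<sigma> \<in> K" and z: "z \<in> ?P \<sigma>" for \<sigma> z
  proof -
    obtain x where x: "x \<in> open_face \<sigma>" "z = \<Phi> x" using z by blast
    then have mfd: "\<Phi> x \<in> manifold_points d X" using z by blast
    obtain \<epsilon> :: int where \<epsilon>: "\<epsilon> \<in> {1, -1}" "\<And>a. scycle K d a \<Longrightarrow>
      local_multiplicity d X (simplicial_class d K X \<Phi> a) (\<Phi> x) = \<epsilon> * star_multiplicity d K \<sigma> a"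
      using local_multiplicity_eq_star_multiplicity [OF K hom \<sigma> x(1) mfd] by blast
    show ?thesis
      by (rule prod_list_signs [OF even(1) \<epsilon>(1)]) (use \<epsilon>(2) \<kappa> x(2) in metis)
  qed
  \<comment> \<open>An empty product would be 1; with at least one factor the convention for
    \<open>local_multiplicity\<close> off the manifold points gives 0.\<close>
  have F_out: "?F z = 0" if "z \<notin> manifold_points d X" for z
    using that even(2) by (cases cs) (simp_all add: local_multiplicity_def)
  have disj: "\<sigma> = \<sigma>'" if P: "z \<in> ?P \<sigma>" "z \<in> ?P \<sigma>'" "\<sigma> \<in> K" "\<sigma>' \<in> K" for \<sigma> \<sigma>' z
  proof -
    obtain x x' where x: "x \<in> open_face \<sigma>" "z = \<Phi> x" "x' \<in> open_face \<sigma>'" "z = \<Phi> x'" using P by blast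
    then have "x = x'" using Phi_facts(3) [OF K hom] z_in_polyhedron [OF K] P(3,4) by (metis inj_onD)
    then show ?thesis using x by (simp add: open_face_def)
  qed
  have F_eq: "?F z = (\<Sum>\<sigma>\<in>K. ?s \<sigma> * indicator (?P \<sigma>) z)" if z: "z \<in> space M" for z
  proof (cases "z \<in> manifold_points d X")
    case True
    have "z \<in> \<Phi> ` polyhedron K" using z sets_M(3) Phi_facts(2) [OF K hom] by simp
    then obtain \<sigma> where \<sigma>: "\<sigma> \<in> K" "z \<in> ?P \<sigma>" using True unfolding polyhedron_eq_Union_open_face [OF K] by blast
    have "(\<Sum>\<sigma>'\<in>K. ?s \<sigma>' * indicator (?P \<sigma>') z) = (\<Sum>\<sigma>'\<in>K. if \<sigma>' = \<sigma> then ?s \<sigma> else 0)"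
    proof (intro sum.cong refl)
      fix \<sigma>' assume "\<sigma>' \<in> K"
      then show "?s \<sigma>' * indicator (?P \<sigma>') z = (if \<sigma>' = \<sigma> then ?s \<sigma> else 0)"
        using disj [OF \<sigma>(2) _ \<sigma>(1)] \<sigma>(2) by (cases "z \<in> ?P \<sigma>'") (auto simp: indicator_def)
    qed
    also have "\<dots> = ?s \<sigma>" using finK \<sigma>(1) by simp
    finally show ?thesis using F_piece [OF \<sigma>] by simp
  next
    case False
    then show ?thesis using F_out [OF False] by simp
  qed
  have P_sets: "?P \<sigma> \<in> sets M" if "\<sigma> \<in> K" for \<sigma>
    using sets_image_open_face [OF that] sets_M(1) [OF openin_manifold_points] by blast
  \<comment> \<open>Finiteness of the measure makes the indicator functions integrable, so the
    integral may be split.\<close>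
  have lt: "emeasure M A < \<infinity>" for A using finite_measure.emeasure_finite [OF fin, of A] by (simp add: less_top)
  have "cycle_form d X M cs = (LINT z|M. (\<Sum>\<sigma>\<in>K. ?s \<sigma> * indicator (?P \<sigma>) z))"
    unfolding cycle_form_def by (rule Bochner_Integration.integral_cong [OF refl F_eq])
  also have "\<dots> = (\<Sum>\<sigma>\<in>K. (LINT z|M. ?s \<sigma> * indicator (?P \<sigma>) z))"
    by (rule Bochner_Integration.integral_sum) (use P_sets lt in \<open>simp add: integrable_real_indicator\<close>)
  also have "\<dots> = (\<Sum>\<sigma>\<in>K. ?s \<sigma> * measure M (?P \<sigma>))"
  proof (intro sum.cong refl)
    fix \<sigma> assume "\<sigma> \<in> K"
    then have "?P \<sigma> \<inter> space M = ?P \<sigma>" using sets.sets_into_space [OF P_sets] by blast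
    then show "(LINT z|M. ?s \<sigma> * indicator (?P \<sigma>) z) = ?s \<sigma> * measure M (?P \<sigma>)" by simp
  qed
  also have "\<dots> = (\<Sum>\<sigma>\<in>set fs. ?s \<sigma> * measure M (?P \<sigma>))"
  proof (rule sum.mono_neutral_right [OF finK])
    show "set fs \<subseteq> K" using fs by (auto simp: lists_faces_def)
    show "\<forall>\<sigma>\<in>K - set fs. ?s \<sigma> * measure M (?P \<sigma>) = 0"
    proof
      fix \<sigma> assume "\<sigma> \<in> K - set fs"
      then have \<sigma>: "\<sigma> \<in> K" "card \<sigma> \<noteq> Suc d" using fs unfolding lists_faces_def by blast+
      show "?s \<sigma> * measure M (?P \<sigma>) = 0"
      \<comment> \<open>An open face of lower dimension that belongs to a \<open>d\<close>-face lies
        in the null boundary of the latter; if it belongs to none, the multiplicities on it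
        vanish.\<close>
      proof (cases "\<exists>\<delta>\<in>K. card \<delta> = Suc d \<and> \<sigma> \<subseteq> \<delta>")
        case True
        then obtain \<delta> where \<delta>: "\<delta> \<in> K" "card \<delta> = Suc d" "\<sigma> \<subseteq> \<delta>" by blast
        have "\<sigma> \<in> faces \<delta>" using \<delta>(3) finite_complexD(3) [OF K \<sigma>(1)] by (simp add: in_faces)
        then have "face_hull \<sigma> \<subseteq> polyhedron (faces \<delta>)" by blast
        then have "open_face \<sigma> \<subseteq> face_hull \<delta>"
          using polyhedron_faces [OF finite_complexD(2,3) [OF K \<delta>(1)]]
            open_face_subset_face_hull [OF finite_complexD(2) [OF K \<sigma>(1)]] by blast
        moreover have "open_face \<sigma> \<inter> open_face \<delta> = {}"
          using \<sigma>(2) \<delta>(2) unfolding open_face_def by auto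
        ultimately have "?P \<sigma> \<subseteq> \<Phi> ` (face_hull \<delta> - open_face \<delta>)" by blast
        then have "?P \<sigma> \<in> null_sets M" using null_sets_subset [OF null_face_boundary [OF \<delta>(1,2)] P_sets [OF \<sigma>(1)]] by blast
        then show ?thesis by (simp add: measure_eq_0_null_sets)
      next
        case no: False
        show ?thesis
        proof (cases "?P \<sigma> = {}")
          case True then show ?thesis by simp
        next
          case False
          then obtain x where x: "x \<in> open_face \<sigma>" "\<Phi> x \<in> manifold_points d X" by blast
          have "star_multiplicity d K \<sigma> (face_chain fs (\<kappa> c)) = 0" if "c \<in> set cs" for c
            using star_multiplicity_eq_0 [OF K hom \<sigma>(1) x _ \<kappa>(1) [OF that]] no by blast
          then have "?s \<sigma> = 0" using even(2) by (cases cs) simp_all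
          then show ?thesis by simp
        qed
      qed
    qed
  qed
  also have "\<dots> = (\<Sum>j<length fs. ?s (fs ! j) * measure M (?P (fs ! j)))"
    using fs by (intro sum.reindex_bij_betw [symmetric] bij_betw_nth) (simp_all add: lists_faces_def)
  also have "\<dots> = (\<Sum>j<length fs. (\<Prod>c\<leftarrow>cs. real_of_int (\<kappa> c j)) * measure M (face_image \<Phi> (fs ! j)))"
  proof (intro sum.cong refl)
    fix j assume "j \<in> {..<length fs}"
    then have j: "j < length fs" by simp
    note \<sigma> = nth_face [OF K fs j]
    have sub: "\<Phi> ` open_face (fs ! j) \<subseteq> manifold_points d X" by (rule top_open_face_manifold [OF \<sigma>(1,2)])
    obtain x where x: "x \<in> open_face (fs ! j)"
      using barycenter_in_open_face [OF finite_complexD(2,3) [OF K \<sigma>(1)]] by blast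
    then have mfd: "\<Phi> x \<in> manifold_points d X" using sub by blast
    obtain \<epsilon> :: int where \<epsilon>: "\<epsilon> \<in> {1, -1}" "\<And>a. scycle K d a \<Longrightarrow>
       star_multiplicity d K (fs ! j) a = \<epsilon> * Poly_Mapping.lookup a (vertex_simplex (fs ! j))"
      using star_multiplicity_top_face [OF K hom \<sigma>(1) x mfd top \<sigma>(2)] by blast
    have s: "?s (fs ! j) = (\<Prod>c\<leftarrow>cs. real_of_int (\<kappa> c j))"
    proof (rule prod_list_signs [OF even(1) \<epsilon>(1)])
      fix c assume "c \<in> set cs"
      from \<epsilon>(2) [OF \<kappa>(1) [OF this]] show "star_multiplicity d K (fs ! j) (face_chain fs (\<kappa> c)) = \<epsilon> * \<kappa> c j"
        by (simp only: lookup_face_chain [OF K fs j])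
    qed
    have P: "?P (fs ! j) = \<Phi> ` open_face (fs ! j)" using sub by blast
    let ?N = "\<Phi> ` (face_hull (fs ! j) - open_face (fs ! j))"
    \<comment> \<open>\<open>face_image\<close> is the closed facet, while the integral produces the
      open one; they differ by the null boundary.\<close>
    have "face_image \<Phi> (fs ! j) = \<Phi> ` open_face (fs ! j) \<union> ?N"
      unfolding face_image_def using open_face_subset_face_hull [OF \<sigma>(3)] by blast
    then have "measure M (face_image \<Phi> (fs ! j)) = measure M (\<Phi> ` open_face (fs ! j))"
      using measure_Un_null_set [OF sets_image_open_face [OF \<sigma>(1)] null_face_boundary [OF \<sigma>(1,2)]] by simp
    then show "?s (fs ! j) * measure M (?P (fs ! j)) = (\<Prod>c\<leftarrow>cs. real_of_int (\<kappa> c j)) * measure M (face_image \<Phi> (fs ! j))"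
      using s P by simp
  qed
  finally show ?thesis .
qed

end

end

end

subsection \<open>Dimension\<close>

lemma compact_space_closed_ball_space: "compact_space (closed_ball_space n)"
proof -
  let ?s = "\<lambda>x::nat \<Rightarrow> real. \<Sum>i<n. (x i)\<^sup>2"
  let ?B = "{x::nat \<Rightarrow> real. (\<forall>i\<ge>n. x i = 0) \<and> ?s x \<le> 1}"
  have B: "closed_ball_space n = subtopology (powertop_real UNIV) ?B"
    unfolding closed_ball_space_def Euclidean_space_def subtopology_subtopology by (rule arg_cong [of _ _ "subtopology _"]) blast
  have cs: "continuous_map (powertop_real UNIV) euclideanreal ?s"
    by (intro continuous_map_sum continuous_map_real_pow continuous_map_product_projection) simp_all
  have e: "?B = topspace (Euclidean_space n) \<inter> {x \<in> topspace (powertop_real UNIV). ?s x \<in> {..1}}"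
    by (auto simp: topspace_Euclidean_space)
  have "closedin (powertop_real UNIV) {x \<in> topspace (powertop_real UNIV). ?s x \<in> {..1}}"
    by (rule closedin_continuous_map_preimage [OF cs]) simp
  then have cl: "closedin (powertop_real UNIV) ?B"
    unfolding e by (rule closedin_Int [OF closedin_Euclidean_space])
  have sub: "?B \<subseteq> PiE UNIV (\<lambda>i. {-1..1})"
  proof
    fix x assume x: "x \<in> ?B"
    have "x i \<in> {-1..1}" for i
    proof (cases "i < n")
      case True
      have "(x i)\<^sup>2 \<le> ?s x" using True by (intro member_le_sum) auto
      also have "\<dots> \<le> 1" using x by simp
      finally have "\<bar>x i\<bar> \<le> 1" by (simp add: abs_square_le_1)
      then show ?thesis by auto
    qed (use x in auto)
    then show "x \<in> PiE UNIV (\<lambda>i. {-1..1})" by auto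
  qed
  have "compactin (powertop_real UNIV) (PiE UNIV (\<lambda>i::nat. {-1..1::real}))"
    by (simp add: compactin_PiE)
  then have "compactin (powertop_real UNIV) ?B" by (rule closed_compactin [OF _ sub cl])
  then show ?thesis unfolding B by (rule compact_space_subtopology)
qed

lemma finite_CW_structureD:
  assumes "finite_CW_structure X \<C>"
  shows "finite \<C>" and "topspace X = (\<Union>c\<in>\<C>. open_cell c)"
    and "c \<in> \<C> \<Longrightarrow> c' \<in> \<C> \<Longrightarrow> c \<noteq> c' \<Longrightarrow> open_cell c \<inter> open_cell c' = {}"
proof -
  note d = assms [unfolded finite_CW_structure_def]
  show "finite \<C>" using d by (elim conjE)
  show "topspace X = (\<Union>c\<in>\<C>. open_cell c)" using d by (elim conjE)
  show "c \<in> \<C> \<Longrightarrow> c' \<in> \<C> \<Longrightarrow> c \<noteq> c' \<Longrightarrow> open_cell c \<inter> open_cell c' = {}"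
    using d by (elim conjE) (simp add: disjnt_def)
qed

text \<open>The closed ball is compact, so its image is closed in the Hausdorff space, and the image
  consists of the open cell and points of cells of smaller dimension.\<close>

lemma CW_cell_image:
  assumes CW: "finite_CW_structure X \<C>" and c: "c \<in> \<C>"
  shows "closedin X (snd c ` topspace (closed_ball_space (fst c)))"
    and "open_cell c \<subseteq> snd c ` topspace (closed_ball_space (fst c))"
    and "snd c ` topspace (closed_ball_space (fst c)) \<subseteq> open_cell c \<union> (\<Union>c'\<in>{c' \<in> \<C>. fst c' < fst c}. open_cell c')"
    and "subtopology X (open_cell c) homeomorphic_space open_ball_space (fst c)"
proof -
  obtain n \<phi> where nf: "c = (n, \<phi>)" by fastforce
  have facts: "continuous_map (closed_ball_space n) X \<phi>"
    "homeomorphic_map (open_ball_space n) (subtopology X (open_cell (n, \<phi>))) \<phi>"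
    "\<phi> ` (topspace (closed_ball_space n) - topspace (open_ball_space n)) \<subseteq> (\<Union>c\<in>{c \<in> \<C>. fst c < n}. open_cell c)"
    using CW c unfolding finite_CW_structure_def nf by blast+
  have haus: "Hausdorff_space X" using CW by (simp add: finite_CW_structure_def)
  have "compactin X (\<phi> ` topspace (closed_ball_space n))"
    by (rule image_compactin [OF _ facts(1)]) (use compact_space_closed_ball_space in \<open>simp add: compact_space_def\<close>)
  then show "closedin X (snd c ` topspace (closed_ball_space (fst c)))"
    unfolding nf using compactin_imp_closedin [OF haus] by simp
  have "topspace (open_ball_space n) \<subseteq> topspace (closed_ball_space n)"
    by (auto simp: open_ball_space_def closed_ball_space_def)
  then show "open_cell c \<subseteq> snd c ` topspace (closed_ball_space (fst c))"
    unfolding nf open_cell_def by auto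
  show "snd c ` topspace (closed_ball_space (fst c)) \<subseteq> open_cell c \<union> (\<Union>c'\<in>{c' \<in> \<C>. fst c' < fst c}. open_cell c')"
    using facts(3) unfolding nf open_cell_def fst_conv snd_conv by blast
  show "subtopology X (open_cell c) homeomorphic_space open_ball_space (fst c)"
    using homeomorphic_map_imp_homeomorphic_space [OF facts(2)] homeomorphic_space_sym unfolding nf by auto
qed

text \<open>The image of a closed ball meets, besides its own open cell, only cells of smaller
  dimension. As \<open>W\<close> meets no cell of dimension above \<open>fst c\<close>, removing the
  closed images of the other cells of dimension at most \<open>fst c\<close> leaves exactly the part
  of \<open>W\<close> in \<open>c\<close>, which is therefore open.\<close>

lemma CW_maximal_cell_manifold:
  assumes CW: "finite_CW_structure X \<C>" and W: "openin X W" and c: "c \<in> \<C>"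
    and max: "\<And>c'. c' \<in> \<C> \<Longrightarrow> W \<inter> open_cell c' \<noteq> {} \<Longrightarrow> fst c' \<le> fst c"
  shows "openin X (W \<inter> open_cell c)" and "W \<inter> open_cell c \<subseteq> manifold_points (fst c) X"
proof -
  let ?C = "{c' \<in> \<C>. c' \<noteq> c \<and> fst c' \<le> fst c}"
  let ?D = "\<lambda>c. snd c ` topspace (closed_ball_space (fst c))"
  note fin = finite_CW_structureD(1) [OF CW] and cover = finite_CW_structureD(2) [OF CW]
    and disj = finite_CW_structureD(3) [OF CW _ c]
  have eq: "W \<inter> open_cell c = W - (\<Union>c'\<in>?C. ?D c')"
  proof
    show "W \<inter> open_cell c \<subseteq> W - (\<Union>c'\<in>?C. ?D c')"
    proof (intro subsetI DiffI)
      fix x assume x: "x \<in> W \<inter> open_cell c"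
      then show "x \<in> W" by blast
      show "x \<notin> (\<Union>c'\<in>?C. ?D c')"
      proof
        assume "x \<in> (\<Union>c'\<in>?C. ?D c')"
        then obtain c' where c': "c' \<in> \<C>" "c' \<noteq> c" "fst c' \<le> fst c" "x \<in> ?D c'" by blast
        then consider "x \<in> open_cell c'" | c'' where "c'' \<in> \<C>" "fst c'' < fst c'" "x \<in> open_cell c''"
          using CW_cell_image(3) [OF CW c'(1)] by blast
        then show False
        proof cases
          case 1 then show False using disj [OF c'(1,2)] x by blast
        next
          case 2
          then have "c'' \<noteq> c" using c'(3) by auto
          then show False using disj [OF 2(1)] 2(3) x by blast
        qed
      qed
    qed
    show "W - (\<Union>c'\<in>?C. ?D c') \<subseteq> W \<inter> open_cell c"
    proof
      fix x assume x: "x \<in> W - (\<Union>c'\<in>?C. ?D c')"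
      then have "x \<in> topspace X" using openin_subset [OF W] by blast
      then obtain c' where c': "c' \<in> \<C>" "x \<in> open_cell c'" using cover by blast
      then have "fst c' \<le> fst c" using max x by blast
      moreover have "x \<in> ?D c'" using CW_cell_image(2) [OF CW c'(1)] c'(2) by blast
      ultimately have "c' = c" using x c'(1) by blast
      then show "x \<in> W \<inter> open_cell c" using x c'(2) by blast
    qed
  qed
  have "closedin X (\<Union>c'\<in>?C. ?D c')"
    by (rule closedin_Union) (use fin CW_cell_image(1) [OF CW] in auto)
  then show op: "openin X (W \<inter> open_cell c)" unfolding eq using W by (rule openin_diff [rotated])
  have "open_cell c \<subseteq> topspace X" using cover c by blast
  then show "W \<inter> open_cell c \<subseteq> manifold_points (fst c) X"
    unfolding manifold_points_def using op CW_cell_image(4) [OF CW c] by blast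
qed

text \<open>The simplicial counterpart: a face whose open face meets \<open>W\<close> and which
  contains \<sigma> has no more vertices than \<sigma>, so inside \<open>W\<close> the open face is
  the complement of the costar.\<close>

lemma maximal_face_manifold:
  assumes K: "finite_complex K" and hom: "homeomorphic_map (realization K) X \<Phi>" and W: "openin X W" and \<sigma>: "\<sigma> \<in> K"
    and max: "\<And>\<delta>. \<delta> \<in> K \<Longrightarrow> W \<inter> \<Phi> ` open_face \<delta> \<noteq> {} \<Longrightarrow> card \<delta> \<le> card \<sigma>"
  shows "W \<inter> \<Phi> ` open_face \<sigma> \<subseteq> manifold_points (card \<sigma> - 1) X"
proof -
  have sub: "open_face \<sigma> \<subseteq> polyhedron K" using z_in_polyhedron [OF K \<sigma>] by blast
  have eq: "W \<inter> \<Phi> ` open_face \<sigma> = W - \<Phi> ` polyhedron (costar \<sigma> K)"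
  proof
    show "W \<inter> \<Phi> ` open_face \<sigma> \<subseteq> W - \<Phi> ` polyhedron (costar \<sigma> K)"
    proof
      fix y assume y: "y \<in> W \<inter> \<Phi> ` open_face \<sigma>"
      then obtain x where x: "x \<in> open_face \<sigma>" "y = \<Phi> x" by blast
      have "y \<notin> \<Phi> ` polyhedron (costar \<sigma> K)"
      proof
        assume "y \<in> \<Phi> ` polyhedron (costar \<sigma> K)"
        then obtain x' where x': "x' \<in> polyhedron (costar \<sigma> K)" "y = \<Phi> x'" by blast
        have "x' = x"
          using Phi_facts(3) [OF K hom] x x' sub bary_min_costar(1) [OF K \<sigma> x(1) x'(1)] by (metis inj_onD subsetD)
        then show False using bary_min_costar(2) [OF K \<sigma> x(1) x'(1)] by blast
      qed
      then show "y \<in> W - \<Phi> ` polyhedron (costar \<sigma> K)" using y by blast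
    qed
    show "W - \<Phi> ` polyhedron (costar \<sigma> K) \<subseteq> W \<inter> \<Phi> ` open_face \<sigma>"
    proof
      fix y assume y: "y \<in> W - \<Phi> ` polyhedron (costar \<sigma> K)"
      then have "y \<in> \<Phi> ` polyhedron K" using openin_subset [OF W] Phi_facts(2) [OF K hom] by blast
      then obtain x where x: "x \<in> polyhedron K" "y = \<Phi> x" by blast
      have xK: "support x \<in> K" "x \<in> open_face (support x)"
        using x(1) in_polyhedron [OF K, of x] by (simp_all add: open_face_def)
      have "x \<notin> polyhedron (costar \<sigma> K)" using y x(2) by blast
      then have sup: "\<sigma> \<subseteq> support x" unfolding polyhedron_costar [OF K] using x(1) by (auto simp: support_def)
      have "card (support x) \<le> card \<sigma>" by (rule max [OF xK(1)]) (use y x(2) xK(2) in blast)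
      then have "\<sigma> = support x" using sup finite_complexD(2) [OF K xK(1)] by (metis card_seteq)
      then show "y \<in> W \<inter> \<Phi> ` open_face \<sigma>" using y x(2) xK(2) by blast
    qed
  qed
  have "closedin X (\<Phi> ` polyhedron (costar \<sigma> K))"
    using closedin_polyhedron_costar [OF K \<sigma>] homeomorphic_map_closedness_eq [OF hom] by blast
  then have op: "openin X (W \<inter> \<Phi> ` open_face \<sigma>)" unfolding eq by (rule openin_diff [OF W])
  have "card \<sigma> = Suc (card \<sigma> - 1)" using finite_complexD(4) [OF K \<sigma>] by simp
  then have "pspace (open_face \<sigma>) homeomorphic_space open_ball_space (card \<sigma> - 1)"
    by (rule open_face_homeomorphic_ball [OF finite_complexD(2) [OF K \<sigma>]])
  from homeomorphic_space_trans [OF homeomorphic_space_sym [THEN iffD1, OF subtopology_image [OF K hom sub]] this]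
  have ball: "subtopology X (\<Phi> ` open_face \<sigma>) homeomorphic_space open_ball_space (card \<sigma> - 1)" .
  have "\<Phi> ` open_face \<sigma> \<subseteq> topspace X" using sub Phi_facts(2) [OF K hom] by blast
  then show ?thesis unfolding manifold_points_def using op ball by blast
qed

lemma complex_dim_bounds:
  assumes K: "finite_complex K" and ne: "K \<noteq> {}"
  shows "\<And>\<delta>. \<delta> \<in> K \<Longrightarrow> card \<delta> \<le> Suc (complex_dim K)" and "\<exists>\<delta>\<in>K. card \<delta> = Suc (complex_dim K)"
proof -
  have fin: "finite (card ` K)" "card ` K \<noteq> {}" using finite_complexD(1) [OF K] ne by simp_all
  then have "Max (card ` K) \<in> card ` K" by (rule Max_in)
  then obtain \<tau> where \<tau>: "\<tau> \<in> K" "card \<tau> = Max (card ` K)" by auto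
  then have c: "card \<tau> = Suc (complex_dim K)" using finite_complexD(4) [OF K \<tau>(1)] by (simp add: complex_dim_def)
  with \<tau>(1) show "\<exists>\<delta>\<in>K. card \<delta> = Suc (complex_dim K)" by blast
  show "card \<delta> \<le> Suc (complex_dim K)" if "\<delta> \<in> K" for \<delta>
    using fin(1) that \<tau>(2) unfolding c [symmetric] by simp
qed

text \<open>Cells and faces may intersect arbitrarily, so the dimensions are compared at single
  points. Inside an open top cell, a face of greatest dimension meeting it is open, whence
  \<open>d \<le> complex_dim K\<close>; inside an open facet, a cell of greatest dimension meeting
  it is open, which gives the converse. Both times a point has two manifold dimensions, which must
  agree.\<close>

theorem complex_dim_eq_CW_dim:
  assumes CW: "finite_CW_complex d X" and K: "finite_complex K" and hom: "homeomorphic_map (realization K) X \<Phi>"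
  shows "K \<noteq> {}" and "complex_dim K = d"
proof -
  obtain \<C> c0 where str: "finite_CW_structure X \<C>" and c0: "c0 \<in> \<C>" "fst c0 = d" and le: "\<And>c. c \<in> \<C> \<Longrightarrow> fst c \<le> d"
    using CW unfolding finite_CW_complex_def by blast
  note finC = finite_CW_structureD(1) [OF str] and cover = finite_CW_structureD(2) [OF str]
  note haus = Phi_facts(4) [OF K hom]
  have pick: "\<exists>a\<in>A. P a \<and> (\<forall>b\<in>A. P b \<longrightarrow> f b \<le> f a)" if "finite A" "a0 \<in> A" "P a0" for A :: "'c set" and P a0 and f :: "'c \<Rightarrow> nat"
  proof -
    have "finite (f ` {a \<in> A. P a})" "f ` {a \<in> A. P a} \<noteq> {}" using that by auto
    then have "Max (f ` {a \<in> A. P a}) \<in> f ` {a \<in> A. P a}" by (rule Max_in)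
    then obtain a where a: "a \<in> A" "P a" "f a = Max (f ` {a \<in> A. P a})" by auto
    have "f b \<le> f a" if "b \<in> A" "P b" for b unfolding a(3) using that \<open>finite A\<close> by (intro Max_ge) auto
    with a show ?thesis by blast
  qed
  have zero: "(\<lambda>i. 0) \<in> topspace (open_ball_space d)" by (simp add: open_ball_space_def topspace_Euclidean_space)
  then have ne: "open_cell c0 \<noteq> {}" using c0(2) by (auto simp: open_cell_def)
  have c0X: "open_cell c0 \<subseteq> topspace X" using cover c0 by blast
  have V: "openin X (topspace X \<inter> open_cell c0)" "topspace X \<inter> open_cell c0 \<subseteq> manifold_points d X"
    using CW_maximal_cell_manifold [OF str openin_topspace c0(1)] le c0(2) by auto
  let ?V = "topspace X \<inter> open_cell c0"
  obtain y where y: "y \<in> ?V" using ne c0X by blast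
  then have "y \<in> \<Phi> ` polyhedron K" using Phi_facts(2) [OF K hom] by blast
  then obtain \<sigma>0 where \<sigma>0: "\<sigma>0 \<in> K" "?V \<inter> \<Phi> ` open_face \<sigma>0 \<noteq> {}"
    using y unfolding polyhedron_eq_Union_open_face [OF K] by blast
  then show neK: "K \<noteq> {}" by blast
  obtain \<sigma> where \<sigma>: "\<sigma> \<in> K" "?V \<inter> \<Phi> ` open_face \<sigma> \<noteq> {}"
      and \<sigma>max: "\<And>\<delta>. \<delta> \<in> K \<Longrightarrow> ?V \<inter> \<Phi> ` open_face \<delta> \<noteq> {} \<Longrightarrow> card \<delta> \<le> card \<sigma>"
    using pick [of K \<sigma>0 "\<lambda>\<delta>. ?V \<inter> \<Phi> ` open_face \<delta> \<noteq> {}" card] finite_complexD(1) [OF K] \<sigma>0 by blast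
  obtain z where z: "z \<in> ?V \<inter> \<Phi> ` open_face \<sigma>" using \<sigma>(2) by blast
  have "z \<in> manifold_points (card \<sigma> - 1) X" using maximal_face_manifold [OF K hom V(1) \<sigma>(1) \<sigma>max] z by blast
  moreover have "z \<in> manifold_points d X" using z V(2) by blast
  ultimately have "card \<sigma> - 1 = d" by (rule manifold_points_unique_dim [OF haus])
  then have de: "d \<le> complex_dim K" using complex_dim_bounds(1) [OF K neK \<sigma>(1)] by simp
  obtain \<tau> where \<tau>: "\<tau> \<in> K" "card \<tau> = Suc (complex_dim K)" using complex_dim_bounds(2) [OF K neK] by blast
  note top = complex_dim_bounds(1) [OF K neK]
  let ?W = "\<Phi> ` open_face \<tau>"
  have W: "openin X ?W"
    by (rule openin_image_maximal_open_face [OF K hom \<tau>(1) top_face_maximal [OF K hom top \<tau>(2)]])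
  have Wm: "?W \<subseteq> manifold_points (complex_dim K) X" by (rule top_open_face_manifold [OF K hom top \<tau>])
  have "?W \<noteq> {}" using barycenter_in_open_face [OF finite_complexD(2,3) [OF K \<tau>(1)]] by blast
  then obtain c1 where c1: "c1 \<in> \<C>" "?W \<inter> open_cell c1 \<noteq> {}" using openin_subset [OF W] cover by blast
  obtain c where c: "c \<in> \<C>" "?W \<inter> open_cell c \<noteq> {}"
      and cmax: "\<And>c'. c' \<in> \<C> \<Longrightarrow> ?W \<inter> open_cell c' \<noteq> {} \<Longrightarrow> fst c' \<le> fst c"
    using pick [of \<C> c1 "\<lambda>c. ?W \<inter> open_cell c \<noteq> {}" fst] finC c1 by blast
  obtain z' where z': "z' \<in> ?W \<inter> open_cell c" using c(2) by blast
  have "z' \<in> manifold_points (fst c) X" using CW_maximal_cell_manifold(2) [OF str W c(1) cmax] z' by blast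
  moreover have "z' \<in> manifold_points (complex_dim K) X" using z' Wm by blast
  ultimately have "fst c = complex_dim K" by (rule manifold_points_unique_dim [OF haus])
  then show "complex_dim K = d" using le [OF c(1)] de by simp
qed

subsection \<open>Integer lattices\<close>

text \<open>Vectors of length \<open>p\<close> are functions padded by zeros, so equality of vectors
  is equality of functions, and shorter vectors are longer ones with vanishing last entries.\<close>

definition int_vecs :: "nat \<Rightarrow> (nat \<Rightarrow> int) set" where
  "int_vecs p = {x. \<forall>i\<ge>p. x i = 0}"

definition int_subgroup :: "(nat \<Rightarrow> int) set \<Rightarrow> bool" where
  "int_subgroup S \<longleftrightarrow> (\<lambda>_. 0) \<in> S \<and> (\<forall>x\<in>S. \<forall>y\<in>S. (\<lambda>i. x i - y i) \<in> S)"

lemma int_subgroupD: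
  assumes "int_subgroup S"
  shows "(\<lambda>_. 0) \<in> S" and "x \<in> S \<Longrightarrow> y \<in> S \<Longrightarrow> (\<lambda>i. x i - y i) \<in> S"
    and "x \<in> S \<Longrightarrow> y \<in> S \<Longrightarrow> (\<lambda>i. x i + y i) \<in> S"
    and "x \<in> S \<Longrightarrow> (\<lambda>i. k * x i) \<in> S"
proof -
  have d: "(\<lambda>i. x i - y i) \<in> S" if "x \<in> S" "y \<in> S" for x y
    using assms that unfolding int_subgroup_def by blast
  then show "x \<in> S \<Longrightarrow> y \<in> S \<Longrightarrow> (\<lambda>i. x i - y i) \<in> S" .
  show "(\<lambda>_. 0) \<in> S" using assms unfolding int_subgroup_def by blast
  then have neg: "(\<lambda>i. - x i) \<in> S" if "x \<in> S" for x using d [OF _ that, of "\<lambda>_. 0"] by simp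
  have add: "(\<lambda>i. x i + y i) \<in> S" if "x \<in> S" "y \<in> S" for x y using d [OF that(1) neg [OF that(2)]] by simp
  then show "x \<in> S \<Longrightarrow> y \<in> S \<Longrightarrow> (\<lambda>i. x i + y i) \<in> S" .
  show "(\<lambda>i. k * x i) \<in> S" if x: "x \<in> S"
  proof -
    have n: "(\<lambda>i. int m * x i) \<in> S" for m
    proof (induction m)
      case 0 then show ?case using \<open>(\<lambda>_. 0) \<in> S\<close> by simp
    next
      case (Suc m) then show ?case using add [OF x Suc] by (simp add: distrib_right)
    qed
    show ?thesis
    proof (cases "0 \<le> k")
      case True then show ?thesis using n [of "nat k"] by simp
    next
      case False then show ?thesis using neg [OF n [of "nat (- k)"]] by simp
    qed
  qed
qed

text \<open>The coordinates \<open>x p\<close> form a nonzero subgroup of the integers; its least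
  positive element divides all others by division with remainder.\<close>

lemma int_subgroup_minimal_coordinate:
  assumes S: "int_subgroup S" and ex: "\<exists>x\<in>S. x p \<noteq> 0"
  shows "\<exists>b\<in>S. 0 < b p \<and> (\<forall>x\<in>S. b p dvd x p)"
proof -
  obtain x where x: "x \<in> S" "x p \<noteq> 0" using ex by blast
  define P where "P n \<longleftrightarrow> (\<exists>x\<in>S. x p = int n \<and> 0 < n)" for n
  have "P (nat \<bar>x p\<bar>)"
  proof (cases "0 < x p")
    case True then show ?thesis unfolding P_def using x by (intro bexI [of _ x]) simp_all
  next
    case False
    then show ?thesis unfolding P_def using int_subgroupD(4) [OF S x(1), of "-1"] x(2)
      by (intro bexI [of _ "\<lambda>i. -1 * x i"]) simp_all
  qed
  then have least: "P (LEAST n. P n)" by (rule LeastI)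
  then obtain b where b: "b \<in> S" "b p = int (LEAST n. P n)" "0 < (LEAST n. P n)" unfolding P_def by blast
  have "b p dvd y p" if y: "y \<in> S" for y
  proof -
    let ?r = "y p mod b p"
    have pos: "0 < b p" using b by simp
    have "(\<lambda>i. y i - (y p div b p) * b i) \<in> S" by (intro int_subgroupD(2,4) [OF S] y b)
    moreover have "y p - (y p div b p) * b p = ?r" by (simp add: minus_div_mult_eq_mod)
    ultimately have "\<exists>x\<in>S. x p = ?r" by (intro bexI) auto
    then have "\<not> 0 < ?r"
    proof (intro notI)
      assume r: "0 < ?r" and "\<exists>x\<in>S. x p = ?r"
      then have "P (nat ?r)" unfolding P_def by simp
      then have "(LEAST n. P n) \<le> nat ?r" by (rule Least_le)
      moreover have "?r < b p" using pos by simp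
      ultimately show False using b(2) r by simp
    qed
    then have "?r = 0" using pos by (metis order_le_less pos_mod_sign)
    then show ?thesis by (simp add: dvd_eq_mod_eq_0)
  qed
  moreover have "0 < b p" using b by simp
  ultimately show ?thesis using b(1) by blast
qed

lemma int_subgroup_hyperplane: "int_subgroup S \<Longrightarrow> int_subgroup {x \<in> S. x p = 0}"
  unfolding int_subgroup_def by simp

text \<open>Subgroups of free abelian groups of finite rank are free: by induction on
  \<open>p\<close>, a vector whose last coordinate generates all last coordinates is added to a
  basis of the part where the last coordinate vanishes.\<close>

theorem int_subgroup_basis:
  assumes "S \<subseteq> int_vecs p" "int_subgroup S"
  shows "\<exists>(r::nat) b. (\<forall>i<r. b i \<in> S) \<and> (\<forall>x\<in>S. \<exists>c. \<forall>j. x j = (\<Sum>i<r. c i * b i j)) \<and>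
    (\<forall>c. (\<forall>j. (\<Sum>i<r. c i * b i j) = 0) \<longrightarrow> (\<forall>i<r. c i = 0))"
  using assms
proof (induction p arbitrary: S)
  case 0
  then have "\<forall>x\<in>S. \<forall>j. x j = 0" by (auto simp: int_vecs_def)
  then show ?case by (intro exI [of _ "0::nat"]) simp
next
  case (Suc p)
  let ?S = "{x \<in> S. x p = 0}"
  have sub: "?S \<subseteq> int_vecs p"
  proof
    fix x assume x: "x \<in> ?S"
    have "x i = 0" if "p \<le> i" for i
      using x Suc.prems(1) that by (cases "i = p") (auto simp: int_vecs_def)
    then show "x \<in> int_vecs p" by (simp add: int_vecs_def)
  qed
  obtain r :: nat and b where rb: "(\<forall>i<r. b i \<in> ?S) \<and> (\<forall>x\<in>?S. \<exists>c. \<forall>j. x j = (\<Sum>i<r. c i * b i j)) \<and>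
    (\<forall>c. (\<forall>j. (\<Sum>i<r. c i * b i j) = 0) \<longrightarrow> (\<forall>i<r. c i = 0))"
    using Suc.IH [OF sub int_subgroup_hyperplane [OF Suc.prems(2)]] by (elim exE)
  have b: "b i \<in> ?S" if "i < r" for i using conjunct1 [OF rb] that by blast
  have span: "\<exists>c. \<forall>j. x j = (\<Sum>i<r. c i * b i j)" if "x \<in> ?S" for x
    by (rule bspec [OF conjunct1 [OF conjunct2 [OF rb]] that])
  have ind: "\<forall>i<r. c i = 0" if "\<And>j. (\<Sum>i<r. c i * b i j) = 0" for c
    using conjunct2 [OF conjunct2 [OF rb]] that by blast
  show ?case
  proof (cases "\<exists>x\<in>S. x p \<noteq> 0")
    case False
    then have e: "?S = S" by blast
    show ?thesis by (intro exI [of _ r] exI [of _ b]) (rule rb [unfolded e])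
  next
    case True
    obtain z where z: "z \<in> S" "0 < z p" "\<And>x. x \<in> S \<Longrightarrow> z p dvd x p"
      using int_subgroup_minimal_coordinate [OF Suc.prems(2) True] by blast
    let ?b = "b(r := z)"
    have sum: "(\<Sum>i<Suc r. c i * ?b i j) = (\<Sum>i<r. c i * b i j) + c r * z j" for c j
      by simp
    show ?thesis
    proof (intro exI [of _ "Suc r"] exI [of _ ?b] conjI ballI allI impI)
      show "?b i \<in> S" if "i < Suc r" for i using that b z by (cases "i = r") auto
    next
      fix x assume x: "x \<in> S"
      obtain q where q: "x p = z p * q" using z(3) [OF x] by (auto elim: dvdE)
      have "(\<lambda>i. x i - q * z i) \<in> ?S"
        using int_subgroupD(2) [OF Suc.prems(2) x int_subgroupD(4) [OF Suc.prems(2) z(1)]] q by simp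
      from span [OF this] obtain c where c: "\<And>j. x j - q * z j = (\<Sum>i<r. c i * b i j)" by blast
      have "x j = (\<Sum>i<Suc r. (c(r := q)) i * ?b i j)" for j
      proof -
        have "(\<Sum>i<r. (c(r := q)) i * b i j) = (\<Sum>i<r. c i * b i j)" by (intro sum.cong) auto
        then show ?thesis unfolding sum using c [of j] by simp
      qed
      then show "\<exists>c. \<forall>j. x j = (\<Sum>i<Suc r. c i * ?b i j)" by blast
    next
      fix c i assume c: "\<forall>j. (\<Sum>i<Suc r. c i * ?b i j) = 0" and i: "i < Suc r"
      have "(\<Sum>i<r. c i * b i p) = 0" using b by (intro sum.neutral) auto
      then have cr: "c r = 0" using c z(2) unfolding sum by (metis add_0 mult_eq_0_iff less_irrefl)
      have "(\<Sum>i<r. c i * b i j) = 0" for j using spec [OF c, of j] unfolding sum cr by simp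
      then have "\<forall>i<r. c i = 0" by (rule ind)
      with cr i show "c i = 0" by (cases "i = r") auto
    qed
  qed
qed

text \<open>The Hermite normal form of a sublattice of full rank, together with a transversal
  \<open>T\<close> of its cosets. The index is the product of the diagonal, since the
  representatives are vectors of remainders modulo the diagonal entries.\<close>

theorem int_subgroup_triangular_basis:
  assumes "S \<subseteq> int_vecs r" "int_subgroup S" "\<forall>i<r. \<exists>N>0. (\<lambda>j. if j = i then N else 0) \<in> S"
  shows "\<exists>b T. (\<forall>i<r. b i \<in> S \<and> 0 < b i i \<and> (\<forall>j>i. b i j = 0)) \<and>
    (\<forall>x\<in>S. \<exists>c. \<forall>j. x j = (\<Sum>i<r. c i * b i j)) \<and>
    T \<subseteq> int_vecs r \<and> finite T \<and> int (card T) = (\<Prod>i<r. b i i) \<and>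
    (\<forall>x\<in>int_vecs r. \<exists>t\<in>T. (\<lambda>j. x j - t j) \<in> S) \<and>
    (\<forall>t\<in>T. \<forall>t'\<in>T. (\<lambda>j. t j - t' j) \<in> S \<longrightarrow> t = t')"
  using assms
proof (induction r arbitrary: S)
  case 0
  then have S: "\<forall>x\<in>S. \<forall>j. x j = 0" by (auto simp: int_vecs_def)
  have "int_vecs 0 = {\<lambda>_. 0}" by (auto simp: int_vecs_def)
  then show ?case using S int_subgroupD(1) [OF 0(2)]
    by (intro exI [of _ "\<lambda>_ _. 0::int"] exI [of _ "{\<lambda>_. 0::int}"]) simp
next
  case (Suc r)
  note S = Suc.prems(2)
  let ?S = "{x \<in> S. x r = 0}"
  have sub: "?S \<subseteq> int_vecs r"
  proof
    fix x assume x: "x \<in> ?S"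
    have "x i = 0" if "r \<le> i" for i
      using x Suc.prems(1) that by (cases "i = r") (auto simp: int_vecs_def)
    then show "x \<in> int_vecs r" by (simp add: int_vecs_def)
  qed
  have full: "\<forall>i<r. \<exists>N>0. (\<lambda>j. if j = i then N else 0) \<in> ?S"
    using Suc.prems(3) by auto
  obtain b T where bT: "(\<forall>i<r. b i \<in> ?S \<and> 0 < b i i \<and> (\<forall>j>i. b i j = 0)) \<and>
    (\<forall>x\<in>?S. \<exists>c. \<forall>j. x j = (\<Sum>i<r. c i * b i j)) \<and>
    T \<subseteq> int_vecs r \<and> finite T \<and> int (card T) = (\<Prod>i<r. b i i) \<and>
    (\<forall>x\<in>int_vecs r. \<exists>t\<in>T. (\<lambda>j. x j - t j) \<in> ?S) \<and>
    (\<forall>t\<in>T. \<forall>t'\<in>T. (\<lambda>j. t j - t' j) \<in> ?S \<longrightarrow> t = t')"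
    using Suc.IH [OF sub int_subgroup_hyperplane [OF S] full] by (elim exE)
  note c1 = conjunct1 [OF bT] and c2 = conjunct1 [OF conjunct2 [OF bT]] and c3 = conjunct2 [OF conjunct2 [OF bT]]
  have b: "b i \<in> ?S" "0 < b i i" if "i < r" for i
    using c1 that by (blast, blast)
  have b0: "b i j = 0" if "i < r" "i < j" for i j using c1 that by blast
  have span: "\<exists>c. \<forall>j. x j = (\<Sum>i<r. c i * b i j)" if "x \<in> ?S" for x by (rule bspec [OF c2 that])
  have T: "T \<subseteq> int_vecs r" "finite T" "int (card T) = (\<Prod>i<r. b i i)" using c3 by (blast, blast, blast)
  have Tex: "\<exists>t\<in>T. (\<lambda>j. x j - t j) \<in> ?S" if "x \<in> int_vecs r" for x
    using conjunct1 [OF conjunct2 [OF conjunct2 [OF conjunct2 [OF c3]]]] that by (rule bspec)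
  have Tun: "t = t'" if "t \<in> T" "t' \<in> T" "(\<lambda>j. t j - t' j) \<in> ?S" for t t'
    using conjunct2 [OF conjunct2 [OF conjunct2 [OF conjunct2 [OF c3]]]] that by blast
  obtain N where N: "0 < (N::int)" "(\<lambda>j. if j = r then N else 0) \<in> S" using Suc.prems(3) by blast
  then have "\<exists>x\<in>S. x r \<noteq> 0" by (intro bexI [of _ "\<lambda>j. if j = r then N else 0"]) simp_all
  from int_subgroup_minimal_coordinate [OF S this]
  obtain z where z: "z \<in> S" "0 < z r" "\<And>x. x \<in> S \<Longrightarrow> z r dvd x r" by blast
  let ?b = "b(r := z)"
  let ?T = "(\<lambda>(t, \<rho>). t(r := \<rho>)) ` (T \<times> {0..<z r})"
  have sum: "(\<Sum>i<Suc r. c i * ?b i j) = (\<Sum>i<r. c i * b i j) + c r * z j" for c j by simp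
  have Tr: "t r = 0" if "t \<in> T" for t using that T(1) by (auto simp: int_vecs_def)
  have inj: "inj_on (\<lambda>(t, \<rho>). t(r := \<rho>)) (T \<times> {0..<z r})"
  proof (rule inj_onI, clarify)
    fix t \<rho> t' \<rho>' assume t: "t \<in> T" "t' \<in> T" and e: "t(r := \<rho>) = t'(r := \<rho>')"
    have "t j = t' j" for j using fun_cong [OF e, of j] Tr [OF t(1)] Tr [OF t(2)] by (cases "j = r") auto
    then show "t = t' \<and> \<rho> = \<rho>'" using fun_cong [OF e, of r] by auto
  qed
  show ?case
  proof (intro exI [of _ ?b] exI [of _ ?T] conjI ballI allI impI)
    fix i assume i: "i < Suc r"
    show "?b i \<in> S" "0 < ?b i i" using i b z by (cases "i = r"; simp)+
    show "?b i j = 0" if "i < j" for j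
    proof (cases "i = r")
      case True
      then show ?thesis using that z(1) Suc.prems(1) by (auto simp: int_vecs_def)
    qed (use i b0 that in simp)
  next
    fix x assume x: "x \<in> S"
    obtain q where q: "x r = z r * q" using z(3) [OF x] by (auto elim: dvdE)
    have "(\<lambda>i. x i - q * z i) \<in> ?S"
      using int_subgroupD(2) [OF S x int_subgroupD(4) [OF S z(1)]] q by simp
    from span [OF this] obtain c where c: "\<And>j. x j - q * z j = (\<Sum>i<r. c i * b i j)" by blast
    have "x j = (\<Sum>i<Suc r. (c(r := q)) i * ?b i j)" for j
    proof -
      have "(\<Sum>i<r. (c(r := q)) i * b i j) = (\<Sum>i<r. c i * b i j)" by (intro sum.cong) auto
      then show ?thesis unfolding sum using c [of j] by simp
    qed
    then show "\<exists>c. \<forall>j. x j = (\<Sum>i<Suc r. c i * ?b i j)" by blast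
  next
    show "?T \<subseteq> int_vecs (Suc r)" using T(1) by (auto simp: int_vecs_def)
    show "finite ?T" using T(2) by simp
    have "card ?T = card T * nat (z r)" by (simp add: card_image [OF inj] card_cartesian_product)
    moreover have "(\<Prod>i<r. ?b i i) = (\<Prod>i<r. b i i)" by (intro prod.cong) auto
    ultimately show "int (card ?T) = (\<Prod>i<Suc r. ?b i i)" using T(3) z(2) by simp
  next
    fix x assume x: "x \<in> int_vecs (Suc r)"
    \<comment> \<open>Division by the last diagonal entry determines the last digit. The carry
      changes the other coordinates, which the representatives \<open>T\<close> of the hyperplane
      then reduce.\<close>
    let ?\<rho> = "x r mod z r" and ?q = "x r div z r"
    let ?y = "\<lambda>j. if j = r then 0 else x j - ?q * z j"
    have "?y \<in> int_vecs r"
      using x z(1) Suc.prems(1) by (auto simp: int_vecs_def)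
    from Tex [OF this] obtain t where t: "t \<in> T" "(\<lambda>j. ?y j - t j) \<in> ?S" by blast
    have "(\<lambda>j. (?y j - t j) + ?q * z j) \<in> S" using int_subgroupD(3,4) [OF S] t(2) z(1) by blast
    moreover have "(\<lambda>j. (?y j - t j) + ?q * z j) = (\<lambda>j. x j - (t(r := ?\<rho>)) j)"
    proof
      fix j
      show "(?y j - t j) + ?q * z j = x j - (t(r := ?\<rho>)) j"
        using Tr [OF t(1)] by (cases "j = r") (simp_all add: minus_mod_eq_div_mult)
    qed
    ultimately have "(\<lambda>j. x j - (t(r := ?\<rho>)) j) \<in> S" by metis
    moreover have "t(r := ?\<rho>) \<in> ?T" using t(1) z(2) by (intro image_eqI [of _ _ "(t, ?\<rho>)"]) simp_all
    ultimately show "\<exists>t\<in>?T. (\<lambda>j. x j - t j) \<in> S" by blast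
  next
    fix u u' assume u: "u \<in> ?T" "u' \<in> ?T" and d: "(\<lambda>j. u j - u' j) \<in> S"
    obtain t \<rho> t' \<rho>' where t: "t \<in> T" "t' \<in> T" and \<rho>: "\<rho> \<in> {0..<z r}" "\<rho>' \<in> {0..<z r}" and e: "u = t(r := \<rho>)" "u' = t'(r := \<rho>')"
      using u by auto
    have "z r dvd \<rho> - \<rho>'" using z(3) [OF d] e by simp
    moreover have "\<bar>\<rho> - \<rho>'\<bar> < z r" using \<rho> by auto
    ultimately have \<rho>e: "\<rho> = \<rho>'" using dvd_imp_le_int [of "\<rho> - \<rho>'" "z r"] z(2) by auto
    have "u j - u' j = t j - t' j" for j
      using Tr [OF t(1)] Tr [OF t(2)] by (cases "j = r") (simp_all add: e \<rho>e)
    then have "(\<lambda>j. u j - u' j) = (\<lambda>j. t j - t' j)" by blast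
    then have "(\<lambda>j. t j - t' j) \<in> ?S" using d Tr [OF t(1)] Tr [OF t(2)] by simp
    from Tun [OF t this] show "u = u'" using e \<rho>e by simp
  qed
qed

subsection \<open>Complementary minors of integer matrices\<close>

lemma mat_times_mat:
  "mat a b f * mat b c g = mat a c (\<lambda>(i, j). \<Sum>k<b. f (i, k) * (g (k, j) :: 'b :: semiring_0))"
  by (rule eq_matI) (auto simp: scalar_prod_def lessThan_atLeast0 intro!: sum.cong)

text \<open>The trace of \<open>A B\<close> is \<open>n\<close>, that of \<open>B A\<close> is
  \<open>k\<close>, and the two agree; characteristic 0 turns this into
  \<open>n = k\<close>.\<close>

lemma two_sided_inverse_dim:
  fixes A B :: "nat \<Rightarrow> nat \<Rightarrow> 'a :: {comm_semiring_1, semiring_char_0}"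
  assumes "\<And>j. j < n \<Longrightarrow> (\<Sum>u<k. A j u * B u j) = 1" "\<And>u. u < k \<Longrightarrow> (\<Sum>j<n. B u j * A j u) = 1"
  shows "n = k"
proof -
  have "of_nat n = (\<Sum>j<n. \<Sum>u<k. A j u * B u j)" using assms(1) by simp
  also have "\<dots> = (\<Sum>u<k. \<Sum>j<n. B u j * A j u)" by (subst sum.swap) (simp add: mult.commute)
  also have "\<dots> = of_nat k" using assms(2) by simp
  finally show ?thesis by simp
qed

lemma sum_split: "(\<Sum>u<r + m. f u) = (\<Sum>u<r. f u) + (\<Sum>b<m. f (r + b))" for f :: "nat \<Rightarrow> 'a :: comm_monoid_add"
  by (induction m) (simp_all add: add.assoc)

lemma bij_betw_pick:
  assumes "finite I" shows "bij_betw (pick I) {..<card I} I"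
proof -
  have inj: "inj_on (pick I) {..<card I}"
  proof (rule inj_onI)
    fix s t assume st: "s \<in> {..<card I}" "t \<in> {..<card I}" "pick I s = pick I t"
    then show "s = t" using pick_mono_le [of s I t] pick_mono_le [of t I s] by (metis lessThan_iff less_irrefl nat_neq_iff)
  qed
  have "pick I ` {..<card I} \<subseteq> I" using pick_in_set_le by blast
  then have "pick I ` {..<card I} = I"
    using card_subset_eq [OF assms] card_image [OF inj] by simp
  with inj show ?thesis by (simp add: bij_betw_def)
qed

definition mat_image :: "(nat \<Rightarrow> nat \<Rightarrow> int) \<Rightarrow> nat \<Rightarrow> (nat \<Rightarrow> int) \<Rightarrow> nat \<Rightarrow> int" where
  "mat_image U n w i = (\<Sum>j<n. U i j * w j)"

definition mat_kernel :: "(nat \<Rightarrow> nat \<Rightarrow> int) \<Rightarrow> nat \<Rightarrow> nat \<Rightarrow> (nat \<Rightarrow> int) set" where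
  "mat_kernel U p n = {x \<in> int_vecs n. \<forall>i<p. mat_image U n x i = 0}"

text \<open>Defined by integer multiples, the form in which torsion produces it; that these are the
  integral vectors of the real column span is \<open>saturated_lattice_real_mat\<close>.\<close>

definition saturation :: "(nat \<Rightarrow> nat \<Rightarrow> int) \<Rightarrow> nat \<Rightarrow> nat \<Rightarrow> (nat \<Rightarrow> int) set" where
  "saturation U p n = {x \<in> int_vecs p. \<exists>N>0. \<exists>w. \<forall>i<p. N * x i = mat_image U n w i}"

definition int_basis :: "(nat \<Rightarrow> int) set \<Rightarrow> nat \<Rightarrow> (nat \<Rightarrow> nat \<Rightarrow> int) \<Rightarrow> bool" where
  "int_basis S r b \<longleftrightarrow> (\<forall>i<r. b i \<in> S) \<and> (\<forall>x\<in>S. \<exists>c. \<forall>j. x j = (\<Sum>i<r. c i * b i j)) \<and>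
    (\<forall>c. (\<forall>j. (\<Sum>i<r. c i * b i j) = 0) \<longrightarrow> (\<forall>i<r. c i = 0))"

lemma int_basisD:
  assumes "int_basis S r b"
  shows "i < r \<Longrightarrow> b i \<in> S" and "x \<in> S \<Longrightarrow> \<exists>c. \<forall>j. x j = (\<Sum>i<r. c i * b i j)"
    and "(\<And>j. (\<Sum>i<r. c i * b i j) = 0) \<Longrightarrow> i < r \<Longrightarrow> c i = 0"
  using assms unfolding int_basis_def by blast+

lemma mat_image_diff: "mat_image U n (\<lambda>j. x j - y j) i = mat_image U n x i - mat_image U n y i"
  by (simp add: mat_image_def right_diff_distrib sum_subtractf)

lemma mat_image_cmul: "mat_image U n (\<lambda>j. k * x j) i = k * mat_image U n x i"
  by (simp add: mat_image_def sum_distrib_left mult_ac)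

lemma mat_image_sum: "mat_image U n (\<lambda>j. \<Sum>s<r. c s * b s j) i = (\<Sum>s<r. c s * mat_image U n (b s) i)"
  unfolding mat_image_def by (simp add: sum_distrib_left mult_ac) (subst sum.swap, rule refl)

lemma int_subgroup_saturation: "int_subgroup (saturation U p n)"
  unfolding int_subgroup_def
proof (intro conjI ballI)
  show "(\<lambda>_. 0) \<in> saturation U p n"
    unfolding saturation_def
    by (auto simp: int_vecs_def mat_image_def intro!: exI [of _ "1::int"] exI [of _ "\<lambda>_. 0"])
  fix x y assume "x \<in> saturation U p n" "y \<in> saturation U p n"
  then obtain N w N' w' where x: "x \<in> int_vecs p" "N > 0" "\<forall>i<p. N * x i = mat_image U n w i"
    and y: "y \<in> int_vecs p" "N' > 0" "\<forall>i<p. N' * y i = mat_image U n w' i" unfolding saturation_def by blast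
  have "(N * N') * (x i - y i) = mat_image U n (\<lambda>j. N' * w j - N * w' j) i" if "i < p" for i
  proof -
    have "(N * N') * (x i - y i) = N' * (N * x i) - N * (N' * y i)" by (simp add: algebra_simps)
    then show ?thesis using x(3) y(3) that by (simp add: mat_image_diff mat_image_cmul)
  qed
  moreover have "N * N' > 0" using x(2) y(2) by simp
  moreover have "(\<lambda>i. x i - y i) \<in> int_vecs p" using x(1) y(1) by (simp add: int_vecs_def)
  ultimately show "(\<lambda>i. x i - y i) \<in> saturation U p n" unfolding saturation_def by blast
qed

lemma int_subgroup_mat_kernel: "int_subgroup (mat_kernel U p n)"
  unfolding int_subgroup_def mat_kernel_def
  by (simp add: int_vecs_def mat_image_diff) (simp add: mat_image_def)

lemma int_basis_exists:
  assumes "S \<subseteq> int_vecs p" "int_subgroup S" shows "\<exists>r b. int_basis S r b"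
  using int_subgroup_basis [OF assms] unfolding int_basis_def .

text \<open>Let \<open>b\<close> be a triangular basis of the image of \<open>W\<close>, lifted to \<open>q\<close>, so that \<open>Q = [q | v]\<close> is
  unimodular. With the rows of \<open>Q\<close> permuted according to \<open>(I, g)\<close>, the minors are compared by taking
  determinants in \<open>[[W\<^sub>I, W\<^sub>g], [0, 1]] Q = [[b, 0], [*, v\<^sub>g]]\<close>.\<close>

theorem integer_matrix_structure:
  assumes v: "int_basis (mat_kernel U p n) m v" and f: "int_basis (saturation U p n) r f"
  shows "\<exists>W T D. n = r + m \<and>
     (\<forall>i<p. \<forall>j<n. U i j = (\<Sum>a<r. f a i * W a j)) \<and>
     (\<forall>a<r. \<exists>N>0. \<exists>w. \<forall>i<p. N * f a i = mat_image U n w i) \<and>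
     finite T \<and> T \<subseteq> saturation U p n \<and> int (card T) = D \<and> 0 < D \<and>
     (\<forall>x\<in>saturation U p n. \<exists>t\<in>T. \<exists>w. \<forall>i<p. x i - t i = mat_image U n w i) \<and>
     (\<forall>t\<in>T. \<forall>t'\<in>T. (\<exists>w. \<forall>i<p. t i - t' i = mat_image U n w i) \<longrightarrow> t = t') \<and>
     (\<forall>g. inj_on g {..<m} \<and> g ` {..<m} \<subseteq> {..<n} \<longrightarrow>
       \<bar>det (mat r r (\<lambda>(a, t). W a (pick ({..<n} - g ` {..<m}) t)))\<bar> = D * \<bar>det (mat m m (\<lambda>(c, b). v b (g c)))\<bar>)"
proof -
  let ?L = "saturation U p n"
  have colL: "(\<lambda>i. if i < p then U i j else 0) \<in> ?L" if j: "j < n" for j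
  proof -
    have "\<forall>i<p. 1 * (if i < p then U i j else 0) = mat_image U n (\<lambda>j'. if j' = j then 1 else 0) i"
      using j by (simp add: mat_image_def if_distrib [of "\<lambda>u. _ * u"] cong: if_cong)
    then have "\<exists>N>0. \<exists>w. \<forall>i<p. N * (if i < p then U i j else 0) = mat_image U n w i"
      by (intro exI [of _ "1::int"] conjI exI [of _ "\<lambda>j'. if j' = j then 1 else 0"]) simp_all
    then show ?thesis unfolding saturation_def int_vecs_def by simp
  qed
  have "\<forall>j. \<exists>c. j < n \<longrightarrow> (\<forall>i. (if i < p then U i j else 0) = (\<Sum>a<r. c a * f a i))"
    using int_basisD(2) [OF f colL] by blast
  then obtain C where C: "\<And>i j. j < n \<Longrightarrow> (if i < p then U i j else 0) = (\<Sum>a<r. C j a * f a i)" by metis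
  define W where "W a j = C j a" for a j
  have UW: "U i j = (\<Sum>a<r. f a i * W a j)" if "i < p" "j < n" for i j
    using C [OF that(2), of i] that(1) by (simp add: W_def mult.commute)
  have fL: "f a \<in> ?L" if "a < r" for a using int_basisD(1) [OF f that] .
  have f0: "f a i = 0" if "a < r" "i \<ge> p" for a i using fL [OF that(1)] that(2) by (simp add: saturation_def int_vecs_def)
  have UF: "mat_image U n w i = (\<Sum>a<r. mat_image W n w a * f a i)" if "i < p" for w i
  proof -
    have "mat_image U n w i = (\<Sum>j<n. \<Sum>a<r. f a i * W a j * w j)"
      unfolding mat_image_def using UW [OF that] by (simp add: sum_distrib_right)
    also have "\<dots> = (\<Sum>a<r. \<Sum>j<n. f a i * W a j * w j)" by (rule sum.swap)
    also have "\<dots> = (\<Sum>a<r. mat_image W n w a * f a i)"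
      unfolding mat_image_def by (simp add: sum_distrib_left mult_ac)
    finally show ?thesis .
  qed
  \<comment> \<open>As the vectors \<open>f a\<close> are independent, equations between vectors of
    length \<open>p\<close> may be read in the \<open>r\<close> coordinates with respect to
    \<open>f\<close>, where \<open>U\<close> becomes \<open>W\<close>.\<close>
  have coord_eq: "(\<forall>i<p. (\<Sum>a<r. c a * f a i) = mat_image U n w i) \<longleftrightarrow> (\<forall>a<r. c a = mat_image W n w a)" for c w
  proof
    assume e: "\<forall>i<p. (\<Sum>a<r. c a * f a i) = mat_image U n w i"
    have "(\<Sum>a<r. (c a - mat_image W n w a) * f a i) = 0" for i
    proof (cases "i < p")
      case True then show ?thesis using e UF [OF True, of w] by (simp add: left_diff_distrib sum_subtractf)
    next
      case False then show ?thesis using f0 by simp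
    qed
    then have "c a - mat_image W n w a = 0" if "a < r" for a by (rule int_basisD(3) [OF f _ that])
    then show "\<forall>a<r. c a = mat_image W n w a" by simp
  qed (simp add: UF)
  \<comment> \<open>The column lattice of \<open>U\<close> in coordinates of the saturation; its
    index in \<open>int_vecs r\<close> will be the order of the torsion.\<close>
  define S where "S = {x \<in> int_vecs r. \<exists>w. \<forall>a<r. x a = mat_image W n w a}"
  have Ssub: "S \<subseteq> int_vecs r" by (auto simp: S_def)
  have S: "int_subgroup S"
    unfolding int_subgroup_def
  proof (intro conjI ballI)
    show "(\<lambda>_. 0) \<in> S" unfolding S_def
      by (auto simp: int_vecs_def mat_image_def intro!: exI [of _ "\<lambda>_. 0"])
    fix x y assume "x \<in> S" "y \<in> S"
    then obtain w w' where x: "x \<in> int_vecs r" "\<forall>a<r. x a = mat_image W n w a" and y: "y \<in> int_vecs r" "\<forall>a<r. y a = mat_image W n w' a"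
      unfolding S_def by blast
    then have "\<forall>a<r. x a - y a = mat_image W n (\<lambda>j. w j - w' j) a" by (simp add: mat_image_diff)
    moreover have "(\<lambda>a. x a - y a) \<in> int_vecs r" using x(1) y(1) by (simp add: int_vecs_def)
    ultimately show "(\<lambda>a. x a - y a) \<in> S" unfolding S_def by blast
  qed
  \<comment> \<open>Some positive multiple of each basis vector \<open>f a\<close> is in the image
    of \<open>U\<close>, so \<open>S\<close> has full rank.\<close>
  have full: "\<forall>a<r. \<exists>N>0. (\<lambda>j. if j = a then N else 0) \<in> S"
  proof (intro allI impI)
    fix a assume a: "a < r"
    obtain N w where N: "N > 0" "\<forall>i<p. N * f a i = mat_image U n w i" using fL [OF a] unfolding saturation_def by blast
    let ?e = "\<lambda>a'. if a' = a then N else 0"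
    have "(\<Sum>a'<r. ?e a' * f a' i) = N * f a i" for i
      using a by (simp add: if_distrib [of "\<lambda>u. u * _"] cong: if_cong)
    then have "\<forall>a'<r. ?e a' = mat_image W n w a'" using coord_eq [of ?e w] N(2) by simp
    moreover have "?e \<in> int_vecs r" using a by (simp add: int_vecs_def)
    ultimately show "\<exists>N>0. (\<lambda>j. if j = a then N else 0) \<in> S" unfolding S_def using N(1) by blast
  qed
  obtain b T0 where bT: "(\<forall>i<r. b i \<in> S \<and> 0 < b i i \<and> (\<forall>j>i. b i j = 0)) \<and>
    (\<forall>x\<in>S. \<exists>c. \<forall>j. x j = (\<Sum>i<r. c i * b i j)) \<and>
    T0 \<subseteq> int_vecs r \<and> finite T0 \<and> int (card T0) = (\<Prod>i<r. b i i) \<and>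
    (\<forall>x\<in>int_vecs r. \<exists>t\<in>T0. (\<lambda>j. x j - t j) \<in> S) \<and>
    (\<forall>t\<in>T0. \<forall>t'\<in>T0. (\<lambda>j. t j - t' j) \<in> S \<longrightarrow> t = t')"
    using int_subgroup_triangular_basis [OF Ssub S full] by (elim exE)
  note c1 = conjunct1 [OF bT] and c2 = conjunct1 [OF conjunct2 [OF bT]] and c3 = conjunct2 [OF conjunct2 [OF bT]]
  have b: "b i \<in> S" "0 < b i i" if "i < r" for i using c1 that by (blast, blast)
  have b0: "b i j = 0" if "i < r" "i < j" for i j using c1 that by blast
  have T0: "T0 \<subseteq> int_vecs r" "finite T0" "int (card T0) = (\<Prod>i<r. b i i)" using c3 by (blast, blast, blast)
  have T0ex: "\<exists>t\<in>T0. (\<lambda>j. x j - t j) \<in> S" if "x \<in> int_vecs r" for x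
    using conjunct1 [OF conjunct2 [OF conjunct2 [OF conjunct2 [OF c3]]]] that by (rule bspec)
  have T0un: "t = t'" if "t \<in> T0" "t' \<in> T0" "(\<lambda>j. t j - t' j) \<in> S" for t t'
    using conjunct2 [OF conjunct2 [OF conjunct2 [OF conjunct2 [OF c3]]]] that by blast
  define D where "D = (\<Prod>i<r. b i i)"
  have Dpos: "0 < D" unfolding D_def using b(2) by (intro prod_pos) simp
  define F where "F c = (\<lambda>i. \<Sum>a<r. c a * f a i)" for c
  have FL: "F c \<in> ?L" for c
  proof -
    have "(\<lambda>i. \<Sum>a<k. c a * f a i) \<in> ?L" if "k \<le> r" for k
      using that
    proof (induction k)
      case 0 show ?case using int_subgroupD(1) [OF int_subgroup_saturation] by simp
    next
      case (Suc k)
      have "(\<lambda>i. (\<Sum>a<k. c a * f a i) + c k * f k i) \<in> ?L"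
        using Suc by (intro int_subgroupD(3,4) [OF int_subgroup_saturation] fL) simp_all
      then show ?case by simp
    qed
    then show ?thesis unfolding F_def by blast
  qed
  have Fdiff: "(\<lambda>a. x a - y a) \<in> S \<longleftrightarrow> (\<exists>w. \<forall>i<p. F x i - F y i = mat_image U n w i)"
    if "x \<in> int_vecs r" "y \<in> int_vecs r" for x y
  proof -
    have "F x i - F y i = (\<Sum>a<r. (x a - y a) * f a i)" for i
      by (simp add: F_def left_diff_distrib sum_subtractf)
    then have "(\<exists>w. \<forall>i<p. F x i - F y i = mat_image U n w i) \<longleftrightarrow> (\<exists>w. \<forall>a<r. x a - y a = mat_image W n w a)"
      using coord_eq [of "\<lambda>a. x a - y a"] by simp
    moreover have "(\<lambda>a. x a - y a) \<in> int_vecs r" using that by (simp add: int_vecs_def)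
    ultimately show ?thesis unfolding S_def by blast
  qed
  have "inj_on F T0"
  proof (rule inj_onI)
    fix t t' assume t: "t \<in> T0" "t' \<in> T0" "F t = F t'"
    have "\<forall>i<p. F t i - F t' i = mat_image U n (\<lambda>_. 0) i" using t(3) by (simp add: mat_image_def)
    then show "t = t'" using T0un [OF t(1,2)] Fdiff [of t t'] T0(1) t by blast
  qed
  then have cardT: "int (card (F ` T0)) = D" using T0(3) by (simp add: card_image D_def)
  have Tex: "\<exists>t\<in>F ` T0. \<exists>w. \<forall>i<p. x i - t i = mat_image U n w i" if x: "x \<in> ?L" for x
  proof -
    obtain c where c: "\<And>i. x i = (\<Sum>a<r. c a * f a i)" using int_basisD(2) [OF f x] by blast
    let ?c = "\<lambda>a. if a < r then c a else 0"
    have "F ?c = x" unfolding F_def using c by (intro ext) simp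
    moreover have cc: "?c \<in> int_vecs r" by (simp add: int_vecs_def)
    moreover obtain t where "t \<in> T0" "(\<lambda>a. ?c a - t a) \<in> S" using T0ex [OF cc] by blast
    ultimately show ?thesis using Fdiff [of ?c t] T0(1) by blast
  qed
  have Tun: "t = t'" if tt: "t \<in> F ` T0" "t' \<in> F ` T0" "\<exists>w. \<forall>i<p. t i - t' i = mat_image U n w i" for t t'
  proof -
    obtain s s' where s: "s \<in> T0" "t = F s" "s' \<in> T0" "t' = F s'" using tt(1,2) by blast
    then have "(\<lambda>a. s a - s' a) \<in> S" using tt(3) Fdiff [of s s'] T0(1) by blast
    then show ?thesis using T0un s by blast
  qed
  have "\<forall>s. \<exists>w. s < r \<longrightarrow> w \<in> int_vecs n \<and> (\<forall>a<r. b s a = mat_image W n w a)"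
  proof
    fix s
    show "\<exists>w. s < r \<longrightarrow> w \<in> int_vecs n \<and> (\<forall>a<r. b s a = mat_image W n w a)"
    proof (cases "s < r")
      case True
      then obtain w where w: "\<forall>a<r. b s a = mat_image W n w a" using b(1) [OF True] unfolding S_def by blast
      have "mat_image W n w a = mat_image W n (\<lambda>j. if j < n then w j else 0) a" for a
        unfolding mat_image_def by (intro sum.cong) simp_all
      with w show ?thesis by (intro exI [of _ "\<lambda>j. if j < n then w j else 0"]) (simp add: int_vecs_def)
    qed simp
  qed
  then obtain q where q: "\<And>s. s < r \<Longrightarrow> q s \<in> int_vecs n" "\<And>s a. s < r \<Longrightarrow> a < r \<Longrightarrow> b s a = mat_image W n (q s) a" by metis
  have ker: "x \<in> mat_kernel U p n \<longleftrightarrow> x \<in> int_vecs n \<and> (\<forall>a<r. mat_image W n x a = 0)" for x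
    using coord_eq [of "\<lambda>_. 0" x] unfolding mat_kernel_def by auto
  have vK: "v c \<in> int_vecs n" "\<And>a. a < r \<Longrightarrow> mat_image W n (v c) a = 0" if "c < m" for c
    using int_basisD(1) [OF v that] unfolding ker by blast+
  \<comment> \<open>Subtracting from a vector the lift of its image leaves a kernel vector, so these
    columns span; triangularity of \<open>b\<close> and independence of \<open>v\<close> make them
    independent.\<close>
  define Q where "Q u = (if u < r then q u else v (u - r))" for u
  have Qv: "Q u \<in> int_vecs n" if "u < r + m" for u using that q(1) vK(1) by (simp add: Q_def)
  have Qsum: "(\<Sum>u<r + m. z u * Q u j) = (\<Sum>s<r. z s * q s j) + (\<Sum>c<m. z (r + c) * v c j)" for z j
    unfolding sum_split by (simp add: Q_def)
  have WQ: "mat_image W n (Q u) a = (if u < r then b u a else 0)" if "u < r + m" "a < r" for u a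
    using that q(2) vK(2) by (simp add: Q_def)
  have Qspan: "\<exists>z. \<forall>j. y j = (\<Sum>u<r + m. z u * Q u j)" if y: "y \<in> int_vecs n" for y
  proof -
    have yS: "(\<lambda>a. if a < r then mat_image W n y a else 0) \<in> S" unfolding S_def int_vecs_def by (simp; blast)
    obtain c where c: "\<And>a. (if a < r then mat_image W n y a else 0) = (\<Sum>s<r. c s * b s a)"
      using bspec [OF c2 yS] by (elim exE) blast
    let ?x = "\<lambda>j. y j - (\<Sum>s<r. c s * q s j)"
    have "mat_image W n ?x a = 0" if "a < r" for a
      unfolding mat_image_diff mat_image_sum using c [of a] q(2) [OF _ that] that by simp
    moreover have "?x \<in> int_vecs n" using y q(1) by (simp add: int_vecs_def)
    ultimately have "?x \<in> mat_kernel U p n" unfolding ker by blast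
    from int_basisD(2) [OF v this] obtain d where d: "\<And>j. ?x j = (\<Sum>i<m. d i * v i j)" by blast
    have "y j = (\<Sum>u<r + m. (if u < r then c u else d (u - r)) * Q u j)" for j
      unfolding Qsum using d [of j] by simp
    then show ?thesis by (intro exI [of _ "\<lambda>u. if u < r then c u else d (u - r)"] allI)
  qed
  have Qind: "z u = 0" if z: "\<And>j. (\<Sum>u<r + m. z u * Q u j) = 0" and u: "u < r + m" for z u
  proof -
    have zb: "(\<Sum>s<r. z s * b s a) = 0" if a: "a < r" for a
    proof -
      have "mat_image W n (\<lambda>j. \<Sum>u<r + m. z u * Q u j) a = (\<Sum>u<r + m. z u * mat_image W n (Q u) a)"
        by (rule mat_image_sum)
      also have "\<dots> = (\<Sum>u<r + m. z u * (if u < r then b u a else 0))" using WQ a by (intro sum.cong) simp_all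
      also have "\<dots> = (\<Sum>s<r. z s * b s a)" unfolding sum_split by simp
      finally show ?thesis using z by (simp add: mat_image_def)
    qed
    \<comment> \<open>At the largest index \<open>k\<close> with \<open>z k \<noteq> 0\<close>,
      triangularity reduces coordinate \<open>k\<close> of the relation to
      \<open>z k * b k k\<close>, which is nonzero.\<close>
    have zr: "z s = 0" if "s < r" for s
    proof (rule ccontr)
      assume "z s \<noteq> 0"
      define k where "k = Max {s. s < r \<and> z s \<noteq> 0}"
      have fin: "finite {s. s < r \<and> z s \<noteq> 0}" "{s. s < r \<and> z s \<noteq> 0} \<noteq> {}" using \<open>z s \<noteq> 0\<close> that by auto
      then have k: "k < r" "z k \<noteq> 0" using Max_in [OF fin] unfolding k_def by auto
      have big: "z s = 0" if "s < r" "k < s" for s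
        using Max_ge [OF fin(1), of s] that unfolding k_def by (metis (mono_tags, lifting) leD mem_Collect_eq)
      have "z s * b s k = (if s = k then z k * b k k else 0)" if "s < r" for s
        using big [OF that] b0 [OF that, of k] by (cases s k rule: linorder_cases) simp_all
      then have "(\<Sum>s<r. z s * b s k) = (\<Sum>s<r. if s = k then z k * b k k else 0)" by (intro sum.cong) simp_all
      also have "\<dots> = z k * b k k" using k(1) by simp
      finally show False using zb [OF k(1)] k(2) b(2) [OF k(1)] by simp
    qed
    have "(\<Sum>c<m. z (r + c) * v c j) = 0" for j using z [of j] zr unfolding Qsum by simp
    then have zm: "z (r + c) = 0" if "c < m" for c
      using int_basisD(3) [OF v, of "\<lambda>c. z (r + c)"] that by blast
    show ?thesis
    proof (cases "u < r")
      case False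
      then have "u = r + (u - r)" "u - r < m" using u by simp_all
      then show ?thesis using zm by metis
    qed (use zr in blast)
  qed
  have "\<forall>j. \<exists>z. j < n \<longrightarrow> (\<forall>i. (if i = j then 1 else 0) = (\<Sum>u<r + m. z u * Q u i))"
  proof
    fix j
    show "\<exists>z. j < n \<longrightarrow> (\<forall>i. (if i = j then 1 else 0) = (\<Sum>u<r + m. z u * Q u i))"
      using Qspan [of "\<lambda>i. if i = j then 1 else 0"] by (cases "j < n") (auto simp: int_vecs_def)
  qed
  then obtain Z where Z: "\<And>i j. j < n \<Longrightarrow> (\<Sum>u<r + m. Z j u * Q u i) = (if i = j then 1 else 0)" by metis
  \<comment> \<open>\<open>Z\<close> exists because the columns span, and it inverts
    \<open>Q\<close> on one side. Independence of the columns yields the other side, and the two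
    together give \<open>n = r + m\<close>.\<close>
  have ZQ: "(\<Sum>j<n. Z j u * Q u' j) = (if u = u' then 1 else 0)" if u: "u < r + m" "u' < r + m" for u u'
  proof -
    let ?d = "\<lambda>u. (\<Sum>j<n. Z j u * Q u' j) - (if u = u' then 1 else 0)"
    have "(\<Sum>u<r + m. ?d u * Q u i) = 0" for i
    proof -
      have "(\<Sum>u<r + m. (\<Sum>j<n. Z j u * Q u' j) * Q u i) = (\<Sum>u<r + m. \<Sum>j<n. Q u' j * (Z j u * Q u i))"
        by (simp add: sum_distrib_left mult_ac)
      also have "\<dots> = (\<Sum>j<n. \<Sum>u<r + m. Q u' j * (Z j u * Q u i))" by (rule sum.swap)
      also have "\<dots> = (\<Sum>j<n. Q u' j * (if i = j then 1 else 0))"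
        using Z by (intro sum.cong) (simp_all add: sum_distrib_left [symmetric])
      also have "\<dots> = Q u' i"
        using Qv [OF u(2)] by (auto simp: int_vecs_def if_distrib [of "\<lambda>u. _ * u"] cong: if_cong)
      finally have 1: "(\<Sum>u<r + m. (\<Sum>j<n. Z j u * Q u' j) * Q u i) = Q u' i" .
      have 2: "(\<Sum>u<r + m. (if u = u' then 1 else 0) * Q u i) = Q u' i"
        using u(2) by (simp add: if_distrib [of "\<lambda>u. u * _"] cong: if_cong)
      show ?thesis unfolding left_diff_distrib sum_subtractf 1 2 by simp
    qed
    from Qind [OF this u(1)] show ?thesis by simp
  qed
  have nrm: "n = r + m"
    by (rule two_sided_inverse_dim [where A = "\<lambda>j u. Q u j" and B = "\<lambda>u j. Z j u"])
       (use Z ZQ in \<open>simp_all add: mult.commute\<close>)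
  have minors: "\<bar>det (mat r r (\<lambda>(a, t). W a (pick ({..<n} - g ` {..<m}) t)))\<bar> = D * \<bar>det (mat m m (\<lambda>(c, b). v b (g c)))\<bar>"
    if g: "inj_on g {..<m}" "g ` {..<m} \<subseteq> {..<n}" for g
  proof -
    let ?I = "{..<n} - g ` {..<m}"
    have cardI: "card ?I = r" using g card_Diff_subset [OF _ g(2)] card_image [OF g(1)] nrm by simp
    have pickI: "bij_betw (pick ?I) {..<r} ?I" using bij_betw_pick [of ?I] cardI by simp
    define \<rho> where "\<rho> s = (if s < r then pick ?I s else g (s - r))" for s
    have "bij_betw (\<lambda>s. g (s - r)) {r..<n} (g ` {..<m})"
    proof -
      have "bij_betw (\<lambda>s. s - r) {r..<n} {..<m}"
        by (rule bij_betw_byWitness [where f' = "\<lambda>c. c + r"]) (auto simp: nrm)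
      from bij_betw_trans [OF this inj_on_imp_bij_betw [OF g(1)]] show ?thesis by (simp add: o_def)
    qed
    then have "bij_betw \<rho> {r..<n} (g ` {..<m})" by (rule bij_betw_cong [THEN iffD1, rotated]) (simp add: \<rho>_def)
    moreover have "bij_betw \<rho> {..<r} ?I" using pickI by (rule bij_betw_cong [THEN iffD1, rotated]) (simp add: \<rho>_def)
    ultimately have "bij_betw \<rho> ({..<r} \<union> {r..<n}) (?I \<union> g ` {..<m})" by (intro bij_betw_combine) auto
    moreover have "{..<r} \<union> {r..<n} = {..<n}" "?I \<union> g ` {..<m} = {..<n}" using nrm g(2) by auto
    ultimately have \<rho>: "bij_betw \<rho> {..<n} {..<n}" by simp
    have \<rho>n: "\<rho> s < n" if "s < n" for s using bij_betwE [OF \<rho>] that by simp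
    have \<rho>inj: "\<rho> s = \<rho> t \<longleftrightarrow> s = t" if "s < n" "t < n" for s t
      using bij_betw_imp_inj_on [OF \<rho>] that by (auto simp: inj_on_def)
    define Y where "Y = mat n n (\<lambda>(s, u). Q u (\<rho> s))"
    define Y' where "Y' = mat n n (\<lambda>(u, s). Z (\<rho> s) u)"
    define Mx where "Mx = mat n n (\<lambda>(s, u). if s < r then W s (\<rho> u) else if s = u then 1 else 0)"
    let ?W = "mat r r (\<lambda>(a, t). W a (pick ?I t))" and ?V = "mat m m (\<lambda>(c, b). v b (g c))"
    have "Y * Y' = 1\<^sub>m n"
      unfolding Y_def Y'_def mat_times_mat
    proof (rule eq_matI)
      fix i j assume "i < dim_row (1\<^sub>m n :: int mat)" "j < dim_col (1\<^sub>m n :: int mat)"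
      then have ij: "i < n" "j < n" by simp_all
      have "(\<Sum>k<n. Q k (\<rho> i) * Z (\<rho> j) k) = (if \<rho> i = \<rho> j then 1 else 0)"
        using Z [OF \<rho>n [OF ij(2)], of "\<rho> i"] by (simp add: nrm mult.commute)
      then show "mat n n (\<lambda>(i, j). \<Sum>k<n. (case (i, k) of (s, u) \<Rightarrow> Q u (\<rho> s)) * (case (k, j) of (u, s) \<Rightarrow> Z (\<rho> s) u)) $$ (i, j) = 1\<^sub>m n $$ (i, j)"
        using ij \<rho>inj [OF ij] by simp
    qed simp_all
    then have "det Y * det Y' = 1"
      using det_mult [of Y n Y'] by (simp add: Y_def Y'_def)
    then have detY: "\<bar>det Y\<bar> = 1" by (auto simp: zmult_eq_1_iff)
    have Mx_block: "Mx = four_block_mat ?W (mat r m (\<lambda>(a, c). W a (g c))) (0\<^sub>m m r) (1\<^sub>m m)"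
      by (rule eq_matI) (auto simp: Mx_def \<rho>_def nrm)
    have detMx: "det Mx = det ?W"
      unfolding Mx_block by (subst det_four_block_mat_lower_left_zero [of _ r _ m]) simp_all
    have prod: "Mx * Y = four_block_mat (mat r r (\<lambda>(a, s). b s a)) (0\<^sub>m r m) (mat m r (\<lambda>(c, s). q s (g c))) ?V"
    proof (rule eq_matI)
      fix i j
      assume "i < dim_row (four_block_mat (mat r r (\<lambda>(a, s). b s a)) (0\<^sub>m r m) (mat m r (\<lambda>(c, s). q s (g c))) ?V)"
        "j < dim_col (four_block_mat (mat r r (\<lambda>(a, s). b s a)) (0\<^sub>m r m) (mat m r (\<lambda>(c, s). q s (g c))) ?V)"
      then have ij: "i < n" "j < n" by (simp_all add: nrm)
      have "(Mx * Y) $$ (i, j) = (\<Sum>k<n. (if i < r then W i (\<rho> k) else if i = k then 1 else 0) * Q j (\<rho> k))"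
        unfolding Mx_def Y_def mat_times_mat using ij by simp
      also have "\<dots> = (if i < r then mat_image W n (Q j) i else Q j (\<rho> i))"
      proof (cases "i < r")
        case True
        then show ?thesis unfolding mat_image_def
          using sum.reindex_bij_betw [OF \<rho>, of "\<lambda>k. W i k * Q j k"] by simp
      next
        case False
        then show ?thesis using ij by (simp add: if_distrib [of "\<lambda>u. u * _"] cong: if_cong)
      qed
      also have "\<dots> = (if i < r then (if j < r then b j i else 0) else Q j (\<rho> i))"
        using WQ [of j i] ij nrm by simp
      also have "\<dots> = four_block_mat (mat r r (\<lambda>(a, s). b s a)) (0\<^sub>m r m) (mat m r (\<lambda>(c, s). q s (g c))) ?V $$ (i, j)"
        using ij nrm by (auto simp: Q_def \<rho>_def)
      finally show "(Mx * Y) $$ (i, j) = four_block_mat (mat r r (\<lambda>(a, s). b s a)) (0\<^sub>m r m) (mat m r (\<lambda>(c, s). q s (g c))) ?V $$ (i, j)" .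
    qed (simp_all add: Mx_def Y_def nrm)
    have "upper_triangular (mat r r (\<lambda>(a, s). b s a))"
      unfolding upper_triangular_def using b0 by simp
    then have "det (mat r r (\<lambda>(a, s). b s a)) = prod_list (diag_mat (mat r r (\<lambda>(a, s). b s a)))"
      by (rule det_upper_triangular [where n = r]) simp
    also have "\<dots> = D"
      unfolding D_def diag_mat_def by (simp add: prod.distinct_set_conv_list [symmetric] lessThan_atLeast0)
    finally have detH: "det (mat r r (\<lambda>(a, s). b s a)) = D" .
    have "det (Mx * Y) = D * det ?V"
      unfolding prod by (subst det_four_block_mat_upper_right_zero [of _ r _ m]) (simp_all add: detH)
    moreover have "det (Mx * Y) = det Mx * det Y" by (rule det_mult [of _ n]) (simp_all add: Mx_def Y_def)
    ultimately have "det ?W * det Y = D * det ?V" by (simp add: detMx)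
    then have "\<bar>det ?W\<bar> * \<bar>det Y\<bar> = \<bar>D\<bar> * \<bar>det ?V\<bar>" by (metis abs_mult)
    then show ?thesis using detY Dpos by simp
  qed
  have fN: "\<forall>a<r. \<exists>N>0. \<exists>w. \<forall>i<p. N * f a i = mat_image U n w i"
    using fL unfolding saturation_def by blast
  show ?thesis
  proof (intro exI [of _ W] exI [of _ "F ` T0"] exI [of _ D] conjI)
    show "n = r + m" by (fact nrm)
    show "\<forall>i<p. \<forall>j<n. U i j = (\<Sum>a<r. f a i * W a j)" using UW by blast
    show "\<forall>a<r. \<exists>N>0. \<exists>w. \<forall>i<p. N * f a i = mat_image U n w i" by (fact fN)
    show "finite (F ` T0)" using T0(2) by simp
    show "F ` T0 \<subseteq> ?L" using FL by blast
    show "\<forall>t\<in>F ` T0. \<forall>t'\<in>F ` T0. (\<exists>w. \<forall>i<p. t i - t' i = mat_image U n w i) \<longrightarrow> t = t'" using Tun by blast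
  qed (use cardT Dpos Tex minors in blast)+
qed

subsection \<open>Real matrices and covolumes\<close>

text \<open>Transports real solutions of integer linear systems to rational ones.\<close>

lemma rational_functional_exists:
  assumes "x \<noteq> (0::real)"
  shows "\<exists>\<pi> :: real \<Rightarrow> rat. (\<forall>y z. \<pi> (y + z) = \<pi> y + \<pi> z) \<and> (\<forall>k y. \<pi> (of_int k * y) = of_int k * \<pi> y) \<and> \<pi> x = 1"
proof -
  interpret vp: vector_space_pair "\<lambda>(q::rat) (y::real). of_rat q * y" "(*) :: rat \<Rightarrow> rat \<Rightarrow> rat"
    by unfold_locales (simp_all add: algebra_simps of_rat_add of_rat_mult)
  have "\<not> vp.vs1.dependent {x}" using assms by (simp add: vp.vs1.dependent_single)
  then obtain \<pi> where \<pi>: "Vector_Spaces.linear (\<lambda>(q::rat) (y::real). of_rat q * y) (*) \<pi>" "\<pi> x = 1"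
    using vp.linear_independent_extend [of "{x}" "\<lambda>_. 1"] by auto
  interpret g: Vector_Spaces.linear "\<lambda>(q::rat) (y::real). of_rat q * y" "(*)" \<pi> by (fact \<pi>(1))
  have add: "\<pi> (y + z) = \<pi> y + \<pi> z" and scale: "\<pi> (of_rat q * y) = q * \<pi> y" for y z q
    by (fact g.add, fact g.scale)
  have "\<pi> (of_int k * y) = of_int k * \<pi> y" for k y
    using scale [of "of_int k" y] by simp
  with add \<pi>(2) show ?thesis by blast
qed

lemma rational_functional_sum:
  assumes "\<And>y z. (\<pi> :: real \<Rightarrow> rat) (y + z) = \<pi> y + \<pi> z" "\<And>k y. \<pi> (of_int k * y) = of_int k * \<pi> y"
  shows "\<pi> (\<Sum>a<(r::nat). of_int (c a) * y a) = (\<Sum>a<r. of_int (c a) * \<pi> (y a))"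
proof -
  have "\<pi> 0 = 0" using assms(2) [of 0 0] by simp
  then show ?thesis by (induction r) (simp_all add: assms)
qed

lemma common_denominator: "\<exists>N>0. \<exists>c. \<forall>a<(r::nat). of_int N * q a = (of_int (c a) :: rat)"
proof (induction r)
  case 0 show ?case by (intro exI [of _ "1::int"]) simp
next
  case (Suc r)
  then obtain N c where N: "N > 0" "\<forall>a<r. of_int N * q a = (of_int (c a) :: rat)" by blast
  obtain u v where uv: "q r = of_int u / of_int v" "v > 0" by (metis quotient_of_denom_pos quotient_of_div surj_pair)
  let ?c = "\<lambda>a. if a = r then N * u else v * c a"
  have c: "of_int (N * v) * q a = of_int (?c a)" if "a < Suc r" for a
    using that N(2) uv by (cases "a = r") (auto simp: mult.assoc mult.left_commute)
  have "N * v > 0" using N(1) uv(2) by simp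
  with c show ?case by (intro exI [of _ "N * v"] exI [of _ ?c] conjI allI impI)
qed

lemma rational_solution_imp_integer_solution:
  assumes "\<And>i. i < p \<Longrightarrow> (\<Sum>j<n. of_int (U i j) * w j) = (of_int (x i) :: rat)"
  shows "\<exists>N>0. \<exists>w'. (\<forall>i<p. N * x i = mat_image U n w' i) \<and> (\<forall>j<n. of_int N * w j = of_int (w' j))"
proof -
  obtain N w' where N: "N > 0" "\<forall>j<n. of_int N * w j = (of_int (w' j) :: rat)" using common_denominator by blast
  have "N * x i = mat_image U n w' i" if "i < p" for i
  proof -
    have "(of_int (N * x i) :: rat) = of_int N * (\<Sum>j<n. of_int (U i j) * w j)"
      using assms [OF that] by simp
    also have "\<dots> = (\<Sum>j<n. of_int (U i j) * (of_int N * w j))" by (simp add: sum_distrib_left mult_ac)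
    also have "\<dots> = of_int (mat_image U n w' i)" using N(2) by (simp add: mat_image_def)
    finally show ?thesis by (simp only: of_int_eq_iff)
  qed
  with N show ?thesis by blast
qed

text \<open>A functional \<pi> with \<open>\<pi> 1 = 1\<close> preserves the integral coefficients
  and right-hand sides, so it maps a real solution to a rational one, whose denominators are then
  cleared.\<close>

lemma real_solution_imp_integer_solution:
  assumes "\<And>i. i < p \<Longrightarrow> (\<Sum>j<n. of_int (U i j) * w j) = (of_int (x i) :: real)"
  shows "\<exists>N>0. \<exists>w'. \<forall>i<p. N * x i = mat_image U n w' i"
proof -
  obtain \<pi> :: "real \<Rightarrow> rat" where \<pi>: "\<And>y z. \<pi> (y + z) = \<pi> y + \<pi> z" "\<And>k y. \<pi> (of_int k * y) = of_int k * \<pi> y" "\<pi> 1 = 1"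
    using rational_functional_exists [of 1] by auto
  have sol: "(\<Sum>j<n. of_int (U i j) * \<pi> (w j)) = of_int (x i)" if "i < p" for i
    using arg_cong [OF assms [OF that], of \<pi>] rational_functional_sum [OF \<pi>(1,2), of "U i" w n] \<pi>(2) [of "x i" 1] \<pi>(3) by simp
  have "\<exists>N>0. \<exists>w'. (\<forall>i<p. N * x i = mat_image U n w' i) \<and> (\<forall>j<n. of_int N * \<pi> (w j) = of_int (w' j))"
    by (rule rational_solution_imp_integer_solution) (rule sol)
  then obtain N w' where "N > 0" "\<forall>i<p. N * x i = mat_image U n w' i" by (elim exE conjE)
  then show ?thesis by (intro exI [of _ N] exI [of _ w'] conjI)
qed

text \<open>If \<open>y a\<close> were nonzero, normalizing the functional by
  \<open>\<pi> (y a) = 1\<close> would give a nontrivial rational relation, hence an integral one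
  after clearing denominators.\<close>

lemma real_independent_if_int_independent:
  fixes f :: "nat \<Rightarrow> nat \<Rightarrow> int" and p r a :: nat
  assumes ind: "\<And>c. (\<And>i. i < p \<Longrightarrow> (\<Sum>a<r. c a * f a i) = 0) \<Longrightarrow> (\<forall>a<r. c a = (0::int))"
    and y: "\<And>i. i < p \<Longrightarrow> (\<Sum>a<r. of_int (f a i) * y a) = (0::real)" and a: "a < r"
  shows "y a = 0"
proof (rule ccontr)
  assume "y a \<noteq> 0"
  then obtain \<pi> :: "real \<Rightarrow> rat" where \<pi>: "\<And>y z. \<pi> (y + z) = \<pi> y + \<pi> z" "\<And>k y. \<pi> (of_int k * y) = of_int k * \<pi> y" "\<pi> (y a) = 1"
    using rational_functional_exists [of "y a"] by blast
  have "\<pi> 0 = 0" using \<pi>(2) [of 0 0] by simp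
  then have "(\<Sum>a<r. of_int (f a i) * \<pi> (y a)) = of_int 0" if "i < p" for i
    using arg_cong [OF y [OF that], of \<pi>] rational_functional_sum [OF \<pi>(1,2), of "\<lambda>a. f a i" y r] by simp
  from rational_solution_imp_integer_solution [where p = p and n = r and U = "\<lambda>i a. f a i" and x = "\<lambda>_. 0", OF this]
  obtain N c where N: "N > 0" "\<forall>i<p. N * 0 = mat_image (\<lambda>i a. f a i) r c i" "\<forall>a<r. of_int N * \<pi> (y a) = of_int (c a)" by blast
  then have "(\<Sum>a<r. c a * f a i) = 0" if "i < p" for i using that by (simp add: mat_image_def mult.commute)
  then have "c a = 0" using ind a by blast
  then show False using N(1,3) a \<pi>(3) by fastforce
qed

section \<open>Integer matrices and their lattices over the reals\<close>

definition real_mat :: "nat \<Rightarrow> nat \<Rightarrow> (nat \<Rightarrow> nat \<Rightarrow> int) \<Rightarrow> real mat" where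
  "real_mat p n U = mat p n (\<lambda>(i, j). of_int (U i j))"

definition real_vec :: "nat \<Rightarrow> (nat \<Rightarrow> int) \<Rightarrow> real Matrix.vec" where
  "real_vec p x = Matrix.vec p (\<lambda>i. of_int (x i))"

lemma real_mat_carrier [simp]: "real_mat p n U \<in> carrier_mat p n" "dim_row (real_mat p n U) = p" "dim_col (real_mat p n U) = n"
  by (simp_all add: real_mat_def)

lemma index_mult_mat_vec_sum:
  "A \<in> carrier_mat p n \<Longrightarrow> w \<in> carrier_vec n \<Longrightarrow> i < p \<Longrightarrow> (A *\<^sub>v w) $ i = (\<Sum>j<n. A $$ (i, j) * w $ j)"
  by (auto simp: scalar_prod_def lessThan_atLeast0 intro!: sum.cong)

lemma mult_unit_vec_eq_col:
  assumes "G \<in> carrier_mat p k" "j < k"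
  shows "G *\<^sub>v unit_vec k j = (col G j :: 'b :: comm_semiring_1 Matrix.vec)"
proof (rule eq_vecI)
  fix i assume "i < dim_vec (col G j)"
  then have i: "i < p" using assms by simp
  have "(G *\<^sub>v unit_vec k j) $ i = (\<Sum>l<k. if l = j then G $$ (i, l) else 0)"
    unfolding index_mult_mat_vec_sum [OF assms(1) unit_vec_carrier i] using assms(2) by (intro sum.cong) auto
  then show "(G *\<^sub>v unit_vec k j) $ i = col G j $ i" using assms i by simp
qed (use assms in simp)

lemma span_cols_eq:
  assumes "A \<in> carrier_mat p n"
  shows "LinearCombinations.module.span class_ring (module_vec TYPE(real) p) (set (cols A)) = (\<lambda>w. A *\<^sub>v w) ` carrier_vec n"
proof -
  interpret V: vec_space "TYPE(real)" p .
  show ?thesis using V.col_space_eq [OF assms] assms unfolding V.col_space_def by force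
qed

text \<open>An integral vector in the real column span is even a rational combination of the
  columns, so clearing denominators puts it into the saturation; conversely one divides by
  \<open>N\<close>.\<close>

lemma saturated_lattice_real_mat:
  "saturated_lattice (real_mat p n U) = real_vec p ` saturation U p n"
proof
  show "saturated_lattice (real_mat p n U) \<subseteq> real_vec p ` saturation U p n"
  proof
    fix x assume "x \<in> saturated_lattice (real_mat p n U)"
    then obtain w where w: "w \<in> carrier_vec n" "x = real_mat p n U *\<^sub>v w" and x: "x \<in> carrier_vec p" "\<forall>i<p. x $ i \<in> \<int>"
      unfolding saturated_lattice_def real_mat_carrier span_cols_eq [OF real_mat_carrier(1)] integer_vecs_def by blast
    define z where "z i = (if i < p then \<lfloor>x $ i\<rfloor> else 0)" for i
    have z: "of_int (z i) = x $ i" if "i < p" for i using x(2) that by (simp add: z_def)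
    have "(\<Sum>j<n. of_int (U i j) * w $ j) = of_int (z i)" if "i < p" for i
      unfolding z [OF that] w(2) index_mult_mat_vec_sum [OF real_mat_carrier(1) w(1) that] using that
      by (intro sum.cong) (simp_all add: real_mat_def)
    from real_solution_imp_integer_solution [where w = "\<lambda>j. w $ j", OF this]
    have "\<exists>N>0. \<exists>w. \<forall>i<p. N * z i = mat_image U n w i" .
    then have "z \<in> saturation U p n" by (simp add: saturation_def int_vecs_def z_def)
    moreover have "x = real_vec p z" using x(1) z by (intro eq_vecI) (simp_all add: real_vec_def)
    ultimately show "x \<in> real_vec p ` saturation U p n" by blast
  qed
  show "real_vec p ` saturation U p n \<subseteq> saturated_lattice (real_mat p n U)"
  proof
    fix y assume "y \<in> real_vec p ` saturation U p n"
    then obtain x N w where y: "y = real_vec p x" and N: "N > 0" "\<forall>i<p. N * x i = mat_image U n w i"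
      unfolding saturation_def by blast
    let ?w = "Matrix.vec n (\<lambda>j. of_int (w j) / of_int N :: real)"
    have "real_mat p n U *\<^sub>v ?w = y"
    proof (rule eq_vecI)
      fix i assume "i < dim_vec y"
      then have i: "i < p" by (simp add: y real_vec_def)
      have "(real_mat p n U *\<^sub>v ?w) $ i = (\<Sum>j<n. of_int (U i j) * (of_int (w j) / of_int N))"
        unfolding index_mult_mat_vec_sum [OF real_mat_carrier(1) vec_carrier i] using i
        by (intro sum.cong) (simp_all add: real_mat_def)
      also have "\<dots> = of_int (mat_image U n w i) / of_int N"
        by (simp add: mat_image_def sum_divide_distrib)
      also have "\<dots> = of_int (N * x i) / of_int N" using N(2) i by simp
      finally show "(real_mat p n U *\<^sub>v ?w) $ i = y $ i" using N(1) i by (simp add: y real_vec_def)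
    qed (simp add: y real_vec_def)
    moreover have "y \<in> integer_vecs p" by (simp add: integer_vecs_def y real_vec_def)
    ultimately show "y \<in> saturated_lattice (real_mat p n U)"
      unfolding saturated_lattice_def real_mat_carrier span_cols_eq [OF real_mat_carrier(1)] by (metis IntI imageI vec_carrier)
  qed
qed

text \<open>The segment from the identity to the Gram matrix consists of invertible matrices; the
  determinant is 1 at the start and cannot change sign.\<close>

lemma gram_det_pos:
  fixes F :: "real mat"
  assumes F: "F \<in> carrier_mat p r" and inj: "\<And>x. x \<in> carrier_vec r \<Longrightarrow> F *\<^sub>v x = 0\<^sub>v p \<Longrightarrow> x = 0\<^sub>v r"
  shows "0 < Determinant.det (transpose_mat F * F)"
proof -
  let ?G = "transpose_mat F * F"
  have G: "?G \<in> carrier_mat r r" using F by simp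
  define M where "M t = mat r r (\<lambda>(i, j). (1 - t) * (if i = j then 1 else 0) + t * ?G $$ (i, j))" for t :: real
  have M: "M t \<in> carrier_mat r r" for t by (simp add: M_def)
  \<comment> \<open>For \<open>x\<close> in the kernel, \<open>1 - t\<close> times the squared norm
    of \<open>x\<close> plus \<open>t\<close> times that of \<open>F x\<close> would be 0; both
    terms are nonnegative, and injectivity of \<open>F\<close> makes one of them positive for
    nonzero \<open>x\<close>.\<close>
  have ne: "Determinant.det (M t) \<noteq> 0" if t: "0 \<le> t" "t \<le> 1" for t
  proof
    assume "Determinant.det (M t) = 0"
    then obtain x where x: "x \<in> carrier_vec r" "x \<noteq> 0\<^sub>v r" "M t *\<^sub>v x = 0\<^sub>v r"
      using det_0_iff_vec_prod_zero [OF M] by blast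
    have Fx: "F *\<^sub>v x \<in> carrier_vec p" by (rule mult_mat_vec_carrier [OF F x(1)])
    have "M t *\<^sub>v x = (1 - t) \<cdot>\<^sub>v x + t \<cdot>\<^sub>v (?G *\<^sub>v x)"
    proof (rule eq_vecI)
      fix i assume "i < dim_vec ((1 - t) \<cdot>\<^sub>v x + t \<cdot>\<^sub>v (?G *\<^sub>v x))"
      then have i: "i < r" using F by simp
      have "(M t *\<^sub>v x) $ i = (\<Sum>j<r. ((1 - t) * (if i = j then 1 else 0) + t * ?G $$ (i, j)) * x $ j)"
        unfolding index_mult_mat_vec_sum [OF M x(1) i] using i by (intro sum.cong) (simp_all add: M_def)
      also have "\<dots> = (\<Sum>j<r. if i = j then (1 - t) * x $ j else 0) + t * (\<Sum>j<r. ?G $$ (i, j) * x $ j)"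
        by (simp add: distrib_right sum.distrib sum_distrib_left mult.assoc if_distrib [of "\<lambda>u. _ * u"] if_distrib [of "\<lambda>u. u * _"] cong: if_cong)
      also have "\<dots> = ((1 - t) \<cdot>\<^sub>v x + t \<cdot>\<^sub>v (?G *\<^sub>v x)) $ i"
        using i x(1) F index_mult_mat_vec_sum [OF G x(1) i] by simp
      finally show "(M t *\<^sub>v x) $ i = ((1 - t) \<cdot>\<^sub>v x + t \<cdot>\<^sub>v (?G *\<^sub>v x)) $ i" .
    qed (use F in \<open>simp add: M_def\<close>)
    then have e0: "(1 - t) \<cdot>\<^sub>v x + t \<cdot>\<^sub>v (?G *\<^sub>v x) = 0\<^sub>v r" using x(3) by (simp only:)
    have "0 = x \<bullet> ((1 - t) \<cdot>\<^sub>v x + t \<cdot>\<^sub>v (?G *\<^sub>v x))" unfolding e0 using x(1) by simp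
    also have "\<dots> = (1 - t) * (x \<bullet> x) + t * (x \<bullet> (?G *\<^sub>v x))"
      using x(1) F by (subst scalar_prod_add_distrib [of _ r]) simp_all
    also have "x \<bullet> (?G *\<^sub>v x) = (F *\<^sub>v x) \<bullet> (F *\<^sub>v x)"
    proof -
      have "?G *\<^sub>v x = transpose_mat F *\<^sub>v (F *\<^sub>v x)" by (rule assoc_mult_mat_vec) (use F x in auto)
      moreover have "transpose_mat F *\<^sub>v (F *\<^sub>v x) \<in> carrier_vec r" by (rule mult_mat_vec_carrier [OF _ Fx]) (use F in simp)
      ultimately show ?thesis using transpose_vec_mult_scalar [OF F x(1) Fx] comm_scalar_prod [OF x(1)] by metis
    qed
    finally have e: "0 = (1 - t) * (x \<bullet> x) + t * ((F *\<^sub>v x) \<bullet> (F *\<^sub>v x))" .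
    have pos: "0 \<le> v \<bullet> v" for v :: "real Matrix.vec" by (simp add: scalar_prod_def sum_nonneg)
    have zero: "v = 0\<^sub>v k" if "v \<in> carrier_vec k" "v \<bullet> v = 0" for v :: "real Matrix.vec" and k
    proof (rule eq_vecI)
      fix i assume "i < dim_vec (0\<^sub>v k :: real Matrix.vec)"
      then show "v $ i = 0\<^sub>v k $ i" using that by (simp add: scalar_prod_def sum_nonneg_eq_0_iff)
    qed (use that in simp)
    have nn: "0 \<le> (1 - t) * (x \<bullet> x)" "0 \<le> t * ((F *\<^sub>v x) \<bullet> (F *\<^sub>v x))" using t pos by simp_all
    show False
    proof (cases "t = 1")
      case True
      then have "(F *\<^sub>v x) \<bullet> (F *\<^sub>v x) = 0" using e by simp
      then show False using inj [OF x(1) zero [OF Fx]] x(2) by blast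
    next
      case False
      have "(1 - t) * (x \<bullet> x) = 0" using e nn by linarith
      then have "x \<bullet> x = 0" using False by simp
      then show False using zero [OF x(1)] x(2) by blast
    qed
  qed
  have cont: "continuous_on {0..1} (\<lambda>t. Determinant.det (M t))"
    unfolding det_def' [OF M] by (intro continuous_intros continuous_on_sum continuous_on_prod)
      (auto simp: M_def intro!: continuous_intros)
  have "M 0 = 1\<^sub>m r" by (rule eq_matI) (simp_all add: M_def)
  then have d0: "Determinant.det (M 0) = 1" by simp
  have "M 1 = ?G" by (rule eq_matI) (use F in \<open>simp_all add: M_def\<close>)
  then have d1: "Determinant.det (M 1) = Determinant.det ?G" by simp
  show ?thesis
  proof (rule ccontr)
    assume "\<not> ?thesis"
    then have "Determinant.det (M 1) \<le> 0" "0 \<le> Determinant.det (M 0)" using d0 d1 by simp_all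
    then obtain t where "0 \<le> t" "t \<le> 1" "Determinant.det (M t) = 0"
      using IVT2' [of "\<lambda>t. Determinant.det (M t)" 1 0 0] cont by auto
    with ne show False by blast
  qed
qed

text \<open>The two changes of basis are integral and mutually inverse, so their determinants are 1
  or -1, and the Gram determinant is multiplied by the square. This makes \<open>covolume\<close>
  independent of the basis.\<close>

lemma lattice_basis_mat_unique:
  assumes F: "lattice_basis_mat p L F" and F': "lattice_basis_mat p L F'"
  shows "dim_col F' = dim_col F" and "Determinant.det (transpose_mat F' * F') = Determinant.det (transpose_mat F * F)"
proof -
  \<comment> \<open>Each column of \<open>F'\<close> is the image of a unit vector, hence lies in
    the lattice, hence is an integral combination of the columns of \<open>F\<close>.\<close>
  have factor: "\<exists>A :: int mat. A \<in> carrier_mat (dim_col F) (dim_col F') \<and> F' = F * map_mat of_int A"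
    if F: "lattice_basis_mat p L F" and F': "lattice_basis_mat p L F'" for F F' :: "real mat"
  proof -
    have "\<exists>x. x \<in> carrier_vec (dim_col F) \<and> col F' b = F *\<^sub>v map_vec of_int x" if b: "b < dim_col F'" for b
    proof -
      have "F' *\<^sub>v map_vec of_int (unit_vec (dim_col F') b) = col F' b"
      proof -
        have "map_vec of_int (unit_vec (dim_col F') b) = (unit_vec (dim_col F') b :: real Matrix.vec)"
          by (rule eq_vecI) (simp_all add: unit_vec_def)
        then show ?thesis using mult_unit_vec_eq_col [of F' "dim_row F'" "dim_col F'" b] b by auto
      qed
      then have "col F' b \<in> L" using F' b unfolding lattice_basis_mat_def by (metis imageI unit_vec_carrier)
      then show ?thesis using F unfolding lattice_basis_mat_def by blast
    qed
    then obtain X where X: "\<And>b. b < dim_col F' \<Longrightarrow> X b \<in> carrier_vec (dim_col F) \<and> col F' b = F *\<^sub>v map_vec of_int (X b)" by metis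
    let ?A = "mat (dim_col F) (dim_col F') (\<lambda>(a, b). X b $ a)"
    have dims: "dim_row F = p" "dim_row F' = p" using F F' by (simp_all add: lattice_basis_mat_def)
    have "F' = F * map_mat of_int ?A"
    proof (rule eq_matI)
      fix i b assume "i < dim_row (F * map_mat of_int ?A)" "b < dim_col (F * map_mat of_int ?A)"
      then have ib: "i < p" "b < dim_col F'" using dims by simp_all
      have colA: "col (map_mat of_int ?A) b = map_vec of_int (X b)"
      proof -
        have "dim_vec (X b) = dim_col F" using X [OF ib(2)] by simp
        then show ?thesis using ib(2) by (intro eq_vecI) simp_all
      qed
      have "F' $$ (i, b) = col F' b $ i" using ib dims by simp
      also have "\<dots> = Matrix.row F i \<bullet> map_vec of_int (X b)" using X [OF ib(2)] ib dims by simp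
      also have "\<dots> = Matrix.row F i \<bullet> col (map_mat of_int ?A) b" unfolding colA ..
      also have "\<dots> = (F * map_mat of_int ?A) $$ (i, b)" using ib dims by (subst index_mult_mat(1)) simp_all
      finally show "F' $$ (i, b) = (F * map_mat of_int ?A) $$ (i, b)" .
    qed (use dims in simp_all)
    moreover have "?A \<in> carrier_mat (dim_col F) (dim_col F')" by simp
    ultimately show ?thesis by blast
  qed
  let ?r = "dim_col F" and ?r' = "dim_col F'"
  have dF: "F \<in> carrier_mat p ?r" "F' \<in> carrier_mat p ?r'" using F F' by (auto simp: lattice_basis_mat_def)
  obtain A :: "int mat" where A: "A \<in> carrier_mat ?r ?r'" "F' = F * map_mat of_int A" using factor [OF F F'] by blast
  obtain B :: "int mat" where B: "B \<in> carrier_mat ?r' ?r" "F = F' * map_mat of_int B" using factor [OF F' F] by blast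
  \<comment> \<open>Injectivity of \<open>G\<close> as a linear map allows cancelling it on the
    left.\<close>
  have cancel: "C = 1\<^sub>m k" if G: "G \<in> carrier_mat p k" "\<forall>x \<in> carrier_vec k. G *\<^sub>v x = 0\<^sub>v p \<longrightarrow> x = 0\<^sub>v k"
    and C: "C \<in> carrier_mat k k" "G = G * C" for G C :: "real mat" and k
  proof (rule eq_matI)
    fix i j assume "i < dim_row (1\<^sub>m k :: real mat)" "j < dim_col (1\<^sub>m k :: real mat)"
    then have ij: "i < k" "j < k" by simp_all
    let ?x = "col C j - unit_vec k j"
    have x: "?x \<in> carrier_vec k" using C ij by simp
    have "G *\<^sub>v ?x = G *\<^sub>v col C j - G *\<^sub>v unit_vec k j"
      by (rule mult_minus_distrib_mat_vec [OF G(1)]) (use C ij in auto)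
    also have "G *\<^sub>v col C j = col (G * C) j" using col_mult2 [OF G(1) C(1) ij(2)] by simp
    also have "\<dots> = col G j" using C(2) by simp
    also have "G *\<^sub>v unit_vec k j = col G j" using mult_unit_vec_eq_col [OF G(1) ij(2)] .
    finally have "G *\<^sub>v ?x = 0\<^sub>v p" using G(1) by auto
    then have "?x = 0\<^sub>v k" using G(2) x by blast
    then have "?x $ i = 0" using ij by simp
    then show "C $$ (i, j) = 1\<^sub>m k $$ (i, j)" using ij C(1) by (simp add: unit_vec_def split: if_splits)
  qed (use C(1) in simp_all)
  let ?A = "map_mat real_of_int A" and ?B = "map_mat real_of_int B"
  have cAB: "?A \<in> carrier_mat ?r ?r'" "?B \<in> carrier_mat ?r' ?r" using A(1) B(1) by simp_all
  have injF: "\<forall>x \<in> carrier_vec ?r. F *\<^sub>v x = 0\<^sub>v p \<longrightarrow> x = 0\<^sub>v ?r"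
    and injF': "\<forall>x \<in> carrier_vec ?r'. F' *\<^sub>v x = 0\<^sub>v p \<longrightarrow> x = 0\<^sub>v ?r'"
    using F F' unfolding lattice_basis_mat_def by blast+
  have AB: "?A * ?B = 1\<^sub>m ?r"
  proof (rule cancel [OF dF(1) injF mult_carrier_mat [OF cAB]])
    have "F * (?A * ?B) = F * ?A * ?B" by (rule assoc_mult_mat [OF dF(1) cAB, symmetric])
    also have "\<dots> = F" unfolding A(2) [symmetric] by (rule B(2) [symmetric])
    finally show "F = F * (?A * ?B)" by (rule sym)
  qed
  have BA: "?B * ?A = 1\<^sub>m ?r'"
  proof (rule cancel [OF dF(2) injF' mult_carrier_mat [OF cAB(2,1)]])
    have "F' * (?B * ?A) = F' * ?B * ?A" by (rule assoc_mult_mat [OF dF(2) cAB(2,1), symmetric])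
    also have "\<dots> = F'" unfolding B(2) [symmetric] by (rule A(2) [symmetric])
    finally show "F' = F' * (?B * ?A)" by (rule sym)
  qed
  have ent: "(C * C') $$ (i, i) = (\<Sum>u<b. C $$ (i, u) * C' $$ (u, i))"
    if "C \<in> carrier_mat a b" "C' \<in> carrier_mat b a" "i < a" for C C' :: "real mat" and a b i
    using that by (auto simp: scalar_prod_def lessThan_atLeast0 intro!: sum.cong)
  \<comment> \<open>The transition matrices must be known to be square before their determinants can
    be multiplied.\<close>
  have "?r = ?r'"
  proof (rule two_sided_inverse_dim [where A = "\<lambda>i u. ?A $$ (i, u)" and B = "\<lambda>u i. ?B $$ (u, i)"])
    show "(\<Sum>u<?r'. ?A $$ (j, u) * ?B $$ (u, j)) = 1" if "j < ?r" for j
      using ent [of ?A ?r ?r' ?B j] AB A(1) B(1) that by simp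
    show "(\<Sum>j<?r. ?B $$ (u, j) * ?A $$ (j, u)) = 1" if "u < ?r'" for u
      using ent [of ?B ?r' ?r ?A u] BA A(1) B(1) that by simp
  qed
  then show rr: "?r' = ?r" by simp
  have cA: "?A \<in> carrier_mat ?r ?r" "?B \<in> carrier_mat ?r ?r" "A \<in> carrier_mat ?r ?r" "B \<in> carrier_mat ?r ?r" using A(1) B(1) rr by simp_all
  have "Determinant.det ?A * Determinant.det ?B = 1" using AB det_mult [OF cA(1,2)] by simp
  then have "of_int (Determinant.det A * Determinant.det B) = (1::real)" by simp
  then have "Determinant.det A * Determinant.det B = 1" by (simp only: of_int_eq_1_iff)
  then have "Determinant.det A = 1 \<or> Determinant.det A = -1" by (auto simp: zmult_eq_1_iff)
  then have dA: "Determinant.det ?A * Determinant.det ?A = 1" by auto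
  have tF: "transpose_mat F \<in> carrier_mat ?r p" by (rule transpose_carrier_mat [THEN iffD2, OF dF(1)])
  have G: "transpose_mat F * F \<in> carrier_mat ?r ?r" by (rule mult_carrier_mat [OF tF dF(1)])
  have tA: "transpose_mat ?A \<in> carrier_mat ?r ?r" using cA by simp
  have "transpose_mat F' * F' = (transpose_mat ?A * transpose_mat F) * (F * ?A)"
    unfolding A(2) by (simp only: transpose_mult [OF dF(1) cA(1)])
  also have "\<dots> = transpose_mat ?A * (transpose_mat F * (F * ?A))"
    by (rule assoc_mult_mat [OF tA tF mult_carrier_mat [OF dF(1) cA(1)]])
  also have "transpose_mat F * (F * ?A) = transpose_mat F * F * ?A"
    by (rule assoc_mult_mat [OF tF dF(1) cA(1), symmetric])
  finally have "Determinant.det (transpose_mat F' * F') = Determinant.det (transpose_mat ?A) * (Determinant.det (transpose_mat F * F) * Determinant.det ?A)"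
    using det_mult [OF tA mult_carrier_mat [OF G cA(1)]] det_mult [OF G cA(1)] by simp
  also have "\<dots> = Determinant.det (transpose_mat F * F)"
    using det_transpose [OF cA(1)] dA by (simp add: mult_ac)
  finally show "Determinant.det (transpose_mat F' * F') = Determinant.det (transpose_mat F * F)" .
qed

lemma covolume_eq:
  assumes "lattice_basis_mat p L F"
  shows "covolume p L = sqrt (Determinant.det (transpose_mat F * F))"
  unfolding covolume_def
proof (rule the_equality)
  fix c assume "\<exists>F. lattice_basis_mat p L F \<and> c = sqrt (Determinant.det (transpose_mat F * F))"
  then obtain F' where F': "lattice_basis_mat p L F'" "c = sqrt (Determinant.det (transpose_mat F' * F'))" by (elim exE conjE)
  show "c = sqrt (Determinant.det (transpose_mat F * F))"
    unfolding F'(2) lattice_basis_mat_unique(2) [OF assms F'(1)] ..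
qed (intro exI [of _ F] conjI assms refl)

lemma real_mat_mult_vec: "x \<in> carrier_vec n \<Longrightarrow> i < p \<Longrightarrow> (real_mat p n U *\<^sub>v x) $ i = (\<Sum>j<n. of_int (U i j) * x $ j)"
  by (subst index_mult_mat_vec_sum [OF real_mat_carrier(1)]) (simp_all add: real_mat_def)

text \<open>Independence over the integers passes to the reals by
  \<open>real_independent_if_int_independent\<close>; generation is by integral combinations on both
  sides.\<close>

lemma lattice_basis_mat_saturation:
  assumes f: "int_basis (saturation U p n) r f"
  shows "lattice_basis_mat p (saturated_lattice (real_mat p n U)) (real_mat p r (\<lambda>i a. f a i))" (is "lattice_basis_mat p _ ?F")
  unfolding lattice_basis_mat_def real_mat_carrier
proof (intro conjI ballI impI)
  have f0: "f a i = 0" if "a < r" "p \<le> i" for a i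
    using int_basisD(1) [OF f that(1)] that(2) by (simp add: saturation_def int_vecs_def)
  have ind: "\<forall>a<r. c a = 0" if c: "\<And>i. i < p \<Longrightarrow> (\<Sum>a<r. c a * f a i) = 0" for c
  proof -
    have "(\<Sum>a<r. c a * f a i) = 0" for i
      using c f0 by (cases "i < p") simp_all
    then show ?thesis using int_basisD(3) [OF f] by blast
  qed
  show "x = 0\<^sub>v r" if x: "x \<in> carrier_vec r" "?F *\<^sub>v x = 0\<^sub>v p" for x
  proof (rule eq_vecI)
    fix a assume "a < dim_vec (0\<^sub>v r :: real Matrix.vec)"
    then have a: "a < r" by simp
    have "(\<Sum>a<r. of_int (f a i) * x $ a) = 0" if "i < p" for i
      using real_mat_mult_vec [OF x(1) that, where U = "\<lambda>i a. f a i"] x(2) that by simp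
    from real_independent_if_int_independent [where f = f and p = p and r = r and y = "\<lambda>a. x $ a", OF ind this a]
    show "x $ a = 0\<^sub>v r $ a" using a by simp
  qed (use x(1) in simp)
  have img: "?F *\<^sub>v map_vec real_of_int x = real_vec p (\<lambda>i. \<Sum>a<r. x $ a * f a i)" if x: "x \<in> carrier_vec r" for x
  proof (rule eq_vecI)
    fix i assume "i < dim_vec (real_vec p (\<lambda>i. \<Sum>a<r. x $ a * f a i))"
    then have i: "i < p" by (simp add: real_vec_def)
    have "map_vec real_of_int x \<in> carrier_vec r" using x by simp
    from real_mat_mult_vec [OF this i, where U = "\<lambda>i a. f a i"]
    show "(?F *\<^sub>v map_vec real_of_int x) $ i = real_vec p (\<lambda>i. \<Sum>a<r. x $ a * f a i) $ i"
      using x i by (simp add: real_vec_def mult.commute)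
  qed (simp add: real_vec_def)
  show "saturated_lattice (real_mat p n U) = (\<lambda>x. ?F *\<^sub>v map_vec real_of_int x) ` carrier_vec r"
    unfolding saturated_lattice_real_mat
  proof
    show "real_vec p ` saturation U p n \<subseteq> (\<lambda>x. ?F *\<^sub>v map_vec real_of_int x) ` carrier_vec r"
    proof
      fix z assume "z \<in> real_vec p ` saturation U p n"
      then obtain x where x: "x \<in> saturation U p n" "z = real_vec p x" by blast
      obtain c where c: "\<And>i. x i = (\<Sum>a<r. c a * f a i)" using int_basisD(2) [OF f x(1)] by blast
      have "?F *\<^sub>v map_vec real_of_int (Matrix.vec r c) = z"
        unfolding img [OF vec_carrier] x(2) c by (simp add: real_vec_def)
      then show "z \<in> (\<lambda>x. ?F *\<^sub>v map_vec real_of_int x) ` carrier_vec r" by (metis imageI vec_carrier)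
    qed
    show "(\<lambda>x. ?F *\<^sub>v map_vec real_of_int x) ` carrier_vec r \<subseteq> real_vec p ` saturation U p n"
    proof
      fix z assume "z \<in> (\<lambda>x. ?F *\<^sub>v map_vec real_of_int x) ` carrier_vec r"
      then obtain x where x: "x \<in> carrier_vec r" "z = real_vec p (\<lambda>i. \<Sum>a<r. x $ a * f a i)" using img by auto
      have "(\<lambda>i. \<Sum>a<s. x $ a * f a i) \<in> saturation U p n" if "s \<le> r" for s
        using that
      proof (induction s)
        case 0
        then show ?case using int_subgroupD(1) [OF int_subgroup_saturation] by simp
      next
        case (Suc s)
        then have "(\<lambda>i. x $ s * f s i) \<in> saturation U p n"
          using int_subgroupD [OF int_subgroup_saturation] int_basisD(1) [OF f] by simp
        then show ?case using int_subgroupD [OF int_subgroup_saturation] Suc by simp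
      qed
      then show "z \<in> real_vec p ` saturation U p n" using x(2) by blast
    qed
  qed
qed simp

text \<open>Each of \<open>U\<close> and \<open>F\<close> factors through the other, so both have
  the same column space, and the columns of \<open>F\<close> are a basis of it.\<close>

lemma rank_eq_of_factorization:
  fixes U F W G :: "real mat"
  assumes U: "U \<in> carrier_mat p n" "U = F * W" and F: "F \<in> carrier_mat p r" "F = U * G"
    and W: "W \<in> carrier_mat r n" and G: "G \<in> carrier_mat n r"
    and inj: "\<And>x. x \<in> carrier_vec r \<Longrightarrow> F *\<^sub>v x = 0\<^sub>v p \<Longrightarrow> x = 0\<^sub>v r"
  shows "vec_space.rank p U = r"
proof -
  interpret V: vec_space "TYPE(real)" p .
  have "(\<lambda>w. U *\<^sub>v w) ` carrier_vec n = (\<lambda>x. F *\<^sub>v x) ` carrier_vec r"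
  proof (intro equalityI subsetI)
    fix z assume "z \<in> (\<lambda>w. U *\<^sub>v w) ` carrier_vec n"
    then obtain w where w: "w \<in> carrier_vec n" "z = U *\<^sub>v w" by blast
    have "z = F *\<^sub>v (W *\<^sub>v w)" unfolding w(2) U(2) by (rule assoc_mult_mat_vec [OF F(1) W w(1)])
    then show "z \<in> (\<lambda>x. F *\<^sub>v x) ` carrier_vec r" using mult_mat_vec_carrier [OF W w(1)] by blast
  next
    fix z assume "z \<in> (\<lambda>x. F *\<^sub>v x) ` carrier_vec r"
    then obtain x where x: "x \<in> carrier_vec r" "z = F *\<^sub>v x" by blast
    have "z = (U * G) *\<^sub>v x" using x(2) F(2) by simp
    also have "\<dots> = U *\<^sub>v (G *\<^sub>v x)" by (rule assoc_mult_mat_vec [OF U(1) G x(1)])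
    finally show "z \<in> (\<lambda>w. U *\<^sub>v w) ` carrier_vec n" using mult_mat_vec_carrier [OF G x(1)] by blast
  qed
  then have "V.rank U = V.rank F"
    unfolding V.rank_def span_cols_eq [OF U(1)] span_cols_eq [OF F(1)] by simp
  moreover have dist: "distinct (cols F)"
    unfolding distinct_conv_nth
  proof (intro allI impI notI)
    fix i j assume ij: "i < length (cols F)" "j < length (cols F)" "i \<noteq> j" and eq: "cols F ! i = cols F ! j"
    then have ir: "i < r" "j < r" using F(1) by simp_all
    have "F *\<^sub>v (unit_vec r i - unit_vec r j) = F *\<^sub>v unit_vec r i - F *\<^sub>v unit_vec r j"
      by (rule mult_minus_distrib_mat_vec [OF F(1)]) simp_all
    also have "\<dots> = col F i - col F j" unfolding mult_unit_vec_eq_col [OF F(1) ir(1)] mult_unit_vec_eq_col [OF F(1) ir(2)] ..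
    also have "\<dots> = 0\<^sub>v p" using eq ij F(1) by auto
    finally have "unit_vec r i - unit_vec r j = (0\<^sub>v r :: real Matrix.vec)" using inj by simp
    then have "(unit_vec r i - unit_vec r j) $ i = (0 :: real)" using ir by simp
    then show False using ir ij(3) by simp
  qed
  moreover have "\<not> V.lin_dep (set (cols F))"
  proof
    assume "V.lin_dep (set (cols F))"
    then obtain x where "x \<in> carrier_vec r" "x \<noteq> 0\<^sub>v r" "F *\<^sub>v x = 0\<^sub>v p" using V.lin_depE [OF F(1) _ dist] by blast
    then show False using inj by blast
  qed
  ultimately show ?thesis using V.lin_indpt_full_rank [OF F(1)] by simp
qed

lemma mult_real_mat: "real_mat p r f * real_mat r n W = real_mat p n (\<lambda>i j. \<Sum>a<r. f i a * W a j)"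
  by (rule eq_matI) (auto simp: real_mat_def scalar_prod_def lessThan_atLeast0)

lemma gram_det_mult:
  fixes F W :: "real mat"
  assumes F: "F \<in> carrier_mat p r" and W: "W \<in> carrier_mat r r"
  shows "Determinant.det (transpose_mat (F * W) * (F * W)) = (Determinant.det W)\<^sup>2 * Determinant.det (transpose_mat F * F)"
proof -
  have tF: "transpose_mat F \<in> carrier_mat r p" and tW: "transpose_mat W \<in> carrier_mat r r" using F W by simp_all
  have G: "transpose_mat F * F \<in> carrier_mat r r" by (rule mult_carrier_mat [OF tF F])
  have "transpose_mat (F * W) * (F * W) = (transpose_mat W * transpose_mat F) * (F * W)"
    by (simp only: transpose_mult [OF F W])
  also have "\<dots> = transpose_mat W * (transpose_mat F * (F * W))"
    by (rule assoc_mult_mat [OF tW tF mult_carrier_mat [OF F W]])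
  also have "transpose_mat F * (F * W) = transpose_mat F * F * W"
    by (rule assoc_mult_mat [OF tF F W, symmetric])
  finally have "Determinant.det (transpose_mat (F * W) * (F * W))
      = Determinant.det (transpose_mat W) * (Determinant.det (transpose_mat F * F) * Determinant.det W)"
    using det_mult [OF tW mult_carrier_mat [OF G W]] det_mult [OF G W] by simp
  then show ?thesis using det_transpose [OF W] by (simp add: power2_eq_square mult_ac)
qed

text \<open>The power of the covolume cancels the Gram determinant of the lattice basis, and
  evenness of \<open>k\<close> makes the power \<open>k div 2\<close> of a square a
  \<open>k\<close>-th power. The complement of the column set is given by an injection
  \<open>g\<close>, as the expansion of the hyperdeterminant supplies it.\<close>

theorem cokernel_torsion_and_minors:
  assumes v: "int_basis (mat_kernel U p n) m v"
  shows "\<exists>r T. n = r + m \<and> vec_space.rank p (real_mat p n U) = r \<and> finite T \<and> T \<subseteq> saturation U p n \<and>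
     (\<forall>x\<in>saturation U p n. \<exists>t\<in>T. \<exists>w. \<forall>i<p. x i - t i = mat_image U n w i) \<and>
     (\<forall>t\<in>T. \<forall>t'\<in>T. (\<exists>w. \<forall>i<p. t i - t' i = mat_image U n w i) \<longrightarrow> t = t') \<and>
     (\<forall>g k. inj_on g {..<m} \<and> g ` {..<m} \<subseteq> {..<n} \<and> even k \<longrightarrow>
       (let U' = submatrix (real_mat p n U) UNIV ({..<n} - g ` {..<m}) in
        Determinant.det (transpose_mat U' * U') ^ (k div 2) / covolume p (saturated_lattice (real_mat p n U)) ^ k
          = (real (card T) * of_int (Determinant.det (mat m m (\<lambda>(c, b). v b (g c))))) ^ k))"
proof -
  have "saturation U p n \<subseteq> int_vecs p" by (auto simp: saturation_def)
  then obtain r f where f: "int_basis (saturation U p n) r f" using int_basis_exists [OF _ int_subgroup_saturation] by blast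
  obtain W T and D :: int where nr: "n = r + m" and UW: "\<forall>i<p. \<forall>j<n. U i j = (\<Sum>a<r. f a i * W a j)"
    and Nf: "\<forall>a<r. \<exists>N>0. \<exists>w. \<forall>i<p. N * f a i = mat_image U n w i"
    and T: "finite T" "T \<subseteq> saturation U p n" "int (card T) = D" "0 < D"
      "\<forall>x\<in>saturation U p n. \<exists>t\<in>T. \<exists>w. \<forall>i<p. x i - t i = mat_image U n w i"
      "\<forall>t\<in>T. \<forall>t'\<in>T. (\<exists>w. \<forall>i<p. t i - t' i = mat_image U n w i) \<longrightarrow> t = t'"
    and minors: "\<forall>g. inj_on g {..<m} \<and> g ` {..<m} \<subseteq> {..<n} \<longrightarrow>
       \<bar>Determinant.det (mat r r (\<lambda>(a, t). W a (pick ({..<n} - g ` {..<m}) t)))\<bar>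
         = D * \<bar>Determinant.det (mat m m (\<lambda>(c, b). v b (g c)))\<bar>"
    using integer_matrix_structure [OF v f] by (elim exE conjE) rule
  let ?U = "real_mat p n U" and ?F = "real_mat p r (\<lambda>i a. f a i)" and ?W = "real_mat r n W"
  let ?L = "saturated_lattice ?U"
  have F: "?F \<in> carrier_mat p r" by simp
  have basis: "lattice_basis_mat p ?L ?F" by (rule lattice_basis_mat_saturation [OF f])
  then have inj: "\<And>x. x \<in> carrier_vec r \<Longrightarrow> ?F *\<^sub>v x = 0\<^sub>v p \<Longrightarrow> x = 0\<^sub>v r"
    unfolding lattice_basis_mat_def real_mat_carrier by blast
  have pos: "0 < Determinant.det (transpose_mat ?F * ?F)" by (rule gram_det_pos [OF F inj])
  have eqU: "?U = ?F * ?W"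
    unfolding mult_real_mat using UW by (intro eq_matI) (simp_all add: real_mat_def)
  obtain N w where Nw: "\<And>a. a < r \<Longrightarrow> 0 < N a" "\<And>a i. a < r \<Longrightarrow> i < p \<Longrightarrow> N a * f a i = mat_image U n (w a) i"
    using Nf by metis
  \<comment> \<open>Up to denominators the saturation adds nothing to the column span:
    \<open>?G\<close> expresses each basis vector by columns of \<open>U\<close>, after division by
    \<open>N a\<close>.\<close>
  let ?G = "mat n r (\<lambda>(j, a). of_int (w a j) / of_int (N a)) :: real mat"
  have eqF: "?F = ?U * ?G"
  proof (rule eq_matI)
    fix i a assume "i < dim_row (?U * ?G)" "a < dim_col (?U * ?G)"
    then have ia: "i < p" "a < r" by simp_all
    have "(?U * ?G) $$ (i, a) = (\<Sum>j<n. of_int (U i j) * (of_int (w a j) / of_int (N a)))"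
      using ia by (simp add: real_mat_def scalar_prod_def lessThan_atLeast0)
    also have "\<dots> = of_int (mat_image U n (w a) i) / of_int (N a)" by (simp add: mat_image_def sum_divide_distrib)
    also have "\<dots> = of_int (N a * f a i) / of_int (N a)" using Nw(2) ia by simp
    finally have e: "(?U * ?G) $$ (i, a) = of_int (f a i)" using Nw(1) [OF ia(2)] by (simp del: index_mult_mat)
    show "?F $$ (i, a) = (?U * ?G) $$ (i, a)" unfolding e using ia by (simp add: real_mat_def)
  qed simp_all
  have rank: "vec_space.rank p ?U = r"
    by (rule rank_eq_of_factorization [OF real_mat_carrier(1) eqU F eqF _ _ inj]) simp_all
  have "Determinant.det (transpose_mat U' * U') ^ (k div 2) / covolume p ?L ^ k
      = (real (card T) * of_int (Determinant.det (mat m m (\<lambda>(c, b). v b (g c))))) ^ k"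
    if g: "inj_on g {..<m}" "g ` {..<m} \<subseteq> {..<n}" and k: "even k"
      and U': "U' = submatrix ?U UNIV ({..<n} - g ` {..<m})" for g k U'
  proof -
    let ?I = "{..<n} - g ` {..<m}" and ?V = "mat m m (\<lambda>(c, b). v b (g c))"
    have cI: "card ?I = r" using g nr by (simp add: card_Diff_subset card_image)
    have cI': "card {j. j < n \<and> j \<in> ?I} = r"
    proof -
      have "{j. j < n \<and> j \<in> ?I} = ?I" by blast
      then show ?thesis using cI by simp
    qed
    have pickI: "pick ?I t < n" if "t < r" for t
      using bij_betwE [OF bij_betw_pick [of ?I]] that cI by auto
    let ?WI = "mat r r (\<lambda>(a, t). W a (pick ?I t))"
    have U'eq: "U' = ?F * map_mat of_int ?WI"
    proof (rule eq_matI)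
      fix i t assume "i < dim_row (?F * map_mat of_int ?WI)" "t < dim_col (?F * map_mat of_int ?WI)"
      then have it: "i < p" "t < r" by simp_all
      have "U' $$ (i, t) = ?U $$ (pick UNIV i, pick ?I t)"
        unfolding U' by (rule submatrix_index) (use it cI' in simp_all)
      also have "\<dots> = of_int (\<Sum>a<r. f a i * W a (pick ?I t))"
        using it pickI UW by (simp add: pick_UNIV real_mat_def)
      finally show "U' $$ (i, t) = (?F * map_mat of_int ?WI) $$ (i, t)"
        using it by (simp add: real_mat_def scalar_prod_def lessThan_atLeast0)
    qed (use cI' in \<open>simp_all add: U' dim_submatrix\<close>)
    have absdet: "\<bar>Determinant.det ?WI\<bar> = D * \<bar>Determinant.det ?V\<bar>" using minors g by blast
    \<comment> \<open>The minors are known only up to sign, so the comparison passes to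
      squares.\<close>
    have "(Determinant.det (map_mat real_of_int ?WI))\<^sup>2 = of_int (\<bar>Determinant.det ?WI\<bar>\<^sup>2)"
      by (simp only: of_int_hom.hom_det power2_abs of_int_power)
    also have "\<dots> = (real (card T) * of_int (Determinant.det ?V))\<^sup>2"
      unfolding absdet T(3) [symmetric] by (simp add: power_mult_distrib)
    finally have "Determinant.det (transpose_mat U' * U')
        = (real (card T) * of_int (Determinant.det ?V))\<^sup>2 * Determinant.det (transpose_mat ?F * ?F)"
      unfolding U'eq using gram_det_mult [OF F, of "map_mat of_int ?WI"] by simp
    moreover have "(covolume p ?L)\<^sup>2 = Determinant.det (transpose_mat ?F * ?F)"
      unfolding covolume_eq [OF basis] using pos by simp
    ultimately have sq: "Determinant.det (transpose_mat U' * U') = (real (card T) * of_int (Determinant.det ?V))\<^sup>2 * (covolume p ?L)\<^sup>2"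
      by simp
    have c0: "covolume p ?L \<noteq> 0" unfolding covolume_eq [OF basis] using pos by simp
    have "(z\<^sup>2) ^ (k div 2) = z ^ k" for z :: real using k by (simp add: power_mult [symmetric])
    then show ?thesis unfolding sq using c0 by (simp add: power_mult_distrib)
  qed
  then show ?thesis
    unfolding Let_def
    by (intro exI [of _ r] exI [of _ T] conjI allI impI nr rank T(1,2,5,6)) blast
qed

subsection \<open>Hyperdeterminants\<close>

text \<open>Expanding the product over \<open>a\<close> gives a map \<open>g\<close> that picks one
  summand for each \<open>a\<close>. For fixed \<open>g\<close> the sum over \<tau> factors over the
  \<open>k\<close> independent permutations, each factor being the Leibniz formula of the same
  determinant.\<close>

lemma hyperdet_sum_products:
  fixes v :: "nat \<Rightarrow> nat \<Rightarrow> int" and y :: "nat \<Rightarrow> real"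
  shows "hyperdet k m (\<lambda>is. \<Sum>j<n. (\<Prod>b\<leftarrow>is. of_int (v b j)) * y j) =
     1 / fact m * (\<Sum>g \<in> {..<m} \<rightarrow>\<^sub>E {..<n}. (\<Prod>a<m. y (g a)) * of_int (Determinant.det (mat m m (\<lambda>(c, b). v b (g c)))) ^ k)"
proof -
  let ?P = "{\<pi>. \<pi> permutes {..<m}}"
  let ?d = "\<lambda>g. of_int (Determinant.det (mat m m (\<lambda>(c, b). v b (g c)))) :: real"
  have fin: "finite ?P" by (simp add: finite_permutations)
  have det: "?d g = (\<Sum>\<pi>\<in>?P. of_int (sign \<pi>) * (\<Prod>a<m. of_int (v (\<pi> a) (g a))))" for g
  proof -
    have "Determinant.det (mat m m (\<lambda>(c, b). v b (g c))) = (\<Sum>\<pi>\<in>?P. sign \<pi> * (\<Prod>a<m. v (\<pi> a) (g a)))"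
      unfolding det_def' [OF mat_carrier] lessThan_atLeast0
    proof (rule sum.cong [OF refl])
      fix \<pi> assume "\<pi> \<in> {\<pi>. \<pi> permutes {0..<m}}"
      then have "\<pi> permutes {0..<m}" by simp
      then have "(\<Prod>i = 0..<m. mat m m (\<lambda>(c, b). v b (g c)) $$ (i, \<pi> i)) = (\<Prod>a = 0..<m. v (\<pi> a) (g a))"
        by (intro prod.cong) (auto simp: permutes_in_image)
      then show "signof \<pi> * (\<Prod>i = 0..<m. mat m m (\<lambda>(c, b). v b (g c)) $$ (i, \<pi> i)) = sign \<pi> * (\<Prod>a = 0..<m. v (\<pi> a) (g a))"
        by simp
    qed
    then show ?thesis by simp
  qed
  have list: "(\<Prod>b\<leftarrow>map h [0..<k]. of_int (v b j)) = (\<Prod>i<k. of_int (v (h i) j) :: real)" for h :: "nat \<Rightarrow> nat" and j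
    using prod.distinct_set_conv_list [of "[0..<k]" "\<lambda>i. of_int (v (h i) j) :: real"] by (simp add: lessThan_atLeast0 comp_def)
  have "(\<Sum>\<tau> \<in> {..<k} \<rightarrow>\<^sub>E ?P. (\<Prod>j<k. of_int (sign (\<tau> j))) *
          (\<Prod>a<m. \<Sum>j<n. (\<Prod>b\<leftarrow>map (\<lambda>j. \<tau> j a) [0..<k]. of_int (v b j)) * y j))
      = (\<Sum>\<tau> \<in> {..<k} \<rightarrow>\<^sub>E ?P. \<Sum>g \<in> {..<m} \<rightarrow>\<^sub>E {..<n}.
          (\<Prod>a<m. y (g a)) * (\<Prod>i<k. of_int (sign (\<tau> i)) * (\<Prod>a<m. of_int (v (\<tau> i a) (g a)))))"
  proof (rule sum.cong [OF refl])
    fix \<tau> :: "nat \<Rightarrow> nat \<Rightarrow> nat"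
    have "(\<Prod>a<m. \<Sum>j<n. (\<Prod>b\<leftarrow>map (\<lambda>j. \<tau> j a) [0..<k]. of_int (v b j)) * y j)
        = (\<Sum>g \<in> {..<m} \<rightarrow>\<^sub>E {..<n}. \<Prod>a<m. (\<Prod>i<k. of_int (v (\<tau> i a) (g a))) * y (g a))"
      unfolding list by (rule prod_sum_PiE) simp_all
    also have "\<dots> = (\<Sum>g \<in> {..<m} \<rightarrow>\<^sub>E {..<n}. (\<Prod>a<m. y (g a)) * (\<Prod>i<k. \<Prod>a<m. of_int (v (\<tau> i a) (g a))))"
      by (intro sum.cong refl) (simp add: prod.distrib mult.commute prod.swap [of _ "{..<k}"])
    finally show "(\<Prod>j<k. of_int (sign (\<tau> j))) * (\<Prod>a<m. \<Sum>j<n. (\<Prod>b\<leftarrow>map (\<lambda>j. \<tau> j a) [0..<k]. of_int (v b j)) * y j)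
        = (\<Sum>g \<in> {..<m} \<rightarrow>\<^sub>E {..<n}. (\<Prod>a<m. y (g a)) * (\<Prod>i<k. of_int (sign (\<tau> i)) * (\<Prod>a<m. of_int (v (\<tau> i a) (g a)))))"
      by (simp add: sum_distrib_left prod.distrib mult_ac)
  qed
  also have "\<dots> = (\<Sum>g \<in> {..<m} \<rightarrow>\<^sub>E {..<n}. (\<Prod>a<m. y (g a)) *
      (\<Sum>\<tau> \<in> {..<k} \<rightarrow>\<^sub>E ?P. \<Prod>i<k. of_int (sign (\<tau> i)) * (\<Prod>a<m. of_int (v (\<tau> i a) (g a)))))"
    by (subst sum.swap) (simp add: sum_distrib_left)
  also have "\<dots> = (\<Sum>g \<in> {..<m} \<rightarrow>\<^sub>E {..<n}. (\<Prod>a<m. y (g a)) * ?d g ^ k)"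
  proof (rule sum.cong [OF refl])
    fix g :: "nat \<Rightarrow> nat"
    have "(\<Sum>\<tau> \<in> {..<k} \<rightarrow>\<^sub>E ?P. \<Prod>i<k. of_int (sign (\<tau> i)) * (\<Prod>a<m. of_int (v (\<tau> i a) (g a))))
        = (\<Prod>i<k. \<Sum>\<pi>\<in>?P. of_int (sign \<pi>) * (\<Prod>a<m. of_int (v (\<pi> a) (g a))) :: real)"
      by (rule prod_sum_PiE [symmetric]) (simp_all add: fin)
    also have "\<dots> = ?d g ^ k" unfolding det [symmetric] by simp
    finally show "(\<Prod>a<m. y (g a)) * (\<Sum>\<tau> \<in> {..<k} \<rightarrow>\<^sub>E ?P. \<Prod>i<k. of_int (sign (\<tau> i)) * (\<Prod>a<m. of_int (v (\<tau> i a) (g a))))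
        = (\<Prod>a<m. y (g a)) * ?d g ^ k" by simp
  qed
  finally show ?thesis unfolding hyperdet_def by simp
qed

text \<open>The summand of an injective \<open>g\<close> depends only on its image, by the
  assumption on \<open>E\<close>, and each image comes from as many injections as the factorial in
  \<open>hyperdet\<close> divides out.\<close>

lemma hyperdet_minors:
  fixes v :: "nat \<Rightarrow> nat \<Rightarrow> int" and y :: "nat \<Rightarrow> real" and c :: real
  assumes E: "\<And>g. inj_on g {..<m} \<Longrightarrow> g ` {..<m} \<subseteq> {..<n} \<Longrightarrow>
      c * of_int (Determinant.det (mat m m (\<lambda>(c, b). v b (g c)))) ^ k = E ({..<n} - g ` {..<m})"
    and n: "n = r + m" and k: "0 < k"
  shows "c * hyperdet k m (\<lambda>is. \<Sum>j<n. (\<Prod>b\<leftarrow>is. of_int (v b j)) * y j) =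
     (\<Sum>I | I \<subseteq> {..<n} \<and> card I = r. E I * (\<Prod>i\<in>{..<n} - I. y i))"
proof -
  let ?d = "\<lambda>g. of_int (Determinant.det (mat m m (\<lambda>(c, b). v b (g c)))) :: real"
  let ?A = "{g \<in> {..<m} \<rightarrow>\<^sub>E {..<n}. inj_on g {..<m}}"
  let ?J = "{J. J \<subseteq> {..<n} \<and> card J = m}"
  let ?h = "\<lambda>J. E ({..<n} - J) * (\<Prod>i\<in>J. y i)"
  have fin: "finite ({..<m} \<rightarrow>\<^sub>E {..<n})" by (intro finite_PiE) simp_all
  have finA: "finite ?A" using fin by (rule finite_subset [rotated]) blast
  have finJ: "finite ?J" by (rule finite_subset [of _ "Pow {..<n}"]) auto
  \<comment> \<open>A map that is not injective repeats a row of the minor; as \<open>0 < k\<close>,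
    its power is 0 as well.\<close>
  have d0: "?d g = 0" if ninj: "\<not> inj_on g {..<m}" for g
  proof -
    obtain a b where ab: "a < m" "b < m" "a \<noteq> b" "g a = g b" using ninj by (auto simp: inj_on_def)
    have "Determinant.det (mat m m (\<lambda>(c, b). v b (g c))) = 0"
      by (rule det_identical_rows [OF mat_carrier ab(3,1,2)]) (use ab in \<open>auto intro!: eq_vecI\<close>)
    then show ?thesis by simp
  qed
  have summand: "c * ((\<Prod>a<m. y (g a)) * ?d g ^ k) = ?h (g ` {..<m})" if "g \<in> ?A" for g
  proof -
    have g: "inj_on g {..<m}" "g ` {..<m} \<subseteq> {..<n}" using that by auto
    have "(\<Prod>a<m. y (g a)) = (\<Prod>i\<in>g ` {..<m}. y i)" using prod.reindex [OF g(1), of y] by (simp add: comp_def)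
    then have "c * ((\<Prod>a<m. y (g a)) * ?d g ^ k) = (c * ?d g ^ k) * (\<Prod>i\<in>g ` {..<m}. y i)" by simp
    then show ?thesis unfolding E [OF g] .
  qed
  have fibre: "card {g \<in> ?A. g ` {..<m} = J} = fact m" if J: "J \<in> ?J" for J
  proof -
    have finJ': "finite J" and cJ: "card J = m" and JB: "J \<subseteq> {..<n}" using J finite_subset by auto
    have "{g \<in> ?A. g ` {..<m} = J} = {g \<in> {..<m} \<rightarrow>\<^sub>E J. inj_on g {..<m}}"
    proof (intro equalityI subsetI)
      fix g assume g: "g \<in> {g \<in> {..<m} \<rightarrow>\<^sub>E J. inj_on g {..<m}}"
      then have gJ: "g ` {..<m} \<subseteq> J" and inj: "inj_on g {..<m}" by auto
      have "g ` {..<m} = J" by (rule card_subset_eq [OF finJ' gJ]) (simp add: card_image [OF inj] cJ)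
      then show "g \<in> {g \<in> ?A. g ` {..<m} = J}" using g JB by (auto simp: PiE_iff)
    qed (auto simp: PiE_iff)
    then have "card {g \<in> ?A. g ` {..<m} = J} = prod ((-) m) {0..<m}"
      using card_inj_on_subset_funcset [of "{..<m}" J "{..<m}"] finJ' cJ by simp
    also have "\<dots> = fact m" by (simp add: fact_prod_rev)
    finally show ?thesis .
  qed
  have "c * hyperdet k m (\<lambda>is. \<Sum>j<n. (\<Prod>b\<leftarrow>is. of_int (v b j)) * y j)
      = 1 / fact m * (\<Sum>g \<in> {..<m} \<rightarrow>\<^sub>E {..<n}. c * ((\<Prod>a<m. y (g a)) * ?d g ^ k))"
    unfolding hyperdet_sum_products by (simp add: sum_distrib_left mult_ac)
  also have "(\<Sum>g \<in> {..<m} \<rightarrow>\<^sub>E {..<n}. c * ((\<Prod>a<m. y (g a)) * ?d g ^ k)) = (\<Sum>g\<in>?A. c * ((\<Prod>a<m. y (g a)) * ?d g ^ k))"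
    by (rule sum.mono_neutral_right [OF fin]) (use d0 k in auto)
  also have "\<dots> = (\<Sum>g\<in>?A. ?h (g ` {..<m}))" using summand by (intro sum.cong refl)
  also have "\<dots> = (\<Sum>J\<in>?J. \<Sum>g | g \<in> ?A \<and> g ` {..<m} = J. ?h (g ` {..<m}))"
  proof (rule sum.group [symmetric, OF finA finJ])
    show "(\<lambda>g. g ` {..<m}) ` ?A \<subseteq> ?J"
    proof
      fix J assume "J \<in> (\<lambda>g. g ` {..<m}) ` ?A"
      then obtain g where "g \<in> {..<m} \<rightarrow>\<^sub>E {..<n}" "inj_on g {..<m}" "J = g ` {..<m}" by blast
      then show "J \<in> ?J" using card_image [of g "{..<m}"] by auto
    qed
  qed
  also have "\<dots> = (\<Sum>J\<in>?J. fact m * ?h J)"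
  proof (rule sum.cong [OF refl])
    fix J assume J: "J \<in> ?J"
    have "(\<Sum>g | g \<in> ?A \<and> g ` {..<m} = J. ?h (g ` {..<m})) = (\<Sum>g \<in> {g \<in> ?A. g ` {..<m} = J}. ?h J)"
      by (rule sum.cong) auto
    then show "(\<Sum>g | g \<in> ?A \<and> g ` {..<m} = J. ?h (g ` {..<m})) = fact m * ?h J"
      using fibre [OF J] by simp
  qed
  also have "1 / fact m * \<dots> = (\<Sum>J\<in>?J. ?h J)" by (simp add: sum_distrib_left [symmetric])
  \<comment> \<open>Complements turn the images, which have \<open>m\<close> elements, into the
    index sets of size \<open>r\<close> that \<open>Sym_complex\<close> uses.\<close>
  also have "\<dots> = (\<Sum>I | I \<subseteq> {..<n} \<and> card I = r. E I * (\<Prod>i\<in>{..<n} - I. y i))"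
  proof (rule sum.reindex_bij_witness [of _ "\<lambda>I. {..<n} - I" "\<lambda>J. {..<n} - J"])
    fix J assume "J \<in> ?J"
    then have J: "J \<subseteq> {..<n}" "card J = m" by auto
    then have JJ: "{..<n} - ({..<n} - J) = J" by blast
    show "{..<n} - ({..<n} - J) = J" by (rule JJ)
    show "{..<n} - J \<in> {I. I \<subseteq> {..<n} \<and> card I = r}" using J n finite_subset [OF J(1)] by (simp add: card_Diff_subset)
    show "E ({..<n} - J) * (\<Prod>i\<in>{..<n} - ({..<n} - J). y i) = ?h J" unfolding JJ ..
  next
    fix I assume "I \<in> {I. I \<subseteq> {..<n} \<and> card I = r}"
    then have I: "I \<subseteq> {..<n}" "card I = r" by auto
    then show "{..<n} - ({..<n} - I) = I" by blast
    show "{..<n} - I \<in> ?J" using I n finite_subset [OF I(1)] by (simp add: card_Diff_subset)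
  qed
  finally show ?thesis .
qed

subsection \<open>Comparison of the two sides\<close>

lemma int_basis_cong:
  assumes "\<And>i. i < r \<Longrightarrow> b i = b' i"
  shows "int_basis S r b \<longleftrightarrow> int_basis S r b'"
proof -
  have "(\<Sum>i<r. c i * b i j) = (\<Sum>i<r. c i * b' i j)" for c j
    by (rule sum.cong) (simp_all add: assms)
  moreover have "(\<forall>i<r. b i \<in> S) \<longleftrightarrow> (\<forall>i<r. b' i \<in> S)" by (simp add: assms)
  ultimately show ?thesis unfolding int_basis_def by simp
qed

text \<open>\<kappa> carries the multiplicative group to integer vectors under addition, so products
  of powers become linear combinations; existence and uniqueness of exponents are then spanning and
  independence.\<close>

lemma abelian_basis_iff_int_basis:
  assumes G: "comm_group G" and \<kappa>: "bij_betw \<kappa> (carrier G) S"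
    and add: "\<And>x y. x \<in> carrier G \<Longrightarrow> y \<in> carrier G \<Longrightarrow> \<kappa> (x \<otimes>\<^bsub>G\<^esub> y) = (\<lambda>j. \<kappa> x j + \<kappa> y j)"
    and v: "set v \<subseteq> carrier G"
  shows "abelian_basis G v \<longleftrightarrow> int_basis S (length v) (\<lambda>i. \<kappa> (v ! i))"
proof -
  interpret comm_group G by (fact G)
  let ?m = "length v" and ?b = "\<lambda>i. \<kappa> (v ! i)"
  let ?P = "\<lambda>f::nat \<Rightarrow> int. \<Otimes>\<^bsub>G\<^esub>i\<in>{..<?m}. (v ! i) [^]\<^bsub>G\<^esub> (f i)"
  have inj: "x = y" if "\<kappa> x = \<kappa> y" "x \<in> carrier G" "y \<in> carrier G" for x y
    using \<kappa> that by (auto simp: bij_betw_def inj_on_def)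
  have one: "\<kappa> \<one>\<^bsub>G\<^esub> = (\<lambda>_. 0)"
    using add [OF one_closed one_closed] by (simp add: fun_eq_iff)
  have inv: "\<kappa> (inv\<^bsub>G\<^esub> x) = (\<lambda>j. - \<kappa> x j)" if "x \<in> carrier G" for x
    using add [OF that inv_closed [OF that]] one that by (simp add: fun_eq_iff eq_neg_iff_add_eq_0 add.commute)
  have npow: "\<kappa> (x [^]\<^bsub>G\<^esub> (n::nat)) = (\<lambda>j. int n * \<kappa> x j)" if "x \<in> carrier G" for x n
    by (induction n) (simp_all add: one add that algebra_simps)
  have ipow: "\<kappa> (x [^]\<^bsub>G\<^esub> (z::int)) = (\<lambda>j. z * \<kappa> x j)" if "x \<in> carrier G" for x z
  proof (cases "z < 0")
    case True
    then have "\<kappa> (x [^]\<^bsub>G\<^esub> z) = \<kappa> (inv\<^bsub>G\<^esub> (x [^]\<^bsub>G\<^esub> nat (- z)))" by (simp only: int_pow_def2 if_True)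
    then show ?thesis unfolding inv [OF nat_pow_closed [OF that]] npow [OF that] using True by simp
  next
    case False
    then have "\<kappa> (x [^]\<^bsub>G\<^esub> z) = \<kappa> (x [^]\<^bsub>G\<^esub> nat z)" by (simp only: int_pow_def2 if_False)
    then show ?thesis unfolding npow [OF that] using False by simp
  qed
  have nth: "v ! i \<in> carrier G" if "i < ?m" for i using v that nth_mem by blast
  have prod: "(\<Otimes>\<^bsub>G\<^esub>i\<in>{..<l}. (v ! i) [^]\<^bsub>G\<^esub> (f i)) \<in> carrier G \<and>
      \<kappa> (\<Otimes>\<^bsub>G\<^esub>i\<in>{..<l}. (v ! i) [^]\<^bsub>G\<^esub> (f i)) = (\<lambda>j. \<Sum>i<l. f i * ?b i j)" if "l \<le> ?m" for f :: "nat \<Rightarrow> int" and l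
    using that
  proof (induction l)
    case (Suc l)
    have c: "v ! l [^]\<^bsub>G\<^esub> f l \<in> carrier G" "\<And>i. i < l \<Longrightarrow> v ! i [^]\<^bsub>G\<^esub> f i \<in> carrier G" using nth Suc.prems by simp_all
    have "(\<Otimes>\<^bsub>G\<^esub>i\<in>{..<Suc l}. (v ! i) [^]\<^bsub>G\<^esub> (f i)) = (v ! l) [^]\<^bsub>G\<^esub> (f l) \<otimes>\<^bsub>G\<^esub> (\<Otimes>\<^bsub>G\<^esub>i\<in>{..<l}. (v ! i) [^]\<^bsub>G\<^esub> (f i))"
      unfolding lessThan_Suc by (rule finprod_insert) (use c in auto)
    moreover have "\<kappa> (v ! l [^]\<^bsub>G\<^esub> f l) = (\<lambda>j. f l * ?b l j)" using ipow [OF nth] Suc.prems by simp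
    ultimately show ?case using Suc c add by (simp add: add.commute)
  qed (simp add: one)
  have P: "?P f \<in> carrier G" "\<kappa> (?P f) = (\<lambda>j. \<Sum>i<?m. f i * ?b i j)" for f using prod [of ?m f] by auto
  show ?thesis
  proof
    assume "abelian_basis G v"
    then have bij: "bij_betw ?P ({..<?m} \<rightarrow>\<^sub>E UNIV) (carrier G)" unfolding abelian_basis_def by blast
    show "int_basis S ?m ?b"
      unfolding int_basis_def
    proof (intro conjI allI ballI impI)
      show "?b i \<in> S" if "i < ?m" for i using bij_betwE [OF \<kappa>] nth that by blast
      show "\<exists>c. \<forall>j. x j = (\<Sum>i<?m. c i * ?b i j)" if x: "x \<in> S" for x
      proof -
        obtain y where y: "y \<in> carrier G" "x = \<kappa> y" using x \<kappa> by (auto simp: bij_betw_def)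
        obtain c where "y = ?P c" using y(1) bij by (auto simp: bij_betw_def)
        then show ?thesis using y(2) P(2) by (intro exI [of _ c]) simp
      qed
      show "c i = 0" if c: "\<forall>j. (\<Sum>i<?m. c i * ?b i j) = 0" and i: "i < ?m" for c i
      proof -
        \<comment> \<open>\<open>abelian_basis\<close> ranges over extensional functions, so the
          exponents are cut off outside the index range before uniqueness applies.\<close>
        let ?c = "restrict c {..<?m}" and ?z = "restrict (\<lambda>_. 0 :: int) {..<?m}"
        have "\<kappa> (?P ?c) = \<kappa> (?P ?z)" unfolding P(2) using c by simp
        then have "?P ?c = ?P ?z" using inj P(1) by blast
        then have "?c = ?z" using bij by (auto simp: bij_betw_def inj_on_def)
        then have "?c i = ?z i" by simp
        then show ?thesis using i by simp
      qed
    qed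
  next
    assume b: "int_basis S ?m ?b"
    have "inj_on ?P ({..<?m} \<rightarrow>\<^sub>E UNIV)"
    proof (rule inj_onI)
      fix f f' :: "nat \<Rightarrow> int" assume f: "f \<in> {..<?m} \<rightarrow>\<^sub>E UNIV" "f' \<in> {..<?m} \<rightarrow>\<^sub>E UNIV" and eq: "?P f = ?P f'"
      have "(\<Sum>i<?m. (f i - f' i) * ?b i j) = 0" for j
        using fun_cong [OF arg_cong [OF eq, of \<kappa>], of j] unfolding P(2) by (simp add: left_diff_distrib sum_subtractf)
      then have "f i - f' i = 0" if "i < ?m" for i by (rule int_basisD(3) [OF b _ that])
      then show "f = f'" using f by (intro PiE_ext) auto
    qed
    moreover have "x \<in> ?P ` ({..<?m} \<rightarrow>\<^sub>E UNIV)" if x: "x \<in> carrier G" for x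
    proof -
      obtain c where c: "\<And>j. \<kappa> x j = (\<Sum>i<?m. c i * ?b i j)" using int_basisD(2) [OF b] bij_betwE [OF \<kappa>] x by blast
      have "\<kappa> (?P (restrict c {..<?m})) = \<kappa> x" unfolding P(2) using c by (intro ext) simp
      then have "x = ?P (restrict c {..<?m})" using inj P(1) x by metis
      then show ?thesis by (rule image_eqI [where x = "restrict c {..<?m}"]) simp
    qed
    ultimately show "abelian_basis G v"
      using v P(1) unfolding abelian_basis_def bij_betw_def by blast
  qed
qed

lemma hyperdet_cong:
  assumes "\<And>is. length is = k \<Longrightarrow> set is \<subseteq> {..<m} \<Longrightarrow> C is = C' is"
  shows "hyperdet k m C = hyperdet k m C'"
  unfolding hyperdet_def
proof (intro arg_cong2 [where f = "(*)"] sum.cong prod.cong refl)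
  fix \<tau> a assume \<tau>: "\<tau> \<in> {..<k} \<rightarrow>\<^sub>E {\<pi>. \<pi> permutes {..<m}}" and a: "a \<in> {..<m}"
  have "\<tau> j a \<in> {..<m}" if "j < k" for j
  proof -
    have "\<tau> j permutes {..<m}" using PiE_mem [OF \<tau>, of j] that by simp
    then show ?thesis using permutes_in_image [of "\<tau> j" "{..<m}" a] a by simp
  qed
  then show "C (map (\<lambda>j. \<tau> j a) [0..<k]) = C' (map (\<lambda>j. \<tau> j a) [0..<k])" by (intro assms) auto
qed

text \<open>\<open>T\<close> is a transversal of the saturation modulo the column lattice, and
  \<psi> identifies this quotient with the torsion subgroup. For \<open>d = 0\<close> both sides are
  1: the group in degree -1 is trivial, and there are no faces without vertices.\<close>

lemma card_torsion_homology:
  assumes K: "finite_complex K" and hom: "homeomorphic_map (realization K) X \<Phi>"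
    and fs: "lists_faces K (Suc d) fs" and gs: "lists_faces K d gs"
    and U: "U = (\<lambda>i j. incidence (gs ! i) (fs ! j))"
    and T: "finite T" "T \<subseteq> saturation U (length gs) (length fs)"
      "\<forall>x\<in>saturation U (length gs) (length fs). \<exists>t\<in>T. \<exists>w. \<forall>i<length gs. x i - t i = mat_image U (length fs) w i"
      "\<forall>t\<in>T. \<forall>t'\<in>T. (\<exists>w. \<forall>i<length gs. t i - t' i = mat_image U (length fs) w i) \<longrightarrow> t = t'"
  shows "card (torsion_elements (homology_group (int d - 1) X)) = card T"
proof (cases d)
  case 0
  let ?G = "homology_group (int d - 1) X"
  have "trivial_group ?G" by (rule trivial_homology_group) (simp add: 0)
  then have G: "group ?G" "carrier ?G = {\<one>\<^bsub>?G\<^esub>}" unfolding trivial_group_def by auto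
  have "\<one>\<^bsub>?G\<^esub> [^]\<^bsub>?G\<^esub> (1::nat) = \<one>\<^bsub>?G\<^esub>" by (rule monoid.nat_pow_one [OF group.is_monoid [OF G(1)]])
  then have "\<exists>n::nat. n > 0 \<and> \<one>\<^bsub>?G\<^esub> [^]\<^bsub>?G\<^esub> n = \<one>\<^bsub>?G\<^esub>" by (intro exI [of _ "1::nat"]) simp
  then have tors: "torsion_elements ?G = {\<one>\<^bsub>?G\<^esub>}" unfolding torsion_elements_def G(2) by blast
  have "gs = []"
  proof (rule ccontr)
    assume "gs \<noteq> []"
    then obtain \<delta> where "\<delta> \<in> set gs" by fastforce
    then have "\<delta> \<in> K" "card \<delta> = 0" using gs 0 by (auto simp: lists_faces_def)
    then show False using finite_complexD(2,3) [OF K] by auto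
  qed
  then have "saturation U (length gs) (length fs) \<subseteq> {\<lambda>_. 0}" by (auto simp: saturation_def int_vecs_def)
  moreover have "(\<lambda>_. 0) \<in> saturation U (length gs) (length fs)" by (rule int_subgroupD(1) [OF int_subgroup_saturation])
  ultimately have "saturation U (length gs) (length fs) = {\<lambda>_. 0}" by blast
  then have "T = {\<lambda>_. 0}" using T(2,3) by auto
  then show ?thesis unfolding tors by simp
next
  case (Suc m)
  let ?L = "saturation U (length gs) (length fs)"
  have L: "?L = {x. (\<forall>i\<ge>length gs. x i = 0) \<and>
      (\<exists>N>0. \<exists>w. \<forall>i<length gs. N * x i = (\<Sum>j<length fs. incidence (gs ! i) (fs ! j) * w j))}"
    by (simp add: saturation_def int_vecs_def mat_image_def U)
  obtain \<psi> where \<psi>: "\<psi> ` ?L = torsion_elements (homology_group (int m) X)"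
    "\<And>x y. x \<in> ?L \<Longrightarrow> y \<in> ?L \<Longrightarrow> \<psi> x = \<psi> y \<longleftrightarrow> (\<exists>w. \<forall>i<length gs. x i - y i = mat_image U (length fs) w i)"
  proof -
    have "\<exists>\<psi>. \<psi> ` ?L = torsion_elements (homology_group (int m) X) \<and>
       (\<forall>x\<in>?L. \<forall>y\<in>?L. \<psi> x = \<psi> y \<longleftrightarrow> (\<exists>w. \<forall>i<length gs. x i - y i = mat_image U (length fs) w i))"
      unfolding L unfolding mat_image_def U
      by (rule torsion_homology_coordinates [OF K hom fs [unfolded Suc] gs [unfolded Suc]])
    then obtain \<psi> where 1: "\<psi> ` ?L = torsion_elements (homology_group (int m) X)"
      and 2: "\<forall>x\<in>?L. \<forall>y\<in>?L. \<psi> x = \<psi> y \<longleftrightarrow> (\<exists>w. \<forall>i<length gs. x i - y i = mat_image U (length fs) w i)"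
      by (elim exE conjE)
    show ?thesis by (rule that [OF 1 bspec [OF bspec [OF 2]]])
  qed
  have "inj_on \<psi> T"
    using \<psi>(2) T(2,4) by (intro inj_onI) blast
  moreover have "\<psi> ` T = \<psi> ` ?L"
  proof (intro equalityI subsetI)
    fix z assume "z \<in> \<psi> ` ?L"
    then obtain x where x: "x \<in> ?L" "z = \<psi> x" by blast
    then obtain t where "t \<in> T" "\<exists>w. \<forall>i<length gs. x i - t i = mat_image U (length fs) w i" using T(3) by blast
    then show "z \<in> \<psi> ` T" using \<psi>(2) x T(2) by blast
  qed (use T(2) in blast)
  ultimately show ?thesis using \<psi>(1) card_image [of \<psi> T] Suc by simp
qed

theorem theorem3p21:
  fixes X :: "'a topology" and M :: "'a measure"
    and d k N :: nat
    and \<Delta> :: "nat set set" and \<Phi> :: "(nat \<Rightarrow> real) \<Rightarrow> 'a"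
  assumes "finite_CW_complex d X"
    and "borel_measure_on X M" and "finite_measure M" and "diffuse d X M"
    and "k \<ge> 2" and "even k"
    and "space_triangulation N \<Delta> \<Phi> X"
  shows "Sym_space k d X M = Sym_complex k \<Delta> (\<lambda>\<delta>. measure M (face_image \<Phi> \<delta>))"
proof -
  have hom: "homeomorphic_map (realization \<Delta>) X \<Phi>" and "abstract_complex N \<Delta>"
    using assms(7) by (simp_all add: space_triangulation_def)
  then have K: "finite_complex \<Delta>" by (intro abstract_complex_imp_finite_complex)
  note dim = complex_dim_eq_CW_dim [OF assms(1) K hom]
  have top: "card \<delta> \<le> Suc d" if "\<delta> \<in> \<Delta>" for \<delta> using complex_dim_bounds(1) [OF K dim(1) that] dim(2) by simp
  define fs gs where "fs = face_list \<Delta> (Suc d)" and "gs = face_list \<Delta> d"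
  have fs: "lists_faces \<Delta> (Suc d) fs" and gs: "lists_faces \<Delta> d gs"
    unfolding fs_def gs_def by (rule lists_faces_face_list [OF K])+
  define U p n where "U = (\<lambda>i j. incidence (gs ! i) (fs ! j))" and "p = length gs" and "n = length fs"
  have top_faces: "top_faces \<Delta> = fs" by (simp add: top_faces_def dim fs_def)
  have inc: "incidence_mat \<Delta> = real_mat p n U"
    unfolding incidence_mat_def top_faces dim(2) gs_def [symmetric] by (simp add: real_mat_def U_def p_def n_def)
  let ?H = "homology_group (int d) X" and ?y = "\<lambda>\<delta>. measure M (face_image \<Phi> \<delta>)"
  let ?t = "card (torsion_elements (homology_group (int d - 1) X))"
  have ker: "mat_kernel U p n = {x. (\<forall>j\<ge>length fs. x j = 0) \<and>
      (\<forall>i<length gs. (\<Sum>j<length fs. incidence (gs ! i) (fs ! j) * x j) = 0)}"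
    by (simp add: mat_kernel_def int_vecs_def mat_image_def U_def p_def n_def)
  obtain \<kappa> where \<kappa>: "bij_betw \<kappa> (carrier ?H) (mat_kernel U p n)"
    and add: "\<And>c c'. c \<in> carrier ?H \<Longrightarrow> c' \<in> carrier ?H \<Longrightarrow> \<kappa> (c \<otimes>\<^bsub>?H\<^esub> c') = (\<lambda>j. \<kappa> c j + \<kappa> c' j)"
    and cyc: "\<And>c. c \<in> carrier ?H \<Longrightarrow> scycle \<Delta> d (face_chain fs (\<kappa> c))"
      "\<And>c. c \<in> carrier ?H \<Longrightarrow> c = simplicial_class d \<Delta> X \<Phi> (face_chain fs (\<kappa> c))"
  proof -
    have "\<exists>\<kappa>. bij_betw \<kappa> (carrier ?H) (mat_kernel U p n) \<and>
       (\<forall>c\<in>carrier ?H. \<forall>c'\<in>carrier ?H. \<kappa> (c \<otimes>\<^bsub>?H\<^esub> c') = (\<lambda>j. \<kappa> c j + \<kappa> c' j)) \<and>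
       (\<forall>c\<in>carrier ?H. scycle \<Delta> d (face_chain fs (\<kappa> c)) \<and> c = simplicial_class d \<Delta> X \<Phi> (face_chain fs (\<kappa> c)))"
      unfolding ker by (rule top_homology_coordinates [OF K hom _ fs gs]) (rule top)
    then show ?thesis using that by (elim exE conjE) blast
  qed
  have basis_iff: "abelian_basis ?H v \<longleftrightarrow> int_basis (mat_kernel U p n) (length v) (\<lambda>i. \<kappa> (v ! i))"
    if "set v \<subseteq> carrier ?H" for v
    by (rule abelian_basis_iff_int_basis [OF abelian_homology_group \<kappa> add that])
  \<comment> \<open>The right-hand side does not mention the basis, so this also gives the
    uniqueness required by the definite description in \<open>Sym_space\<close>.\<close>
  have val: "real ?t ^ k * hyperdet k (length v) (\<lambda>is. cycle_form d X M (map ((!) v) is)) = Sym_complex k \<Delta> ?y"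
    if v: "abelian_basis ?H v" for v
  proof -
    let ?m = "length v" and ?b = "\<lambda>i. \<kappa> (v ! i)"
    have vH: "set v \<subseteq> carrier ?H" using v by (simp add: abelian_basis_def)
    have b: "int_basis (mat_kernel U p n) ?m ?b" using v basis_iff [OF vH] by blast
    obtain r T where nr: "n = r + ?m" and rank: "vec_space.rank p (real_mat p n U) = r"
      and T: "finite T" "T \<subseteq> saturation U p n"
        "\<forall>x\<in>saturation U p n. \<exists>t\<in>T. \<exists>w. \<forall>i<p. x i - t i = mat_image U n w i"
        "\<forall>t\<in>T. \<forall>t'\<in>T. (\<exists>w. \<forall>i<p. t i - t' i = mat_image U n w i) \<longrightarrow> t = t'"
      and minors: "\<forall>g k. inj_on g {..<?m} \<and> g ` {..<?m} \<subseteq> {..<n} \<and> even k \<longrightarrow>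
       (let U' = submatrix (real_mat p n U) UNIV ({..<n} - g ` {..<?m}) in
        Determinant.det (transpose_mat U' * U') ^ (k div 2) / covolume p (saturated_lattice (real_mat p n U)) ^ k
          = (real (card T) * of_int (Determinant.det (mat ?m ?m (\<lambda>(c, b). ?b b (g c))))) ^ k)"
      using cokernel_torsion_and_minors [OF b] by (elim exE conjE) rule
    have t: "?t = card T"
      by (rule card_torsion_homology [OF K hom fs gs U_def]) (use T in \<open>simp_all add: p_def n_def\<close>)
    have form: "cycle_form d X M (map ((!) v) is) = (\<Sum>j<n. (\<Prod>i\<leftarrow>is. of_int (?b i j)) * ?y (fs ! j))"
      if "length is = k" "set is \<subseteq> {..<?m}" for "is"
    proof -
      have sub: "c \<in> carrier ?H" if "c \<in> set (map ((!) v) is)" for c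
        using that \<open>set is \<subseteq> {..<?m}\<close> vH nth_mem by fastforce
      have "even (length (map ((!) v) is))" "map ((!) v) is \<noteq> []" using that assms(5,6) by auto
      from cycle_form_coordinates [OF K hom top assms(2-4) fs this cyc(1) [OF sub] cyc(2) [OF sub]]
      show ?thesis by (simp add: n_def comp_def)
    qed
    have "real ?t ^ k * hyperdet k ?m (\<lambda>is. cycle_form d X M (map ((!) v) is))
        = real (card T) ^ k * hyperdet k ?m (\<lambda>is. \<Sum>j<n. (\<Prod>i\<leftarrow>is. of_int (?b i j)) * ?y (fs ! j))"
      unfolding t using hyperdet_cong [OF form] by simp
    also have "\<dots> = (\<Sum>I | I \<subseteq> {..<n} \<and> card I = r. (let U' = submatrix (real_mat p n U) UNIV I in
        Determinant.det (transpose_mat U' * U') ^ (k div 2) / covolume p (saturated_lattice (real_mat p n U)) ^ k) *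
        (\<Prod>i\<in>{..<n} - I. ?y (fs ! i)))"
      by (rule hyperdet_minors [OF _ nr]) (use minors assms(5,6) in \<open>simp_all add: Let_def power_mult_distrib\<close>)
    also have "\<dots> = Sym_complex k \<Delta> ?y"
      unfolding Sym_complex_def inc Let_def real_mat_carrier rank top_faces by (simp add: sum_divide_distrib)
    finally show ?thesis .
  qed
  \<comment> \<open>The description still needs one basis to exist: a basis of the kernel lattice is
    pulled back along \<kappa>.\<close>
  have "mat_kernel U p n \<subseteq> int_vecs n" by (auto simp: mat_kernel_def)
  then obtain m b where b: "int_basis (mat_kernel U p n) m b" using int_basis_exists [OF _ int_subgroup_mat_kernel] by blast
  have pre: "\<exists>c. c \<in> carrier ?H \<and> \<kappa> c = b i" if "i < m" for i
  proof -
    have "b i \<in> \<kappa> ` carrier ?H" using int_basisD(1) [OF b that] bij_betw_imp_surj_on [OF \<kappa>] by simp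
    then show ?thesis by (elim imageE) metis
  qed
  then obtain c where c: "\<And>i. i < m \<Longrightarrow> c i \<in> carrier ?H \<and> \<kappa> (c i) = b i" by metis
  have "set (map c [0..<m]) \<subseteq> carrier ?H" using c by auto
  moreover have "int_basis (mat_kernel U p n) (length (map c [0..<m])) (\<lambda>i. \<kappa> (map c [0..<m] ! i))"
    using b int_basis_cong [of m "\<lambda>i. \<kappa> (map c [0..<m] ! i)" b] c by simp
  ultimately have "abelian_basis ?H (map c [0..<m])" using basis_iff by blast
  then show ?thesis unfolding Sym_space_def using val by (intro the_equality) fastforce+
qed

end
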